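(* Let $t>0$ and a locally integrable adapted process $G$ be given. Conditions (A), (B), (C) are those of the context. (i) Let $\{\eta_k\}$ be an increasing sequence of (finite) stopping times with $\lim_{k\to\infty}\mathbb P[\eta_k<t]=0$. Let $\{\pi^n\}$ be a sequence of partitions satisfying (A), (B) and (C) with the given $G$, a locally integrable process $H$, and $\tau=\eta_k$ for all $k$. Then $$H(u)\ge\frac{3d}{(d+2)G(u)}\qquad \mathrm du\otimes\mathrm d\mathbb P\text{-a.e. on }[0,t]\times\Omega.$$ (ii) If $G$ is positive and continuous on $[0,t]$, then the sequence $\{\pi^n\}$ defined by $$\pi^n_0=0,\qquad \pi^n_{m+1}=\inf\Big\{s>\pi^n_m:\ |W(s)-W(\pi^n_m)|^2=\frac{d}{n\,G(\pi^n_m)}\Big\}$$ satisfies (A), (B) and (C) for $\tau=\hat\eta_k$ and attains the equality in the inequality of (i), where $$\hat\eta_k=\inf\{s>0:\ G(s)>k\text{ or }G(s)<1/k\}.$$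
   Context: Let $W=(W^1,\dots,W^d)$ be a $d$-dimensional standard Brownian motion on a probability space $(\Omega,\mathcal F,\mathbb P)$, and $\{\mathcal F_s\}_{s\ge0}$ the augmentation of its natural filtration; stopping times and adaptedness refer to it. A partition $\pi=\{\pi_m\}_{m\ge0}$ is an increasing sequence of stopping times with $\pi_0=0$ and $\lim_m\pi_m=\infty$. For a sequence of partitions $\{\pi^n\}_{n\ge1}$ and a finite stopping time $\tau$ put $\Delta_m\pi^n=\pi^n_m-\pi^n_{m-1}$, $\Delta^n_mW^j=W^j(\pi^n_m)-W^j(\pi^n_{m-1})$, $\mathcal F^n_m=\mathcal F_{\pi^n_m}$, $N^n_\tau=\min\{m\ge0;\pi^n_m\ge\tau\}$, and $\pi^n(s)=\pi^n_m$ for $s\in[\pi^n_m,\pi^n_{m+1})$. Put $$G^n(\pi^n_m)=\frac1{n\,\mathbb E[\Delta_{m+1}\pi^n|\mathcal F^n_m]},\quad m=0,1,\dots$$ Conditions on $\{\pi^n\}$, for processes $G$, $H$ ($H$ progressively measurable) and some progressively measurable processes $H^n$: (A) for $\tau$: $\sum_{m=1}^{N^n_\tau}\mathbb E[|\Delta_m\pi^n|^2|\mathcal F^n_{m-1}]\to0$ and $\sup_{0\le s\le\tau}|G^n(\pi^n(s))-G(s)|\to0$ in probability as $n\to\infty$. (B) (symmetry; does not involve $\tau$) for every $n$ and every $m\ge0$: $\mathbb E[(\Delta^n_{m+1}W^j)^3|\mathcal F^n_m]=0$ and $\mathbb E[|\Delta^n_{m+1}W^j|^4|\mathcal F^n_m]=\frac1{n^2}\frac{H^n(\pi^n_m)}{G^n(\pi^n_m)}$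 for all $1\le j\le d$, and $\mathbb E[L^{n,i,j}_{m+1}|\mathcal F^n_m]=0$ for all $1\le i,j\le d$ with $i\ne j$, where $L^{n,i,j}_m=\int_{\pi^n_{m-1}}^{\pi^n_m}(W^i(s)-W^i(\pi^n_{m-1}))(W^j(s)-W^j(\pi^n_{m-1}))\,\mathrm ds$. (C) for $\tau$: $\sup_{0\le s\le\tau}|H^n(\pi^n(s))-H(s)|\to0$, $n^2\sum_{m=1}^{N^n_\tau}\mathbb E[|\Delta_m\pi^n|^4|\mathcal F^n_{m-1}]\to0$ and $n^2\sum_{m=1}^{N^n_\tau}\mathbb E[|\Delta_m\pi^n|^6|\mathcal F^n_{m-1}]\to0$ in probability as $n\to\infty$. A process is locally integrable if its paths are a.s. integrable on bounded time intervals.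
   Formalization: In (ii), π^n is built from any adapted positive continuous process on [0,∞) equal to G on [0,t] (G may fail after t), and (A),(C) are claimed for min(η̂_k,t) and for every finite stopping time below η̂_k of that process, since η̂_k may be infinite (e.g. G=1). *)

theory Defs
  imports "HOL-Probability.Probability"
begin

section \<open>Brownian motion and its augmented filtration\<close>

definition past_events :: "'a measure \<Rightarrow> (real \<Rightarrow> 'a \<Rightarrow> 'b::topological_space) \<Rightarrow> real \<Rightarrow> 'a set set" where
  "past_events M W s = {W u -` B \<inter> space M | u B. 0 \<le> u \<and> u \<le> s \<and> B \<in> sets borel}"

definition natural_filtration :: "'a measure \<Rightarrow> (real \<Rightarrow> 'a \<Rightarrow> 'b::topological_space) \<Rightarrow> real \<Rightarrow> 'a measure" where
  "natural_filtration M W s = sigma (space M) (past_events M W s)"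

definition standard_brownian_motion :: "'a measure \<Rightarrow> (real \<Rightarrow> 'a \<Rightarrow> real ^ 'd) \<Rightarrow> bool" where
  "standard_brownian_motion M W \<longleftrightarrow>
     prob_space M \<and>
     (\<forall>s\<ge>0. W s \<in> borel_measurable M) \<and>
     (AE \<omega> in M. W 0 \<omega> = 0) \<and>
     (AE \<omega> in M. continuous_on {0..} (\<lambda>s. W s \<omega>)) \<and>
     (\<forall>s u. 0 \<le> s \<and> s < u \<longrightarrow>
        prob_space.indep_set M (sets (natural_filtration M W s))
          (sets (vimage_algebra (space M) (\<lambda>\<omega>. W u \<omega> - W s \<omega>) borel)) \<and>
        prob_space.indep_vars M (\<lambda>_. borel) (\<lambda>j \<omega>. (W u \<omega> - W s \<omega>) $ j) UNIV \<and>
        (\<forall>j. distributed M lborel (\<lambda>\<omega>. (W u \<omega> - W s \<omega>) $ j)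
              (\<lambda>x. ennreal (normal_density 0 (sqrt (u - s)) x))))"

text \<open>The augmentation adjoins all subsets of null sets, so it lives on the completion of \<open>M\<close>;
  conditional expectations and probabilities below are therefore taken with respect to
  \<^term>\<open>completion M\<close>, and \<open>M\<close> itself need not be complete.  At negative times the
  \<open>\<sigma>\<close>-algebra consists of the null sets and their complements.\<close>

definition augmented_filtration :: "'a measure \<Rightarrow> (real \<Rightarrow> 'a \<Rightarrow> 'b::topological_space) \<Rightarrow> real \<Rightarrow> 'a measure" where
  "augmented_filtration M W s = sigma (space M) (past_events M W s \<union> null_sets (completion M))"

lemma augmented_generator_subset:
  "past_events M W s \<union> null_sets (completion M) \<subseteq> Pow (space M)"
proof -
  have "N \<subseteq> space M" if "N \<in> null_sets (completion M)" for N
    using that sets.sets_into_space[of N "completion M"] by auto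
  then show ?thesis by (auto simp: past_events_def)
qed

lemma filtration_augmented: "filtration (space M) (augmented_filtration M W)"
proof
  show "space (augmented_filtration M W i) = space M" for i
    unfolding augmented_filtration_def by (rule space_measure_of[OF augmented_generator_subset])
  show "sets (augmented_filtration M W i) \<le> sets (augmented_filtration M W j)" if "i \<le> j" for i j
  proof -
    have "past_events M W i \<subseteq> past_events M W j"
      using that by (auto simp: past_events_def) (metis order_trans)
    then show ?thesis
      unfolding augmented_filtration_def sets_measure_of[OF augmented_generator_subset]
      by (intro sigma_sets_mono') auto
  qed
qed

lemma subalgebra_augmented:
  assumes "\<And>u. 0 \<le> u \<Longrightarrow> W u \<in> borel_measurable M"
  shows "subalgebra (completion M) (augmented_filtration M W s)"
proof -
  have "past_events M W s \<union> null_sets (completion M) \<subseteq> sets (completion M)"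
    using assms by (auto simp: past_events_def simp del: null_sets_completion_iff2
        intro: sets_completionI_sets measurable_sets)
  then have "sigma_sets (space M) (past_events M W s \<union> null_sets (completion M)) \<subseteq> sets (completion M)"
    using sets.sigma_sets_subset[of _ "completion M"] by simp
  then show ?thesis
    unfolding subalgebra_def augmented_filtration_def
    by (simp add: sets_measure_of[OF augmented_generator_subset] space_measure_of[OF augmented_generator_subset])
qed

abbreviation stopped_algebra :: "'a measure \<Rightarrow> (real \<Rightarrow> 'a \<Rightarrow> 'b::topological_space) \<Rightarrow> ('a \<Rightarrow> real) \<Rightarrow> 'a measure" where
  "stopped_algebra M W \<tau> \<equiv> filtration.pre_sigma (space M) (augmented_filtration M W) \<tau>"

definition finite_stopping_time :: "'a measure \<Rightarrow> (real \<Rightarrow> 'a \<Rightarrow> 'b::topological_space) \<Rightarrow> ('a \<Rightarrow> real) \<Rightarrow> bool" where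
  "finite_stopping_time M W \<tau> \<longleftrightarrow>
     stopping_time (augmented_filtration M W) \<tau> \<and> (AE \<omega> in M. 0 \<le> \<tau> \<omega>)"

section \<open>Processes, conditional expectation, convergence in probability\<close>

definition adapted_process :: "'a measure \<Rightarrow> (real \<Rightarrow> 'a \<Rightarrow> 'b::topological_space) \<Rightarrow> (real \<Rightarrow> 'a \<Rightarrow> real) \<Rightarrow> bool" where
  "adapted_process M W X \<longleftrightarrow> (\<forall>s\<ge>0. X s \<in> borel_measurable (augmented_filtration M W s))"

definition progressive_process :: "'a measure \<Rightarrow> (real \<Rightarrow> 'a \<Rightarrow> 'b::topological_space) \<Rightarrow> (real \<Rightarrow> 'a \<Rightarrow> real) \<Rightarrow> bool" where
  "progressive_process M W X \<longleftrightarrow>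
     (\<forall>s\<ge>0. (\<lambda>(u, \<omega>). X u \<omega>)
        \<in> borel_measurable (restrict_space borel {0..s} \<Otimes>\<^sub>M augmented_filtration M W s))"

definition locally_integrable :: "'a measure \<Rightarrow> (real \<Rightarrow> 'a \<Rightarrow> real) \<Rightarrow> bool" where
  "locally_integrable M X \<longleftrightarrow> (AE \<omega> in M. \<forall>T\<ge>0. set_integrable lebesgue {0..T} (\<lambda>s. X s \<omega>))"

text \<open>\<open>E[X | \<A>] = Y\<close> for a not necessarily integrable \<open>X\<close>.  The first conjunct excludes
  \<^const>\<open>real_cond_exp\<close> returning a value where the conditional expectation is undefined.\<close>

definition has_cond_exp :: "'a measure \<Rightarrow> 'a measure \<Rightarrow> ('a \<Rightarrow> real) \<Rightarrow> ('a \<Rightarrow> real) \<Rightarrow> bool" where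
  "has_cond_exp M \<A> X Y \<longleftrightarrow>
     (AE \<omega> in completion M. nn_cond_exp (completion M) \<A> (\<lambda>\<omega>. ennreal \<bar>X \<omega>\<bar>) \<omega> < \<infinity> \<and>
        real_cond_exp (completion M) \<A> X \<omega> = Y \<omega>)"

text \<open>The outer measure is used because a supremum over uncountably many times of a process that
  is merely adapted need not be measurable; on measurable events it is the probability.\<close>

definition tends_to_0_in_prob :: "'a measure \<Rightarrow> (nat \<Rightarrow> 'a \<Rightarrow> ennreal) \<Rightarrow> bool" where
  "tends_to_0_in_prob M X \<longleftrightarrow>
     (\<forall>\<epsilon>>0. (\<lambda>n. outer_measure_of M {\<omega> \<in> space M. ennreal \<epsilon> < X n \<omega>}) \<longlonglongrightarrow> 0)"

section \<open>Partitions and the conditions (A), (B), (C)\<close>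

definition random_partition :: "'a measure \<Rightarrow> (real \<Rightarrow> 'a \<Rightarrow> 'b::topological_space) \<Rightarrow> (nat \<Rightarrow> 'a \<Rightarrow> real) \<Rightarrow> bool" where
  "random_partition M W p \<longleftrightarrow>
     (\<forall>m. stopping_time (augmented_filtration M W) (p m)) \<and>
     (AE \<omega> in M. p 0 \<omega> = 0 \<and> incseq (\<lambda>m. p m \<omega>) \<and> filterlim (\<lambda>m. p m \<omega>) at_top sequentially)"

definition first_index :: "(nat \<Rightarrow> 'a \<Rightarrow> real) \<Rightarrow> ('a \<Rightarrow> real) \<Rightarrow> 'a \<Rightarrow> nat" where
  "first_index p \<tau> \<omega> = (LEAST m. \<tau> \<omega> \<le> p m \<omega>)"

definition current_index :: "(nat \<Rightarrow> 'a \<Rightarrow> real) \<Rightarrow> real \<Rightarrow> 'a \<Rightarrow> nat" where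
  "current_index p s \<omega> = (THE m. p m \<omega> \<le> s \<and> s < p (Suc m) \<omega>)"

text \<open>\<open>G\<^sup>n(\<pi>\<^sup>n\<^sub>m)\<close>, for the \<open>n\<close>-th partition \<open>p\<close>.  The value is \<open>0\<close> where
  the conditional expectation is infinite (as it should be), and also where it vanishes; the
  latter happens only if the \<open>(m+1)\<close>-st interval is almost surely empty.\<close>

definition G_approx ::
  "'a measure \<Rightarrow> (real \<Rightarrow> 'a \<Rightarrow> 'b::topological_space) \<Rightarrow> nat \<Rightarrow> (nat \<Rightarrow> 'a \<Rightarrow> real) \<Rightarrow> nat \<Rightarrow> 'a \<Rightarrow> real" where
  "G_approx M W n p m \<omega> =
     1 / (real n * real_cond_exp (completion M) (stopped_algebra M W (p m))
                     (\<lambda>\<omega>. p (Suc m) \<omega> - p m \<omega>) \<omega>)"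

text \<open>\<open>\<Sum>\<^bsub>m=1\<^esub>\<^bsup>N\<^esup> E[|\<Delta>\<^sub>m\<pi>|\<^sup>r | \<F>\<^bsub>m-1\<^esub>]\<close> with the summation index shifted by one.\<close>

definition cond_power_sum ::
  "'a measure \<Rightarrow> (real \<Rightarrow> 'a \<Rightarrow> 'b::topological_space) \<Rightarrow> (nat \<Rightarrow> 'a \<Rightarrow> real) \<Rightarrow> ('a \<Rightarrow> real) \<Rightarrow> nat \<Rightarrow> 'a \<Rightarrow> ennreal" where
  "cond_power_sum M W p \<tau> r \<omega> =
     (\<Sum>m<first_index p \<tau> \<omega>.
        nn_cond_exp (completion M) (stopped_algebra M W (p m))
          (\<lambda>\<omega>. ennreal (\<bar>p (Suc m) \<omega> - p m \<omega>\<bar> ^ r)) \<omega>)"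

definition condition_A ::
  "'a measure \<Rightarrow> (real \<Rightarrow> 'a \<Rightarrow> 'b::topological_space) \<Rightarrow> (nat \<Rightarrow> nat \<Rightarrow> 'a \<Rightarrow> real) \<Rightarrow>
   (real \<Rightarrow> 'a \<Rightarrow> real) \<Rightarrow> ('a \<Rightarrow> real) \<Rightarrow> bool" where
  "condition_A M W p G \<tau> \<longleftrightarrow>
     tends_to_0_in_prob M (\<lambda>n. cond_power_sum M W (p n) \<tau> 2) \<and>
     tends_to_0_in_prob M (\<lambda>n \<omega>. SUP s\<in>{0..\<tau> \<omega>}.
        ennreal \<bar>G_approx M W n (p n) (current_index (p n) s \<omega>) \<omega> - G s \<omega>\<bar>)"

definition cross_integral :: "(real \<Rightarrow> 'a \<Rightarrow> real ^ 'd) \<Rightarrow> (nat \<Rightarrow> 'a \<Rightarrow> real) \<Rightarrow> nat \<Rightarrow> 'd \<Rightarrow> 'd \<Rightarrow> 'a \<Rightarrow> real" where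
  "cross_integral W p m i j \<omega> =
     (LINT s:{p m \<omega>..p (Suc m) \<omega>}|lborel.
        (W s \<omega> $ i - W (p m \<omega>) \<omega> $ i) * (W s \<omega> $ j - W (p m \<omega>) \<omega> $ j))"

definition condition_B ::
  "'a measure \<Rightarrow> (real \<Rightarrow> 'a \<Rightarrow> real ^ 'd) \<Rightarrow> (nat \<Rightarrow> nat \<Rightarrow> 'a \<Rightarrow> real) \<Rightarrow>
   (nat \<Rightarrow> real \<Rightarrow> 'a \<Rightarrow> real) \<Rightarrow> bool" where
  "condition_B M W p Hn \<longleftrightarrow>
     (\<forall>n\<ge>1. \<forall>m.
        (\<forall>j. has_cond_exp M (stopped_algebra M W (p n m))
               (\<lambda>\<omega>. (W (p n (Suc m) \<omega>) \<omega> $ j - W (p n m \<omega>) \<omega> $ j) ^ 3) (\<lambda>\<omega>. 0) \<and>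
             has_cond_exp M (stopped_algebra M W (p n m))
               (\<lambda>\<omega>. \<bar>W (p n (Suc m) \<omega>) \<omega> $ j - W (p n m \<omega>) \<omega> $ j\<bar> ^ 4)
               (\<lambda>\<omega>. 1 / (real n)\<^sup>2 * (Hn n (p n m \<omega>) \<omega> / G_approx M W n (p n) m \<omega>))) \<and>
        (\<forall>i j. i \<noteq> j \<longrightarrow>
             has_cond_exp M (stopped_algebra M W (p n m)) (cross_integral W (p n) m i j) (\<lambda>\<omega>. 0)))"

definition condition_C ::
  "'a measure \<Rightarrow> (real \<Rightarrow> 'a \<Rightarrow> 'b::topological_space) \<Rightarrow> (nat \<Rightarrow> nat \<Rightarrow> 'a \<Rightarrow> real) \<Rightarrow>
   (nat \<Rightarrow> real \<Rightarrow> 'a \<Rightarrow> real) \<Rightarrow> (real \<Rightarrow> 'a \<Rightarrow> real) \<Rightarrow> ('a \<Rightarrow> real) \<Rightarrow> bool" where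
  "condition_C M W p Hn H \<tau> \<longleftrightarrow>
     tends_to_0_in_prob M (\<lambda>n \<omega>. SUP s\<in>{0..\<tau> \<omega>}.
        ennreal \<bar>Hn n (p n (current_index (p n) s \<omega>) \<omega>) \<omega> - H s \<omega>\<bar>) \<and>
     tends_to_0_in_prob M (\<lambda>n \<omega>. of_nat (n\<^sup>2) * cond_power_sum M W (p n) \<tau> 4 \<omega>) \<and>
     tends_to_0_in_prob M (\<lambda>n \<omega>. of_nat (n\<^sup>2) * cond_power_sum M W (p n) \<tau> 6 \<omega>)"

definition exhausting_times ::
  "'a measure \<Rightarrow> (real \<Rightarrow> 'a \<Rightarrow> 'b::topological_space) \<Rightarrow> real \<Rightarrow> (nat \<Rightarrow> 'a \<Rightarrow> real) \<Rightarrow> bool" where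
  "exhausting_times M W t \<eta> \<longleftrightarrow>
     (\<forall>k. finite_stopping_time M W (\<eta> k)) \<and>
     (AE \<omega> in M. incseq (\<lambda>k. \<eta> k \<omega>)) \<and>
     (\<lambda>k. measure (completion M) {\<omega> \<in> space M. \<eta> k \<omega> < t}) \<longlonglongrightarrow> 0"

section \<open>The sequence of exit times from balls\<close>

text \<open>The infimum is over a set that is almost surely nonempty when \<open>G\<close> is positive.\<close>

primrec ball_partition ::
  "(real \<Rightarrow> 'a \<Rightarrow> real ^ 'd) \<Rightarrow> (real \<Rightarrow> 'a \<Rightarrow> real) \<Rightarrow> nat \<Rightarrow> nat \<Rightarrow> 'a \<Rightarrow> real" where
  "ball_partition W G n 0 = (\<lambda>\<omega>. 0)"
| "ball_partition W G n (Suc m) = (\<lambda>\<omega>.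
     Inf {s. s > ball_partition W G n m \<omega> \<and>
             (norm (W s \<omega> - W (ball_partition W G n m \<omega>) \<omega>))\<^sup>2
               = real CARD('d) / (real n * G (ball_partition W G n m \<omega>) \<omega>)})"

definition eta_hat :: "(real \<Rightarrow> 'a \<Rightarrow> real) \<Rightarrow> nat \<Rightarrow> 'a \<Rightarrow> ereal" where
  "eta_hat G k \<omega> = Inf (ereal ` {s. s > 0 \<and> (G s \<omega> > real k \<or> G s \<omega> < 1 / real k)})"

definition eta_hat_upto :: "(real \<Rightarrow> 'a \<Rightarrow> real) \<Rightarrow> real \<Rightarrow> nat \<Rightarrow> 'a \<Rightarrow> real" where
  "eta_hat_upto G t k \<omega> = real_of_ereal (min (eta_hat G k \<omega>) (ereal t))"

text \<open>Positivity and continuity of \<open>G\<close> on \<open>[0,t]\<close> do not determine the recursion for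
  \<^const>\<open>ball_partition\<close> after time \<open>t\<close>, where \<open>G\<close> may be negative or blow up.  It is
  therefore run with an adapted, positive and continuous process \<open>G'\<close> that coincides with \<open>G\<close> on
  \<open>[0,t]\<close>: for example \<open>G\<close> itself if it is positive and continuous on \<open>[0,\<infinity>)\<close>, or in any case
  \<open>G(min s t)\<close>.\<close>

definition positive_continuous_extension ::
  "'a measure \<Rightarrow> (real \<Rightarrow> 'a \<Rightarrow> 'b::topological_space) \<Rightarrow> real \<Rightarrow> (real \<Rightarrow> 'a \<Rightarrow> real) \<Rightarrow> (real \<Rightarrow> 'a \<Rightarrow> real) \<Rightarrow> bool" where
  "positive_continuous_extension M W t G G' \<longleftrightarrow>
     adapted_process M W G' \<and>
     (AE \<omega> in M. continuous_on {0..} (\<lambda>s. G' s \<omega>) \<and> (\<forall>s\<ge>0. G' s \<omega> > 0) \<and>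
        (\<forall>s\<in>{0..t}. G' s \<omega> = G s \<omega>))"

lemma positive_continuous_extension_stopped:
  assumes "0 \<le> t" and G: "adapted_process M W G"
    and "AE \<omega> in M. continuous_on {0..t} (\<lambda>s. G s \<omega>) \<and> (\<forall>s\<in>{0..t}. G s \<omega> > 0)"
  shows "positive_continuous_extension M W t G (\<lambda>s. G (min s t))"
proof -
  interpret filtration "space M" "augmented_filtration M W" by (rule filtration_augmented)
  have "(\<lambda>\<omega>. G (min s t) \<omega>) \<in> borel_measurable (augmented_filtration M W s)" if "0 \<le> s" for s
  proof -
    have "G (min s t) \<in> borel_measurable (augmented_filtration M W (min s t))"
      using G that \<open>0 \<le> t\<close> by (auto simp: adapted_process_def)
    then show ?thesis
      using sets_F_mono[of "min s t" s] space_F by (auto simp: measurable_def)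
  qed
  moreover have "continuous_on {0..} (\<lambda>s. G (min s t) \<omega>)" if "continuous_on {0..t} (\<lambda>s. G s \<omega>)" for \<omega>
    by (rule continuous_on_compose2[OF that]) (use \<open>0 \<le> t\<close> in \<open>auto intro!: continuous_intros\<close>)
  ultimately show ?thesis
    using assms by (auto simp: positive_continuous_extension_def adapted_process_def elim!: AE_mp)
qed

end

theory Submission
  imports Defs
begin

text \<open>Lower bound: the polynomial \<open>(d + 2) \<Sum>\<^sub>j x\<^sub>j\<^sup>4 - 3 |x|\<^sup>4\<close> is harmonic, so on an interval between stopping times
  \<open>(d + 2) \<Sum>\<^sub>j E[\<Delta>W\<^sub>j\<^sup>4] = 3 E[|\<Delta>W|\<^sup>4] \<ge> 3 (2cd E[\<Delta>\<pi>] - c\<^sup>2)\<close> conditionally on the past; the choice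
  \<open>c = d E[\<Delta>\<pi>]\<close> bounds \<open>H\<^sup>n G\<^sup>n\<close> below by \<open>3 d / (d + 2)\<close>, and (A) and (C) pass this to the limit.
  Equality holds when \<open>|\<Delta>W|\<^sup>2\<close> is determined by the past, as for exits from balls.  There harmonic
  polynomials give the conditional moments in (B), the martingale \<open>|x|\<^sup>2 - d s\<close> gives
  \<open>E[\<Delta>\<pi>\<^sup>k] \<le> k! (E[\<Delta>\<pi>])\<^sup>k\<close>, and the number of intervals before a bounded time is of order \<open>n\<close> in
  the mean.  That \<open>G\<close> leaves \<open>[1/k, k]\<close> at a stopping time rests on the right-continuity of the
  augmented filtration.\<close>

text \<open>The number \<open>3 / (d (d + 2))\<close> behind the bound is the fourth moment of a
  coordinate of a uniform point of the unit sphere; the harmonic quartic forces it. Time-dependent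
  polynomials are needed because the intervals end at stopping times that are neither bounded nor
  integrable a priori. Every identity is proved for times cut at an integer \<open>K\<close>, where
  products of Hermite polynomials are martingales. The cut is removed by domination or Fatou's lemma
  or, for the fourth moments in the lower bound, by a convexity inequality whose error is controlled
  by the second moment of the time cut off. Conditional moments are finite only locally, so
  conditional statements are proved on events of the past on which the moments are bounded. A second
  obstacle is that paths are regular only almost surely, while hitting times are defined path by
  path: the argument runs on the completion with the paths replaced on a null set, and stopping
  times, stopped algebras and conditional expectations are carried back through almost sure
  equality.\<close>

section \<open>Convergence of integrals under an L2 bound\<close>

text \<open>An L2 bound gives uniform integrability: clipping at level \<open>L\<close> changes each
  integral by at most \<open>C / L\<close>, and the clipped functions converge by domination. The
  limit inherits the bound by Fatou's lemma.\<close>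

lemma (in prob_space) integral_tendsto_L2_bounded:
  fixes X :: "nat \<Rightarrow> 'a \<Rightarrow> real"
  assumes [measurable]: "\<And>n. X n \<in> borel_measurable M" "Z \<in> borel_measurable M"
    and lim: "AE w in M. (\<lambda>n. X n w) \<longlonglongrightarrow> Z w"
    and bnd: "\<And>n. (\<integral>\<^sup>+w. ennreal ((X n w)\<^sup>2) \<partial>M) \<le> ennreal C"
  shows "\<And>n. integrable M (X n)" "integrable M Z" "(\<lambda>n. integral\<^sup>L M (X n)) \<longlonglongrightarrow> integral\<^sup>L M Z"
proof -
  have "(\<integral>\<^sup>+w. ennreal ((Z w)\<^sup>2) \<partial>M) = (\<integral>\<^sup>+w. liminf (\<lambda>n. ennreal ((X n w)\<^sup>2)) \<partial>M)"
  proof (rule nn_integral_cong_AE, use lim in \<open>eventually_elim\<close>)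
    case (elim w)
    have "(\<lambda>n. ennreal ((X n w)\<^sup>2)) \<longlonglongrightarrow> ennreal ((Z w)\<^sup>2)"
      by (intro tendsto_intros elim)
    then show ?case by (rule lim_imp_Liminf[OF sequentially_bot, symmetric])
  qed
  also have "\<dots> \<le> liminf (\<lambda>n. \<integral>\<^sup>+w. ennreal ((X n w)\<^sup>2) \<partial>M)"
    by (rule nn_integral_liminf) simp
  also have "\<dots> \<le> limsup (\<lambda>n. \<integral>\<^sup>+w. ennreal ((X n w)\<^sup>2) \<partial>M)"
    by (rule Liminf_le_Limsup) simp
  also have "\<dots> \<le> ennreal C" by (rule Limsup_bounded) (auto intro: always_eventually bnd)
  finally have bndZ: "(\<integral>\<^sup>+w. ennreal ((Z w)\<^sup>2) \<partial>M) \<le> ennreal C" .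
  \<comment> \<open>\<open>ennreal\<close> sends a negative \<open>C\<close> to 0, so the real
    estimates use the positive part.\<close>
  define C' where "C' = max 0 C"
  have C': "ennreal C = ennreal C'" "0 \<le> C'" by (auto simp: C'_def max_def ennreal_neg)
  have sq: "integrable M (\<lambda>w. (V w)\<^sup>2)" "(\<integral>w. (V w)\<^sup>2 \<partial>M) \<le> C'" "integrable M V"
    if [measurable]: "V \<in> borel_measurable M" and b: "(\<integral>\<^sup>+w. ennreal ((V w)\<^sup>2) \<partial>M) \<le> ennreal C" for V
  proof -
    show i: "integrable M (\<lambda>w. (V w)\<^sup>2)"
      using b by (intro integrableI_bounded) (auto simp: order.strict_trans1)
    show "(\<integral>w. (V w)\<^sup>2 \<partial>M) \<le> C'"
      using b C' by (subst integral_eq_nn_integral) (auto simp: enn2real_leI)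
    show "integrable M V"
    proof (rule Bochner_Integration.integrable_bound[of _ "\<lambda>w. 1 + (V w)\<^sup>2"])
      have "\<bar>x\<bar> \<le> 1 + x\<^sup>2" for x :: real
        using zero_le_power2[of "\<bar>x\<bar> - 1"] power2_abs[of x] by (simp add: power2_diff) 
      then show "AE w in M. norm (V w) \<le> norm (1 + (V w)\<^sup>2)" by (auto intro!: AE_I2)
    qed (use i in auto)
  qed
  note sqX = sq[OF _ bnd, simplified] and sqZ = sq[OF _ bndZ, simplified]
  show iX: "integrable M (X n)" for n using sqX(3)[of n] by simp
  show iZ: "integrable M Z" using sqZ(3) by simp
  define cl where "cl L x = max (-L) (min L x)" for L x :: real
  have cl_err: "\<bar>x - cl L x\<bar> \<le> x\<^sup>2 / L" if "L > 0" for L x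
  proof (cases "\<bar>x\<bar> \<le> L")
    case True then show ?thesis using that by (auto simp: cl_def)
  next
    case False
    then have "L * \<bar>x\<bar> \<le> x\<^sup>2" by (metis abs_ge_zero linorder_le_cases mult_right_mono power2_abs power2_eq_square)
    moreover have "\<bar>x - cl L x\<bar> \<le> \<bar>x\<bar>" using False that by (auto simp: cl_def)
    ultimately show ?thesis using that by (simp add: field_simps) (smt (verit) mult.commute mult_left_mono)
  qed
  have cl_int: "integrable M (\<lambda>w. cl L (V w))" if [measurable]: "V \<in> borel_measurable M" for V L
    by (rule integrable_const_bound[where B="\<bar>L\<bar>"]) (auto simp: cl_def)
  have err: "\<bar>integral\<^sup>L M V - (\<integral>w. cl L (V w) \<partial>M)\<bar> \<le> C' / L"
    if [measurable]: "V \<in> borel_measurable M" and b: "(\<integral>\<^sup>+w. ennreal ((V w)\<^sup>2) \<partial>M) \<le> ennreal C" and L: "L > 0" for V L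
  proof -
    have "\<bar>integral\<^sup>L M V - (\<integral>w. cl L (V w) \<partial>M)\<bar> = \<bar>\<integral>w. V w - cl L (V w) \<partial>M\<bar>"
      using sq(3)[OF that(1,2)] cl_int[OF that(1)] by simp
    also have "\<dots> \<le> (\<integral>w. (V w)\<^sup>2 / L \<partial>M)"
      using sq[OF that(1,2)] cl_int[OF that(1)] cl_err[OF L]
      by (intro order_trans[OF integral_abs_bound] integral_mono) auto
    also have "\<dots> \<le> C' / L" using sq(2)[OF that(1,2)] L by (simp add: divide_right_mono)
    finally show ?thesis .
  qed
  show "(\<lambda>n. integral\<^sup>L M (X n)) \<longlonglongrightarrow> integral\<^sup>L M Z"
  proof (rule LIMSEQ_I)
    fix r :: real assume r: "0 < r"
    \<comment> \<open>The clipping errors of \<open>X n\<close> and of \<open>Z\<close> are then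
      each below \<open>r / 4\<close>; the summand 1 keeps \<open>L\<close> positive when
      \<open>C'\<close> is 0.\<close>
    define L where "L = 4 * (C' + 1) / r"
    have L: "L > 0" using r C' by (simp add: L_def)
    have "(\<lambda>n. \<integral>w. cl L (X n w) \<partial>M) \<longlonglongrightarrow> (\<integral>w. cl L (Z w) \<partial>M)"
    proof (rule integral_dominated_convergence[where w="\<lambda>_. L"])
      show "AE w in M. (\<lambda>n. cl L (X n w)) \<longlonglongrightarrow> cl L (Z w)"
        using lim by eventually_elim (auto simp: cl_def intro!: tendsto_intros)
    qed (use L in \<open>auto simp: cl_def\<close>)
    then obtain n0 where n0: "\<And>n. n \<ge> n0 \<Longrightarrow> \<bar>(\<integral>w. cl L (X n w) \<partial>M) - (\<integral>w. cl L (Z w) \<partial>M)\<bar> < r / 4"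
      using LIMSEQ_D[of "\<lambda>n. \<integral>w. cl L (X n w) \<partial>M" "\<integral>w. cl L (Z w) \<partial>M" "r/4"] r unfolding real_norm_def by fastforce
    have cl: "C' / L < r / 4" using r C' by (simp add: L_def field_simps)
    have "\<bar>integral\<^sup>L M (X n) - integral\<^sup>L M Z\<bar> < r" if "n \<ge> n0" for n
    proof -
      have "\<bar>integral\<^sup>L M (X n) - (\<integral>w. cl L (X n w) \<partial>M)\<bar> \<le> C' / L" "\<bar>integral\<^sup>L M Z - (\<integral>w. cl L (Z w) \<partial>M)\<bar> \<le> C' / L"
        using err[OF _ bnd L, of n] err[OF _ bndZ L] by auto
      then show ?thesis using n0[OF that] cl r by linarith
    qed
    then show "\<exists>no. \<forall>n\<ge>no. norm (integral\<^sup>L M (X n) - integral\<^sup>L M Z) < r" by auto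
  qed
qed

section \<open>Moments of Gaussian increments\<close>

abbreviation gauss :: "real \<Rightarrow> real measure" where
  "gauss h \<equiv> density lborel (\<lambda>x. ennreal (normal_density 0 (sqrt h) x))"

context
  fixes h :: real assumes h: "0 < h"
begin

lemma prob_space_gauss: "prob_space (gauss h)"
  using prob_space_normal_density[of "sqrt h" 0] h by simp

lemma gauss_moment:
  shows integrable_gauss_power: "integrable (gauss h) (\<lambda>z. z ^ k)"
    and gauss_moment_even: "(\<integral>z. z ^ (2 * k) \<partial>gauss h) = fact (2 * k) / ((2 / h) ^ k * fact k)"
    and gauss_moment_odd: "(\<integral>z. z ^ (2 * k + 1) \<partial>gauss h) = 0"
proof -
  have s: "0 < sqrt h" using h by simp
  show "integrable (gauss h) (\<lambda>z. z ^ k)"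
    using integrable_normal_moment[OF s, of 0 k] by (subst integrable_density) (auto simp: normal_density_nonneg)
  show "(\<integral>z. z ^ (2 * k) \<partial>gauss h) = fact (2 * k) / ((2 / h) ^ k * fact k)"
    using integral_normal_moment_even[OF s, of 0 k] h by (subst integral_density) (auto simp: normal_density_nonneg)
  show "(\<integral>z. z ^ (2 * k + 1) \<partial>gauss h) = 0"
    using integral_normal_moment_odd[OF s, of 0 k] h by (subst integral_density) (auto simp: normal_density_nonneg)
qed

lemma gauss_moments:
  "(\<integral>z. z \<partial>gauss h) = 0" "(\<integral>z. z\<^sup>2 \<partial>gauss h) = h" "(\<integral>z. z ^ 3 \<partial>gauss h) = 0" "(\<integral>z. z ^ 4 \<partial>gauss h) = 3 * h\<^sup>2"
  using gauss_moment_odd[of 0] gauss_moment_even[of 1] gauss_moment_odd[of 1] gauss_moment_even[of 2] h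
  by (simp_all add: fact_numeral power2_eq_square)

lemma integrable_gauss_shift_power: "integrable (gauss h) (\<lambda>z. (x + z) ^ k)"
  unfolding binomial_ring by (intro Bochner_Integration.integrable_sum integrable_mult_right integrable_gauss_power)

text \<open>Jensen's inequality through the tangent at \<open>x\<close>: its linear term has mean
  zero under the centred Gaussian law.\<close>

lemma gauss_even_power_ge: "x ^ (2 * q) \<le> (\<integral>z. (x + z) ^ (2 * q) \<partial>gauss h)"
proof -
  interpret prob_space "gauss h" by (rule prob_space_gauss)
  have tangent: "x ^ (2 * q) + real (2 * q) * x ^ (2 * q - 1) * z \<le> (x + z) ^ (2 * q)" for z
  proof -
    have "real (2 * q) * x ^ (2 * q - 1) * ((x + z) - x) \<le> (x + z) ^ (2 * q) - x ^ (2 * q)"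
      by (rule convex_on_imp_above_tangent[where A=UNIV])
        (auto intro!: derivative_eq_intros convex_power_even)
    then show ?thesis by simp
  qed
  have i: "integrable (gauss h) (\<lambda>z. z)" using integrable_gauss_power[of 1] by simp
  have "x ^ (2 * q) = (\<integral>z. x ^ (2 * q) + real (2 * q) * x ^ (2 * q - 1) * z \<partial>gauss h)"
    using i gauss_moments(1) prob_space by simp
  also have "\<dots> \<le> (\<integral>z. (x + z) ^ (2 * q) \<partial>gauss h)"
    by (rule integral_mono) (use i tangent integrable_gauss_shift_power in auto)
  finally show ?thesis .
qed

end

text \<open>Space-time Hermite polynomials; degrees above four are never used, so their value is arbitrary.\<close>

fun herm :: "nat \<Rightarrow> real \<Rightarrow> real \<Rightarrow> real" where
  "herm 0 s x = 1"
| "herm (Suc 0) s x = x"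
| "herm (Suc (Suc 0)) s x = x\<^sup>2 - s"
| "herm (Suc (Suc (Suc 0))) s x = x ^ 3 - 3 * s * x"
| "herm (Suc (Suc (Suc (Suc k)))) s x = x ^ 4 - 6 * s * x\<^sup>2 + 3 * s\<^sup>2"

lemma herm_eqs: "herm 1 s x = x" "herm 2 s x = x\<^sup>2 - s" "herm 3 s x = x ^ 3 - 3 * s * x"
    "herm 4 s x = x ^ 4 - 6 * s * x\<^sup>2 + 3 * s\<^sup>2"
  by (simp_all add: numeral_eq_Suc)

lemma herm_cases: "herm k = herm 0 \<or> herm k = herm 1 \<or> herm k = herm 2 \<or> herm k = herm 3 \<or> herm k = herm 4"
proof -
  consider "k = 0" | "k = 1" | "k = 2" | "k = 3" | m where "k = Suc (Suc (Suc (Suc m)))"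
    by (metis One_nat_def Suc_1 numeral_3_eq_3 old.nat.exhaust)
  then show ?thesis
    by cases (auto simp: fun_eq_iff numeral_eq_Suc)
qed

lemma tendsto_herm [tendsto_intros]:
  assumes "(f \<longlongrightarrow> a) Fl" "(g \<longlongrightarrow> b) Fl"
  shows "((\<lambda>x. herm k (f x) (g x)) \<longlongrightarrow> herm k a b) Fl"
  using herm_cases[of k] by (elim disjE) (auto simp: herm_eqs simp del: One_nat_def intro!: tendsto_intros assms)

lemma measurable_herm [measurable (raw)]:
  assumes [measurable]: "f \<in> borel_measurable A" "g \<in> borel_measurable A"
  shows "(\<lambda>x. herm k (f x) (g x)) \<in> borel_measurable A"
  using herm_cases[of k] by (elim disjE) (simp_all add: herm_eqs del: One_nat_def)

text \<open>The one-step martingale property: averaging over a Gaussian increment of variance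
  \<open>h\<close> moves the polynomial back in time by \<open>h\<close>. After expansion in
  \<open>z\<close> only the moments \<open>h\<close> and \<open>3 h^2\<close> survive, and they
  compensate the shift of \<open>s\<close>.\<close>

lemma gauss_herm:
  assumes h: "0 < h"
  shows "integrable (gauss h) (\<lambda>z. herm k (s + h) (x + z))" "(\<integral>z. herm k (s + h) (x + z) \<partial>gauss h) = herm k s x"
proof -
  interpret prob_space "gauss h" by (rule prob_space_gauss[OF h])
  note m = gauss_moments[OF h] prob_space[simplified]
  have i: "integrable (gauss h) (\<lambda>z. z)" "integrable (gauss h) (\<lambda>z. z\<^sup>2)" "integrable (gauss h) (\<lambda>z. z ^ 3)" "integrable (gauss h) (\<lambda>z. z ^ 4)"
    using integrable_gauss_power[OF h, of 1] integrable_gauss_power[OF h] by auto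
  have e2: "(x + z)\<^sup>2 - (s + h) = x\<^sup>2 - s - h + 2 * x * z + z\<^sup>2" for z
    by (simp add: power2_eq_square algebra_simps)
  have e3: "(x + z) ^ 3 - 3 * (s + h) * (x + z) = (x ^ 3 - 3 * (s + h) * x) + (3 * x\<^sup>2 - 3 * (s + h)) * z + 3 * x * z\<^sup>2 + z ^ 3" for z
    by (simp add: power2_eq_square power3_eq_cube algebra_simps)
  have e4: "(x + z) ^ 4 - 6 * (s + h) * (x + z)\<^sup>2 + 3 * (s + h)\<^sup>2 =
      (x ^ 4 - 6 * (s + h) * x\<^sup>2 + 3 * (s + h)\<^sup>2) + (4 * x ^ 3 - 12 * (s + h) * x) * z + (6 * x\<^sup>2 - 6 * (s + h)) * z\<^sup>2 + 4 * x * z ^ 3 + z ^ 4" for z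
    by (simp add: power2_eq_square power3_eq_cube power4_eq_xxxx algebra_simps)
  show "integrable (gauss h) (\<lambda>z. herm k (s + h) (x + z))"
    using herm_cases[of k] by (elim disjE) (simp_all only: herm_eqs herm.simps e2 e3 e4, simp_all add: i)
  show "(\<integral>z. herm k (s + h) (x + z) \<partial>gauss h) = herm k s x"
    using herm_cases[of k] by (elim disjE) (simp_all only: herm_eqs herm.simps e2 e3 e4, simp_all add: i m, simp_all add: power2_eq_square algebra_simps)
qed

text \<open>Uniform in \<open>s\<close> up to \<open>K\<close> and of one degree for all
  \<open>k\<close>, so that square integrability reduces to even moments of the Brownian
  motion.\<close>

lemma herm_bound:
  assumes "0 \<le> s" "s \<le> K"
  shows "\<bar>herm k s x\<bar> \<le> (1 + 6 * K + 3 * K\<^sup>2) * (1 + \<bar>x\<bar>) ^ 4"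
proof -
  define c where "c = 1 + 6 * K + 3 * K\<^sup>2"
  define y where "y = \<bar>x\<bar>"
  have y: "0 \<le> y" by (simp add: y_def)
  have K: "0 \<le> K" using assms by simp
  have p: "1 \<le> (1 + y) ^ 4" "y \<le> (1 + y) ^ 4" "y\<^sup>2 \<le> (1 + y) ^ 4" "y ^ 3 \<le> (1 + y) ^ 4" "y ^ 4 \<le> (1 + y) ^ 4"
  proof -
    have le: "(1 + y) ^ i \<le> (1 + y) ^ 4" if "i \<le> 4" for i using that y by (intro power_increasing) auto
    have "y ^ i \<le> (1 + y) ^ 4" if "i \<le> 4" for i
      using order_trans[OF power_mono[of y "1 + y" i] le[OF that]] y by auto
    from this[of 0] this[of 1] this[of 2] this[of 3] this[of 4]
    show "1 \<le> (1 + y) ^ 4" "y \<le> (1 + y) ^ 4" "y\<^sup>2 \<le> (1 + y) ^ 4" "y ^ 3 \<le> (1 + y) ^ 4" "y ^ 4 \<le> (1 + y) ^ 4"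
      by simp_all
  qed
  have q: "s \<le> K" "s\<^sup>2 \<le> K\<^sup>2" "0 \<le> s" using assms by (auto intro: power_mono)
  have s1: "s * a \<le> K * (1 + y) ^ 4" if "0 \<le> a" "a \<le> (1 + y) ^ 4" for a
    using q that K by (intro mult_mono) auto
  have s2: "s\<^sup>2 \<le> K\<^sup>2 * (1 + y) ^ 4" 
    using mult_mono[OF q(2) p(1)] by simp
  have KK: "0 \<le> K * (1 + y) ^ 4" "0 \<le> K\<^sup>2 * (1 + y) ^ 4" using K y by auto
  have ab: "\<bar>x\<bar> = y" "\<bar>x ^ 3\<bar> = y ^ 3" "\<bar>x ^ 4\<bar> = y ^ 4" "x\<^sup>2 = y\<^sup>2" "\<bar>s * x\<bar> = s * y"
    using q by (simp_all add: y_def power_abs abs_mult)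
  have y2: "0 \<le> y\<^sup>2" "0 \<le> y ^ 3" "0 \<le> y ^ 4" using y by auto
  have sy: "s * 1 \<le> K * (1 + y) ^ 4" "s * y \<le> K * (1 + y) ^ 4" "s * y\<^sup>2 \<le> K * (1 + y) ^ 4" "0 \<le> s * y\<^sup>2"
    by (rule s1, use p y q in simp, use p in simp)+ (use q in simp)
  have "\<bar>herm k s x\<bar> \<le> (1 + y) ^ 4 + 6 * (K * (1 + y) ^ 4) + 3 * (K\<^sup>2 * (1 + y) ^ 4)"
    using herm_cases[of k]
    apply (elim disjE)
        apply (simp_all only: herm_eqs herm.simps)
    subgoal using p KK by linarith
    subgoal using p KK ab by linarith
    subgoal using p KK ab sy q y2 by (simp only: ab)
    subgoal
    proof -
      have "\<bar>x ^ 3 - 3 * s * x\<bar> \<le> y ^ 3 + 3 * (s * y)"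
        using abs_triangle_ineq4[of "x ^ 3" "3 * s * x"] ab q by (simp add: abs_mult mult.assoc)
      then show ?thesis using p KK sy y2 by linarith
    qed
    subgoal
    proof -
      have "x ^ 4 = y ^ 4" "0 \<le> s\<^sup>2" using ab(3) by (simp_all add: power_even_abs_numeral)
      moreover have "x ^ 4 - 6 * s * x\<^sup>2 + 3 * s\<^sup>2 = x ^ 4 - 6 * (s * y\<^sup>2) + 3 * s\<^sup>2" using ab(4) by simp
      ultimately show ?thesis using p(5) KK sy(3,4) y2 s2 by linarith
    qed
    done
  then show ?thesis by (simp add: y_def algebra_simps)
qed

section \<open>Products of Hermite polynomials over the coordinates\<close>

text \<open>The coordinates being independent, products of one-dimensional martingale polynomials
  are again martingales. Every polynomial martingale used later is a linear combination of these
  products.\<close>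

definition hp :: "('d::finite \<Rightarrow> nat) \<Rightarrow> real \<Rightarrow> real ^ 'd \<Rightarrow> real" where
  "hp a s x = (\<Prod>j\<in>UNIV. herm (a j) s (x $ j))"

lemma measurable_hp [measurable (raw)]:
  assumes [measurable]: "f \<in> borel_measurable A" "g \<in> borel_measurable A"
  shows "(\<lambda>x. hp a (f x) (g x)) \<in> borel_measurable A"
proof -
  have [measurable]: "(\<lambda>x. g x $ j) \<in> borel_measurable A" for j
    by (rule measurable_compose[OF assms(2)]) simp
  show ?thesis unfolding hp_def by measurable
qed

lemma tendsto_hp [tendsto_intros]:
  assumes "(f \<longlongrightarrow> x) Fl" "(g \<longlongrightarrow> b) Fl"
  shows "((\<lambda>x. hp a (f x) (g x)) \<longlongrightarrow> hp a x b) Fl"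
  unfolding hp_def by (intro tendsto_intros assms)

lemma hp_bound:
  fixes x :: "real ^ 'd::finite"
  assumes "0 \<le> s" "s \<le> K"
  shows "\<bar>hp a s x\<bar> \<le> (1 + 6 * K + 3 * K\<^sup>2) ^ CARD('d) * (1 + norm x) ^ (4 * CARD('d))"
proof -
  have c: "0 \<le> 1 + 6 * K + 3 * K\<^sup>2" using assms by simp
  have "\<bar>hp a s x\<bar> = (\<Prod>j\<in>UNIV. \<bar>herm (a j) s (x $ j)\<bar>)" by (simp add: hp_def abs_prod)
  also have "\<dots> \<le> (\<Prod>j\<in>(UNIV :: 'd set). (1 + 6 * K + 3 * K\<^sup>2) * (1 + norm x) ^ 4)"
  proof (rule prod_mono, rule conjI)
    fix j
    have "(1 + \<bar>x $ j\<bar>) ^ 4 \<le> (1 + norm x) ^ 4" by (intro power_mono add_left_mono component_le_norm_cart) auto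
    then show "\<bar>herm (a j) s (x $ j)\<bar> \<le> (1 + 6 * K + 3 * K\<^sup>2) * (1 + norm x) ^ 4"
      using herm_bound[OF assms, of "a j" "x $ j"] c by (meson mult_left_mono order_trans)
  qed simp
  also have "\<dots> = (1 + 6 * K + 3 * K\<^sup>2) ^ CARD('d) * (1 + norm x) ^ (4 * CARD('d))"
    by (simp add: power_mult_distrib power_mult)
  finally show ?thesis .
qed

text \<open>Crude but sufficient: the sum is at most the number of terms times the largest of
  them.\<close>

lemma sum_power_le:
  fixes u :: "'i \<Rightarrow> real"
  assumes "finite I" "I \<noteq> {}" "\<And>i. i \<in> I \<Longrightarrow> 0 \<le> u i"
  shows "(\<Sum>i\<in>I. u i) ^ p \<le> real (card I) ^ p * (\<Sum>i\<in>I. u i ^ p)"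
proof -
  define m where "m = Max (u ` I)"
  have m: "u i \<le> m" if "i \<in> I" for i using that assms by (simp add: m_def)
  obtain i where i: "i \<in> I" "m = u i" using Max_in[of "u ` I"] assms(1,2) unfolding m_def by blast
  have "(\<Sum>i\<in>I. u i) ^ p \<le> (real (card I) * m) ^ p"
    using assms m by (intro power_mono sum_nonneg) (auto intro: sum_bounded_above)
  also have "\<dots> = real (card I) ^ p * u i ^ p" by (simp add: power_mult_distrib i)
  also have "u i ^ p \<le> (\<Sum>i\<in>I. u i ^ p)"
    using assms i by (intro member_le_sum) auto
  finally show ?thesis by (simp add: mult_left_mono)
qed

text \<open>Reduces a power of the norm of a difference to even powers of the coordinates of the two
  end points, which are submartingales and can therefore be estimated by their values at the final
  time.\<close>

lemma norm_diff_power_le: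
  fixes x y :: "real ^ 'd::finite"
  shows "(1 + norm (x - y)) ^ (2 * q) \<le>
    (3 * real CARD('d)) ^ (2 * q) * (1 + (\<Sum>j\<in>UNIV. (x $ j) ^ (2 * q)) + (\<Sum>j\<in>UNIV. (y $ j) ^ (2 * q)))"
proof -
  let ?d = "real CARD('d)"
  have d: "1 \<le> ?d" by (simp add: Suc_leI)
  have n: "norm z ^ (2 * q) \<le> ?d ^ (2 * q) * (\<Sum>j\<in>UNIV. (z $ j) ^ (2 * q))" for z :: "real ^ 'd"
  proof -
    have "norm z ^ (2 * q) \<le> (\<Sum>j\<in>UNIV. \<bar>z $ j\<bar>) ^ (2 * q)"
      by (intro power_mono norm_le_l1_cart) simp
    also have "\<dots> \<le> ?d ^ (2 * q) * (\<Sum>j\<in>UNIV. \<bar>z $ j\<bar> ^ (2 * q))"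
      by (rule sum_power_le) auto
    finally show ?thesis by (simp add: power_even_abs)
  qed
  have t: "(a + b + c) ^ p \<le> 3 ^ p * (a ^ p + b ^ p + c ^ p)" if "0 \<le> a" "0 \<le> b" "0 \<le> c" for a b c :: real and p
    using sum_power_le[of "{0,1,2::nat}" "\<lambda>i. if i = 0 then a else if i = 1 then b else c" p] that by (simp add: add.assoc)
  have "(1 + norm (x - y)) ^ (2 * q) \<le> (1 + norm x + norm y) ^ (2 * q)"
    by (intro power_mono) (auto intro: norm_triangle_ineq4 order_trans simp: add.assoc)
  also have "\<dots> \<le> 3 ^ (2 * q) * (1 ^ (2 * q) + norm x ^ (2 * q) + norm y ^ (2 * q))"
    by (rule t) auto
  also have "\<dots> \<le> 3 ^ (2 * q) * (?d ^ (2 * q) * (1 + (\<Sum>j\<in>UNIV. (x $ j) ^ (2 * q)) + (\<Sum>j\<in>UNIV. (y $ j) ^ (2 * q))))"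
    using n[of x] n[of y] one_le_power[OF d, of "2 * q"]
    by (intro mult_left_mono; simp only: distrib_left mult_1_right power_one) simp_all
  finally show ?thesis by (simp add: power_mult_distrib mult.assoc)
qed

section \<open>Brownian motion with continuous paths on a complete filtered space\<close>

text \<open>The path properties hold at every point, which costs only a change on a null set
  (\<open>bm_completion\<close>). \<open>prob_increment\<close> expresses on boxes that the
  increment is independent of \<open>F s\<close>, with independent centred Gaussian coordinates of
  variance \<open>u - s\<close>. As each \<open>F s\<close> contains the null sets, events and
  stopping times may be altered there.\<close>

locale bm = prob_space N + filtration "space N" F
  for N :: "'a measure" and F :: "real \<Rightarrow> 'a measure" +
  fixes W :: "real \<Rightarrow> 'a \<Rightarrow> real ^ 'd"
  assumes sets_F_subset: "sets (F s) \<subseteq> sets N"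
    and complete_N: "complete_measure N"
    and null_sets_F: "null_sets N \<subseteq> sets (F s)"
    and adapted_W: "0 \<le> s \<Longrightarrow> W s \<in> borel_measurable (F s)"
    and continuous_W: "w \<in> space N \<Longrightarrow> continuous_on {0..} (\<lambda>s. W s w)"
    and W_0: "w \<in> space N \<Longrightarrow> W 0 w = 0"
    and prob_increment: "0 \<le> s \<Longrightarrow> s < u \<Longrightarrow> A \<in> sets (F s) \<Longrightarrow> (\<And>j. B j \<in> sets borel) \<Longrightarrow>
      prob (A \<inter> {w \<in> space N. \<forall>j. W u w $ j - W s w $ j \<in> B j}) =
      prob A * (\<Prod>j\<in>UNIV. measure (gauss (u - s)) (B j))"
begin

sublocale complete_measure N by (rule complete_N)

lemma subalgebra_F: "subalgebra N (F s)"
  using sets_F_subset by (simp add: subalgebra_def space_F)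

lemma measurable_F_mono: "f \<in> measurable (F s) B \<Longrightarrow> s \<le> u \<Longrightarrow> f \<in> measurable (F u) B"
  using sets_F_mono[of s u] by (auto simp: measurable_def space_F)

lemma measurable_F_N: "f \<in> measurable (F s) B \<Longrightarrow> f \<in> measurable N B"
  by (rule measurable_from_subalg[OF subalgebra_F])

lemma measurable_W [measurable (raw)]: "0 \<le> s \<Longrightarrow> W s \<in> borel_measurable N"
  using adapted_W measurable_F_N by blast

lemma measurable_vec_nth_compose: "f \<in> borel_measurable A \<Longrightarrow> (\<lambda>x. f x $ j) \<in> borel_measurable A"
  for f :: "_ \<Rightarrow> real ^ 'd"
  by (rule measurable_compose[of f]) auto

text \<open>For a fixed event \<open>A\<close> of \<open>F s\<close>, both sides are finite measures
  in the second factor; they agree on boxes by \<open>prob_increment\<close> and therefore on all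
  measurable sets.\<close>

lemma joint_law:
  assumes s: "0 \<le> s" "s < u"
  shows "restr_to_subalg N (F s) \<Otimes>\<^sub>M (\<Pi>\<^sub>M j\<in>UNIV. gauss (u - s)) =
    distr N (F s \<Otimes>\<^sub>M (\<Pi>\<^sub>M j\<in>UNIV. borel)) (\<lambda>w. (w, \<lambda>j. W u w $ j - W s w $ j))"
proof -
  let ?G = "gauss (u - s)" and ?\<xi> = "\<lambda>w j. W u w $ j - W s w $ j"
  interpret g: prob_space ?G using s by (intro prob_space_gauss) simp
  interpret P: product_prob_space "\<lambda>_::'d. ?G" UNIV ..
  interpret R: prob_space "restr_to_subalg N (F s)"
    by (rule prob_space_restr_to_subalg[OF subalgebra_F]) (rule prob_space_axioms)
  have setsP: "sets (\<Pi>\<^sub>M j\<in>(UNIV::'d set). ?G) = sets (\<Pi>\<^sub>M j\<in>UNIV. borel)"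
    by (rule sets_PiM_cong) auto
  have Wm: "W u \<in> borel_measurable N" "W s \<in> borel_measurable N" using s by auto
  have m\<xi>[measurable]: "?\<xi> \<in> N \<rightarrow>\<^sub>M (\<Pi>\<^sub>M j\<in>UNIV. borel)"
    by (rule measurable_PiM_single') (auto intro!: borel_measurable_diff measurable_vec_nth_compose Wm)
  have id[measurable]: "(\<lambda>w. w) \<in> N \<rightarrow>\<^sub>M F s"
    using sets_F_subset by (auto simp: measurable_def space_F)
  have [measurable]: "(\<lambda>w. (w, ?\<xi> w)) \<in> N \<rightarrow>\<^sub>M F s \<Otimes>\<^sub>M (\<Pi>\<^sub>M j\<in>UNIV. borel)" by measurable
  show ?thesis
  proof (rule pair_measure_eqI)
    show "sets (restr_to_subalg N (F s) \<Otimes>\<^sub>M (\<Pi>\<^sub>M j\<in>UNIV. ?G)) =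
      sets (distr N (F s \<Otimes>\<^sub>M (\<Pi>\<^sub>M j\<in>UNIV. borel)) (\<lambda>w. (w, ?\<xi> w)))"
      using setsP by (simp add: sets_restr_to_subalg[OF subalgebra_F] cong: sets_pair_measure_cong)
    fix A B assume A: "A \<in> sets (restr_to_subalg N (F s))" and B: "B \<in> sets (\<Pi>\<^sub>M j\<in>(UNIV::'d set). ?G)"
    then have A': "A \<in> sets (F s)" by (simp add: sets_restr_to_subalg[OF subalgebra_F])
    then have AN[measurable]: "A \<in> sets N" using sets_F_subset by auto
    have B'[measurable]: "B \<in> sets (\<Pi>\<^sub>M j\<in>(UNIV::'d set). borel)" using B setsP by auto
    let ?P = "distr (density N (indicator A)) (\<Pi>\<^sub>M j\<in>(UNIV::'d set). borel) ?\<xi>"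
    let ?Q = "scale_measure (emeasure N A) (\<Pi>\<^sub>M j\<in>(UNIV::'d set). ?G)"
    have eP: "emeasure ?P C = emeasure N (A \<inter> (?\<xi> -` C \<inter> space N))" if [measurable]: "C \<in> sets (\<Pi>\<^sub>M j\<in>(UNIV::'d set). borel)" for C
    proof -
      have "emeasure ?P C = (\<integral>\<^sup>+w. indicator A w * indicator (?\<xi> -` C \<inter> space N) w \<partial>N)"
        by (subst emeasure_distr) (auto simp: emeasure_density)
      also have "\<dots> = (\<integral>\<^sup>+w. indicator (A \<inter> (?\<xi> -` C \<inter> space N)) w \<partial>N)"
        by (intro nn_integral_cong) (auto split: split_indicator)
      finally show ?thesis by (subst (asm) nn_integral_indicator) auto
    qed
    have "?P = ?Q"
    proof (rule measure_eqI_PiM_finite[where I="UNIV::'d set" and M="\<lambda>_. borel" and A="\<lambda>_::nat. space (\<Pi>\<^sub>M j\<in>(UNIV::'d set). borel::real measure)"])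
      show "sets ?Q = sets (\<Pi>\<^sub>M j\<in>(UNIV::'d set). borel)" using setsP by simp
      fix C :: "'d \<Rightarrow> real set" assume C: "\<And>i. i \<in> UNIV \<Longrightarrow> C i \<in> sets borel"
      have [measurable]: "Pi\<^sub>E UNIV C \<in> sets (\<Pi>\<^sub>M j\<in>UNIV. borel)" using C by (intro sets_PiM_I_finite) auto
      have "emeasure ?P (Pi\<^sub>E UNIV C) = emeasure N (A \<inter> {w \<in> space N. \<forall>j. ?\<xi> w j \<in> C j})"
        by (subst eP) (auto intro!: arg_cong[where f="emeasure N"])
      also have "\<dots> = ennreal (prob A * (\<Prod>j\<in>UNIV. measure ?G (C j)))"
        using prob_increment[OF s A', of C] C by (simp add: emeasure_eq_measure)
      also have "\<dots> = emeasure N A * (\<Prod>j\<in>UNIV. emeasure ?G (C j))"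
        by (simp add: emeasure_eq_measure g.emeasure_eq_measure ennreal_mult prod_nonneg prod_ennreal)
      also have "(\<Prod>j\<in>UNIV. emeasure ?G (C j)) = emeasure (\<Pi>\<^sub>M j\<in>(UNIV::'d set). ?G) (Pi\<^sub>E UNIV C)"
        using C by (subst P.emeasure_PiM) auto
      finally show "emeasure ?P (Pi\<^sub>E UNIV C) = emeasure ?Q (Pi\<^sub>E UNIV C)" by simp
    next
      show "range (\<lambda>_::nat. space (\<Pi>\<^sub>M j\<in>(UNIV::'d set). borel::real measure)) \<subseteq> prod_algebra UNIV (\<lambda>_. borel)"
        using prod_algebraI_finite[of UNIV "\<lambda>_::'d. UNIV" "\<lambda>_. borel::real measure"] by (auto simp: space_PiM)
      show "emeasure ?P (space (\<Pi>\<^sub>M j\<in>(UNIV::'d set). borel)) \<noteq> \<infinity>"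
        by (subst eP) auto
    qed auto
    then have "emeasure N A * emeasure (\<Pi>\<^sub>M j\<in>(UNIV::'d set). ?G) B = emeasure N (A \<inter> (?\<xi> -` B \<inter> space N))"
      using eP[OF B'] by simp
    also have "\<dots> = emeasure (distr N (F s \<Otimes>\<^sub>M (\<Pi>\<^sub>M j\<in>UNIV. borel)) (\<lambda>w. (w, ?\<xi> w))) (A \<times> B)"
      using A' AN by (subst emeasure_distr) (auto intro!: arg_cong[where f="emeasure N"])
    finally show "emeasure (restr_to_subalg N (F s)) A * emeasure (\<Pi>\<^sub>M j\<in>(UNIV::'d set). ?G) B =
       emeasure (distr N (F s \<Otimes>\<^sub>M (\<Pi>\<^sub>M j\<in>UNIV. borel)) (\<lambda>w. (w, ?\<xi> w))) (A \<times> B)"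
      by (simp add: emeasure_restr_to_subalg[OF subalgebra_F A'])
  qed (unfold_locales)
qed

text \<open>The freezing lemma: what is known at time \<open>s\<close> is held fixed while the
  increment is integrated out. The measure is restricted to \<open>F s\<close> because joint
  measurability is only assumed with respect to that algebra.\<close>

lemma increment_integral:
  fixes \<phi> :: "'a \<times> ('d \<Rightarrow> real) \<Rightarrow> real"
  assumes s: "0 \<le> s" "s < u"
    and \<phi>: "\<phi> \<in> borel_measurable (F s \<Otimes>\<^sub>M (\<Pi>\<^sub>M j\<in>UNIV. borel))"
    and int: "integrable N (\<lambda>w. \<phi> (w, \<lambda>j. W u w $ j - W s w $ j))"
  shows "(\<integral>w. \<phi> (w, \<lambda>j. W u w $ j - W s w $ j) \<partial>N) =
     (\<integral>w. (\<integral>z. \<phi> (w, z) \<partial>(\<Pi>\<^sub>M j\<in>UNIV. gauss (u - s))) \<partial>restr_to_subalg N (F s))"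
proof -
  let ?G = "gauss (u - s)" and ?\<xi> = "\<lambda>w j. W u w $ j - W s w $ j"
  interpret g: prob_space ?G using s by (intro prob_space_gauss) simp
  interpret P: product_prob_space "\<lambda>_::'d. ?G" UNIV ..
  interpret R: prob_space "restr_to_subalg N (F s)"
    by (rule prob_space_restr_to_subalg[OF subalgebra_F]) (rule prob_space_axioms)
  interpret pair_sigma_finite "restr_to_subalg N (F s)" "\<Pi>\<^sub>M j\<in>(UNIV::'d set). ?G" ..
  have Wm: "W u \<in> borel_measurable N" "W s \<in> borel_measurable N" using s by auto
  have m\<xi>[measurable]: "?\<xi> \<in> N \<rightarrow>\<^sub>M (\<Pi>\<^sub>M j\<in>UNIV. borel)"
    by (rule measurable_PiM_single') (auto intro!: borel_measurable_diff measurable_vec_nth_compose Wm)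
  have id[measurable]: "(\<lambda>w. w) \<in> N \<rightarrow>\<^sub>M F s"
    using sets_F_subset by (auto simp: measurable_def space_F)
  have m[measurable]: "(\<lambda>w. (w, ?\<xi> w)) \<in> N \<rightarrow>\<^sub>M F s \<Otimes>\<^sub>M (\<Pi>\<^sub>M j\<in>UNIV. borel)" by measurable
  have i: "integrable (restr_to_subalg N (F s) \<Otimes>\<^sub>M (\<Pi>\<^sub>M j\<in>UNIV. ?G)) \<phi>"
    unfolding joint_law[OF s] using int by (subst integrable_distr_eq[OF m \<phi>]) simp
  have "(\<integral>w. \<phi> (w, ?\<xi> w) \<partial>N) = integral\<^sup>L (restr_to_subalg N (F s) \<Otimes>\<^sub>M (\<Pi>\<^sub>M j\<in>UNIV. ?G)) \<phi>"
    unfolding joint_law[OF s] by (subst integral_distr[OF m \<phi>]) simp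
  also have "\<dots> = (\<integral>w. (\<integral>z. \<phi> (w, z) \<partial>(\<Pi>\<^sub>M j\<in>UNIV. ?G)) \<partial>restr_to_subalg N (F s))"
    by (rule integral_fst'[symmetric, OF i])
  finally show ?thesis .
qed

lemma distr_increment:
  assumes s: "0 \<le> s" "s < u"
  shows "distr N borel (\<lambda>w. W u w $ j - W s w $ j) = gauss (u - s)"
proof (rule measure_eqI)
  interpret g: prob_space "gauss (u - s)" using s by (intro prob_space_gauss) simp
  have Wm: "W u \<in> borel_measurable N" "W s \<in> borel_measurable N" using s by auto
  have m: "(\<lambda>w. W u w $ j - W s w $ j) \<in> borel_measurable N"
    by (intro borel_measurable_diff measurable_vec_nth_compose Wm)
  fix A assume "A \<in> sets (distr N borel (\<lambda>w. W u w $ j - W s w $ j))"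
  then have A: "A \<in> sets borel" by simp
  have "emeasure (distr N borel (\<lambda>w. W u w $ j - W s w $ j)) A =
      prob (space N \<inter> {w \<in> space N. \<forall>i. W u w $ i - W s w $ i \<in> (if i = j then A else UNIV)})"
    using m A by (subst emeasure_distr) (auto simp: emeasure_eq_measure intro!: arg_cong[where f=prob])
  also have "\<dots> = prob (space N) * (\<Prod>i\<in>UNIV. measure (gauss (u - s)) (if i = j then A else UNIV))"
    by (rule arg_cong[where f=ennreal], rule prob_increment[OF s]) (use A in \<open>auto simp: space_F[symmetric, of s]\<close>)
  also have "(\<Prod>i\<in>UNIV. measure (gauss (u - s)) (if i = j then A else UNIV)) = (\<Prod>i\<in>UNIV. if i = j then measure (gauss (u - s)) A else 1)"
    using g.prob_space by (intro prod.cong) auto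
  also have "\<dots> = measure (gauss (u - s)) A" by simp
  finally show "emeasure (distr N borel (\<lambda>w. W u w $ j - W s w $ j)) A = emeasure (gauss (u - s)) A"
    by (simp add: prob_space g.emeasure_eq_measure)
qed simp

lemma integrable_W_power:
  assumes "0 \<le> s"
  shows "integrable N (\<lambda>w. (W s w $ j) ^ p)"
proof (cases "s = 0")
  case True
  have "integrable N (\<lambda>w. (0::real) ^ p)" by simp
  then show ?thesis by (rule Bochner_Integration.integrable_cong[THEN iffD1, rotated 2]) (auto simp: True W_0)
next
  case False
  then have s: "0 \<le> (0::real)" "0 < s" using assms by auto
  have Wm: "W 0 \<in> borel_measurable N" "W s \<in> borel_measurable N" using s by auto
  have m: "(\<lambda>w. W s w $ j - W 0 w $ j) \<in> borel_measurable N"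
    by (intro borel_measurable_diff measurable_vec_nth_compose Wm)
  have "integrable (distr N borel (\<lambda>w. W s w $ j - W 0 w $ j)) (\<lambda>z. z ^ p)"
    unfolding distr_increment[OF s] using s by (intro integrable_gauss_power) auto
  then have "integrable N (\<lambda>w. (W s w $ j - W 0 w $ j) ^ p)"
    by (subst (asm) integrable_distr_eq[OF m]) auto
  then show ?thesis by (rule Bochner_Integration.integrable_cong[THEN iffD1, rotated 2]) (auto simp: W_0)
qed

text \<open>Conditional Jensen inequality: by freezing, the inner integral of the difference is
  nonnegative at each point.\<close>

lemma increment_even_power_ge:
  assumes s: "0 \<le> s" "s < u" and A: "A \<in> sets (F s)"
  shows "(\<integral>w. indicator A w * (W s w $ j) ^ (2 * q) \<partial>N) \<le> (\<integral>w. indicator A w * (W u w $ j) ^ (2 * q) \<partial>N)"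
proof -
  let ?G = "gauss (u - s)"
  interpret g: prob_space ?G using s by (intro prob_space_gauss) simp
  interpret P: product_prob_space "\<lambda>_::'d. ?G" UNIV ..
  have AN: "A \<in> sets N" using A sets_F_subset by auto
  have i: "integrable N (\<lambda>w. indicator A w * (W v w $ j) ^ (2 * q))" if "0 \<le> v" for v
    using AN integrable_W_power[OF that] by (intro integrable_mult_indicator[where 'b=real, simplified]) auto
  define \<phi> where "\<phi> = (\<lambda>(w, z). indicator A w * ((W s w $ j + z j) ^ (2 * q) - (W s w $ j) ^ (2 * q)))"
  have Wm[measurable]: "(\<lambda>w. W s w $ j) \<in> borel_measurable (F s)" using s adapted_W by (intro measurable_vec_nth_compose) auto
  have [measurable]: "\<phi> \<in> borel_measurable (F s \<Otimes>\<^sub>M (\<Pi>\<^sub>M j\<in>UNIV. borel))"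
    unfolding \<phi>_def using A by measurable
  have \<phi>eq: "\<phi> (w, \<lambda>j. W u w $ j - W s w $ j) = indicator A w * (W u w $ j) ^ (2 * q) - indicator A w * (W s w $ j) ^ (2 * q)" for w
    by (simp add: \<phi>_def algebra_simps)
  have inner: "0 \<le> (\<integral>z. \<phi> (w, z) \<partial>(\<Pi>\<^sub>M j\<in>UNIV. ?G))" for w
  proof -
    have "(\<integral>z. \<phi> (w, z) \<partial>(\<Pi>\<^sub>M j\<in>UNIV. ?G)) = (\<integral>z. indicator A w * ((W s w $ j + z) ^ (2 * q) - (W s w $ j) ^ (2 * q)) \<partial>(distr (\<Pi>\<^sub>M j\<in>UNIV. ?G) ?G (\<lambda>z. z j)))"
      by (subst integral_distr) (auto simp: \<phi>_def)
    also have "\<dots> = (\<integral>z. indicator A w * ((W s w $ j + z) ^ (2 * q) - (W s w $ j) ^ (2 * q)) \<partial>?G)"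
      by (subst P.PiM_component) auto
    also have "\<dots> = indicator A w * ((\<integral>z. (W s w $ j + z) ^ (2 * q) \<partial>?G) - (W s w $ j) ^ (2 * q))"
      using integrable_gauss_shift_power[of "u - s"] s g.prob_space by simp
    also have "0 \<le> \<dots>" using gauss_even_power_ge[of "u - s"] s by (intro mult_nonneg_nonneg) auto
    finally show ?thesis .
  qed
  have "0 \<le> (\<integral>w. \<phi> (w, \<lambda>j. W u w $ j - W s w $ j) \<partial>N)"
    by (subst increment_integral[OF s]) (use i[of u] i[of s] s inner in \<open>auto simp: \<phi>eq\<close>)
  then show ?thesis using i[of u] i[of s] s by (simp add: \<phi>eq)
qed

text \<open>Here \<open>v\<close> is the time elapsed and \<open>X\<close> the displacement since
  some earlier stopping time, both known at time \<open>s\<close>. With them frozen, the Gaussian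
  integral factors over the coordinates and \<open>gauss_herm\<close> applies to each
  factor.\<close>

lemma increment_hp_zero:
  assumes s: "0 \<le> s" "s < u"
    and [measurable]: "Y \<in> borel_measurable (F s)" "v \<in> borel_measurable (F s)" "X \<in> borel_measurable (F s)"
    and int: "integrable N (\<lambda>w. Y w * (hp a (v w + (u - s)) (X w + (W u w - W s w)) - hp a (v w) (X w)))"
  shows "(\<integral>w. Y w * (hp a (v w + (u - s)) (X w + (W u w - W s w)) - hp a (v w) (X w)) \<partial>N) = 0"
proof -
  let ?G = "gauss (u - s)"
  have h: "0 < u - s" using s by simp
  interpret g: prob_space ?G using h by (intro prob_space_gauss)
  interpret PP: prob_space "\<Pi>\<^sub>M j\<in>(UNIV::'d set). ?G" by (rule prob_space_PiM) (rule g.prob_space_axioms)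
  interpret P: product_prob_space "\<lambda>_::'d. ?G" UNIV ..
  have [measurable]: "(\<lambda>w. X w $ j) \<in> borel_measurable (F s)" for j by (intro measurable_vec_nth_compose) auto
  define \<phi> where "\<phi> = (\<lambda>(w, z). Y w * ((\<Prod>j\<in>UNIV. herm (a j) (v w + (u - s)) (X w $ j + z j)) - hp a (v w) (X w)))"
  have m: "\<phi> \<in> borel_measurable (F s \<Otimes>\<^sub>M (\<Pi>\<^sub>M j\<in>UNIV. borel))"
    unfolding \<phi>_def by measurable
  have \<phi>eq: "\<phi> (w, \<lambda>j. W u w $ j - W s w $ j) = Y w * (hp a (v w + (u - s)) (X w + (W u w - W s w)) - hp a (v w) (X w))" for w
    by (simp add: \<phi>_def hp_def)
  have "(\<integral>z. \<phi> (w, z) \<partial>(\<Pi>\<^sub>M j\<in>UNIV. ?G)) = 0" for w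
  proof -
    note i = gauss_herm(1)[OF h]
    have "(\<integral>z. (\<Prod>j\<in>UNIV. herm (a j) (v w + (u - s)) (X w $ j + z j)) \<partial>(\<Pi>\<^sub>M j\<in>UNIV. ?G)) = hp a (v w) (X w)"
      unfolding hp_def by (subst P.product_integral_prod) (auto simp: i gauss_herm(2)[OF h])
    moreover have "integrable (\<Pi>\<^sub>M j\<in>UNIV. ?G) (\<lambda>z. \<Prod>j\<in>UNIV. herm (a j) (v w + (u - s)) (X w $ j + z j))"
      by (rule P.product_integrable_prod) (auto simp: i)
    ultimately show ?thesis using PP.prob_space by (simp add: \<phi>_def)
  qed
  then show ?thesis
    using increment_integral[OF s m] int by (simp add: \<phi>eq)
qed

subsection \<open>Stopping times with values in a grid\<close>

context
  fixes \<delta> :: real assumes \<delta>: "0 < \<delta>"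
begin

definition grid_stop :: "('a \<Rightarrow> nat) \<Rightarrow> bool" where
  "grid_stop T \<longleftrightarrow> (\<forall>k. {w \<in> space N. T w \<le> k} \<in> sets (F (real k * \<delta>)))"

lemma grid_stop_measurable: "grid_stop T \<Longrightarrow> (\<lambda>w. min (T w) k) \<in> F (real k * \<delta>) \<rightarrow>\<^sub>M count_space UNIV"
proof -
  assume 2: "grid_stop T"
  have le: "{w \<in> space N. T w \<le> i} \<in> sets (F (real k * \<delta>))" if "i \<le> k" for i
    using 2 sets_F_mono[of "real i * \<delta>" "real k * \<delta>"] that \<delta> by (auto simp: grid_stop_def)
  have "(\<lambda>w. min (T w) k) -` {i} \<inter> space (F (real k * \<delta>)) \<in> sets (F (real k * \<delta>))" for i
  proof -
    consider "i > k" | "i = k" | "i < k" by linarith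
    then show ?thesis
    proof cases
      case 1 then have "(\<lambda>w. min (T w) k) -` {i} = {}" by auto
      then show ?thesis by simp
    next
      case 2
      show ?thesis
      proof (cases k)
        case 0 then have "(\<lambda>w. min (T w) k) -` {i} = UNIV" using 2 by auto
        then show ?thesis by simp
      next
        case (Suc m)
        then have "(\<lambda>w. min (T w) k) -` {i} \<inter> space (F (real k * \<delta>)) = space (F (real k * \<delta>)) - {w \<in> space N. T w \<le> m}"
          using 2 by (auto simp: space_F)
        then show ?thesis using le[of m] Suc by auto
      qed
    next
      case 3
      then have "(\<lambda>w. min (T w) k) -` {i} \<inter> space (F (real k * \<delta>)) = {w \<in> space N. T w \<le> i} - (if i = 0 then {} else {w \<in> space N. T w \<le> i - 1})"
        by (auto simp: space_F)
      then show ?thesis using le[of i] le[of "i - 1"] 3 by auto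
    qed
  qed
  then show ?thesis by (intro measurable_count_space_eq2_countable[THEN iffD2]) auto
qed

lemma measurable_grid_W:
  assumes "grid_stop T"
  shows "(\<lambda>w. W (real (min (T w) k) * \<delta>) w) \<in> borel_measurable (F (real k * \<delta>))"
proof -
  have "(\<lambda>w. W (real (min (min (T w) k) k) * \<delta>) w) \<in> borel_measurable (F (real k * \<delta>))"
  proof (rule measurable_compose_countable[OF _ grid_stop_measurable[OF assms]])
    show "(\<lambda>w. W (real (min i k) * \<delta>) w) \<in> borel_measurable (F (real k * \<delta>))" for i
      by (rule measurable_F_mono[OF adapted_W]) (use \<delta> in \<open>auto simp: mult_right_mono\<close>)
  qed
  then show ?thesis by simp
qed

text \<open>The index takes finitely many values, so the sum over all grid times dominates; the even
  exponent keeps its terms nonnegative.\<close>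

lemma grid_power_integrable:
  assumes T: "grid_stop T" "\<And>w. w \<in> space N \<Longrightarrow> T w \<le> n"
  shows "integrable N (\<lambda>w. (W (real (T w) * \<delta>) w $ j) ^ (2 * q))"
proof (rule Bochner_Integration.integrable_bound[of _ "\<lambda>w. \<Sum>i\<le>n. (W (real i * \<delta>) w $ j) ^ (2 * q)"])
  show "integrable N (\<lambda>w. \<Sum>i\<le>n. (W (real i * \<delta>) w $ j) ^ (2 * q))"
    using \<delta> by (intro Bochner_Integration.integrable_sum integrable_W_power) auto
  have "(\<lambda>w. (W (real (min (T w) n) * \<delta>) w $ j) ^ (2 * q)) \<in> borel_measurable N"
    by (intro borel_measurable_power measurable_vec_nth_compose measurable_F_N[OF measurable_grid_W] T)
  then show "(\<lambda>w. (W (real (T w) * \<delta>) w $ j) ^ (2 * q)) \<in> borel_measurable N"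
    by (rule measurable_cong[THEN iffD1, rotated]) (use T in \<open>auto simp: min_absorb1\<close>)
  show "AE w in N. norm ((W (real (T w) * \<delta>) w $ j) ^ (2 * q)) \<le> norm (\<Sum>i\<le>n. (W (real i * \<delta>) w $ j) ^ (2 * q))" (is "AE w in N. ?P w")
  proof (rule AE_I2)
    fix w assume "w \<in> space N"
    then have "(W (real (T w) * \<delta>) w $ j) ^ (2 * q) \<le> (\<Sum>i\<le>n. (W (real i * \<delta>) w $ j) ^ (2 * q))"
      using T by (intro member_le_sum[where f="\<lambda>i. (W (real i * \<delta>) w $ j) ^ (2 * q)"]) auto
    then show "?P w"
      by (simp add: power_mult) 
  qed
qed

text \<open>Optional stopping for a submartingale, one grid step at a time: passing from
  \<open>max T k\<close> to \<open>max T (k + 1)\<close> changes the value only on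
  \<open>T \<le> k\<close>, an event known at step \<open>k\<close>.\<close>

lemma grid_power_le:
  assumes T: "grid_stop T" "\<And>w. w \<in> space N \<Longrightarrow> T w \<le> n"
  shows "(\<integral>w. (W (real (T w) * \<delta>) w $ j) ^ (2 * q) \<partial>N) \<le> (\<integral>w. (W (real n * \<delta>) w $ j) ^ (2 * q) \<partial>N)"
proof -
  have T': "{w \<in> space N. T w \<le> k} \<in> sets (F (real k * \<delta>))" for k using T by (auto simp: grid_stop_def)
  have g: "grid_stop (\<lambda>w. max (T w) k)" for k
    unfolding grid_stop_def
  proof
    fix i
    have "{w \<in> space N. max (T w) k \<le> i} = (if k \<le> i then {w \<in> space N. T w \<le> i} else {})" by auto
    then show "{w \<in> space N. max (T w) k \<le> i} \<in> sets (F (real i * \<delta>))" using T' by simp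
  qed
  have step: "(\<integral>w. (W (real (max (T w) k) * \<delta>) w $ j) ^ (2 * q) \<partial>N) \<le> (\<integral>w. (W (real (max (T w) (Suc k)) * \<delta>) w $ j) ^ (2 * q) \<partial>N)" if "k < n" for k
  proof -
    let ?A = "{w \<in> space N. T w \<le> k}"
    have i: "integrable N (\<lambda>w. (W (real (max (T w) i) * \<delta>) w $ j) ^ (2 * q))" if "i \<le> n" for i
      by (rule grid_power_integrable[OF g]) (use T that in auto)
    have AN: "?A \<in> sets N" using T' sets_F_subset by blast
    have ii: "integrable N (\<lambda>w. indicator ?A w * (W (real i * \<delta>) w $ j) ^ (2 * q))" for i
      using AN integrable_W_power[of "real i * \<delta>"] \<delta> by (intro integrable_mult_indicator[where 'b=real, simplified]) auto
    have "(\<integral>w. (W (real (max (T w) (Suc k)) * \<delta>) w $ j) ^ (2 * q) - (W (real (max (T w) k) * \<delta>) w $ j) ^ (2 * q) \<partial>N) =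
      (\<integral>w. indicator ?A w * (W (real (Suc k) * \<delta>) w $ j) ^ (2 * q) - indicator ?A w * (W (real k * \<delta>) w $ j) ^ (2 * q) \<partial>N)"
      by (intro Bochner_Integration.integral_cong) (auto split: split_indicator simp: max_def not_less_eq_eq le_Suc_eq)
    also have "\<dots> \<ge> 0"
      using increment_even_power_ge[OF _ _ T'[of k], of "real (Suc k) * \<delta>" j q] ii[of k] ii[of "Suc k"] \<delta>
      by (subst Bochner_Integration.integral_diff) auto
    finally show ?thesis using i[of k] i[of "Suc k"] that by simp
  qed
  have "(\<integral>w. (W (real (max (T w) 0) * \<delta>) w $ j) ^ (2 * q) \<partial>N) \<le> (\<integral>w. (W (real (max (T w) k) * \<delta>) w $ j) ^ (2 * q) \<partial>N)" if "k \<le> n" for k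
    using that
  proof (induction k)
    case (Suc k) then show ?case using step[of k] by auto
  qed simp
  from this[of n] have "(\<integral>w. (W (real (T w) * \<delta>) w $ j) ^ (2 * q) \<partial>N) \<le> (\<integral>w. (W (real (max (T w) n) * \<delta>) w $ j) ^ (2 * q) \<partial>N)"
    by simp
  also have "\<dots> = (\<integral>w. (W (real n * \<delta>) w $ j) ^ (2 * q) \<partial>N)"
    by (intro Bochner_Integration.integral_cong) (use T in \<open>auto simp: max_absorb2\<close>)
  finally show ?thesis .
qed

end

end

section \<open>Martingale identities for times in a grid\<close>

context bm
begin

text \<open>The square of the constant of \<open>hp_bound\<close>, times that of
  \<open>norm_diff_power_le\<close>, times moments at the final time, with a factor 2 for the two
  end points. It depends on the horizon \<open>K\<close> alone and not on the mesh of the grid, so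
  bounds by it survive refinement.\<close>

definition L2_const :: "real \<Rightarrow> real" where
  "L2_const K = ((1 + 6 * K + 3 * K\<^sup>2) ^ CARD('d))\<^sup>2 * ((3 * real CARD('d)) ^ (2 * (4 * CARD('d))) *
     (1 + 2 * (\<Sum>j\<in>UNIV. \<integral>w. (W K w $ j) ^ (2 * (4 * CARD('d))) \<partial>N)))"

lemma grid_hp_L2:
  assumes \<delta>: "0 < \<delta>" and A: "grid_stop \<delta> A" "\<And>w. w \<in> space N \<Longrightarrow> A w \<le> n"
    and C: "grid_stop \<delta> C" "\<And>w. w \<in> space N \<Longrightarrow> C w \<le> n"
    and v: "\<And>w. w \<in> space N \<Longrightarrow> 0 \<le> v w \<and> v w \<le> real n * \<delta>"
  shows "(\<integral>\<^sup>+w. ennreal ((hp a (v w) (W (real (A w) * \<delta>) w - W (real (C w) * \<delta>) w))\<^sup>2) \<partial>N) \<le> ennreal (L2_const (real n * \<delta>))"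
proof -
  define K where "K = real n * \<delta>"
  define q where "q = 4 * CARD('d)"
  define c1 where "c1 = ((1 + 6 * K + 3 * K\<^sup>2) ^ CARD('d))\<^sup>2"
  define c2 where "c2 = (3 * real CARD('d)) ^ (2 * q)"
  let ?U = "\<lambda>w. c1 * (c2 * (1 + (\<Sum>j\<in>UNIV. (W (real (A w) * \<delta>) w $ j) ^ (2 * q)) + (\<Sum>j\<in>UNIV. (W (real (C w) * \<delta>) w $ j) ^ (2 * q))))"
  have c: "0 \<le> c1" "0 \<le> c2" by (auto simp: c1_def c2_def)
  have le: "(hp a (v w) (W (real (A w) * \<delta>) w - W (real (C w) * \<delta>) w))\<^sup>2 \<le> ?U w" if "w \<in> space N" for w
  proof -
    let ?x = "W (real (A w) * \<delta>) w" and ?y = "W (real (C w) * \<delta>) w"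
    have "(hp a (v w) (?x - ?y))\<^sup>2 \<le> ((1 + 6 * K + 3 * K\<^sup>2) ^ CARD('d) * (1 + norm (?x - ?y)) ^ (4 * CARD('d)))\<^sup>2"
      using hp_bound[of "v w" K a "?x - ?y"] v[OF that] by (intro abs_le_square_iff[THEN iffD1]) (auto simp: K_def)
    also have "\<dots> = c1 * (1 + norm (?x - ?y)) ^ (2 * q)"
      by (simp add: c1_def q_def power_mult_distrib power_mult[symmetric] mult.commute)
    also have "\<dots> \<le> c1 * (c2 * (1 + (\<Sum>j\<in>UNIV. (?x $ j) ^ (2 * q)) + (\<Sum>j\<in>UNIV. (?y $ j) ^ (2 * q))))"
      unfolding c2_def by (intro mult_left_mono norm_diff_power_le c)
    finally show ?thesis .
  qed
  note i = grid_power_integrable[OF \<delta> A] grid_power_integrable[OF \<delta> C]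
  have iU: "integrable N ?U"
    by (intro integrable_mult_right Bochner_Integration.integrable_add Bochner_Integration.integrable_sum i integrable_const)
  have "(\<integral>\<^sup>+w. ennreal ((hp a (v w) (W (real (A w) * \<delta>) w - W (real (C w) * \<delta>) w))\<^sup>2) \<partial>N) \<le> (\<integral>\<^sup>+w. ennreal (?U w) \<partial>N)"
    using le by (intro nn_integral_mono ennreal_leI)
  also have "\<dots> = ennreal (\<integral>w. ?U w \<partial>N)"
    by (rule nn_integral_eq_integral[OF iU]) (use c in \<open>auto intro!: mult_nonneg_nonneg add_nonneg_nonneg sum_nonneg simp: zero_le_even_power\<close>)
  also have "(\<integral>w. ?U w \<partial>N) = c1 * (c2 * (1 + (\<Sum>j\<in>UNIV. \<integral>w. (W (real (A w) * \<delta>) w $ j) ^ (2 * q) \<partial>N) + (\<Sum>j\<in>UNIV. \<integral>w. (W (real (C w) * \<delta>) w $ j) ^ (2 * q) \<partial>N)))"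
    using i prob_space by (simp add: Bochner_Integration.integrable_sum)
  also have "\<dots> \<le> c1 * (c2 * (1 + (\<Sum>j\<in>UNIV. \<integral>w. (W K w $ j) ^ (2 * q) \<partial>N) + (\<Sum>j\<in>UNIV. \<integral>w. (W K w $ j) ^ (2 * q) \<partial>N)))"
    unfolding K_def by (intro mult_left_mono add_mono sum_mono grid_power_le[OF \<delta>] A C c) auto
  also have "\<dots> = L2_const K" by (simp add: L2_const_def c1_def c2_def q_def)
  finally show ?thesis by (simp add: K_def ennreal_leI)
qed

lemma integrable_of_sq:
  assumes "f \<in> borel_measurable N" "(\<integral>\<^sup>+w. ennreal ((f w)\<^sup>2) \<partial>N) \<le> ennreal C"
  shows "integrable N f"
  using integral_tendsto_L2_bounded(2)[of "\<lambda>_. f" f C] assms by auto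

text \<open>Telescoping over the grid: from step \<open>k\<close> to \<open>k + 1\<close> the
  polynomial in elapsed time and displacement since \<open>S\<close> changes by a quantity of mean
  zero under the weight \<open>Y\<close> restricted to \<open>R \<le> k < T\<close>, which is known
  at step \<open>k\<close>. The measurability hypothesis says that \<open>Y\<close> is known by the
  time \<open>R\<close>. The L2 bound serves the later refinement of the grid.\<close>

lemma grid_mart:
  assumes \<delta>: "0 < \<delta>" and S: "grid_stop \<delta> S" and R: "grid_stop \<delta> R" and T: "grid_stop \<delta> T"
    and ord: "\<And>w. w \<in> space N \<Longrightarrow> S w \<le> R w \<and> R w \<le> T w \<and> T w \<le> n"
    and Y: "\<And>k. (\<lambda>w. if R w \<le> k then Y w else 0) \<in> borel_measurable (F (real k * \<delta>))"
    and B: "\<And>w. w \<in> space N \<Longrightarrow> \<bar>Y w\<bar> \<le> B"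
  shows "(\<integral>w. Y w * hp a (real (T w) * \<delta> - real (S w) * \<delta>) (W (real (T w) * \<delta>) w - W (real (S w) * \<delta>) w) \<partial>N)
       = (\<integral>w. Y w * hp a (real (R w) * \<delta> - real (S w) * \<delta>) (W (real (R w) * \<delta>) w - W (real (S w) * \<delta>) w) \<partial>N)"
    and "(\<integral>\<^sup>+w. ennreal ((Y w * hp a (real (T w) * \<delta> - real (S w) * \<delta>) (W (real (T w) * \<delta>) w - W (real (S w) * \<delta>) w))\<^sup>2) \<partial>N)
       \<le> ennreal (B\<^sup>2 * L2_const (real n * \<delta>))"
    and "(\<lambda>w. Y w * hp a (real (T w) * \<delta> - real (S w) * \<delta>) (W (real (T w) * \<delta>) w - W (real (S w) * \<delta>) w)) \<in> borel_measurable N"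
proof -
  have Ym[measurable]: "Y \<in> borel_measurable N"
    by (rule measurable_cong[THEN iffD1, OF _ measurable_F_N[OF Y[of n]]]) (use ord order_trans in auto)
  have const: "grid_stop \<delta> (\<lambda>_. k)" for k
    unfolding grid_stop_def[OF \<delta>] using sets.top[of "F _"] by (auto simp: space_F)
  have mins: "grid_stop \<delta> (\<lambda>w. min (V w) k)" if "grid_stop \<delta> V" for V k
    unfolding grid_stop_def[OF \<delta>]
  proof
    fix i
    have "{w \<in> space N. min (V w) k \<le> i} = (if k \<le> i then space N else {w \<in> space N. V w \<le> i})" by auto
    then show "{w \<in> space N. min (V w) k \<le> i} \<in> sets (F (real i * \<delta>))"
      using that sets.top[of "F (real i * \<delta>)"] by (auto simp: space_F grid_stop_def[OF \<delta>])
  qed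
  have WN: "(\<lambda>w. W (real (V w) * \<delta>) w) \<in> borel_measurable N" if "grid_stop \<delta> V" "\<And>w. w \<in> space N \<Longrightarrow> V w \<le> m" for V m
    by (rule measurable_cong[THEN iffD1, OF _ measurable_F_N[OF measurable_grid_W[OF \<delta> that(1), of m]]]) (use that in auto)
  have VN: "(\<lambda>w. real (V w) * \<delta>) \<in> borel_measurable N" if "grid_stop \<delta> V" "\<And>w. w \<in> space N \<Longrightarrow> V w \<le> m" for V m
  proof -
    have "(\<lambda>w. real (min (V w) m) * \<delta>) \<in> borel_measurable N"
      using measurable_compose[OF measurable_F_N[OF grid_stop_measurable[OF \<delta> that(1), of m]], of real borel] by simp
    then show ?thesis by (rule measurable_cong[THEN iffD1, rotated]) (use that in auto)
  qed
  have Sn: "S w \<le> n" "R w \<le> n" "T w \<le> n" if "w \<in> space N" for w using ord[OF that] by auto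
  note [measurable] = WN[OF S Sn(1)] WN[OF R Sn(2)] WN[OF T Sn(3)] VN[OF S Sn(1)] VN[OF R Sn(2)] VN[OF T Sn(3)]
  define E where "E k w = hp a (real k * \<delta> - real (S w) * \<delta>) (W (real k * \<delta>) w - W (real (S w) * \<delta>) w)" for k w
  have L2: "(\<integral>\<^sup>+w. ennreal ((E (V w) w)\<^sup>2) \<partial>N) \<le> ennreal (L2_const (real n * \<delta>))" 
    if "grid_stop \<delta> V" "\<And>w. w \<in> space N \<Longrightarrow> S w \<le> V w \<and> V w \<le> n" for V
    unfolding E_def
  proof (rule grid_hp_L2[OF \<delta> that(1) _ S])
    fix w assume w: "w \<in> space N"
    then have "real (S w) * \<delta> \<le> real (V w) * \<delta>" "real (V w) * \<delta> \<le> real n * \<delta>" "0 \<le> real (S w) * \<delta>"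
      using that \<delta> by (auto intro!: mult_right_mono)
    then show "0 \<le> real (V w) * \<delta> - real (S w) * \<delta> \<and> real (V w) * \<delta> - real (S w) * \<delta> \<le> real n * \<delta>" by simp
  qed (use that Sn in auto)
  show mT: "(\<lambda>w. Y w * hp a (real (T w) * \<delta> - real (S w) * \<delta>) (W (real (T w) * \<delta>) w - W (real (S w) * \<delta>) w)) \<in> borel_measurable N"
    by measurable
  have sqY: "(\<integral>\<^sup>+w. ennreal ((Y w * E (V w) w)\<^sup>2) \<partial>N) \<le> ennreal (B\<^sup>2 * L2_const (real n * \<delta>))"
    if V: "grid_stop \<delta> V" "\<And>w. w \<in> space N \<Longrightarrow> S w \<le> V w \<and> V w \<le> n" for V
  proof -
    have V': "V w \<le> n" if "w \<in> space N" for w using V(2)[OF that] by simp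
    note [measurable] = WN[OF V(1) V'] VN[OF V(1) V']
    have [measurable]: "(\<lambda>w. E (V w) w) \<in> borel_measurable N" unfolding E_def by measurable
    have "(\<integral>\<^sup>+w. ennreal ((Y w * E (V w) w)\<^sup>2) \<partial>N) \<le> (\<integral>\<^sup>+w. ennreal (B\<^sup>2) * ennreal ((E (V w) w)\<^sup>2) \<partial>N)"
    proof (rule nn_integral_mono)
      fix w assume "w \<in> space N"
      then have "(Y w)\<^sup>2 \<le> B\<^sup>2" using B[of w] by (intro abs_le_square_iff[THEN iffD1]) auto
      then show "ennreal ((Y w * E (V w) w)\<^sup>2) \<le> ennreal (B\<^sup>2) * ennreal ((E (V w) w)\<^sup>2)"
        by (simp add: power_mult_distrib ennreal_mult'[symmetric] mult_right_mono)
    qed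
    also have "\<dots> \<le> ennreal (B\<^sup>2) * ennreal (L2_const (real n * \<delta>))"
      by (subst nn_integral_cmult) (use L2[OF V] in \<open>auto intro!: mult_left_mono\<close>)
    finally show ?thesis by (simp add: ennreal_mult')
  qed
  show "(\<integral>\<^sup>+w. ennreal ((Y w * hp a (real (T w) * \<delta> - real (S w) * \<delta>) (W (real (T w) * \<delta>) w - W (real (S w) * \<delta>) w))\<^sup>2) \<partial>N)
       \<le> ennreal (B\<^sup>2 * L2_const (real n * \<delta>))"
  proof -
    have "S w \<le> T w \<and> T w \<le> n" if "w \<in> space N" for w using ord[OF that] by simp
    from sqY[OF T this] show ?thesis by (simp add: E_def)
  qed
  have iE: "integrable N (\<lambda>w. Y w * E (V w) w)"
    if V: "grid_stop \<delta> V" "\<And>w. w \<in> space N \<Longrightarrow> S w \<le> V w \<and> V w \<le> n" for V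
  proof -
    have V': "V w \<le> n" if "w \<in> space N" for w using V(2)[OF that] by simp
    note [measurable] = WN[OF V(1) V'] VN[OF V(1) V']
    have [measurable]: "(\<lambda>w. E (V w) w) \<in> borel_measurable N" unfolding E_def by measurable
    show ?thesis by (rule integrable_of_sq[OF _ sqY[OF V]]) simp
  qed
  define Z where "Z k w = (if R w \<le> k then Y w else 0) * (if T w \<le> k then 0 else 1)" for k w
  \<comment> \<open>The minimum with \<open>k\<close> makes the elapsed time measurable at step
    \<open>k\<close>. Where \<open>Z k\<close> is nonzero, \<open>S \<le> R \<le> k\<close> holds
    and the minimum changes nothing.\<close>
  define v where "v k w = real k * \<delta> - real (min (S w) k) * \<delta>" for k w
  define X where "X k w = W (real k * \<delta>) w - W (real (min (S w) k) * \<delta>) w" for k w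
  define D where "D k w = Z k w * (hp a (v k w + (real (Suc k) * \<delta> - real k * \<delta>)) (X k w + (W (real (Suc k) * \<delta>) w - W (real k * \<delta>) w)) - hp a (v k w) (X k w))" for k w
  have Zm[measurable]: "Z k \<in> borel_measurable (F (real k * \<delta>))" for k
  proof -
    have "(\<lambda>w. if T w \<le> k then 0 else 1::real) \<in> borel_measurable (F (real k * \<delta>))"
      using T by (intro measurable_If) (auto simp: space_F grid_stop_def[OF \<delta>])
    then show ?thesis unfolding Z_def using Y[of k] by measurable
  qed
  have vm: "v k \<in> borel_measurable (F (real k * \<delta>))" for k
    unfolding v_def using measurable_compose[OF grid_stop_measurable[OF \<delta> S, of k], of real borel] by measurable
  have Xm: "X k \<in> borel_measurable (F (real k * \<delta>))" for k
    unfolding X_def by (intro borel_measurable_diff measurable_grid_W[OF \<delta> S] adapted_W) (use \<delta> in auto)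
  have hpi: "integrable N (\<lambda>w. Z k w * hp a (u w) (W (real m * \<delta>) w - W (real (min (S w) k) * \<delta>) w))"
    if u: "u \<in> borel_measurable N" "\<And>w. w \<in> space N \<Longrightarrow> 0 \<le> u w \<and> u w \<le> real m * \<delta>" and m: "k \<le> m" for u k m
  proof (rule Bochner_Integration.integrable_bound[of _ "\<lambda>w. B * hp a (u w) (W (real m * \<delta>) w - W (real (min (S w) k) * \<delta>) w)"])
    have [measurable]: "(\<lambda>w. W (real (min (S w) k) * \<delta>) w) \<in> borel_measurable N"
      by (rule WN[OF mins[OF S], of k k]) auto
    have [measurable]: "W (real m * \<delta>) \<in> borel_measurable N" using \<delta> by simp
    have mm: "(\<lambda>w. hp a (u w) (W (real m * \<delta>) w - W (real (min (S w) k) * \<delta>) w)) \<in> borel_measurable N"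
      using u(1) by measurable
    show "integrable N (\<lambda>w. B * hp a (u w) (W (real m * \<delta>) w - W (real (min (S w) k) * \<delta>) w))"
    proof (intro integrable_mult_right integrable_of_sq[OF mm])
      show "(\<integral>\<^sup>+w. ennreal ((hp a (u w) (W (real m * \<delta>) w - W (real (min (S w) k) * \<delta>) w))\<^sup>2) \<partial>N) \<le> ennreal (L2_const (real m * \<delta>))"
        by (rule grid_hp_L2[OF \<delta> const[of m] _ mins[OF S]]) (use m u in auto)
    qed
    have "Z k \<in> borel_measurable N" by (rule measurable_F_N[OF Zm])
    then show "(\<lambda>w. Z k w * hp a (u w) (W (real m * \<delta>) w - W (real (min (S w) k) * \<delta>) w)) \<in> borel_measurable N"
      using mm by measurable
    show "AE w in N. norm (Z k w * hp a (u w) (W (real m * \<delta>) w - W (real (min (S w) k) * \<delta>) w)) \<le> norm (B * hp a (u w) (W (real m * \<delta>) w - W (real (min (S w) k) * \<delta>) w))" (is "AE w in N. ?P w")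
    proof (rule AE_I2)
      fix w assume "w \<in> space N"
      then have "\<bar>Z k w\<bar> \<le> \<bar>B\<bar>" using B[of w] by (auto simp: Z_def)
      then show "?P w"
        by (simp add: abs_mult mult_right_mono)
    qed
  qed
  have Di: "integrable N (D k)" for k
  proof -
    have vN: "v k \<in> borel_measurable N" by (rule measurable_F_N[OF vm])
    have "0 \<le> v k w" "v k w \<le> real k * \<delta>" for w using \<delta> by (auto simp: v_def mult_right_mono)
    then have "integrable N (\<lambda>w. Z k w * hp a (v k w + (real (Suc k) * \<delta> - real k * \<delta>)) (W (real (Suc k) * \<delta>) w - W (real (min (S w) k) * \<delta>) w)
        - Z k w * hp a (v k w) (W (real k * \<delta>) w - W (real (min (S w) k) * \<delta>) w))"
      by (intro Bochner_Integration.integrable_diff hpi) (use \<delta> vN in \<open>auto simp: algebra_simps\<close>)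
    then show ?thesis by (rule Bochner_Integration.integrable_cong[THEN iffD1, rotated 2]) (auto simp: D_def X_def algebra_simps)
  qed
  have D0: "(\<integral>w. D k w \<partial>N) = 0" for k
    using Di[of k] \<delta> unfolding D_def[abs_def] by (intro increment_hp_zero[OF _ _ Zm vm Xm] mult_strict_right_mono) auto
  have tele: "Y w * E (T w) w - Y w * E (R w) w = (\<Sum>k<n. D k w)" if w: "w \<in> space N" for w
  proof -
    have "D k w = (if k \<in> {R w..<T w} then Y w * (E (Suc k) w - E k w) else 0)" for k
      using ord[OF w] by (auto simp: D_def Z_def E_def v_def X_def min_def algebra_simps)
    then have "(\<Sum>k<n. D k w) = (\<Sum>k\<in>{..<n} \<inter> {R w..<T w}. Y w * (E (Suc k) w - E k w))"
      by (simp add: sum.inter_restrict)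
    also have "{..<n} \<inter> {R w..<T w} = {R w..<T w}" using ord[OF w] by auto
    also have "(\<Sum>k\<in>{R w..<T w}. Y w * (E (Suc k) w - E k w)) = Y w * (E (T w) w - E (R w) w)"
      using ord[OF w] sum_Suc_diff'[of "R w" "T w" "\<lambda>k. E k w"] by (simp add: sum_distrib_left[symmetric])
    finally show ?thesis by (simp add: algebra_simps)
  qed
  have "(\<integral>w. Y w * E (T w) w \<partial>N) - (\<integral>w. Y w * E (R w) w \<partial>N) = (\<integral>w. Y w * E (T w) w - Y w * E (R w) w \<partial>N)"
    by (rule Bochner_Integration.integral_diff[symmetric]) (use ord in \<open>auto intro!: iE T R intro: order_trans\<close>)
  also have "\<dots> = (\<integral>w. (\<Sum>k<n. D k w) \<partial>N)" by (rule Bochner_Integration.integral_cong) (auto simp: tele)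
  also have "\<dots> = 0" by (simp add: Di D0)
  finally show "(\<integral>w. Y w * hp a (real (T w) * \<delta> - real (S w) * \<delta>) (W (real (T w) * \<delta>) w - W (real (S w) * \<delta>) w) \<partial>N)
       = (\<integral>w. Y w * hp a (real (R w) * \<delta> - real (S w) * \<delta>) (W (real (R w) * \<delta>) w - W (real (S w) * \<delta>) w) \<partial>N)"
    by (simp add: E_def)
qed

subsection \<open>Optional stopping for space-time Hermite polynomials\<close>

text \<open>Rounding up, and not down, keeps the stopping property while approximating
  \<open>\<tau>\<close> from above; \<open>nat\<close> sends negative values to 0.\<close>

definition disc :: "nat \<Rightarrow> ('a \<Rightarrow> real) \<Rightarrow> 'a \<Rightarrow> nat" where
  "disc n \<tau> w = nat \<lceil>\<tau> w * 2 ^ n\<rceil>"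

lemma disc_le_iff: "disc n \<tau> w \<le> k \<longleftrightarrow> \<tau> w \<le> real k * (1 / 2 ^ n)"
  by (simp add: disc_def nat_le_iff ceiling_le_iff field_simps)

lemma disc_mono: "\<sigma> w \<le> \<tau> w \<Longrightarrow> disc n \<sigma> w \<le> disc n \<tau> w"
  unfolding disc_def by (intro nat_mono ceiling_mono mult_right_mono) auto

lemma disc_tendsto:
  assumes "0 \<le> \<tau> w"
  shows "(\<lambda>n. real (disc n \<tau> w) * (1 / 2 ^ n)) \<longlonglongrightarrow> \<tau> w"
proof (rule tendsto_sandwich)
  have eq: "real (disc n \<tau> w) = of_int \<lceil>\<tau> w * 2 ^ n\<rceil>" for n using assms by (simp add: disc_def)
  show "\<forall>\<^sub>F n in sequentially. \<tau> w \<le> real (disc n \<tau> w) * (1 / 2 ^ n)"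
    unfolding eq using le_of_int_ceiling by (intro always_eventually allI) (simp add: field_simps)
  show "\<forall>\<^sub>F n in sequentially. real (disc n \<tau> w) * (1 / 2 ^ n) \<le> \<tau> w + (1 / 2) ^ n"
  proof (intro always_eventually allI)
    fix n
    have "of_int \<lceil>\<tau> w * 2 ^ n\<rceil> \<le> \<tau> w * 2 ^ n + 1" by linarith
    then show "real (disc n \<tau> w) * (1 / 2 ^ n) \<le> \<tau> w + (1 / 2) ^ n" unfolding eq by (simp add: field_simps power_divide)
  qed
  have "(\<lambda>n. \<tau> w + (1 / 2) ^ n) \<longlonglongrightarrow> \<tau> w + 0" by (intro tendsto_intros) auto
  then show "(\<lambda>n. \<tau> w + (1 / 2) ^ n) \<longlonglongrightarrow> \<tau> w" by simp
qed auto

lemma grid_stop_disc: "stopping_time F \<tau> \<Longrightarrow> grid_stop (1 / 2 ^ n) (disc n \<tau>)"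
  by (subst grid_stop_def) (auto simp: disc_le_iff stopping_time_def pred_def space_F)

lemma W_disc_tendsto:
  assumes "w \<in> space N" "0 \<le> \<tau> w"
  shows "(\<lambda>n. W (real (disc n \<tau> w) * (1 / 2 ^ n)) w) \<longlonglongrightarrow> W (\<tau> w) w"
  by (rule continuous_on_tendsto_compose[OF continuous_W[OF assms(1)] disc_tendsto[of \<tau> w, OF assms(2)]]) (use assms in auto)

lemma measurable_stopping_time_N: "stopping_time F \<tau> \<Longrightarrow> \<tau> \<in> borel_measurable N"
  by (rule measurable_stopping_time[of F]) (auto simp: space_F intro: sets_F_subset[THEN subsetD])

lemma measurable_W_random:
  assumes [measurable]: "\<tau> \<in> borel_measurable N" and nn: "\<And>w. w \<in> space N \<Longrightarrow> 0 \<le> \<tau> w"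
  shows "(\<lambda>w. W (\<tau> w) w) \<in> borel_measurable N"
proof (rule borel_measurable_LIMSEQ_metric[where f="\<lambda>n w. W (real (disc n \<tau> w) * (1 / 2 ^ n)) w"])
  fix n
  have "disc n \<tau> \<in> N \<rightarrow>\<^sub>M count_space UNIV" unfolding disc_def by measurable
  then show "(\<lambda>w. W (real (disc n \<tau> w) * (1 / 2 ^ n)) w) \<in> borel_measurable N"
    by (rule measurable_compose_countable[rotated]) simp
qed (use W_disc_tendsto nn in auto)

lemma measurable_restrict_pre_sigma:
  assumes \<tau>: "stopping_time F \<tau>" and Y: "Y \<in> borel_measurable (pre_sigma \<tau>)"
  shows "(\<lambda>w. if \<tau> w \<le> t then Y w else (0::real)) \<in> borel_measurable (F t)"
proof (rule measurableI)
  fix A :: "real set" assume A: "A \<in> sets borel"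
  have "Y -` A \<inter> space N \<in> sets (pre_sigma \<tau>)" using measurable_sets[OF Y A] by (simp add: space_pre_sigma)
  then have 1: "{w \<in> Y -` A \<inter> space N. \<tau> w \<le> t} \<in> sets (F t)" by (rule sets_pre_sigmaD[OF \<tau>])
  have 2: "{w \<in> space (F t). t < \<tau> w} \<in> sets (F t)" using stopping_timeD2[OF \<tau>] by (simp add: pred_def)
  have "(\<lambda>w. if \<tau> w \<le> t then Y w else 0) -` A \<inter> space (F t) =
     {w \<in> Y -` A \<inter> space N. \<tau> w \<le> t} \<union> (if 0 \<in> A then {w \<in> space (F t). t < \<tau> w} else {})"
    by (auto simp: space_F split: if_splits)
  then show "(\<lambda>w. if \<tau> w \<le> t then Y w else 0) -` A \<inter> space (F t) \<in> sets (F t)" using 1 2 by simp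
qed simp

lemma subalgebra_pre_sigma: "stopping_time F \<tau> \<Longrightarrow> subalgebra N (pre_sigma \<tau>)"
proof -
  assume \<tau>: "stopping_time F \<tau>"
  have "A \<in> sets N" if A: "A \<in> sets (pre_sigma \<tau>)" for A
  proof -
    have "A \<subseteq> space N" using sets.sets_into_space[OF A] by (simp add: space_pre_sigma)
    then have "A = (\<Union>n::nat. {w \<in> A. \<tau> w \<le> real n})" using real_arch_simple by auto
    moreover have "{w \<in> A. \<tau> w \<le> real n} \<in> sets N" for n
      using sets_pre_sigmaD[OF \<tau> A] sets_F_subset by blast
    ultimately show ?thesis by (metis (no_types, lifting) sets.countable_UN subsetI image_iff)
  qed
  then show ?thesis by (auto simp: subalgebra_def space_pre_sigma)
qed

lemma measurable_pre_sigma_N: "stopping_time F \<tau> \<Longrightarrow> f \<in> measurable (pre_sigma \<tau>) B \<Longrightarrow> f \<in> measurable N B"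
  by (rule measurable_from_subalg[OF subalgebra_pre_sigma])

text \<open>Says that \<open>P\<close>, evaluated at elapsed time and displacement since
  \<open>\<sigma>\<close>, is a martingale, in the form of optional stopping between bounded times
  tested against bounded functions known at \<open>\<rho>\<close>. Being an integral identity it is
  linear in \<open>P\<close>, so it passes from the products \<open>hp\<close> to all polynomials
  needed.\<close>

definition mart :: "(real \<Rightarrow> real ^ 'd \<Rightarrow> real) \<Rightarrow> bool" where
  "mart P \<longleftrightarrow> (\<forall>\<sigma> \<rho> \<tau> K Y B. stopping_time F \<sigma> \<longrightarrow> stopping_time F \<rho> \<longrightarrow> stopping_time F \<tau> \<longrightarrow>
     (\<forall>w\<in>space N. 0 \<le> \<sigma> w \<and> \<sigma> w \<le> \<rho> w \<and> \<rho> w \<le> \<tau> w \<and> \<tau> w \<le> real (K::nat)) \<longrightarrow>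
     Y \<in> borel_measurable (pre_sigma \<rho>) \<longrightarrow> (\<forall>w\<in>space N. \<bar>Y w\<bar> \<le> (B::real)) \<longrightarrow>
     integrable N (\<lambda>w. Y w * P (\<tau> w - \<sigma> w) (W (\<tau> w) w - W (\<sigma> w) w)) \<and>
     integrable N (\<lambda>w. Y w * P (\<rho> w - \<sigma> w) (W (\<rho> w) w - W (\<sigma> w) w)) \<and>
     (\<integral>w. Y w * P (\<tau> w - \<sigma> w) (W (\<tau> w) w - W (\<sigma> w) w) \<partial>N) =
     (\<integral>w. Y w * P (\<rho> w - \<sigma> w) (W (\<rho> w) w - W (\<sigma> w) w) \<partial>N))"

lemma mart_add: "mart P \<Longrightarrow> mart Q \<Longrightarrow> mart (\<lambda>s x. P s x + Q s x)"
  unfolding mart_def by (simp add: distrib_left)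

lemma mart_cmult: "mart P \<Longrightarrow> mart (\<lambda>s x. c * P s x)"
  unfolding mart_def by (simp add: mult.left_commute[of _ c])

lemma mart_sum: "finite I \<Longrightarrow> (\<And>i. i \<in> I \<Longrightarrow> mart (P i)) \<Longrightarrow> mart (\<lambda>s x. \<Sum>i\<in>I. P i s x)"
proof (induction I rule: finite_induct)
  case empty then show ?case by (simp add: mart_def)
next
  case (insert i I) then show ?case by (simp add: mart_add)
qed

lemma mart_diff: "mart P \<Longrightarrow> mart Q \<Longrightarrow> mart (\<lambda>s x. P s x - Q s x)"
  using mart_add[OF _ mart_cmult[of Q "-1"]] by simp

text \<open>The identity holds for the rounded times on each dyadic grid. \<open>K * 2 ^ n\<close>
  steps of length \<open>1 / 2 ^ n\<close> keep the horizon at \<open>K\<close>, so the L2 bound is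
  the same at all levels and both sides converge along the continuous paths.\<close>

lemma mart_hp: "mart (hp a)"
  unfolding mart_def
proof (intro allI impI)
  fix \<sigma> \<rho> \<tau> :: "'a \<Rightarrow> real" and K :: nat and Y :: "'a \<Rightarrow> real" and B :: real
  assume st: "stopping_time F \<sigma>" "stopping_time F \<rho>" "stopping_time F \<tau>"
    and ord: "\<forall>w\<in>space N. 0 \<le> \<sigma> w \<and> \<sigma> w \<le> \<rho> w \<and> \<rho> w \<le> \<tau> w \<and> \<tau> w \<le> real K"
    and Y: "Y \<in> borel_measurable (pre_sigma \<rho>)" and B: "\<forall>w\<in>space N. \<bar>Y w\<bar> \<le> B"
  note [measurable] = measurable_stopping_time_N[OF st(1)] measurable_stopping_time_N[OF st(2)] measurable_stopping_time_N[OF st(3)]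
  have [measurable]: "Y \<in> borel_measurable N" by (rule measurable_pre_sigma_N[OF st(2) Y])
  have [measurable]: "(\<lambda>w. W (\<sigma> w) w) \<in> borel_measurable N" "(\<lambda>w. W (\<rho> w) w) \<in> borel_measurable N" "(\<lambda>w. W (\<tau> w) w) \<in> borel_measurable N"
    using ord by (auto intro!: measurable_W_random intro: order_trans)
  define X where "X \<tau> n w = Y w * hp a (real (disc n \<tau> w) * (1 / 2 ^ n) - real (disc n \<sigma> w) * (1 / 2 ^ n))
      (W (real (disc n \<tau> w) * (1 / 2 ^ n)) w - W (real (disc n \<sigma> w) * (1 / 2 ^ n)) w)" for \<tau> n w
  have d: "disc n \<sigma> w \<le> disc n \<rho> w" "disc n \<rho> w \<le> disc n \<tau> w" "disc n \<tau> w \<le> K * 2 ^ n" if "w \<in> space N" for n w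
    by (rule disc_mono, use ord that in auto)+ (use ord that in \<open>simp add: disc_le_iff\<close>)
  have d2: "disc n \<rho> w \<le> K * 2 ^ n" if "w \<in> space N" for n w
    using d(2,3)[OF that] by (rule order_trans)
  have Yk: "(\<lambda>w. if disc n \<rho> w \<le> k then Y w else 0) \<in> borel_measurable (F (real k * (1 / 2 ^ n)))" for n k
    unfolding disc_le_iff by (rule measurable_restrict_pre_sigma[OF st(2) Y])
  have Kn: "real (K * 2 ^ n) * (1 / 2 ^ n) = real K" for n by simp
  have h0: "0 < (1::real) / 2 ^ n" for n :: nat by simp
  note gs = grid_stop_disc[OF st(1)] grid_stop_disc[OF st(2)] grid_stop_disc[OF st(3)]
  have eq: "(\<integral>w. X \<tau> n w \<partial>N) = (\<integral>w. X \<rho> n w \<partial>N)" for n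
    unfolding X_def by (rule grid_mart(1)[OF h0 gs, where n="K * 2 ^ n"]) (use d Yk B in auto)
  have bT: "(\<integral>\<^sup>+w. ennreal ((X \<tau> n w)\<^sup>2) \<partial>N) \<le> ennreal (B\<^sup>2 * L2_const (real K))" for n
    unfolding X_def Kn[of n, symmetric] by (rule grid_mart(2)[OF h0 gs]) (use d Yk B in auto)
  have bR: "(\<integral>\<^sup>+w. ennreal ((X \<rho> n w)\<^sup>2) \<partial>N) \<le> ennreal (B\<^sup>2 * L2_const (real K))" for n
    unfolding X_def Kn[of n, symmetric] by (rule grid_mart(2)[OF h0 gs(1,2,2)]) (use d d2 Yk B in auto)
  have mT: "X \<tau> n \<in> borel_measurable N" for n
    unfolding X_def by (rule grid_mart(3)[OF h0 gs, where n="K * 2 ^ n"]) (use d Yk B in auto)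
  have mR: "X \<rho> n \<in> borel_measurable N" for n
    unfolding X_def by (rule grid_mart(3)[OF h0 gs(1,2,2), where n="K * 2 ^ n"]) (use d d2 Yk B in auto)
  have lim: "AE w in N. (\<lambda>n. X \<theta> n w) \<longlonglongrightarrow> Y w * hp a (\<theta> w - \<sigma> w) (W (\<theta> w) w - W (\<sigma> w) w)"
    if "\<forall>w\<in>space N. 0 \<le> \<theta> w" for \<theta>
    unfolding X_def using that ord by (intro AE_I2 tendsto_intros disc_tendsto W_disc_tendsto) auto
  have nn: "\<forall>w\<in>space N. 0 \<le> \<tau> w" "\<forall>w\<in>space N. 0 \<le> \<rho> w" using ord by (auto intro: order_trans)
  note T = integral_tendsto_L2_bounded[OF mT _ lim[OF nn(1)] bT] and R = integral_tendsto_L2_bounded[OF mR _ lim[OF nn(2)] bR]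
  show "integrable N (\<lambda>w. Y w * hp a (\<tau> w - \<sigma> w) (W (\<tau> w) w - W (\<sigma> w) w)) \<and>
     integrable N (\<lambda>w. Y w * hp a (\<rho> w - \<sigma> w) (W (\<rho> w) w - W (\<sigma> w) w)) \<and>
     (\<integral>w. Y w * hp a (\<tau> w - \<sigma> w) (W (\<tau> w) w - W (\<sigma> w) w) \<partial>N) =
     (\<integral>w. Y w * hp a (\<rho> w - \<sigma> w) (W (\<rho> w) w - W (\<sigma> w) w) \<partial>N)"
  proof (intro conjI)
    show "integrable N (\<lambda>w. Y w * hp a (\<tau> w - \<sigma> w) (W (\<tau> w) w - W (\<sigma> w) w))" by (rule T(2)) measurable
    show "integrable N (\<lambda>w. Y w * hp a (\<rho> w - \<sigma> w) (W (\<rho> w) w - W (\<sigma> w) w))" by (rule R(2)) measurable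
    have "(\<lambda>n. \<integral>w. X \<tau> n w \<partial>N) \<longlonglongrightarrow> (\<integral>w. Y w * hp a (\<tau> w - \<sigma> w) (W (\<tau> w) w - W (\<sigma> w) w) \<partial>N)" by (rule T(3)) measurable
    moreover have "(\<lambda>n. \<integral>w. X \<rho> n w \<partial>N) \<longlonglongrightarrow> (\<integral>w. Y w * hp a (\<rho> w - \<sigma> w) (W (\<rho> w) w - W (\<sigma> w) w) \<partial>N)" by (rule R(3)) measurable
    ultimately show "(\<integral>w. Y w * hp a (\<tau> w - \<sigma> w) (W (\<tau> w) w - W (\<sigma> w) w) \<partial>N) =
     (\<integral>w. Y w * hp a (\<rho> w - \<sigma> w) (W (\<rho> w) w - W (\<sigma> w) w) \<partial>N)"
      unfolding eq using LIMSEQ_unique by blast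
  qed
qed

end

section \<open>Harmonic polynomials as martingales\<close>

lemma hp_1: "hp (\<lambda>l. if l = i then k else 0) s x = herm k s (x $ i)" for x :: "real ^ 'd::finite"
proof -
  have "hp (\<lambda>l. if l = i then k else 0) s x = (\<Prod>l\<in>UNIV. if l = i then herm k s (x $ l) else 1)"
    unfolding hp_def by (intro prod.cong) auto
  then show ?thesis by simp
qed

lemma hp_2:
  fixes x :: "real ^ 'd::finite"
  assumes "i \<noteq> j"
  shows "hp (\<lambda>l. if l = i then k else if l = j then m else 0) s x = herm k s (x $ i) * herm m s (x $ j)"
proof -
  have "hp (\<lambda>l. if l = i then k else if l = j then m else 0) s x =
      (\<Prod>l\<in>UNIV. (if l = i then herm k s (x $ l) else 1) * (if l = j then herm m s (x $ l) else 1))"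
    unfolding hp_def using assms by (intro prod.cong) auto
  then show ?thesis by (simp add: prod.distrib)
qed

lemma hp_3:
  fixes x :: "real ^ 'd::finite"
  assumes "i \<noteq> j" "i \<noteq> h" "j \<noteq> h"
  shows "hp (\<lambda>l. if l = i then k else if l = j then m else if l = h then n else 0) s x =
     herm k s (x $ i) * herm m s (x $ j) * herm n s (x $ h)"
proof -
  have "hp (\<lambda>l. if l = i then k else if l = j then m else if l = h then n else 0) s x =
      (\<Prod>l\<in>UNIV. (if l = i then herm k s (x $ l) else 1) * (if l = j then herm m s (x $ l) else 1) * (if l = h then herm n s (x $ l) else 1))"
    unfolding hp_def using assms by (intro prod.cong) auto
  then show ?thesis by (simp add: prod.distrib)
qed

lemma norm_sq_sum: "(norm x)\<^sup>2 = (\<Sum>j\<in>UNIV. (x $ j)\<^sup>2)" for x :: "real ^ 'd::finite"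
  unfolding power2_norm_eq_inner inner_vec_def by (simp add: power2_eq_square)

lemma sum_offdiag: "(\<Sum>k\<in>UNIV - {j}. f k) = (\<Sum>k\<in>UNIV. f k) - f j" for f :: "'d::finite \<Rightarrow> real"
  by (simp add: sum_diff1)

lemma norm_four_sum:
  "(norm x) ^ 4 = (\<Sum>j\<in>UNIV. (x $ j) ^ 4) + (\<Sum>j\<in>UNIV. \<Sum>k\<in>UNIV - {j}. (x $ j)\<^sup>2 * (x $ k)\<^sup>2)" for x :: "real ^ 'd::finite"
proof -
  have "(norm x) ^ 4 = (norm x)\<^sup>2 * (norm x)\<^sup>2" by (simp add: power_add[symmetric])
  also have "\<dots> = (\<Sum>j\<in>UNIV. \<Sum>k\<in>UNIV. (x $ j)\<^sup>2 * (x $ k)\<^sup>2)" by (simp add: norm_sq_sum sum_product)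
  finally show ?thesis by (simp add: sum_offdiag sum_subtractf power4_eq_xxxx power2_eq_square mult.assoc)
qed

context bm
begin

lemma mart_eq: "mart P \<Longrightarrow> (\<And>s x. P s x = Q s x) \<Longrightarrow> mart Q"
  by (metis (no_types, lifting) ext)

lemma mart_1: "mart (\<lambda>s x. herm k s (x $ i))"
  using mart_hp[of "\<lambda>l. if l = i then k else 0"] by (rule mart_eq) (rule hp_1)

lemma mart_2: "i \<noteq> j \<Longrightarrow> mart (\<lambda>s x. herm k s (x $ i) * herm m s (x $ j))"
  using mart_hp[of "\<lambda>l. if l = i then k else if l = j then m else 0"] by (rule mart_eq) (rule hp_2)

lemma mart_3: "i \<noteq> j \<Longrightarrow> i \<noteq> h \<Longrightarrow> j \<noteq> h \<Longrightarrow> mart (\<lambda>s x. herm k s (x $ i) * herm m s (x $ j) * herm n s (x $ h))"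
  using mart_hp[of "\<lambda>l. if l = i then k else if l = j then m else if l = h then n else 0"] by (rule mart_eq) (rule hp_3)

lemma mart_norm2: "mart (\<lambda>s x. (norm x)\<^sup>2 - real CARD('d) * s)"
proof (rule mart_eq)
  show "mart (\<lambda>s x. \<Sum>j\<in>UNIV. herm 2 s (x $ j))" by (intro mart_sum mart_1) auto
qed (simp add: herm_eqs norm_sq_sum sum_subtractf)

text \<open>The weights \<open>d - 1\<close> and \<open>-3\<close> are those for which the terms in
  \<open>s |x|^2\<close> and in \<open>s^2\<close> of the two Hermite sums cancel; what remains is
  \<open>(d - 1)\<close> times the sum of fourth powers minus three times the mixed terms, hence the
  stated harmonic polynomial.\<close>

lemma mart_quartic: "mart (\<lambda>s x. (real CARD('d) + 2) * (\<Sum>j\<in>UNIV. (x $ j) ^ 4) - 3 * (norm x) ^ 4)"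
proof (rule mart_eq)
  show "mart (\<lambda>s x. (real CARD('d) - 1) * (\<Sum>j\<in>UNIV. herm 4 s (x $ j)) - 3 * (\<Sum>j\<in>UNIV. \<Sum>k\<in>UNIV - {j}. herm 2 s (x $ j) * herm 2 s (x $ k)))"
    by (intro mart_diff mart_cmult mart_sum mart_1 mart_2) auto
  fix s :: real and x :: "real ^ 'd"
  have A: "(\<Sum>j\<in>UNIV. herm 4 s (x $ j)) = (\<Sum>j\<in>UNIV. (x $ j) ^ 4) - 6 * s * (norm x)\<^sup>2 + 3 * real CARD('d) * s\<^sup>2"
    by (simp add: herm_eqs norm_sq_sum sum.distrib sum_subtractf sum_distrib_left)
  have B: "(\<Sum>j\<in>UNIV. \<Sum>k\<in>UNIV - {j}. herm 2 s (x $ j) * herm 2 s (x $ k)) =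
    (\<Sum>j\<in>UNIV. \<Sum>k\<in>UNIV - {j}. (x $ j)\<^sup>2 * (x $ k)\<^sup>2) - 2 * (real CARD('d) - 1) * s * (norm x)\<^sup>2 + real CARD('d) * (real CARD('d) - 1) * s\<^sup>2"
  proof -
    have "(\<Sum>k\<in>UNIV - {j}. herm 2 s (x $ j) * herm 2 s (x $ k)) =
       (\<Sum>k\<in>UNIV - {j}. (x $ j)\<^sup>2 * (x $ k)\<^sup>2) - s * ((real CARD('d) - 1) * (x $ j)\<^sup>2) - s * ((norm x)\<^sup>2 - (x $ j)\<^sup>2) + (real CARD('d) - 1) * s\<^sup>2" for j
    proof -
      have "(\<Sum>k\<in>UNIV - {j}. herm 2 s (x $ j) * herm 2 s (x $ k)) =
        (\<Sum>k\<in>UNIV - {j}. (x $ j)\<^sup>2 * (x $ k)\<^sup>2 - s * (x $ j)\<^sup>2 - s * (x $ k)\<^sup>2 + s\<^sup>2)"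
        by (intro sum.cong) (auto simp: herm_eqs algebra_simps power2_eq_square)
      also have "\<dots> = (\<Sum>k\<in>UNIV - {j}. (x $ j)\<^sup>2 * (x $ k)\<^sup>2) - (\<Sum>k\<in>UNIV - {j}. s * (x $ j)\<^sup>2) - s * (\<Sum>k\<in>UNIV - {j}. (x $ k)\<^sup>2) + (\<Sum>k\<in>UNIV - {j}. s\<^sup>2)"
        by (simp only: sum.distrib sum_subtractf sum_distrib_left)
      also have "(\<Sum>k\<in>UNIV - {j}. (x $ k)\<^sup>2) = (norm x)\<^sup>2 - (x $ j)\<^sup>2" by (simp add: sum_offdiag norm_sq_sum)
      also have "(\<Sum>k\<in>UNIV - {j}. s * (x $ j)\<^sup>2) = s * ((real CARD('d) - 1) * (x $ j)\<^sup>2)" by (simp add: sum_offdiag algebra_simps)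
      also have "(\<Sum>k\<in>UNIV - {j}. s\<^sup>2) = (real CARD('d) - 1) * s\<^sup>2" by (simp add: sum_offdiag algebra_simps)
      finally show ?thesis .
    qed
    then have "(\<Sum>j\<in>UNIV. \<Sum>k\<in>UNIV - {j}. herm 2 s (x $ j) * herm 2 s (x $ k)) =
      (\<Sum>j\<in>UNIV. (\<Sum>k\<in>UNIV - {j}. (x $ j)\<^sup>2 * (x $ k)\<^sup>2) - s * ((real CARD('d) - 1) * (x $ j)\<^sup>2) - s * ((norm x)\<^sup>2 - (x $ j)\<^sup>2) + (real CARD('d) - 1) * s\<^sup>2)"
      by simp
    also have "\<dots> = (\<Sum>j\<in>UNIV. \<Sum>k\<in>UNIV - {j}. (x $ j)\<^sup>2 * (x $ k)\<^sup>2) - s * ((real CARD('d) - 1) * (norm x)\<^sup>2) - s * (real CARD('d) * (norm x)\<^sup>2 - (norm x)\<^sup>2) + (real CARD('d) - 1) * (real CARD('d) * s\<^sup>2)"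
      by (simp only: sum.distrib sum_subtractf sum_distrib_left[symmetric] norm_sq_sum sum_constant)
    finally show ?thesis by (simp add: algebra_simps)
  qed
  show "(real CARD('d) - 1) * (\<Sum>j\<in>UNIV. herm 4 s (x $ j)) - 3 * (\<Sum>j\<in>UNIV. \<Sum>k\<in>UNIV - {j}. herm 2 s (x $ j) * herm 2 s (x $ k)) =
     (real CARD('d) + 2) * (\<Sum>j\<in>UNIV. (x $ j) ^ 4) - 3 * (norm x) ^ 4"
    unfolding A B norm_four_sum by (simp add: algebra_simps power2_eq_square)
qed

section \<open>Cutting unbounded stopping times\<close>

text \<open>If \<open>K \<le> t\<close>, the event is already decided at time \<open>K\<close>. If
  \<open>t < K\<close>, then \<open>min \<sigma> K \<le> t\<close> forces
  \<open>\<sigma> \<le> t\<close>, where the function is \<open>Y\<close> and is known by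
  \<open>t\<close>.\<close>

lemma measurable_trunc:
  assumes \<sigma>: "stopping_time F \<sigma>" and Y: "Y \<in> borel_measurable (pre_sigma \<sigma>)"
  shows "(\<lambda>w. if \<sigma> w \<le> K then Y w else (0::real)) \<in> borel_measurable (pre_sigma (\<lambda>w. min (\<sigma> w) K))"
proof (rule measurableI)
  have st: "stopping_time F (\<lambda>w. min (\<sigma> w) K)" by (intro stopping_time_min \<sigma> stopping_time_const)
  fix A :: "real set" assume A: "A \<in> sets borel"
  show "(\<lambda>w. if \<sigma> w \<le> K then Y w else 0) -` A \<inter> space (pre_sigma (\<lambda>w. min (\<sigma> w) K)) \<in> sets (pre_sigma (\<lambda>w. min (\<sigma> w) K))"
  proof (rule sets_pre_sigmaI[OF st])
    fix t
    let ?f = "\<lambda>u w. if \<sigma> w \<le> u then Y w else (0::real)"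
    have m: "?f u -` A \<inter> space (F u) \<in> sets (F u)" for u
      by (rule measurable_sets[OF measurable_restrict_pre_sigma[OF \<sigma> Y] A])
    show "{w \<in> ?f K -` A \<inter> space (pre_sigma (\<lambda>w. min (\<sigma> w) K)). min (\<sigma> w) K \<le> t} \<in> sets (F t)"
    proof (cases "K \<le> t")
      case True
      then have "{w \<in> ?f K -` A \<inter> space (pre_sigma (\<lambda>w. min (\<sigma> w) K)). min (\<sigma> w) K \<le> t} = ?f K -` A \<inter> space (F K)"
        by (auto simp: space_pre_sigma space_F)
      then show ?thesis using m[of K] sets_F_mono[OF True] by auto
    next
      case False
      then have "{w \<in> ?f K -` A \<inter> space (pre_sigma (\<lambda>w. min (\<sigma> w) K)). min (\<sigma> w) K \<le> t} = (?f t -` A \<inter> space (F t)) \<inter> {w \<in> space (F t). \<sigma> w \<le> t}"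
        by (auto simp: space_pre_sigma space_F)
      moreover have "{w \<in> space (F t). \<sigma> w \<le> t} \<in> sets (F t)" using stopping_timeD[OF \<sigma>] by (simp add: pred_def)
      ultimately show ?thesis using m[of t] by auto
    qed
  qed
qed simp

lemma measurable_pre_sigma_mono:
  assumes "stopping_time F \<sigma>" "stopping_time F \<rho>" "\<And>w. w \<in> space N \<Longrightarrow> \<sigma> w \<le> \<rho> w" "Y \<in> measurable (pre_sigma \<sigma>) B"
  shows "Y \<in> measurable (pre_sigma \<rho>) B"
  using mono_pre_sigma[OF assms(1-3)] assms(4) by (auto simp: measurable_def space_pre_sigma)

text \<open>All three times are replaced by their minimum with \<open>K\<close>, and the weight is
  set to 0 where \<open>\<rho>\<close> exceeds \<open>K\<close>. Where the weight survives,
  \<open>\<sigma>\<close> and \<open>\<rho>\<close> are unchanged, so only \<open>\<tau>\<close>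
  appears cut.\<close>

lemma mart_truncated:
  fixes K :: nat
  assumes P: "mart P" and st: "stopping_time F \<sigma>" "stopping_time F \<rho>" "stopping_time F \<tau>"
    and ord: "\<And>w. w \<in> space N \<Longrightarrow> 0 \<le> \<sigma> w \<and> \<sigma> w \<le> \<rho> w \<and> \<rho> w \<le> \<tau> w"
    and Y: "Y \<in> borel_measurable (pre_sigma \<rho>)" and B: "\<And>w. w \<in> space N \<Longrightarrow> \<bar>Y w\<bar> \<le> B"
  defines "Z \<equiv> \<lambda>w. if \<rho> w \<le> K then Y w else 0"
  shows "integrable N (\<lambda>w. Z w * P (min (\<tau> w) K - \<sigma> w) (W (min (\<tau> w) K) w - W (\<sigma> w) w))" (is ?A)
    and "integrable N (\<lambda>w. Z w * P (\<rho> w - \<sigma> w) (W (\<rho> w) w - W (\<sigma> w) w))" (is ?B)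
    and "(\<integral>w. Z w * P (min (\<tau> w) K - \<sigma> w) (W (min (\<tau> w) K) w - W (\<sigma> w) w) \<partial>N) =
      (\<integral>w. Z w * P (\<rho> w - \<sigma> w) (W (\<rho> w) w - W (\<sigma> w) w) \<partial>N)" (is ?C)
proof -
  let ?m = "\<lambda>\<tau> w. min (\<tau> w) (real K)"
  have s: "stopping_time F (?m \<sigma>)" "stopping_time F (?m \<rho>)" "stopping_time F (?m \<tau>)"
    by (intro stopping_time_min st stopping_time_const)+
  have Z: "Z \<in> borel_measurable (pre_sigma (?m \<rho>))" unfolding Z_def by (rule measurable_trunc[OF st(2) Y])
  have o: "\<forall>w\<in>space N. 0 \<le> ?m \<sigma> w \<and> ?m \<sigma> w \<le> ?m \<rho> w \<and> ?m \<rho> w \<le> ?m \<tau> w \<and> ?m \<tau> w \<le> real K"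
    using ord by fastforce
  have b: "\<forall>w\<in>space N. \<bar>Z w\<bar> \<le> \<bar>B\<bar>" using B by (fastforce simp: Z_def)
  have e: "Z w * P (?m \<tau> w - ?m \<sigma> w) (W (?m \<tau> w) w - W (?m \<sigma> w) w) = Z w * P (?m \<tau> w - \<sigma> w) (W (?m \<tau> w) w - W (\<sigma> w) w)"
    "Z w * P (?m \<rho> w - ?m \<sigma> w) (W (?m \<rho> w) w - W (?m \<sigma> w) w) = Z w * P (\<rho> w - \<sigma> w) (W (\<rho> w) w - W (\<sigma> w) w)"
    if "w \<in> space N" for w
    using ord[OF that] by (auto simp: Z_def)
  note * = P[unfolded mart_def, rule_format, of "?m \<sigma>" "?m \<rho>" "?m \<tau>" K Z "\<bar>B\<bar>", OF s _ Z]
  from * o b show ?A ?B ?C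
    by (simp_all add: e cong: Bochner_Integration.integrable_cong Bochner_Integration.integral_cong)
qed

lemma mart_truncated_0:
  fixes K :: nat
  assumes P: "mart P" and st: "stopping_time F \<sigma>" "stopping_time F \<tau>"
    and ord: "\<And>w. w \<in> space N \<Longrightarrow> 0 \<le> \<sigma> w \<and> \<sigma> w \<le> \<tau> w"
    and Y: "Y \<in> borel_measurable (pre_sigma \<sigma>)" and B: "\<And>w. w \<in> space N \<Longrightarrow> \<bar>Y w\<bar> \<le> B"
    and P0: "P 0 0 = 0"
  shows "integrable N (\<lambda>w. (if \<sigma> w \<le> K then Y w else 0) * P (min (\<tau> w) K - \<sigma> w) (W (min (\<tau> w) K) w - W (\<sigma> w) w))"
    and "(\<integral>w. (if \<sigma> w \<le> K then Y w else 0) * P (min (\<tau> w) K - \<sigma> w) (W (min (\<tau> w) K) w - W (\<sigma> w) w) \<partial>N) = 0"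
  using mart_truncated(1,3)[OF P st(1) st(1) st(2) _ Y B, of K] ord by (auto simp: P0)

text \<open>The moment \<open>E x\<^sup>2\<^sup>k\<close> of a stopped coordinate is controlled by that of the elapsed time; the bound on the
  fourth moment comes from \<open>x\<^sup>4 - 6sx\<^sup>2 + 3s\<^sup>2\<close> and \<open>6sx\<^sup>2 \<le> x\<^sup>4/2 + 18s\<^sup>2\<close>.\<close>

lemma fourth_moment_truncated:
  fixes K :: nat
  assumes st: "stopping_time F \<sigma>" "stopping_time F \<tau>"
    and ord: "\<And>w. w \<in> space N \<Longrightarrow> 0 \<le> \<sigma> w \<and> \<sigma> w \<le> \<tau> w"
    and Y: "Y \<in> borel_measurable (pre_sigma \<sigma>)" and B: "\<And>w. w \<in> space N \<Longrightarrow> 0 \<le> Y w \<and> Y w \<le> B"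
  defines "Z \<equiv> \<lambda>w. if \<sigma> w \<le> K then Y w else 0"
    and "s \<equiv> \<lambda>w. min (\<tau> w) K - \<sigma> w" and "x \<equiv> \<lambda>w. W (min (\<tau> w) K) w - W (\<sigma> w) w"
  shows "integrable N Z" "integrable N (\<lambda>w. Z w * s w ^ p)"
    "integrable N (\<lambda>w. Z w * (x w $ j)\<^sup>2)" "integrable N (\<lambda>w. Z w * (x w $ j) ^ 4)"
    "(\<integral>w. Z w * (x w $ j) ^ 4 \<partial>N) \<le> 36 * (\<integral>w. Z w * (s w)\<^sup>2 \<partial>N)"
proof -
  have [measurable]: "Y \<in> borel_measurable N" "\<sigma> \<in> borel_measurable N" "\<tau> \<in> borel_measurable N"
    using st by (auto intro: measurable_pre_sigma_N[OF _ Y] measurable_stopping_time_N)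
  have [measurable]: "Z \<in> borel_measurable N" "s \<in> borel_measurable N" by (simp_all add: Z_def s_def)
  have [measurable]: "x \<in> borel_measurable N"
    unfolding x_def using ord by (intro borel_measurable_diff measurable_W_random) (auto intro: order_trans)
  have [measurable]: "(\<lambda>w. x w $ j) \<in> borel_measurable N" by (intro measurable_vec_nth_compose) simp
  have Z: "0 \<le> Z w" "Z w \<le> \<bar>B\<bar>" if "w \<in> space N" for w using B[OF that] by (auto simp: Z_def)
  have s: "Z w = 0 \<or> 0 \<le> s w \<and> s w \<le> real K" if "w \<in> space N" for w using ord[OF that] by (auto simp: Z_def s_def)
  have bnd: "\<bar>Z w * s w ^ p\<bar> \<le> \<bar>B\<bar> * real K ^ p" if "w \<in> space N" for w p
  proof (cases "Z w = 0")
    case False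
    then show ?thesis using s[OF that] Z[OF that] by (auto simp: abs_mult intro!: mult_mono power_mono)
  qed simp
  show iZs: "integrable N (\<lambda>w. Z w * s w ^ p)" for p
    by (rule integrable_const_bound[where B="\<bar>B\<bar> * real K ^ p"]) (auto intro!: AE_I2 bnd)
  from this[of 0] show iZ: "integrable N Z" by simp
  have YB: "\<bar>Y w\<bar> \<le> \<bar>B\<bar>" if "w \<in> space N" for w using B[OF that] by auto
  have i2: "integrable N (\<lambda>w. Z w * herm 2 (s w) (x w $ j))"
    unfolding Z_def s_def x_def by (rule mart_truncated_0(1)[OF mart_1 st ord Y YB]) (auto simp: herm_eqs)
  have "integrable N (\<lambda>w. Z w * herm 2 (s w) (x w $ j) + Z w * s w ^ 1)" by (intro Bochner_Integration.integrable_add i2 iZs)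
  then show ix2: "integrable N (\<lambda>w. Z w * (x w $ j)\<^sup>2)" by (simp add: herm_eqs algebra_simps)
  have ih4: "integrable N (\<lambda>w. Z w * herm 4 (s w) (x w $ j))" and h4: "(\<integral>w. Z w * herm 4 (s w) (x w $ j) \<partial>N) = 0"
    unfolding Z_def s_def x_def by (rule mart_truncated_0[OF mart_1 st ord Y YB]; simp add: herm_eqs)+
  have isx: "integrable N (\<lambda>w. Z w * (s w * (x w $ j)\<^sup>2))"
  proof (rule Bochner_Integration.integrable_bound[of _ "\<lambda>w. real K * (Z w * (x w $ j)\<^sup>2)"])
    show "AE w in N. norm (Z w * (s w * (x w $ j)\<^sup>2)) \<le> norm (real K * (Z w * (x w $ j)\<^sup>2))" (is "AE w in N. ?P w")
    proof (rule AE_I2)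
      fix w assume "w \<in> space N"
      then show "?P w"
        using s[of w] Z[of w] mult_right_mono[of "s w" "real K" "Z w * (x w $ j)\<^sup>2"] by (auto simp: abs_mult algebra_simps)
    qed
  qed (use ix2 in auto)
  have e4: "Z w * (x w $ j) ^ 4 = Z w * herm 4 (s w) (x w $ j) + 6 * (Z w * (s w * (x w $ j)\<^sup>2)) - 3 * (Z w * (s w)\<^sup>2)" for w
    by (simp add: herm_eqs algebra_simps)
  show ix4: "integrable N (\<lambda>w. Z w * (x w $ j) ^ 4)"
    unfolding e4 by (intro Bochner_Integration.integrable_add Bochner_Integration.integrable_diff integrable_mult_right ih4 isx iZs)
  have "(\<integral>w. Z w * (x w $ j) ^ 4 \<partial>N) = 6 * (\<integral>w. Z w * (s w * (x w $ j)\<^sup>2) \<partial>N) - 3 * (\<integral>w. Z w * (s w)\<^sup>2 \<partial>N)"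
    unfolding e4 using h4 ih4 isx iZs[of 2] by simp
  also have "\<dots> \<le> 6 * (\<integral>w. Z w * (s w * (x w $ j)\<^sup>2) \<partial>N)"
    using Z by (simp add: integral_nonneg_AE)
  also have "\<dots> = (\<integral>w. 6 * (Z w * (s w * (x w $ j)\<^sup>2)) \<partial>N)" by simp
  also have "\<dots> \<le> (\<integral>w. (1/2) * (Z w * (x w $ j) ^ 4) + 18 * (Z w * (s w)\<^sup>2) \<partial>N)"
  proof (rule integral_mono)
    fix w assume w: "w \<in> space N"
    have "0 \<le> ((x w $ j)\<^sup>2 - 6 * s w)\<^sup>2" by simp
    then have "12 * (s w * (x w $ j)\<^sup>2) \<le> (x w $ j) ^ 4 + 36 * (s w)\<^sup>2"
      by (simp add: power2_diff power_mult[symmetric] power_mult_distrib algebra_simps)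
    from mult_left_mono[OF this Z(1)[OF w]]
    show "6 * (Z w * (s w * (x w $ j)\<^sup>2)) \<le> (1/2) * (Z w * (x w $ j) ^ 4) + 18 * (Z w * (s w)\<^sup>2)"
      by (simp add: algebra_simps)
  qed (use isx ix4 iZs[of 2] in auto)
  also have "\<dots> = (1/2) * (\<integral>w. Z w * (x w $ j) ^ 4 \<partial>N) + 18 * (\<integral>w. Z w * (s w)\<^sup>2 \<partial>N)"
    using ix4 iZs[of 2] by simp
  \<comment> \<open>Half of the fourth moment, finite by \<open>ix4\<close>, is absorbed on the
    left, which doubles 18 to 36.\<close>
  finally show "(\<integral>w. Z w * (x w $ j) ^ 4 \<partial>N) \<le> 36 * (\<integral>w. Z w * (s w)\<^sup>2 \<partial>N)" by simp
qed

end

section \<open>The fourth moment inequality over an event of the past\<close>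

text \<open>Convexity with weights \<open>1 - l\<close> and \<open>l\<close>. The point is that the
  coefficient of \<open>a ^ 4\<close> tends to 1 as \<open>l\<close> tends to 0; the large
  coefficient falls on the difference, which is made small beforehand.\<close>

lemma convex_fourth_power:
  fixes a b :: real
  assumes "0 < l" "l < 1"
  shows "b ^ 4 \<le> a ^ 4 / (1 - l) ^ 3 + (b - a) ^ 4 / l ^ 3"
proof -
  have c: "convex_on UNIV (\<lambda>x::real. x ^ 4)" using convex_power_even[of 4] by simp
  have "((1 - l) *\<^sub>R (a / (1 - l)) + l *\<^sub>R ((b - a) / l)) ^ 4 \<le> (1 - l) * (a / (1 - l)) ^ 4 + l * ((b - a) / l) ^ 4"
    by (rule convex_onD[OF c]) (use assms in auto)
  moreover have "(1 - l) *\<^sub>R (a / (1 - l)) + l *\<^sub>R ((b - a) / l) = b" using assms by simp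
  moreover have "(1 - l) * (a / (1 - l)) ^ 4 = a ^ 4 / (1 - l) ^ 3" "l * ((b - a) / l) ^ 4 = (b - a) ^ 4 / l ^ 3"
    using assms by (simp_all add: power_divide power4_eq_xxxx power3_eq_cube)
  ultimately show ?thesis by simp
qed

lemma abs_le_one_plus_sq: "\<bar>r\<bar> \<le> 1 + r\<^sup>2" for r :: real
proof -
  have "0 \<le> (\<bar>r\<bar> - 1)\<^sup>2" by simp
  then have "2 * \<bar>r\<bar> \<le> 1 + r\<^sup>2" by (simp only: power2_diff power2_abs) simp
  then show ?thesis by linarith
qed

context bm
begin

lemma eventually_min_eq: "\<forall>\<^sub>F K in sequentially. min (t::real) (real K) = t"
proof -
  obtain k :: nat where "t \<le> real k" using real_arch_simple by auto
  then have "min t (real K) = t" if "K \<ge> k" for K using that by (auto simp: min_def)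
  then show ?thesis unfolding eventually_sequentially by blast
qed

text \<open>For \<open>\<tau>\<close> cut at \<open>K\<close> the two martingale identities and a
  square give the inequality exactly. The difficulty is the limit in \<open>K\<close>: the
  displacement at the cut time need not be dominated by the full one, so the two are compared
  through the fourth moment of the displacement after the cut, which the second moment of the
  remaining time controls.\<close>

lemma quartic_lower:
  assumes st: "stopping_time F \<sigma>" "stopping_time F \<tau>"
    and ord: "\<And>w. w \<in> space N \<Longrightarrow> 0 \<le> \<sigma> w \<and> \<sigma> w \<le> \<tau> w"
    and B: "B \<in> sets (pre_sigma \<sigma>)"
    and i\<Delta>: "integrable N (\<lambda>w. indicator B w * (\<tau> w - \<sigma> w)\<^sup>2)"
    and i4: "\<And>j. integrable N (\<lambda>w. indicator B w * ((W (\<tau> w) w - W (\<sigma> w) w) $ j) ^ 4)"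
    and c: "0 \<le> c"
  shows "3 * (2 * c * real CARD('d) * (\<integral>w. indicator B w * (\<tau> w - \<sigma> w) \<partial>N) - c\<^sup>2 * (\<integral>w. indicator B w \<partial>N))
     \<le> (real CARD('d) + 2) * (\<Sum>j\<in>UNIV. \<integral>w. indicator B w * ((W (\<tau> w) w - W (\<sigma> w) w) $ j) ^ 4 \<partial>N)"
proof -
  let ?d = "real CARD('d)"
  define Z :: "nat \<Rightarrow> 'a \<Rightarrow> real" where "Z K w = (if \<sigma> w \<le> real K then indicator B w else 0)" for K w
  define s where "s K w = min (\<tau> w) (real K) - \<sigma> w" for K w
  define x where "x K w = W (min (\<tau> w) (real K)) w - W (\<sigma> w) w" for K w
  define X where "X w = W (\<tau> w) w - W (\<sigma> w) w" for w
  \<comment> \<open>The mean square of the time cut off; it tends to 0 because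
    \<open>i\<Delta>\<close> provides a dominating function.\<close>
  define e where "e K = (\<integral>w. Z K w * (\<tau> w - min (\<tau> w) (real K))\<^sup>2 \<partial>N)" for K
  have BN: "B \<in> sets N" using B subalgebra_pre_sigma[OF st(1)] by (auto simp: subalgebra_def)
  note [measurable] = BN measurable_stopping_time_N[OF st(1)] measurable_stopping_time_N[OF st(2)]
  have nn: "0 \<le> \<sigma> w" "0 \<le> \<tau> w" "\<sigma> w \<le> \<tau> w" if "w \<in> space N" for w using ord[OF that] by auto
  have [measurable]: "(\<lambda>w. W (\<sigma> w) w) \<in> borel_measurable N" "(\<lambda>w. W (\<tau> w) w) \<in> borel_measurable N"
    "(\<lambda>w. W (min (\<tau> w) (real K)) w) \<in> borel_measurable N" for K
    by (intro measurable_W_random; use nn in force)+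
  have [measurable]: "Z K \<in> borel_measurable N" "s K \<in> borel_measurable N" for K by (simp_all add: Z_def[abs_def] s_def[abs_def])
  have [measurable]: "(\<lambda>w. x K w $ j) \<in> borel_measurable N" "(\<lambda>w. X w $ j) \<in> borel_measurable N" for j K
    unfolding x_def X_def by (intro measurable_vec_nth_compose; simp)+
  have Zb: "0 \<le> Z K w" "Z K w \<le> 1" "Z K w \<le> indicator B w" "Z K w \<noteq> 0 \<Longrightarrow> Z K w = 1 \<and> \<sigma> w \<le> K" for K w
    by (auto simp: Z_def indicator_def split: if_splits)
  have Y: "(indicator B :: 'a \<Rightarrow> real) \<in> borel_measurable (pre_sigma \<sigma>)" using B by simp
  have Yb: "\<bar>indicator B w :: real\<bar> \<le> 1" "0 \<le> (indicator B w :: real) \<and> (indicator B w :: real) \<le> 1" for w by (auto split: split_indicator)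
  have fm: "integrable N (Z K)" "integrable N (\<lambda>w. Z K w * s K w ^ p)"
    "integrable N (\<lambda>w. Z K w * (x K w $ j)\<^sup>2)" "integrable N (\<lambda>w. Z K w * (x K w $ j) ^ 4)" for K j p
    unfolding Z_def s_def x_def by (rule fourth_moment_truncated[OF st ord Y Yb(2)]; simp)+
  have fm1: "integrable N (\<lambda>w. Z K w * s K w)" for K using fm(2)[of K 1] by simp
  have q: "integrable N (\<lambda>w. Z K w * ((?d + 2) * (\<Sum>j\<in>UNIV. (x K w $ j) ^ 4) - 3 * (norm (x K w)) ^ 4))"
    "(\<integral>w. Z K w * ((?d + 2) * (\<Sum>j\<in>UNIV. (x K w $ j) ^ 4) - 3 * (norm (x K w)) ^ 4) \<partial>N) = 0" for K
    unfolding Z_def s_def x_def by (rule mart_truncated_0[OF mart_quartic st ord Y Yb(1)]; simp)+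
  have q2: "integrable N (\<lambda>w. Z K w * ((norm (x K w))\<^sup>2 - ?d * s K w))"
    "(\<integral>w. Z K w * ((norm (x K w))\<^sup>2 - ?d * s K w) \<partial>N) = 0" for K
    unfolding Z_def s_def x_def by (rule mart_truncated_0[OF mart_norm2 st ord Y Yb(1)]; simp)+
  have i44: "integrable N (\<lambda>w. \<Sum>j\<in>UNIV. Z K w * (x K w $ j) ^ 4)" for K by (intro Bochner_Integration.integrable_sum fm)
  have step1: "3 * (2 * c * ?d * (\<integral>w. Z K w * s K w \<partial>N) - c\<^sup>2 * (\<integral>w. Z K w \<partial>N)) \<le> (?d + 2) * (\<Sum>j\<in>UNIV. \<integral>w. Z K w * (x K w $ j) ^ 4 \<partial>N)" for K
  proof -
    \<comment> \<open>The identities for the quartic and for \<open>|x|^2 - d s\<close> are added,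
      the second with weight \<open>6 c\<close>. Then \<open>2 c |x|^2 \<le> |x|^4 + c^2\<close>
      eliminates the fourth power of the norm.\<close>
    have "0 = (\<integral>w. Z K w * ((?d + 2) * (\<Sum>j\<in>UNIV. (x K w $ j) ^ 4) - 3 * (norm (x K w)) ^ 4) \<partial>N) + 6 * c * (\<integral>w. Z K w * ((norm (x K w))\<^sup>2 - ?d * s K w) \<partial>N)"
      by (simp add: q q2)
    also have "\<dots> = (\<integral>w. Z K w * ((?d + 2) * (\<Sum>j\<in>UNIV. (x K w $ j) ^ 4) - 3 * (norm (x K w)) ^ 4) + 6 * c * (Z K w * ((norm (x K w))\<^sup>2 - ?d * s K w)) \<partial>N)"
      using q q2 by simp
    also have "\<dots> \<le> (\<integral>w. (?d + 2) * (\<Sum>j\<in>UNIV. Z K w * (x K w $ j) ^ 4) + 3 * c\<^sup>2 * Z K w - 6 * c * ?d * (Z K w * s K w) \<partial>N)"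
    proof (rule integral_mono)
      fix w
      have "0 \<le> ((norm (x K w))\<^sup>2 - c)\<^sup>2" by simp
      then have "2 * c * (norm (x K w))\<^sup>2 \<le> (norm (x K w)) ^ 4 + c\<^sup>2"
        by (simp add: power2_diff power_mult[symmetric] algebra_simps)
      from mult_left_mono[OF this Zb(1)[of K w]]
      show "Z K w * ((?d + 2) * (\<Sum>j\<in>UNIV. (x K w $ j) ^ 4) - 3 * (norm (x K w)) ^ 4) + 6 * c * (Z K w * ((norm (x K w))\<^sup>2 - ?d * s K w))
        \<le> (?d + 2) * (\<Sum>j\<in>UNIV. Z K w * (x K w $ j) ^ 4) + 3 * c\<^sup>2 * Z K w - 6 * c * ?d * (Z K w * s K w)"
        by (simp add: sum_distrib_left[symmetric] algebra_simps)
    qed (use q q2 fm(1) fm1 i44 in auto)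
    also have "\<dots> = (?d + 2) * (\<Sum>j\<in>UNIV. \<integral>w. Z K w * (x K w $ j) ^ 4 \<partial>N) + 3 * c\<^sup>2 * (\<integral>w. Z K w \<partial>N) - 6 * c * ?d * (\<integral>w. Z K w * s K w \<partial>N)"
      using fm(1,4) fm1 i44 by simp
    finally show ?thesis by (simp add: algebra_simps)
  qed
  have tail: "0 \<le> Z K w * (\<tau> w - min (\<tau> w) (real K))\<^sup>2 \<and> Z K w * (\<tau> w - min (\<tau> w) (real K))\<^sup>2 \<le> indicator B w * (\<tau> w - \<sigma> w)\<^sup>2" if "w \<in> space N" for K w
  proof (cases "Z K w = 0")
    case False
    then have "Z K w = 1" "\<sigma> w \<le> K" "w \<in> B" using Zb(3,4)[of K w] by (auto split: split_indicator_asm)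
    then show ?thesis using nn[OF that] by (auto intro!: power_mono)
  qed (auto intro!: mult_nonneg_nonneg)
  have itail: "integrable N (\<lambda>w. Z K w * (\<tau> w - min (\<tau> w) (real K))\<^sup>2)" for K
    by (rule Bochner_Integration.integrable_bound[OF i\<Delta>]) (use tail in \<open>auto intro!: AE_I2\<close>)
  have e0: "e \<longlonglongrightarrow> 0"
  proof -
    have "(\<lambda>K. \<integral>w. Z K w * (\<tau> w - min (\<tau> w) (real K))\<^sup>2 \<partial>N) \<longlonglongrightarrow> (\<integral>w. 0 \<partial>N)"
    proof (rule integral_dominated_convergence[OF _ _ i\<Delta>])
      show "AE w in N. (\<lambda>K. Z K w * (\<tau> w - min (\<tau> w) (real K))\<^sup>2) \<longlonglongrightarrow> 0" (is "AE w in N. ?P w")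
      proof (rule AE_I2)
        fix w
        show "?P w"
          by (rule tendsto_eventually, use eventually_min_eq[of "\<tau> w"] in \<open>eventually_elim\<close>) simp
      qed
    qed (use tail in \<open>auto intro!: AE_I2\<close>)
    then show ?thesis by (simp add: e_def[abs_def])
  qed
  \<comment> \<open>The displacement from \<open>min \<tau> K\<close> to \<open>\<tau>\<close> is
    again one between stopping times, so \<open>fourth_moment_truncated\<close> applies to it with a
    second cut \<open>L\<close>, which Fatou's lemma removes.\<close>
  have gap: "integrable N (\<lambda>w. Z K w * ((X w - x K w) $ j) ^ 4) \<and> (\<integral>w. Z K w * ((X w - x K w) $ j) ^ 4 \<partial>N) \<le> 36 * e K" for K j
  proof -
    let ?\<rho> = "\<lambda>w. min (\<tau> w) (real K)"
    define v where "v L w = W (min (\<tau> w) (real L)) w - W (min (\<tau> w) (real K)) w" for L w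
    have [measurable]: "(\<lambda>w. v L w $ j) \<in> borel_measurable N" for L unfolding v_def by (intro measurable_vec_nth_compose) simp
    have st\<rho>: "stopping_time F ?\<rho>" "stopping_time F (\<lambda>w. min (\<sigma> w) (real K))" by (intro stopping_time_min st stopping_time_const)+
    have ZY: "Z K \<in> borel_measurable (pre_sigma ?\<rho>)"
      by (rule measurable_pre_sigma_mono[OF st\<rho>(2,1)]) (use nn measurable_trunc[OF st(1) Y, of "real K"] in \<open>auto simp: Z_def[abs_def] min_le_iff_disj\<close>)
    have bnd: "(\<integral>w. Z K w * (v L w $ j) ^ 4 \<partial>N) \<le> 36 * e K" "integrable N (\<lambda>w. Z K w * (v L w $ j) ^ 4)" if L: "L \<ge> K" for L
    proof -
      have if_eq: "(if ?\<rho> w \<le> real L then Z K w else 0) = Z K w" for w using L by (auto simp: min_le_iff_disj)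
      have o: "0 \<le> ?\<rho> w \<and> ?\<rho> w \<le> \<tau> w" if "w \<in> space N" for w using nn[OF that] by auto
      have zb: "0 \<le> Z K w \<and> Z K w \<le> 1" for w using Zb by auto
      note f = fourth_moment_truncated[OF st\<rho>(1) st(2) o ZY zb, where K=L, simplified if_eq, folded v_def]
      show "integrable N (\<lambda>w. Z K w * (v L w $ j) ^ 4)" using f(4) by simp
      have "(\<integral>w. Z K w * (v L w $ j) ^ 4 \<partial>N) \<le> 36 * (\<integral>w. Z K w * (min (\<tau> w) (real L) - ?\<rho> w)\<^sup>2 \<partial>N)" using f(5) by simp
      also have "(\<integral>w. Z K w * (min (\<tau> w) (real L) - ?\<rho> w)\<^sup>2 \<partial>N) \<le> e K"
        unfolding e_def
      proof (rule integral_mono)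
        show "integrable N (\<lambda>w. Z K w * (min (\<tau> w) (real L) - ?\<rho> w)\<^sup>2)" using f(2)[of 2] by simp
        show "Z K w * (min (\<tau> w) (real L) - ?\<rho> w)\<^sup>2 \<le> Z K w * (\<tau> w - ?\<rho> w)\<^sup>2" for w
          using L Zb(1)[of K w] by (intro mult_left_mono power_mono) auto
      qed (rule itail)
      finally show "(\<integral>w. Z K w * (v L w $ j) ^ 4 \<partial>N) \<le> 36 * e K" by simp
    qed
    have m: "(\<lambda>w. Z K w * ((X w - x K w) $ j) ^ 4) \<in> borel_measurable N" by simp
    have z4: "0 \<le> Z K w * r ^ 4" for w r using Zb(1)[of K w] by (simp add: zero_le_even_power)
    have "(\<integral>\<^sup>+w. ennreal (Z K w * ((X w - x K w) $ j) ^ 4) \<partial>N) = (\<integral>\<^sup>+w. liminf (\<lambda>L. ennreal (Z K w * (v L w $ j) ^ 4)) \<partial>N)"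
    proof (rule nn_integral_cong)
      fix w
      have "(\<lambda>L. ennreal (Z K w * (v L w $ j) ^ 4)) \<longlonglongrightarrow> ennreal (Z K w * ((X w - x K w) $ j) ^ 4)"
        by (rule tendsto_eventually, use eventually_min_eq[of "\<tau> w"] in \<open>eventually_elim\<close>) (simp add: v_def X_def x_def)
      then show "ennreal (Z K w * ((X w - x K w) $ j) ^ 4) = liminf (\<lambda>L. ennreal (Z K w * (v L w $ j) ^ 4))"
        by (rule lim_imp_Liminf[OF sequentially_bot, symmetric])
    qed
    also have "\<dots> \<le> liminf (\<lambda>L. \<integral>\<^sup>+w. ennreal (Z K w * (v L w $ j) ^ 4) \<partial>N)" by (rule nn_integral_liminf) simp
    also have "\<dots> \<le> limsup (\<lambda>L. \<integral>\<^sup>+w. ennreal (Z K w * (v L w $ j) ^ 4) \<partial>N)" by (rule Liminf_le_Limsup) simp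
    also have "\<dots> \<le> ennreal (36 * e K)"
    proof (rule Limsup_bounded)
      show "\<forall>\<^sub>F L in sequentially. (\<integral>\<^sup>+w. ennreal (Z K w * (v L w $ j) ^ 4) \<partial>N) \<le> ennreal (36 * e K)"
        using eventually_ge_at_top[of K]
      proof eventually_elim
        case (elim L)
        then show ?case using bnd[of L] z4 by (subst nn_integral_eq_integral) (auto intro!: ennreal_leI)
      qed
    qed
    finally have le: "(\<integral>\<^sup>+w. ennreal (Z K w * ((X w - x K w) $ j) ^ 4) \<partial>N) \<le> ennreal (36 * e K)" .
    have e_nn: "0 \<le> e K" unfolding e_def using tail by (intro integral_nonneg_AE AE_I2) auto
    have i: "integrable N (\<lambda>w. Z K w * ((X w - x K w) $ j) ^ 4)"
      by (rule integrableI_nonneg[OF m]) (use le z4 in \<open>auto simp: order.strict_trans1\<close>)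
    then show ?thesis using le e_nn z4 by (subst (asm) nn_integral_eq_integral) auto
  qed
  \<comment> \<open>With \<open>l\<close> fixed the error \<open>36 e K / l^3\<close> vanishes as
    \<open>K\<close> grows; only afterwards may \<open>l\<close> tend to 0.\<close>
  have main: "3 * (2 * c * ?d * (\<integral>w. indicator B w * (\<tau> w - \<sigma> w) \<partial>N) - c\<^sup>2 * (\<integral>w. indicator B w \<partial>N)) \<le> (?d + 2) * (\<Sum>j\<in>UNIV. (\<integral>w. indicator B w * (X w $ j) ^ 4 \<partial>N) / (1 - l) ^ 3)"
    if l: "0 < l" "l < 1" for l
  proof (rule LIMSEQ_le)
    have i1: "integrable N (\<lambda>w. indicator B w * (\<tau> w - \<sigma> w))"
    proof (rule Bochner_Integration.integrable_bound[of _ "\<lambda>w. 1 + indicator B w * (\<tau> w - \<sigma> w)\<^sup>2"])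
      show "AE w in N. norm (indicator B w * (\<tau> w - \<sigma> w)) \<le> norm (1 + indicator B w * (\<tau> w - \<sigma> w)\<^sup>2)"
        by (rule AE_I2) (simp add: abs_le_one_plus_sq split: split_indicator)
    qed (use i\<Delta> in auto)
    have Z_lim: "\<forall>\<^sub>F K in sequentially. Z K w = indicator B w \<and> s K w = \<tau> w - \<sigma> w" for w
    proof -
      have "\<forall>\<^sub>F K in sequentially. \<sigma> w \<le> real K" using eventually_min_eq[of "\<sigma> w"] by eventually_elim (auto simp: min_def split: if_splits)
      with eventually_min_eq[of "\<tau> w"] show ?thesis by eventually_elim (auto simp: Z_def s_def)
    qed
    have lim1: "(\<lambda>K. \<integral>w. Z K w * s K w \<partial>N) \<longlonglongrightarrow> (\<integral>w. indicator B w * (\<tau> w - \<sigma> w) \<partial>N)"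
    proof (rule integral_dominated_convergence[OF _ _ i1])
      show "AE w in N. (\<lambda>K. Z K w * s K w) \<longlonglongrightarrow> indicator B w * (\<tau> w - \<sigma> w)" (is "AE w in N. ?P w")
      proof (rule AE_I2)
        fix w show "?P w"
          by (rule tendsto_eventually, use Z_lim[of w] in \<open>eventually_elim\<close>) simp
      qed
      show "AE w in N. norm (Z K w * s K w) \<le> indicator B w * (\<tau> w - \<sigma> w)" for K
        using nn by (auto intro!: AE_I2 simp: Z_def s_def split: split_indicator)
    qed auto
    have lim2: "(\<lambda>K. \<integral>w. Z K w \<partial>N) \<longlonglongrightarrow> (\<integral>w. indicator B w \<partial>N)"
    proof (rule integral_dominated_convergence[where w="\<lambda>_. 1"])
      show "AE w in N. (\<lambda>K. Z K w) \<longlonglongrightarrow> indicator B w" (is "AE w in N. ?P w")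
      proof (rule AE_I2)
        fix w show "?P w"
          by (rule tendsto_eventually, use Z_lim[of w] in \<open>eventually_elim\<close>) simp
      qed
    qed (use Zb in auto)
    show "(\<lambda>K. 3 * (2 * c * ?d * (\<integral>w. Z K w * s K w \<partial>N) - c\<^sup>2 * (\<integral>w. Z K w \<partial>N))) \<longlonglongrightarrow>
       3 * (2 * c * ?d * (\<integral>w. indicator B w * (\<tau> w - \<sigma> w) \<partial>N) - c\<^sup>2 * (\<integral>w. indicator B w \<partial>N))"
      by (intro tendsto_intros lim1 lim2)
    have "(\<lambda>K. (?d + 2) * (\<Sum>j\<in>UNIV. (\<integral>w. indicator B w * (X w $ j) ^ 4 \<partial>N) / (1 - l) ^ 3 + 36 * e K / l ^ 3)) \<longlonglongrightarrow>
       (?d + 2) * (\<Sum>j\<in>(UNIV::'d set). (\<integral>w. indicator B w * (X w $ j) ^ 4 \<partial>N) / (1 - l) ^ 3 + 36 * 0 / l ^ 3)"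
      by (intro tendsto_intros e0) (use l in auto)
    then show "(\<lambda>K. (?d + 2) * (\<Sum>j\<in>UNIV. (\<integral>w. indicator B w * (X w $ j) ^ 4 \<partial>N) / (1 - l) ^ 3 + 36 * e K / l ^ 3)) \<longlonglongrightarrow>
       (?d + 2) * (\<Sum>j\<in>UNIV. (\<integral>w. indicator B w * (X w $ j) ^ 4 \<partial>N) / (1 - l) ^ 3)" by simp
    have "(\<integral>w. Z K w * (x K w $ j) ^ 4 \<partial>N) \<le> (\<integral>w. indicator B w * (X w $ j) ^ 4 \<partial>N) / (1 - l) ^ 3 + 36 * e K / l ^ 3" for K j
    proof -
      have iX: "integrable N (\<lambda>w. indicator B w * (X w $ j) ^ 4)" using i4[of j] by (simp add: X_def)
      note g = gap[of K j]
      have "(\<integral>w. Z K w * (x K w $ j) ^ 4 \<partial>N) \<le> (\<integral>w. indicator B w * (X w $ j) ^ 4 / (1 - l) ^ 3 + Z K w * ((X w - x K w) $ j) ^ 4 / l ^ 3 \<partial>N)"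
      proof (rule integral_mono)
        fix w
        have sw: "(x K w $ j - X w $ j) ^ 4 = (X w $ j - x K w $ j) ^ 4" by (simp add: power4_eq_xxxx algebra_simps)
        have "Z K w * (x K w $ j) ^ 4 \<le> Z K w * ((X w $ j) ^ 4 / (1 - l) ^ 3 + ((X w - x K w) $ j) ^ 4 / l ^ 3)"
          using convex_fourth_power[OF l, of "x K w $ j" "X w $ j"] Zb(1)[of K w] sw by (intro mult_left_mono) simp_all
        also have "\<dots> = Z K w * ((X w $ j) ^ 4 / (1 - l) ^ 3) + Z K w * ((X w - x K w) $ j) ^ 4 / l ^ 3" by (simp add: distrib_left)
        also have "\<dots> \<le> indicator B w * ((X w $ j) ^ 4 / (1 - l) ^ 3) + Z K w * ((X w - x K w) $ j) ^ 4 / l ^ 3"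
          using Zb(3)[of K w] l by (intro add_right_mono mult_right_mono) (auto simp: zero_le_even_power intro!: divide_nonneg_pos)
        finally show "Z K w * (x K w $ j) ^ 4 \<le> indicator B w * (X w $ j) ^ 4 / (1 - l) ^ 3 + Z K w * ((X w - x K w) $ j) ^ 4 / l ^ 3" by simp
      qed (use fm(4)[of K j] iX g in auto)
      also have "\<dots> = (\<integral>w. indicator B w * (X w $ j) ^ 4 \<partial>N) / (1 - l) ^ 3 + (\<integral>w. Z K w * ((X w - x K w) $ j) ^ 4 \<partial>N) / l ^ 3"
        using iX g by (subst Bochner_Integration.integral_add) auto
      also have "\<dots> \<le> (\<integral>w. indicator B w * (X w $ j) ^ 4 \<partial>N) / (1 - l) ^ 3 + 36 * e K / l ^ 3"
        using g l by (intro add_left_mono divide_right_mono) auto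
      finally show ?thesis .
    qed
    then show "\<exists>n. \<forall>K\<ge>n. 3 * (2 * c * ?d * (\<integral>w. Z K w * s K w \<partial>N) - c\<^sup>2 * (\<integral>w. Z K w \<partial>N)) \<le> (?d + 2) * (\<Sum>j\<in>UNIV. (\<integral>w. indicator B w * (X w $ j) ^ 4 \<partial>N) / (1 - l) ^ 3 + 36 * e K / l ^ 3)"
      by (intro exI[of _ 0] allI impI order_trans[OF step1] mult_left_mono sum_mono) auto
  qed
  have "((\<lambda>l. (?d + 2) * (\<Sum>j\<in>(UNIV::'d set). (\<integral>w. indicator B w * (X w $ j) ^ 4 \<partial>N) / (1 - l) ^ 3)) \<longlongrightarrow>
      (?d + 2) * (\<Sum>j\<in>(UNIV::'d set). (\<integral>w. indicator B w * (X w $ j) ^ 4 \<partial>N) / (1 - 0) ^ 3)) (at_right 0)"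
    by (intro tendsto_intros) auto
  moreover have "\<forall>\<^sub>F l in at_right 0. 3 * (2 * c * ?d * (\<integral>w. indicator B w * (\<tau> w - \<sigma> w) \<partial>N) - c\<^sup>2 * (\<integral>w. indicator B w \<partial>N)) \<le> (?d + 2) * (\<Sum>j\<in>UNIV. (\<integral>w. indicator B w * (X w $ j) ^ 4 \<partial>N) / (1 - l) ^ 3)"
    by (rule eventually_mono[OF eventually_at_right_real[of 0 "1::real"]]) (use main in auto)
  ultimately have "3 * (2 * c * ?d * (\<integral>w. indicator B w * (\<tau> w - \<sigma> w) \<partial>N) - c\<^sup>2 * (\<integral>w. indicator B w \<partial>N)) \<le>
      (?d + 2) * (\<Sum>j\<in>(UNIV::'d set). (\<integral>w. indicator B w * (X w $ j) ^ 4 \<partial>N) / (1 - 0) ^ 3)"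
    by (rule tendsto_lowerbound) simp
  then show ?thesis by (simp add: X_def)
qed

section \<open>Conditional expectations and changes on null sets\<close>

lemma sigma_finite_subalgebra_pre_sigma:
  "stopping_time F \<sigma> \<Longrightarrow> finite_measure_subalgebra N (pre_sigma \<sigma>)"
  by (unfold_locales) (auto simp: subalgebra_pre_sigma)

text \<open>\<open>enn2real\<close> sends infinity to 0, but integrability over \<open>E\<close>
  makes the conditional expectation finite almost everywhere on \<open>E\<close>, so nothing is lost
  there.\<close>

lemma nn_cond_exp_set_integral:
  assumes \<sigma>: "stopping_time F \<sigma>" and E: "E \<in> sets (pre_sigma \<sigma>)"
    and f[measurable]: "f \<in> borel_measurable N" and nn: "\<And>w. w \<in> space N \<Longrightarrow> 0 \<le> f w"
    and i: "integrable N (\<lambda>w. indicator E w * f w)"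
  defines "g \<equiv> \<lambda>w. enn2real (nn_cond_exp N (pre_sigma \<sigma>) (\<lambda>w. ennreal (f w)) w)"
  shows "integrable N (\<lambda>w. indicator E w * g w)" "(\<integral>w. indicator E w * g w \<partial>N) = (\<integral>w. indicator E w * f w \<partial>N)"
proof -
  interpret S: finite_measure_subalgebra N "pre_sigma \<sigma>" by (rule sigma_finite_subalgebra_pre_sigma[OF \<sigma>])
  let ?c = "nn_cond_exp N (pre_sigma \<sigma>) (\<lambda>w. ennreal (f w))"
  have EN[measurable]: "E \<in> sets N" using E subalgebra_pre_sigma[OF \<sigma>] by (auto simp: subalgebra_def)
  have "(\<integral>\<^sup>+w. indicator E w * ?c w \<partial>N) = (\<integral>\<^sup>+w. indicator E w * ennreal (f w) \<partial>N)"
    by (rule S.nn_cond_exp_intg) (use E in auto)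
  also have "\<dots> = (\<integral>\<^sup>+w. ennreal (indicator E w * f w) \<partial>N)"
    by (intro nn_integral_cong) (auto split: split_indicator)
  also have eq: "\<dots> = ennreal (\<integral>w. indicator E w * f w \<partial>N)"
    by (rule nn_integral_eq_integral[OF i]) (use nn in \<open>auto intro!: AE_I2\<close>)
  finally have 1: "(\<integral>\<^sup>+w. indicator E w * ?c w \<partial>N) = ennreal (\<integral>w. indicator E w * f w \<partial>N)" .
  then have "AE w in N. indicator E w * ?c w \<noteq> \<infinity>"
    by (intro nn_integral_PInf_AE) auto
  then have "AE w in N. ennreal (indicator E w * g w) = indicator E w * ?c w"
    by eventually_elim (auto simp: g_def less_top split: split_indicator)
  then have 2: "(\<integral>\<^sup>+w. ennreal (indicator E w * g w) \<partial>N) = ennreal (\<integral>w. indicator E w * f w \<partial>N)"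
    unfolding 1[symmetric] by (rule nn_integral_cong_AE)
  have gm[measurable]: "g \<in> borel_measurable N" unfolding g_def by measurable
  show ig: "integrable N (\<lambda>w. indicator E w * g w)"
    by (rule integrableI_nonneg) (use 2 in \<open>auto simp: g_def\<close>)
  have "0 \<le> (\<integral>w. indicator E w * f w \<partial>N)" "0 \<le> (\<integral>w. indicator E w * g w \<partial>N)"
    using nn by (intro integral_nonneg_AE AE_I2; auto simp: g_def)+
  moreover have "(\<integral>\<^sup>+w. ennreal (indicator E w * g w) \<partial>N) = ennreal (\<integral>w. indicator E w * g w \<partial>N)"
    by (rule nn_integral_eq_integral[OF ig]) (auto simp: g_def)
  ultimately show "(\<integral>w. indicator E w * g w \<partial>N) = (\<integral>w. indicator E w * f w \<partial>N)"
    using 2 by simp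
qed

end

context bm
begin

lemma measurable_AE_cong:
  assumes f: "f \<in> measurable N B" and eq: "AE w in N. f w = g w" and sp: "\<And>w. w \<in> space N \<Longrightarrow> g w \<in> space B"
  shows "g \<in> measurable N B"
proof (rule measurableI)
  fix A assume "A \<in> sets B"
  then have "f -` A \<inter> space N \<in> sets N" using f by auto
  moreover have eq': "AE w in N. w \<in> f -` A \<inter> space N \<longleftrightarrow> w \<in> g -` A \<inter> space N" using eq by eventually_elim auto
  ultimately show "g -` A \<inter> space N \<in> sets N" by (intro in_sets_AE[OF eq']) auto
qed (use sp in auto)

text \<open>The differences \<open>A - B\<close> and \<open>B - A\<close> are null sets, and these
  belong to every \<open>F t\<close>.\<close>

lemma sets_F_AE:
  assumes A: "A \<in> sets (F t)" and eq: "AE w in N. w \<in> A \<longleftrightarrow> w \<in> B" and B: "B \<subseteq> space N"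
  shows "B \<in> sets (F t)"
proof -
  have AN: "A \<in> sets N" using A sets_F_subset by auto
  have BN: "B \<in> sets N" by (rule in_sets_AE[OF eq AN B])
  have "A - B \<in> null_sets N" "B - A \<in> null_sets N"
    using eq AN BN B by (auto simp: null_sets_iff_AE dest: sets.sets_into_space elim!: AE_mp)
  then have "A - B \<in> sets (F t)" "B - A \<in> sets (F t)" using null_sets_F by auto
  moreover have "B = (A - (A - B)) \<union> (B - A)" by auto
  ultimately show ?thesis using A by (metis sets.Diff sets.Un)
qed

lemma stopping_time_AE_cong:
  assumes "stopping_time F \<sigma>" "AE w in N. \<sigma> w = \<rho> w"
  shows "stopping_time F \<rho>"
proof
  fix t
  have "{w \<in> space N. \<sigma> w \<le> t} \<in> sets (F t)" using stopping_timeD[OF assms(1)] by (simp add: pred_def space_F)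
  then have "{w \<in> space N. \<rho> w \<le> t} \<in> sets (F t)" by (rule sets_F_AE) (use assms(2) in \<open>auto elim!: AE_mp\<close>)
  then show "Measurable.pred (F t) (\<lambda>w. \<rho> w \<le> t)" by (simp add: pred_def space_F)
qed

text \<open>Lets the stopped algebra at a time defined from the original paths be replaced by the
  one at its version with regular paths everywhere.\<close>

lemma pre_sigma_AE_cong:
  assumes "AE w in N. \<sigma> w = \<rho> w"
  shows "pre_sigma \<sigma> = pre_sigma \<rho>"
proof -
  have *: "(\<forall>t. {w \<in> A. \<rho> w \<le> t} \<in> sets (F t))" if A: "\<forall>t. {w \<in> A. \<sigma> w \<le> t} \<in> sets (F t)" and eq: "AE w in N. \<sigma> w = \<rho> w" for A \<sigma> \<rho>
  proof
    fix t
    have "{w \<in> A. \<sigma> w \<le> t} \<subseteq> space N" for t using A sets.sets_into_space[of _ "F t"] by (auto simp: space_F)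
    then have "A \<subseteq> space N" by blast
    then show "{w \<in> A. \<rho> w \<le> t} \<in> sets (F t)" using A[rule_format, of t] by (intro sets_F_AE[OF A[rule_format, of t]]) (use eq in \<open>auto elim!: AE_mp\<close>)
  qed
  have "{A. \<forall>t. {w \<in> A. \<sigma> w \<le> t} \<in> sets (F t)} = {A. \<forall>t. {w \<in> A. \<rho> w \<le> t} \<in> sets (F t)}"
  proof -
    have "AE w in N. \<rho> w = \<sigma> w" using assms by eventually_elim simp
    then show ?thesis using *[OF _ assms] *[of _ \<rho> \<sigma>] by blast
  qed
  then show ?thesis by (simp add: pre_sigma_def)
qed

lemma real_cond_exp_nonneg:
  assumes \<sigma>: "stopping_time F \<sigma>" and f: "f \<in> borel_measurable N" "AE w in N. 0 \<le> f w"
  shows "AE w in N. real_cond_exp N (pre_sigma \<sigma>) f w = enn2real (nn_cond_exp N (pre_sigma \<sigma>) (\<lambda>w. ennreal (f w)) w)"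
proof -
  interpret S: finite_measure_subalgebra N "pre_sigma \<sigma>" by (rule sigma_finite_subalgebra_pre_sigma[OF \<sigma>])
  have "AE w in N. nn_cond_exp N (pre_sigma \<sigma>) (\<lambda>w. ennreal (- f w)) w = nn_cond_exp N (pre_sigma \<sigma>) (\<lambda>w. 0) w"
    by (rule S.nn_cond_exp_cong) (use f in \<open>auto elim!: AE_mp simp: ennreal_neg\<close>)
  moreover have "AE w in N. nn_cond_exp N (pre_sigma \<sigma>) (\<lambda>w. 0) w = 0"
    using S.nn_cond_exp_F_meas[of "\<lambda>w. 0"] by (auto elim!: AE_mp)
  ultimately show ?thesis by eventually_elim (simp add: real_cond_exp_def)
qed

lemma integrable_indicator_nn_cond_exp:
  assumes \<sigma>: "stopping_time F \<sigma>" and E: "E \<in> sets (pre_sigma \<sigma>)"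
    and f[measurable]: "f \<in> borel_measurable N" and nn: "\<And>w. w \<in> space N \<Longrightarrow> 0 \<le> f w"
    and C: "\<And>w. w \<in> E \<Longrightarrow> nn_cond_exp N (pre_sigma \<sigma>) (\<lambda>w. ennreal (f w)) w \<le> of_nat C"
  shows "integrable N (\<lambda>w. indicator E w * f w)"
proof -
  interpret S: finite_measure_subalgebra N "pre_sigma \<sigma>" by (rule sigma_finite_subalgebra_pre_sigma[OF \<sigma>])
  have EN[measurable]: "E \<in> sets N" using E subalgebra_pre_sigma[OF \<sigma>] by (auto simp: subalgebra_def)
  have "(\<integral>\<^sup>+w. ennreal (indicator E w * f w) \<partial>N) = (\<integral>\<^sup>+w. indicator E w * ennreal (f w) \<partial>N)"
    by (intro nn_integral_cong) (auto split: split_indicator)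
  also have "\<dots> = (\<integral>\<^sup>+w. indicator E w * nn_cond_exp N (pre_sigma \<sigma>) (\<lambda>w. ennreal (f w)) w \<partial>N)"
    by (rule S.nn_cond_exp_intg[symmetric]) (use E in auto)
  also have "\<dots> \<le> (\<integral>\<^sup>+w. of_nat C \<partial>N)"
    using C by (intro nn_integral_mono) (auto split: split_indicator)
  also have "\<dots> < \<infinity>" by (simp add: emeasure_space_1 of_nat_less_top)
  finally show ?thesis using nn by (intro integrableI_nonneg) (auto intro!: AE_I2)
qed

section \<open>The conditional fourth moment inequality\<close>

text \<open>The integral inequality over all events of the past yields a pointwise one for each
  fixed \<open>a\<close>, and then \<open>a\<close> is optimised point by point. The last claim
  holds because the duration integrates to 0 over the event where its conditional expectation
  vanishes.\<close>

lemma cond_quartic_lower: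
  assumes st: "stopping_time F \<sigma>" "stopping_time F \<tau>"
    and ord: "\<And>w. w \<in> space N \<Longrightarrow> 0 \<le> \<sigma> w \<and> \<sigma> w \<le> \<tau> w"
  defines "X \<equiv> \<lambda>j w. ((W (\<tau> w) w - W (\<sigma> w) w) $ j) ^ 4"
    and "c \<equiv> \<lambda>f. nn_cond_exp N (pre_sigma \<sigma>) (\<lambda>w. ennreal (f w))"
  assumes fin: "\<And>j. AE w in N. c (X j) w < \<infinity>"
  shows "AE w in N. c (\<lambda>w. (\<tau> w - \<sigma> w)\<^sup>2) w < \<infinity> \<longrightarrow>
      3 * (real CARD('d) * enn2real (c (\<lambda>w. \<tau> w - \<sigma> w) w))\<^sup>2 \<le> (real CARD('d) + 2) * (\<Sum>j\<in>UNIV. enn2real (c (X j) w)) \<and>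
      (\<sigma> w < \<tau> w \<longrightarrow> 0 < enn2real (c (\<lambda>w. \<tau> w - \<sigma> w) w))"
proof -
  interpret S: finite_measure_subalgebra N "pre_sigma \<sigma>" by (rule sigma_finite_subalgebra_pre_sigma[OF st(1)])
  let ?d = "real CARD('d)"
  note [measurable] = measurable_stopping_time_N[OF st(1)] measurable_stopping_time_N[OF st(2)]
  have "(\<lambda>w. W (\<sigma> w) w) \<in> borel_measurable N" "(\<lambda>w. W (\<tau> w) w) \<in> borel_measurable N"
    by (intro measurable_W_random; use ord in force)+
  then have Xm[measurable]: "X j \<in> borel_measurable N" for j
    unfolding X_def by (intro borel_measurable_power measurable_vec_nth_compose borel_measurable_diff)
  have Xnn: "0 \<le> X j w" for j w by (simp add: X_def zero_le_even_power)
  have cm[measurable]: "c f \<in> borel_measurable (pre_sigma \<sigma>)" for f unfolding c_def by simp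
  \<comment> \<open>On these events of the past all conditional moments involved are at most
    \<open>C\<close>, so \<open>quartic_lower\<close> applies to each of their subevents in the
    past.\<close>
  define A where "A C = {w \<in> space (pre_sigma \<sigma>). c (\<lambda>w. (\<tau> w - \<sigma> w)\<^sup>2) w \<le> of_nat C \<and> (\<forall>j. c (X j) w \<le> of_nat C)}" for C
  have A[measurable]: "A C \<in> sets (pre_sigma \<sigma>)" for C unfolding A_def by measurable
  define v where "v w = enn2real (c (\<lambda>w. \<tau> w - \<sigma> w) w)" for w
  define u where "u j w = enn2real (c (X j) w)" for j w
  define h where "h a w = (?d + 2) * (\<Sum>j\<in>UNIV. u j w) - 3 * (2 * a * ?d * v w - a\<^sup>2)" for a w
  have [measurable]: "v \<in> borel_measurable (pre_sigma \<sigma>)" "u j \<in> borel_measurable (pre_sigma \<sigma>)" for j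
    unfolding v_def[abs_def] u_def[abs_def] by measurable
  have [measurable]: "h a \<in> borel_measurable (pre_sigma \<sigma>)" for a unfolding h_def[abs_def] by measurable
  have key: "0 \<le> (\<integral>w. indicator E w * h a w \<partial>N) \<and> integrable N (\<lambda>w. indicator E w * h a w)" if E: "E \<in> sets (pre_sigma \<sigma>)" "E \<subseteq> A C" and a: "0 \<le> a" for E C a
  proof -
    have EN[measurable]: "E \<in> sets N" using E subalgebra_pre_sigma[OF st(1)] by (auto simp: subalgebra_def)
    have i2: "integrable N (\<lambda>w. indicator E w * (\<tau> w - \<sigma> w)\<^sup>2)"
      by (rule integrable_indicator_nn_cond_exp[OF st(1) E(1), of _ C]) (use E(2) in \<open>auto simp: A_def c_def\<close>)
    have i4: "integrable N (\<lambda>w. indicator E w * X j w)" for j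
      by (rule integrable_indicator_nn_cond_exp[OF st(1) E(1), of _ C]) (use E(2) Xnn in \<open>auto simp: A_def c_def\<close>)
    have i1: "integrable N (\<lambda>w. indicator E w * (\<tau> w - \<sigma> w))"
      by (rule Bochner_Integration.integrable_bound[of _ "\<lambda>w. 1 + indicator E w * (\<tau> w - \<sigma> w)\<^sup>2"])
        (use i2 in \<open>auto intro!: AE_I2 simp: abs_le_one_plus_sq split: split_indicator\<close>)
    have V: "integrable N (\<lambda>w. indicator E w * v w)" "(\<integral>w. indicator E w * v w \<partial>N) = (\<integral>w. indicator E w * (\<tau> w - \<sigma> w) \<partial>N)"
      using nn_cond_exp_set_integral[OF st(1) E(1) _ _ i1] ord by (simp_all add: v_def c_def)
    have U: "integrable N (\<lambda>w. indicator E w * u j w)" "(\<integral>w. indicator E w * u j w \<partial>N) = (\<integral>w. indicator E w * X j w \<partial>N)" for j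
      using nn_cond_exp_set_integral[OF st(1) E(1) Xm Xnn i4] by (simp_all add: u_def c_def)
    have iE: "integrable N (\<lambda>w. indicator E w :: real)" by (rule integrable_real_indicator[OF EN]) (simp add: emeasure_eq_measure)
    define T where "T w = (\<Sum>j\<in>UNIV. indicator E w * u j w)" for w
    have hexp: "indicator E w * h a w = (?d + 2) * T w - 3 * (2 * a * ?d * (indicator E w * v w) - a\<^sup>2 * indicator E w)" for w
      by (simp add: T_def h_def sum_distrib_left[symmetric] algebra_simps split: split_indicator)
    have US: "integrable N T" "(\<integral>w. T w \<partial>N) = (\<Sum>j\<in>UNIV. \<integral>w. indicator E w * X j w \<partial>N)"
      unfolding T_def using U(1) by (intro Bochner_Integration.integrable_sum) (simp_all only: U Bochner_Integration.integral_sum)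
    have ih: "integrable N (\<lambda>w. indicator E w * h a w)"
      unfolding hexp by (intro Bochner_Integration.integrable_diff integrable_mult_right US V iE)
    have "(\<integral>w. indicator E w * h a w \<partial>N) = (?d + 2) * (\<Sum>j\<in>UNIV. \<integral>w. indicator E w * X j w \<partial>N) - 3 * (2 * a * ?d * (\<integral>w. indicator E w * (\<tau> w - \<sigma> w) \<partial>N) - a\<^sup>2 * (\<integral>w. indicator E w \<partial>N))"
      unfolding hexp using US V iE by simp
    also have "\<dots> \<ge> 0"
      using quartic_lower[OF st ord E(1) i2 _ a] i4 by (simp add: X_def)
    finally show ?thesis using ih by simp
  qed
  \<comment> \<open>The best \<open>a\<close> varies with the point, whereas an exceptional null set
    belongs to one \<open>a\<close>. Rational values keep the null sets countable in number;
    continuity in \<open>a\<close> supplies the others.\<close>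
  have "AE w in N. \<forall>C. \<forall>a\<in>\<rat> \<inter> {0..}. w \<in> A C \<longrightarrow> 0 \<le> h a w"
    unfolding AE_all_countable
  proof (intro allI AE_ball_countable[THEN iffD2] ballI countable_Int1 countable_rat)
    fix C and a :: real assume a: "a \<in> \<rat> \<inter> {0..}"
    define E where "E = A C \<inter> {w \<in> space (pre_sigma \<sigma>). h a w < 0}"
    have E: "E \<in> sets (pre_sigma \<sigma>)" "E \<subseteq> A C" unfolding E_def by auto
    have k: "0 \<le> (\<integral>w. indicator E w * h a w \<partial>N)" "integrable N (\<lambda>w. indicator E w * h a w)" using key[OF E] a by auto
    have nonpos: "indicator E w * h a w \<le> 0" for w by (auto simp: E_def split: split_indicator)
    have "(\<integral>w. - (indicator E w * h a w) \<partial>N) = 0"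
    proof (rule antisym)
      show "0 \<le> (\<integral>w. - (indicator E w * h a w) \<partial>N)" by (intro integral_nonneg_AE AE_I2) (use nonpos in \<open>simp only: neg_0_le_iff_le\<close>)
    qed (use k in simp)
    then have "AE w in N. - (indicator E w * h a w) = 0"
      by (subst (asm) integral_nonneg_eq_0_iff_AE) (use k nonpos in auto)
    with AE_space show "AE w in N. w \<in> A C \<longrightarrow> 0 \<le> h a w"
      by eventually_elim (auto simp: E_def space_pre_sigma split: split_indicator_asm)
  qed
  moreover have "AE w in N. \<forall>j\<in>UNIV. c (X j) w < \<infinity>" by (rule AE_finite_allI) (simp, rule fin)
  moreover have "AE w in N. c (\<lambda>w. \<tau> w - \<sigma> w) w = 0 \<longrightarrow> \<not> \<sigma> w < \<tau> w"
  proof -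
    define E where "E = {w \<in> space (pre_sigma \<sigma>). c (\<lambda>w. \<tau> w - \<sigma> w) w = 0}"
    have E: "E \<in> sets (pre_sigma \<sigma>)" unfolding E_def by measurable
    then have EN[measurable]: "E \<in> sets N" using subalgebra_pre_sigma[OF st(1)] by (auto simp: subalgebra_def)
    have "(\<integral>\<^sup>+w. indicator E w * ennreal (\<tau> w - \<sigma> w) \<partial>N) = (\<integral>\<^sup>+w. indicator E w * c (\<lambda>w. \<tau> w - \<sigma> w) w \<partial>N)"
      unfolding c_def by (rule S.nn_cond_exp_intg[symmetric]) (use E in auto)
    also have "\<dots> = (\<integral>\<^sup>+w. 0 \<partial>N)" by (intro nn_integral_cong) (auto simp: E_def split: split_indicator)
    finally have "AE w in N. indicator E w * ennreal (\<tau> w - \<sigma> w) = 0" by (subst nn_integral_0_iff_AE[symmetric]) auto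
    with AE_space show ?thesis by eventually_elim (auto simp: E_def space_pre_sigma ennreal_eq_0_iff split: split_indicator_asm)
  qed
  moreover have "AE w in N. c (\<lambda>w. (\<tau> w - \<sigma> w)\<^sup>2) w < \<infinity> \<longrightarrow> c (\<lambda>w. \<tau> w - \<sigma> w) w < \<infinity>"
  proof -
    have "AE w in N. c (\<lambda>w. \<tau> w - \<sigma> w) w \<le> nn_cond_exp N (pre_sigma \<sigma>) (\<lambda>w. 1 + ennreal ((\<tau> w - \<sigma> w)\<^sup>2)) w"
      unfolding c_def
    proof (rule S.nn_cond_exp_mono)
      have "ennreal r \<le> 1 + ennreal (r\<^sup>2)" for r
      proof -
        have "ennreal r \<le> ennreal (1 + r\<^sup>2)" using abs_le_one_plus_sq[of r] by (intro ennreal_leI) linarith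
        then show ?thesis by (simp add: ennreal_plus)
      qed
      then show "AE w in N. ennreal (\<tau> w - \<sigma> w) \<le> 1 + ennreal ((\<tau> w - \<sigma> w)\<^sup>2)" by auto
    qed auto
    moreover have "AE w in N. nn_cond_exp N (pre_sigma \<sigma>) (\<lambda>w. 1) w + c (\<lambda>w. (\<tau> w - \<sigma> w)\<^sup>2) w = nn_cond_exp N (pre_sigma \<sigma>) (\<lambda>w. 1 + ennreal ((\<tau> w - \<sigma> w)\<^sup>2)) w"
      unfolding c_def by (rule S.nn_cond_exp_sum) auto
    moreover have "AE w in N. 1 = nn_cond_exp N (pre_sigma \<sigma>) (\<lambda>w. 1) w" by (rule S.nn_cond_exp_F_meas) simp
    ultimately show ?thesis
    proof eventually_elim
      case (elim w)
      show ?case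
      proof
        assume "c (\<lambda>w. (\<tau> w - \<sigma> w)\<^sup>2) w < \<infinity>"
        then have "1 + c (\<lambda>w. (\<tau> w - \<sigma> w)\<^sup>2) w < \<infinity>" by simp
        moreover have "c (\<lambda>w. \<tau> w - \<sigma> w) w \<le> 1 + c (\<lambda>w. (\<tau> w - \<sigma> w)\<^sup>2) w"
          using elim(1) unfolding elim(2)[symmetric] elim(3)[symmetric] .
        ultimately show "c (\<lambda>w. \<tau> w - \<sigma> w) w < \<infinity>" by (rule le_less_trans[rotated])
      qed
    qed
  qed
  ultimately show ?thesis using AE_space
  proof eventually_elim
    case (elim w)
    show ?case
    proof (intro impI conjI)
      have nat_bd: "\<exists>C::nat. y \<le> of_nat C" if "y < \<infinity>" for y :: ennreal
        using ennreal_Ex_less_of_nat[of y] that by (auto intro: less_imp_le)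
      assume f2: "c (\<lambda>w. (\<tau> w - \<sigma> w)\<^sup>2) w < \<infinity>"
      then obtain C0 :: nat where C0: "c (\<lambda>w. (\<tau> w - \<sigma> w)\<^sup>2) w \<le> of_nat C0" using nat_bd by blast
      have "\<exists>C::nat. c (X j) w \<le> of_nat C" for j using elim by (intro nat_bd) blast
      then obtain Cj :: "'d \<Rightarrow> nat" where Cj: "\<And>j. c (X j) w \<le> of_nat (Cj j)" using choice[of "\<lambda>j C. c (X j) w \<le> of_nat C"] by blast
      define C where "C = C0 + (\<Sum>j\<in>UNIV. Cj j)"
      have CC: "Cj j \<le> C" for j unfolding C_def by (rule trans_le_add2, rule member_le_sum) auto
      have "c (X j) w \<le> of_nat C" for j by (rule order_trans[OF Cj of_nat_mono[OF CC]])
      moreover have "c (\<lambda>w. (\<tau> w - \<sigma> w)\<^sup>2) w \<le> of_nat C" unfolding C_def by (rule order_trans[OF C0 of_nat_mono]) simp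
      ultimately have AC: "w \<in> A C" using elim by (simp add: A_def space_pre_sigma)
      have v0: "0 \<le> v w" by (simp add: v_def)
      have hq: "0 \<le> h \<bar>a\<bar> w" if "a \<in> \<rat>" for a using elim(1) AC that by auto
      have "0 \<le> h \<bar>a\<bar> w" for a
      proof -
        have "continuous_on (closure \<rat>) (\<lambda>a. h \<bar>a\<bar> w)" unfolding h_def by (intro continuous_intros)
        then show ?thesis by (rule continuous_ge_on_closure) (use hq in \<open>auto simp: Rats_closure_real\<close>)
      qed
      \<comment> \<open>The value \<open>a = d v\<close> maximises
        \<open>2 a d v - a^2\<close>.\<close>
      from this[of "?d * v w"] v0 have "0 \<le> h (?d * v w) w" by simp
      then have "3 * (?d * v w)\<^sup>2 \<le> (?d + 2) * (\<Sum>j\<in>UNIV. u j w)" by (simp add: h_def power2_eq_square algebra_simps)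
      then show "3 * (?d * enn2real (c (\<lambda>w. \<tau> w - \<sigma> w) w))\<^sup>2 \<le> (?d + 2) * (\<Sum>j\<in>UNIV. enn2real (c (X j) w))" by (simp add: v_def u_def)
      show "0 < enn2real (c (\<lambda>w. \<tau> w - \<sigma> w) w)" if "\<sigma> w < \<tau> w"
      proof -
        have "c (\<lambda>w. \<tau> w - \<sigma> w) w \<noteq> 0" "c (\<lambda>w. \<tau> w - \<sigma> w) w < \<infinity>" using elim(3,4) f2 that by blast+
        then show ?thesis by (subst enn2real_positive_iff) (simp add: zero_less_iff_neq_zero)
      qed
    qed
  qed
qed

text \<open>The form in which the inequality meets partitions: order and increments are known almost
  surely only, so the times are corrected by maxima, and \<open>f j\<close> may be built from the
  original instead of the corrected paths.\<close>

lemma interval_lower: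
  assumes st: "stopping_time F \<sigma>" "stopping_time F \<tau>"
    and ord: "AE w in N. 0 \<le> \<sigma> w \<and> \<sigma> w \<le> \<tau> w"
    and f: "\<And>j. AE w in N. f j w = \<bar>(W (\<tau> w) w - W (\<sigma> w) w) $ j\<bar> ^ 4"
    and fin: "\<And>j. AE w in N. nn_cond_exp N (pre_sigma \<sigma>) (\<lambda>w. ennreal \<bar>f j w\<bar>) w < \<infinity>"
  shows "AE w in N. nn_cond_exp N (pre_sigma \<sigma>) (\<lambda>w. ennreal (\<bar>\<tau> w - \<sigma> w\<bar> ^ 2)) w < \<infinity> \<longrightarrow>
      3 * (real CARD('d) * real_cond_exp N (pre_sigma \<sigma>) (\<lambda>w. \<tau> w - \<sigma> w) w)\<^sup>2 \<le>
        (real CARD('d) + 2) * (\<Sum>j\<in>UNIV. real_cond_exp N (pre_sigma \<sigma>) (f j) w) \<and>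
      (\<sigma> w < \<tau> w \<longrightarrow> 0 < real_cond_exp N (pre_sigma \<sigma>) (\<lambda>w. \<tau> w - \<sigma> w) w)"
proof -
  define \<sigma>' where "\<sigma>' w = max 0 (\<sigma> w)" for w
  define \<tau>' where "\<tau>' w = max (\<sigma>' w) (\<tau> w)" for w
  have st': "stopping_time F \<sigma>'" "stopping_time F \<tau>'"
    unfolding \<tau>'_def[abs_def] \<sigma>'_def[abs_def] by (intro stopping_time_max st stopping_time_const)+
  have ord': "0 \<le> \<sigma>' w \<and> \<sigma>' w \<le> \<tau>' w" for w by (auto simp: \<sigma>'_def \<tau>'_def)
  have eq: "AE w in N. \<sigma> w = \<sigma>' w \<and> \<tau> w = \<tau>' w" using ord by eventually_elim (auto simp: \<sigma>'_def \<tau>'_def)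
  have ps: "pre_sigma \<sigma> = pre_sigma \<sigma>'" by (rule pre_sigma_AE_cong) (use eq in auto)
  interpret S: finite_measure_subalgebra N "pre_sigma \<sigma>'" by (rule sigma_finite_subalgebra_pre_sigma[OF st'(1)])
  note [measurable] = measurable_stopping_time_N[OF st(1)] measurable_stopping_time_N[OF st(2)]
    measurable_stopping_time_N[OF st'(1)] measurable_stopping_time_N[OF st'(2)]
  define X where "X j w = ((W (\<tau>' w) w - W (\<sigma>' w) w) $ j) ^ 4" for j w
  have "(\<lambda>w. W (\<sigma>' w) w) \<in> borel_measurable N" "(\<lambda>w. W (\<tau>' w) w) \<in> borel_measurable N"
    by (intro measurable_W_random; auto simp: \<sigma>'_def \<tau>'_def)+
  then have Xm[measurable]: "X j \<in> borel_measurable N" for j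
    unfolding X_def[abs_def] by (intro borel_measurable_power measurable_vec_nth_compose borel_measurable_diff)
  have fX: "AE w in N. f j w = X j w" for j
    using f[of j] eq by eventually_elim (simp add: X_def power_even_abs)
  have [measurable]: "f j \<in> borel_measurable N" for j
    by (rule measurable_AE_cong[OF Xm]) (use fX[of j] in \<open>auto elim!: AE_mp\<close>)
  have Xnn: "0 \<le> X j w" for j w by (simp add: X_def zero_le_even_power)
  let ?c = "\<lambda>f. nn_cond_exp N (pre_sigma \<sigma>') (\<lambda>w. ennreal (f w))"
  have cX: "AE w in N. ?c (\<lambda>w. \<bar>f j w\<bar>) w = ?c (X j) w" for j
    by (rule S.nn_cond_exp_cong) (use fX[of j] Xnn[of j] in \<open>auto elim!: AE_mp\<close>)
  have rX: "AE w in N. real_cond_exp N (pre_sigma \<sigma>') (f j) w = enn2real (?c (X j) w)" for j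
    using real_cond_exp_nonneg[OF st'(1) Xm[of j]] S.real_cond_exp_cong[OF fX[of j]] Xnn by (auto elim!: AE_mp)
  have r\<Delta>: "AE w in N. real_cond_exp N (pre_sigma \<sigma>') (\<lambda>w. \<tau> w - \<sigma> w) w = enn2real (?c (\<lambda>w. \<tau>' w - \<sigma>' w) w)"
  proof -
    have "AE w in N. real_cond_exp N (pre_sigma \<sigma>') (\<lambda>w. \<tau> w - \<sigma> w) w = real_cond_exp N (pre_sigma \<sigma>') (\<lambda>w. \<tau>' w - \<sigma>' w) w"
      by (rule S.real_cond_exp_cong) (use eq in \<open>auto elim!: AE_mp\<close>)
    moreover have "AE w in N. real_cond_exp N (pre_sigma \<sigma>') (\<lambda>w. \<tau>' w - \<sigma>' w) w = enn2real (?c (\<lambda>w. \<tau>' w - \<sigma>' w) w)"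
      by (rule real_cond_exp_nonneg[OF st'(1)]) (use ord' in auto)
    ultimately show ?thesis by eventually_elim simp
  qed
  have c2: "AE w in N. ?c (\<lambda>w. \<bar>\<tau> w - \<sigma> w\<bar> ^ 2) w = ?c (\<lambda>w. (\<tau>' w - \<sigma>' w)\<^sup>2) w"
    by (rule S.nn_cond_exp_cong) (use eq in \<open>auto elim!: AE_mp\<close>)
  have fin': "AE w in N. ?c (X j) w < \<infinity>" for j
    using fin[of j] cX[of j] unfolding ps by eventually_elim simp
  have all: "AE w in N. \<forall>j\<in>UNIV. real_cond_exp N (pre_sigma \<sigma>') (f j) w = enn2real (?c (X j) w)"
    by (rule AE_finite_allI) (simp, rule rX)
  show ?thesis
    unfolding ps using cond_quartic_lower[OF st' ord' fin'[unfolded X_def]] all r\<Delta> c2 eq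
    by eventually_elim (simp add: X_def)
qed

end

section \<open>Passing to continuous paths and the completed space\<close>

text \<open>Induction over the generated algebra: a null set is matched with the empty set. This
  carries the independence of increments from the natural to the augmented filtration.\<close>

lemma augmented_ex_natural:
  assumes W: "\<And>u. 0 \<le> u \<Longrightarrow> W u \<in> borel_measurable M" and A: "A \<in> sets (augmented_filtration M W s)"
  shows "\<exists>A'\<in>sets (natural_filtration M W s). AE w in M. w \<in> A \<longleftrightarrow> w \<in> A'"
proof -
  have past: "past_events M W s \<subseteq> Pow (space M)" by (auto simp: past_events_def)
  have nat: "sets (natural_filtration M W s) = sigma_sets (space M) (past_events M W s)"
    unfolding natural_filtration_def by (rule sets_measure_of[OF past])
  have "A \<in> sigma_sets (space M) (past_events M W s \<union> null_sets (completion M))"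
    using A unfolding augmented_filtration_def sets_measure_of[OF augmented_generator_subset] .
  then show ?thesis
  proof (induction A rule: sigma_sets.induct)
    case (Basic a)
    then show ?case
    proof
      assume "a \<in> past_events M W s" then show ?thesis unfolding nat by (intro bexI[of _ a]) auto
    next
      assume "a \<in> null_sets (completion M)"
      then have "AE w in M. w \<notin> a" by (simp add: completion.null_sets_iff_AE AE_completion_iff)
      then show ?thesis unfolding nat by (intro bexI[of _ "{}"]) (auto intro: sigma_sets.Empty)
    qed
  next
    case Empty then show ?case unfolding nat by (intro bexI[of _ "{}"]) (auto intro: sigma_sets.Empty)
  next
    case (Compl a)
    then obtain A' where A': "A' \<in> sets (natural_filtration M W s)" "AE w in M. w \<in> a \<longleftrightarrow> w \<in> A'" by auto
    have "space M - A' \<in> sets (natural_filtration M W s)" using A'(1) unfolding nat by (rule sigma_sets.Compl)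
    moreover have "AE w in M. w \<in> space M - a \<longleftrightarrow> w \<in> space M - A'" using A'(2) by eventually_elim auto
    ultimately show ?case by blast
  next
    case (Union a)
    then obtain A' where A': "\<And>i::nat. A' i \<in> sets (natural_filtration M W s)" "\<And>i. AE w in M. w \<in> a i \<longleftrightarrow> w \<in> A' i" by metis
    have "AE w in M. \<forall>i. w \<in> a i \<longleftrightarrow> w \<in> A' i" using A'(2) by (simp add: AE_all_countable)
    then have "AE w in M. w \<in> (\<Union>i. a i) \<longleftrightarrow> w \<in> (\<Union>i. A' i)" by eventually_elim auto
    moreover have "(\<Union>i. A' i) \<in> sets (natural_filtration M W s)" using A'(1) by auto
    ultimately show ?case by blast
  qed
qed

text \<open>Off \<open>good\<close> the path becomes a straight line, which is continuous, starts at
  0 and is unbounded. Adaptedness survives because the change happens on a null set, and the law of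
  the increment is computed for the original \<open>W\<close> and a natural event that agree with
  the new ones almost surely.\<close>

lemma bm_completion:
  fixes W :: "real \<Rightarrow> 'a \<Rightarrow> real ^ 'd"
  assumes bm: "standard_brownian_motion M W"
    and good: "AE w in M. good w" "\<And>w. good w \<Longrightarrow> W 0 w = 0 \<and> continuous_on {0..} (\<lambda>s. W s w)"
  shows "bm (completion M) (augmented_filtration M W) (\<lambda>s w. if good w then W s w else s *\<^sub>R axis undefined 1)"
proof -
  let ?F = "augmented_filtration M W"
  let ?W = "\<lambda>s w. if good w then W s w else s *\<^sub>R axis undefined 1 :: real ^ 'd"
  have W: "\<And>u. 0 \<le> u \<Longrightarrow> W u \<in> borel_measurable M" and pM: "prob_space M"
    using bm by (auto simp: standard_brownian_motion_def)
  interpret M: prob_space M by (rule pM)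
  have spF: "space (?F s) = space M" for s
    unfolding augmented_filtration_def by (rule space_measure_of[OF augmented_generator_subset])
  have setsF: "sets (?F s) = sigma_sets (space M) (past_events M W s \<union> null_sets (completion M))" for s
    unfolding augmented_filtration_def by (rule sets_measure_of[OF augmented_generator_subset])
  have sub: "sets (?F s) \<subseteq> sets (completion M)" for s
    using subalgebra_augmented[of W M s] W by (simp add: subalgebra_def)
  have nullF: "null_sets (completion M) \<subseteq> sets (?F s)" for s unfolding setsF by auto
  define Bad where "Bad = {w \<in> space M. \<not> good w}"
  have Bad: "Bad \<in> null_sets (completion M)"
  proof -
    have "AE w in completion M. good w" using good(1) by (simp add: AE_completion_iff)
    then show ?thesis unfolding Bad_def completion.AE_iff_null_sets space_completion .
  qed
  have subBad: "C \<in> null_sets (completion M)" if "C \<subseteq> Bad" for C using completion.complete2[OF that Bad] .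
  interpret C: prob_space "completion M" by (rule prob_spaceI) (simp add: M.emeasure_space_1)
  show ?thesis
  proof
    show "space (?F i) = space (completion M)" for i by (simp add: spF)
    show "sets (?F i) \<subseteq> sets (?F j)" if "i \<le> j" for i j using filtration.sets_F_mono[OF filtration_augmented that] .
    show "sets (?F s) \<subseteq> sets (completion M)" for s by (rule sub)
    show "null_sets (completion M) \<subseteq> sets (?F s)" for s by (rule nullF)
    show "?W s \<in> borel_measurable (?F s)" if s: "0 \<le> s" for s
    proof (rule measurableI)
      fix B :: "(real ^ 'd) set" assume B: "B \<in> sets borel"
      have "W s -` B \<inter> space M \<in> past_events M W s" using s B unfolding past_events_def by blast
      then have 1: "W s -` B \<inter> space M \<in> sets (?F s)" unfolding setsF by auto
      have "Bad \<in> sets (?F s)" using Bad nullF by blast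
      moreover have "?W s -` B \<inter> Bad \<in> sets (?F s)" by (rule subsetD[OF nullF subBad]) auto
      ultimately have 2: "Bad \<in> sets (?F s)" "?W s -` B \<inter> Bad \<in> sets (?F s)" by auto
      have "?W s -` B \<inter> space (?F s) = ((W s -` B \<inter> space M) - Bad) \<union> (?W s -` B \<inter> Bad)"
        by (auto simp: spF Bad_def)
      then show "?W s -` B \<inter> space (?F s) \<in> sets (?F s)" using 1 2 by auto
    qed simp
    show "continuous_on {0..} (\<lambda>s. ?W s w)" for w
      using good(2)[of w] by (cases "good w") (auto intro!: continuous_intros)
    show "?W 0 w = 0" for w using good(2)[of w] by auto
    fix s u :: real and A and B :: "'d \<Rightarrow> real set"
    assume s: "0 \<le> s" "s < u" and A: "A \<in> sets (?F s)" and B: "\<And>j. B j \<in> sets borel"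
    let ?D = "{w \<in> space M. \<forall>j. (W u w - W s w) $ j \<in> B j}"
    let ?D' = "{w \<in> space (completion M). \<forall>j. ?W u w $ j - ?W s w $ j \<in> B j}"
    have ind: "M.indep_set (sets (natural_filtration M W s)) (sets (vimage_algebra (space M) (\<lambda>w. W u w - W s w) borel))"
      "M.indep_vars (\<lambda>_. borel) (\<lambda>j w. (W u w - W s w) $ j) UNIV"
      "\<And>j. distributed M lborel (\<lambda>w. (W u w - W s w) $ j) (\<lambda>x. ennreal (normal_density 0 (sqrt (u - s)) x))"
      using bm s by (auto simp: standard_brownian_motion_def)
    obtain A' where A': "A' \<in> sets (natural_filtration M W s)" "AE w in M. w \<in> A \<longleftrightarrow> w \<in> A'"
      using augmented_ex_natural[OF W A] by blast
    have "(\<lambda>x::real ^ 'd. x $ j) \<in> borel_measurable borel" for j by simp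
    then have [measurable]: "{x :: real ^ 'd. \<forall>j. x $ j \<in> B j} \<in> sets borel"
      using B by (simp add: pred_def[symmetric] pred_intros_finite measurable_compose[of _ borel borel] del: pred_def) 
    have Dv: "?D \<in> sets (vimage_algebra (space M) (\<lambda>w. W u w - W s w) borel)"
    proof -
      have "(\<lambda>w. W u w - W s w) -` {x. \<forall>j. x $ j \<in> B j} \<inter> space M \<in> sets (vimage_algebra (space M) (\<lambda>w. W u w - W s w) borel)"
        by (rule in_vimage_algebra) simp
      also have "(\<lambda>w. W u w - W s w) -` {x. \<forall>j. x $ j \<in> B j} \<inter> space M = ?D" by auto
      finally show ?thesis .
    qed
    have ev: "A' \<in> sets M" "?D \<in> sets M"
      using ind(1) A'(1) Dv unfolding M.indep_set_def M.indep_sets_def by (auto split: bool.splits)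
    have AN: "A \<in> sets (completion M)" using A sub by auto
    have "AE w in M. w \<in> A \<inter> ?D' \<longleftrightarrow> w \<in> A' \<inter> ?D" using A'(2) good(1) by eventually_elim auto
    then have AE': "AE w in completion M. w \<in> A' \<inter> ?D \<longleftrightarrow> w \<in> A \<inter> ?D'" by (auto simp: AE_completion_iff elim!: AE_mp)
    have evc: "A' \<inter> ?D \<in> sets (completion M)" using ev by auto
    have mD: "A \<inter> ?D' \<in> sets (completion M)"
      by (rule completion.in_sets_AE[OF AE' evc]) auto
    have "measure (completion M) (A \<inter> ?D') = measure (completion M) (A' \<inter> ?D)"
      by (rule measure_eq_AE) (use AE' evc mD in \<open>auto elim!: AE_mp\<close>)
    also have "\<dots> = measure M (A' \<inter> ?D)" using ev by simp
    also have "\<dots> = measure M A' * measure M ?D" by (rule M.indep_setD[OF ind(1) A'(1) Dv])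
    also have "measure M A' = measure (completion M) A'" using ev by simp
    also have "\<dots> = measure (completion M) A"
    proof (rule measure_eq_AE)
      show "AE w in completion M. w \<in> A' \<longleftrightarrow> w \<in> A" using A'(2) by (auto simp: AE_completion_iff elim!: AE_mp)
    qed (use ev AN in auto)
    also have "measure M ?D = measure M (\<Inter>j\<in>UNIV. (\<lambda>w. (W u w - W s w) $ j) -` B j \<inter> space M)"
      by (rule arg_cong[where f="measure M"]) auto
    also have "\<dots> = (\<Prod>j\<in>UNIV. measure M ((\<lambda>w. (W u w - W s w) $ j) -` B j \<inter> space M))"
      by (rule M.indep_varsD[OF ind(2)]) (use B in auto)
    also have "\<dots> = (\<Prod>j\<in>UNIV. measure (gauss (u - s)) (B j))"
    proof (rule prod.cong)
      fix j
      have m: "(\<lambda>w. (W u w - W s w) $ j) \<in> M \<rightarrow>\<^sub>M lborel" using ind(3)[of j] by (rule distributed_measurable)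
      have "measure (gauss (u - s)) (B j) = measure (distr M lborel (\<lambda>w. (W u w - W s w) $ j)) (B j)"
        by (simp only: distributed_distr_eq_density[OF ind(3)[of j]])
      also have "\<dots> = measure M ((\<lambda>w. (W u w - W s w) $ j) -` B j \<inter> space M)"
        by (rule measure_distr[OF m]) (use B in auto)
      finally show "measure M ((\<lambda>w. (W u w - W s w) $ j) -` B j \<inter> space M) = measure (gauss (u - s)) (B j)" by simp
    qed simp
    finally show "measure (completion M) (A \<inter> ?D') = measure (completion M) A * (\<Prod>j\<in>UNIV. measure (gauss (u - s)) (B j))" .
  qed
qed

section \<open>The lower bound\<close>

text \<open>A point violating the conclusion lies, for every \<open>n \<ge> 1\<close>, in one of
  three sets whose outer measures tend to 0. As \<open>n\<close> may depend on the point, no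
  subsequence has to be extracted.\<close>

lemma tends_to_0_AE_exists:
  assumes X: "tends_to_0_in_prob M X" and Y: "tends_to_0_in_prob M Y" and Z: "tends_to_0_in_prob M Z" and e: "0 < \<epsilon>"
  shows "AE w in M. \<exists>n\<ge>1. X n w \<le> ennreal \<epsilon> \<and> Y n w \<le> ennreal \<epsilon> \<and> Z n w \<le> ennreal \<epsilon>"
proof -
  define Bad where "Bad = {w \<in> space M. \<not> (\<exists>n\<ge>1. X n w \<le> ennreal \<epsilon> \<and> Y n w \<le> ennreal \<epsilon> \<and> Z n w \<le> ennreal \<epsilon>)}"
  let ?O = "\<lambda>X n. outer_measure_of M {w \<in> space M. ennreal \<epsilon> < X n w}"
  have le: "outer_measure_of M Bad \<le> ?O X n + ?O Y n + ?O Z n" if "n \<ge> 1" for n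
  proof -
    have ex: "\<exists>E. E \<in> sets M \<and> {w \<in> space M. ennreal \<epsilon> < X n w} \<subseteq> E \<and> ?O X n = emeasure M E" for X
      using outer_measure_of_attain[of "{w \<in> space M. ennreal \<epsilon> < X n w}" M] by blast
    obtain A where A: "A \<in> sets M" "{w \<in> space M. ennreal \<epsilon> < X n w} \<subseteq> A" "?O X n = emeasure M A" using ex[of X] by blast
    obtain B where B: "B \<in> sets M" "{w \<in> space M. ennreal \<epsilon> < Y n w} \<subseteq> B" "?O Y n = emeasure M B" using ex[of Y] by blast
    obtain C where C: "C \<in> sets M" "{w \<in> space M. ennreal \<epsilon> < Z n w} \<subseteq> C" "?O Z n = emeasure M C" using ex[of Z] by blast
    have "Bad \<subseteq> A \<union> B \<union> C"
    proof
      fix x assume "x \<in> Bad"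
      then have "x \<in> space M" "ennreal \<epsilon> < X n x \<or> ennreal \<epsilon> < Y n x \<or> ennreal \<epsilon> < Z n x"
        using that unfolding Bad_def mem_Collect_eq not_le[symmetric] by blast+
      then show "x \<in> A \<union> B \<union> C" using A(2) B(2) C(2) by blast
    qed
    then have "outer_measure_of M Bad \<le> outer_measure_of M (A \<union> B \<union> C)" by (rule outer_measure_of_mono)
    also have "\<dots> = emeasure M (A \<union> B \<union> C)" using A(1) B(1) C(1) by (intro outer_measure_of_eq) auto
    also have "\<dots> \<le> emeasure M (A \<union> B) + emeasure M C" using A(1) B(1) C(1) by (intro emeasure_subadditive) auto
    also have "\<dots> \<le> emeasure M A + emeasure M B + emeasure M C"
      using A(1) B(1) by (intro add_right_mono emeasure_subadditive) auto
    finally show ?thesis by (simp only: A(3) B(3) C(3))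
  qed
  have "(\<lambda>n. ?O X n + ?O Y n + ?O Z n) \<longlonglongrightarrow> 0 + 0 + 0"
    using X Y Z e unfolding tends_to_0_in_prob_def by (intro tendsto_add) auto
  then have "outer_measure_of M Bad \<le> 0"
    by (intro LIMSEQ_le_const[of "\<lambda>n. ?O X n + ?O Y n + ?O Z n"]) (use le in auto)
  moreover obtain E where "E \<in> sets M" "Bad \<subseteq> E" "outer_measure_of M Bad = emeasure M E"
    using outer_measure_of_attain[of Bad M] by (auto simp: Bad_def)
  ultimately have "E \<in> null_sets M" "Bad \<subseteq> E" by auto
  then show ?thesis by (intro AE_I'[of E]) (auto simp: Bad_def)
qed

text \<open>The end time \<open>t\<close> is left out, a null slice: an interval containing
  \<open>t\<close> may begin exactly at the stopping time and is then not among the summands in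
  (A).\<close>

lemma AE_pair_lborel:
  fixes t :: real
  assumes "prob_space M" and AE: "AE w in M. \<forall>u\<in>{0..<t}. P u w"
  shows "AE (u, w) in restrict_space lborel {0..t} \<Otimes>\<^sub>M M. P u w"
proof -
  interpret M: prob_space M by fact
  let ?L = "restrict_space lborel {0..t}"
  obtain N0 where N0: "N0 \<in> null_sets M" "{w \<in> space M. \<not> (\<forall>u\<in>{0..<t}. P u w)} \<subseteq> N0"
    using AE by (auto elim!: AE_E)
  have L: "{0..t} \<in> sets ?L" using sets.top[of ?L] by (simp add: space_restrict_space)
  have "{0..t} \<times> N0 \<in> null_sets (?L \<Otimes>\<^sub>M M)"
  proof (rule null_setsI)
    show "emeasure (?L \<Otimes>\<^sub>M M) ({0..t} \<times> N0) = 0"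
      using N0(1) L by (subst M.emeasure_pair_measure_Times) auto
  qed (use N0(1) L in \<open>auto intro!: pair_measureI\<close>)
  moreover have "({t} \<inter> {0..t}) \<times> space M \<in> null_sets (?L \<Otimes>\<^sub>M M)"
  proof (rule null_setsI)
    have "{t} \<inter> {0..t} \<in> sets ?L" by (subst sets_restrict_space_iff) auto
    then show "({t} \<inter> {0..t}) \<times> space M \<in> sets (?L \<Otimes>\<^sub>M M)" by (intro pair_measureI) auto
    have "emeasure ?L ({t} \<inter> {0..t}) = emeasure lborel ({t} \<inter> {0..t})" by (rule emeasure_restrict_space) auto
    also have "\<dots> \<le> emeasure lborel {t}" by (rule emeasure_mono) auto
    finally have "emeasure ?L ({t} \<inter> {0..t}) = 0" by simp
    then show "emeasure (?L \<Otimes>\<^sub>M M) (({t} \<inter> {0..t}) \<times> space M) = 0"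
      using \<open>{t} \<inter> {0..t} \<in> sets ?L\<close> by (subst M.emeasure_pair_measure_Times) auto
  qed
  ultimately have "{0..t} \<times> N0 \<union> ({t} \<inter> {0..t}) \<times> space M \<in> null_sets (?L \<Otimes>\<^sub>M M)" by (rule null_sets.Un)
  then show ?thesis
  proof (rule AE_I')
    show "{x \<in> space (?L \<Otimes>\<^sub>M M). \<not> (case x of (u, w) \<Rightarrow> P u w)} \<subseteq> {0..t} \<times> N0 \<union> ({t} \<inter> {0..t}) \<times> space M"
      using N0(2) by (force simp: space_pair_measure space_restrict_space)
  qed
qed

text \<open>Uniqueness holds although a partition may repeat a time, since an empty interval
  contains no \<open>s\<close>.\<close>

lemma current_index_ex:
  assumes p0: "p 0 w = 0" and mono: "incseq (\<lambda>m. p m w)" and lim: "filterlim (\<lambda>m. p m w) at_top sequentially" and s: "0 \<le> s"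
  shows "p (current_index p s w) w \<le> s \<and> s < p (Suc (current_index p s w)) w"
  unfolding current_index_def
proof (rule theI')
  have "\<forall>\<^sub>F m in sequentially. s < p m w" using lim by (auto simp: filterlim_at_top_dense)
  then obtain m0 where m0: "s < p m0 w" by (auto simp: eventually_sequentially)
  define m where "m = (LEAST m. s < p m w)"
  have 1: "s < p m w" unfolding m_def by (rule LeastI[of "\<lambda>m. s < p m w", OF m0])
  then have "m \<noteq> 0" using p0 s by (metis not_less)
  then obtain k where k: "m = Suc k" using not0_implies_Suc by blast
  have 2: "p k w \<le> s" using not_less_Least[of k "\<lambda>m. s < p m w"] k unfolding m_def[symmetric] by auto
  show "\<exists>!m. p m w \<le> s \<and> s < p (Suc m) w"
  proof (rule ex1I[of _ k])
    show "p k w \<le> s \<and> s < p (Suc k) w" using 1 2 k by simp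
    fix l assume l: "p l w \<le> s \<and> s < p (Suc l) w"
    have "\<not> Suc l \<le> k" using incseqD[OF mono, of "Suc l" k] l 2 by auto
    moreover have "\<not> Suc k \<le> l" using incseqD[OF mono, of "Suc k" l] l 1 k by auto
    ultimately show "l = k" by auto
  qed
qed

lemma less_first_index:
  assumes mono: "incseq (\<lambda>m. p m w)" and lim: "filterlim (\<lambda>m. p m w) at_top sequentially"
  shows "m < first_index p \<tau> w \<longleftrightarrow> p m w < \<tau> w"
proof -
  have "\<forall>\<^sub>F m in sequentially. \<tau> w \<le> p m w" using lim by (auto simp: filterlim_at_top)
  then obtain m0 where m0: "\<tau> w \<le> p m0 w" by (auto simp: eventually_sequentially)
  have 1: "\<tau> w \<le> p (first_index p \<tau> w) w" unfolding first_index_def by (rule LeastI[of "\<lambda>m. \<tau> w \<le> p m w", OF m0])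
  have 2: "p m w < \<tau> w" if "m < first_index p \<tau> w" for m
    using not_less_Least[of m "\<lambda>m. \<tau> w \<le> p m w"] that unfolding first_index_def by auto
  show ?thesis using 1 2[of m] incseqD[OF mono, of "first_index p \<tau> w" m] by (cases "m < first_index p \<tau> w") auto
qed

text \<open>The product form passes to the limit without division; \<open>c > 0\<close> then
  excludes \<open>G = 0\<close>, which is how positivity of the limit arises.\<close>

lemma limit_lower_bound:
  fixes g h :: "nat \<Rightarrow> real"
  assumes c: "0 < c" and g: "\<And>j. 0 < g j" and gh: "\<And>j. c \<le> h j * g j"
    and "\<And>j. \<bar>g j - G\<bar> \<le> 1 / real (Suc j)" "\<And>j. \<bar>h j - H\<bar> \<le> 1 / real (Suc j)"
  shows "0 < G \<and> c / G \<le> H"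
proof -
  have z: "(\<lambda>j. 1 / real (Suc j)) \<longlonglongrightarrow> 0" using LIMSEQ_inverse_real_of_nat by (simp add: inverse_eq_divide)
  have "(\<lambda>j. g j - G) \<longlonglongrightarrow> 0" "(\<lambda>j. h j - H) \<longlonglongrightarrow> 0"
    by (rule Lim_null_comparison[OF _ z], use assms in auto)+
  then have lim: "g \<longlonglongrightarrow> G" "h \<longlonglongrightarrow> H" by (simp_all add: LIM_zero_iff)
  have "c \<le> H * G" by (rule LIMSEQ_le_const[OF tendsto_mult[OF lim(2,1)]]) (use gh in auto)
  moreover have "0 \<le> G" by (rule LIMSEQ_le_const[OF lim(1)]) (use g in \<open>auto intro: less_imp_le\<close>)
  ultimately show ?thesis using c by (cases "G = 0") (auto simp: field_simps)
qed

text \<open>For a fixed point, time and accuracy \<open>1 / (j + 1)\<close>, one suitable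
  \<open>n\<close> is enough: the interval of that partition containing \<open>u\<close> gives
  values of \<open>G\<close> and \<open>H\<close> obeying the bound and close to the limits. Letting
  \<open>j\<close> grow finishes.\<close>

lemma lower_bound:
  fixes M :: "'a measure" and W :: "real \<Rightarrow> 'a \<Rightarrow> real ^ 'd"
  assumes bm: "standard_brownian_motion M W" and t: "t > 0"
    and ex: "exhausting_times M W t \<eta>"
    and part: "\<And>n. n \<ge> 1 \<Longrightarrow> random_partition M W (p n)"
    and B: "condition_B M W p Hn"
    and AC: "\<And>k. condition_A M W p G (\<eta> k)" "\<And>k. condition_C M W p Hn H (\<eta> k)"
  shows "AE (u, w) in restrict_space lborel {0..t} \<Otimes>\<^sub>M M.
             G u w > 0 \<and> H u w \<ge> 3 * real CARD('d) / ((real CARD('d) + 2) * G u w)"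
proof -
  let ?d = "real CARD('d)"
  let ?F = "augmented_filtration M W"
  define good where "good w \<longleftrightarrow> W 0 w = 0 \<and> continuous_on {0..} (\<lambda>s. W s w)" for w
  have good: "AE w in M. good w" using bm by (auto simp: standard_brownian_motion_def good_def)
  have pM: "prob_space M" using bm by (simp add: standard_brownian_motion_def)
  interpret M: prob_space M by (rule pM)
  interpret bm "completion M" ?F "\<lambda>s w. if good w then W s w else s *\<^sub>R axis undefined 1"
    by (rule bm_completion[OF bm good]) (simp add: good_def)
  have d: "0 < ?d" by simp
  define c where "c = 3 * ?d / (?d + 2)"
  have c: "0 < c" using d by (simp add: c_def)
  have step: "AE w in completion M.
      nn_cond_exp (completion M) (stopped_algebra M W (p n m)) (\<lambda>w. ennreal (\<bar>p n (Suc m) w - p n m w\<bar> ^ 2)) w < \<infinity> \<longrightarrow>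
      p n m w < p n (Suc m) w \<longrightarrow>
      0 < G_approx M W n (p n) m w \<and> c \<le> Hn n (p n m w) w * G_approx M W n (p n) m w" if n: "n \<ge> 1" for n m
  proof -
    have st: "stopping_time ?F (p n m)" "stopping_time ?F (p n (Suc m))"
      and ae: "AE w in M. p n 0 w = 0 \<and> incseq (\<lambda>m. p n m w)"
      using part[OF n] by (auto simp: random_partition_def)
    have ord: "AE w in completion M. 0 \<le> p n m w \<and> p n m w \<le> p n (Suc m) w"
      using ae unfolding AE_completion_iff
    proof eventually_elim
      case (elim w)
      then show ?case using incseqD[of "\<lambda>m. p n m w" 0 m] incseqD[of "\<lambda>m. p n m w" m "Suc m"] by auto
    qed
    define f where "f j w = \<bar>W (p n (Suc m) w) w $ j - W (p n m w) w $ j\<bar> ^ 4" for j w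
    have fB: "has_cond_exp M (stopped_algebra M W (p n m)) (f j) (\<lambda>w. 1 / (real n)\<^sup>2 * (Hn n (p n m w) w / G_approx M W n (p n) m w))" for j
      using B n unfolding condition_B_def f_def by blast
    have fe: "AE w in completion M. f j w = \<bar>((if good w then W (p n (Suc m) w) w else p n (Suc m) w *\<^sub>R axis undefined 1) -
        (if good w then W (p n m w) w else p n m w *\<^sub>R axis undefined 1)) $ j\<bar> ^ 4" for j
      using good unfolding AE_completion_iff by eventually_elim (simp add: f_def)
    have fin: "AE w in completion M. nn_cond_exp (completion M) (pre_sigma (p n m)) (\<lambda>w. ennreal \<bar>f j w\<bar>) w < \<infinity>" for j
      using fB[of j] unfolding has_cond_exp_def space_completion by eventually_elim simp
    have val: "AE w in completion M. \<forall>j\<in>UNIV. real_cond_exp (completion M) (pre_sigma (p n m)) (f j) w = 1 / (real n)\<^sup>2 * (Hn n (p n m w) w / G_approx M W n (p n) m w)"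
    proof (rule AE_finite_allI)
      show "AE w in completion M. real_cond_exp (completion M) (pre_sigma (p n m)) (f j) w = 1 / (real n)\<^sup>2 * (Hn n (p n m w) w / G_approx M W n (p n) m w)" for j
        using fB[of j] unfolding has_cond_exp_def space_completion by eventually_elim simp
    qed simp
    show ?thesis
      using interval_lower[OF st ord fe fin] val unfolding space_completion
    proof eventually_elim
      case (elim w)
      show ?case
      proof (intro impI)
        assume f: "nn_cond_exp (completion M) (stopped_algebra M W (p n m)) (\<lambda>w. ennreal (\<bar>p n (Suc m) w - p n m w\<bar> ^ 2)) w < \<infinity>"
          and lt: "p n m w < p n (Suc m) w"
        define e where "e = real_cond_exp (completion M) (stopped_algebra M W (p n m)) (\<lambda>w. p n (Suc m) w - p n m w) w"
        define g where "g = G_approx M W n (p n) m w"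
        define h where "h = Hn n (p n m w) w"
        have e: "0 < e" and le: "3 * (?d * e)\<^sup>2 \<le> (?d + 2) * (\<Sum>j\<in>(UNIV::'d set). 1 / (real n)\<^sup>2 * (h / g))"
          using elim f lt unfolding e_def g_def h_def by simp_all
        have g_eq: "g = 1 / (real n * e)" by (simp add: g_def G_approx_def e_def)
        have n0: "0 < real n" using n by simp
        have g: "0 < g" using e n0 by (simp add: g_eq)
        have e_eq: "e = 1 / (real n * g)" using e n0 by (simp add: g_eq)
        \<comment> \<open>Multiplication by \<open>n^2 g^2 / d\<close>, with
          \<open>e = 1 / (n g)\<close>, turns the inequality between conditional moments into a
          bound for \<open>h g\<close>.\<close>
        have "3 * (?d * e)\<^sup>2 * ((real n)\<^sup>2 * g\<^sup>2 / ?d) \<le> (?d + 2) * (?d * (1 / (real n)\<^sup>2 * (h / g))) * ((real n)\<^sup>2 * g\<^sup>2 / ?d)"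
          using le by (intro mult_right_mono) auto
        moreover have "3 * (?d * e)\<^sup>2 * ((real n)\<^sup>2 * g\<^sup>2 / ?d) = 3 * ?d"
          unfolding e_eq using n0 g d by (simp add: field_simps power2_eq_square)
        moreover have "(?d + 2) * (?d * (1 / (real n)\<^sup>2 * (h / g))) * ((real n)\<^sup>2 * g\<^sup>2 / ?d) = (?d + 2) * (h * g)"
          using n0 g d by (simp add: field_simps power2_eq_square)
        ultimately have "3 * ?d \<le> (?d + 2) * (h * g)" by simp
        then have "c \<le> h * g" using d by (simp add: c_def field_simps)
        then show "0 < G_approx M W n (p n) m w \<and> c \<le> Hn n (p n m w) w * G_approx M W n (p n) m w"
          using g by (simp add: g_def h_def)
      qed
    qed
  qed
  have step': "AE w in M. \<forall>n\<in>{1..}. \<forall>m.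
      nn_cond_exp (completion M) (stopped_algebra M W (p n m)) (\<lambda>w. ennreal (\<bar>p n (Suc m) w - p n m w\<bar> ^ 2)) w < \<infinity> \<longrightarrow>
      p n m w < p n (Suc m) w \<longrightarrow>
      0 < G_approx M W n (p n) m w \<and> c \<le> Hn n (p n m w) w * G_approx M W n (p n) m w"
    using step by (auto simp: AE_ball_countable AE_all_countable AE_completion_iff)
  have part': "AE w in M. \<forall>n\<in>{1..}. p n 0 w = 0 \<and> incseq (\<lambda>m. p n m w) \<and> filterlim (\<lambda>m. p n m w) at_top sequentially"
    using part by (auto simp: AE_ball_countable random_partition_def)
  define XG where "XG k n w = (SUP s\<in>{0..\<eta> k w}. ennreal \<bar>G_approx M W n (p n) (current_index (p n) s w) w - G s w\<bar>)" for k n w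
  define XH where "XH k n w = (SUP s\<in>{0..\<eta> k w}. ennreal \<bar>Hn n (p n (current_index (p n) s w) w) w - H s w\<bar>)" for k n w
  have conv: "AE w in M. \<forall>k j. \<exists>n\<ge>1. cond_power_sum M W (p n) (\<eta> k) 2 w \<le> ennreal (1 / real (Suc j)) \<and>
      XG k n w \<le> ennreal (1 / real (Suc j)) \<and> XH k n w \<le> ennreal (1 / real (Suc j))"
    unfolding AE_all_countable
  proof (intro allI)
    fix k j
    show "AE w in M. \<exists>n\<ge>1. cond_power_sum M W (p n) (\<eta> k) 2 w \<le> ennreal (1 / real (Suc j)) \<and>
      XG k n w \<le> ennreal (1 / real (Suc j)) \<and> XH k n w \<le> ennreal (1 / real (Suc j))"
      using AC(1)[of k] AC(2)[of k] unfolding condition_A_def condition_C_def XG_def XH_def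
      by (intro tends_to_0_AE_exists) auto
  qed
  \<comment> \<open>The probability that \<open>\<eta> k < t\<close> for all \<open>k\<close> is at
    most each single probability, and these tend to 0.\<close>
  have exh: "AE w in M. \<exists>k. t \<le> \<eta> k w"
  proof -
    let ?E = "\<lambda>k. {w \<in> space M. \<eta> k w < t}"
    have m: "\<eta> k \<in> borel_measurable (completion M)" for k
      using ex measurable_stopping_time_N by (auto simp: exhausting_times_def finite_stopping_time_def)
    then have E: "?E k \<in> sets (completion M)" for k
      using borel_measurable_less[OF m borel_measurable_const, of k t] by simp
    have "measure (completion M) (\<Inter>k. ?E k) \<le> 0"
    proof (rule LIMSEQ_le_const)
      show "(\<lambda>k. measure (completion M) (?E k)) \<longlonglongrightarrow> 0" using ex by (simp add: exhausting_times_def)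
      show "\<exists>N. \<forall>n\<ge>N. measure (completion M) (\<Inter>k. ?E k) \<le> measure (completion M) (?E n)"
        using E by (intro exI[of _ 0] allI impI finite_measure_mono) auto
    qed
    then have "(\<Inter>k. ?E k) \<in> null_sets (completion M)"
      using E by (intro null_setsI) (auto simp: emeasure_eq_measure measure_le_0_iff)
    then have "AE w in completion M. w \<notin> (\<Inter>k. ?E k)" by (rule AE_not_in)
    with AE_space[of "completion M"] have "AE w in completion M. \<exists>k. t \<le> \<eta> k w" by eventually_elim (auto simp: not_less)
    then show ?thesis by (simp add: AE_completion_iff)
  qed
  have "AE w in M. \<forall>u\<in>{0..<t}. G u w > 0 \<and> H u w \<ge> 3 * ?d / ((?d + 2) * G u w)"
    using step' part' conv exh
  proof eventually_elim
    case (elim w)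
    show ?case
    proof
      fix u assume u: "u \<in> {0..<t}"
      obtain k where k: "t \<le> \<eta> k w" using elim(4) by blast
      have "\<exists>g h. 0 < g \<and> c \<le> h * g \<and> \<bar>g - G u w\<bar> \<le> 1 / real (Suc j) \<and> \<bar>h - H u w\<bar> \<le> 1 / real (Suc j)" for j
      proof -
        obtain n where n: "n \<ge> 1" "cond_power_sum M W (p n) (\<eta> k) 2 w \<le> ennreal (1 / real (Suc j))"
          "XG k n w \<le> ennreal (1 / real (Suc j))" "XH k n w \<le> ennreal (1 / real (Suc j))" using elim(3) by blast
        have pn: "p n 0 w = 0" "incseq (\<lambda>m. p n m w)" "filterlim (\<lambda>m. p n m w) at_top sequentially" using elim(2) n(1) by auto
        define m where "m = current_index (p n) u w"
        have m: "p n m w \<le> u" "u < p n (Suc m) w" using current_index_ex[where p="p n" and w=w and s=u, OF pn] u by (auto simp: m_def)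
        then have mf: "m < first_index (p n) (\<eta> k) w" using u k by (subst less_first_index[where p="p n" and w=w, OF pn(2,3)]) auto
        \<comment> \<open>The interval containing \<open>u\<close> is among those summed up to
          \<open>\<eta> k\<close>, so the bound on the sum makes its conditional second moment
          finite, as \<open>step'\<close> requires.\<close>
        have "nn_cond_exp (completion M) (stopped_algebra M W (p n m)) (\<lambda>w. ennreal (\<bar>p n (Suc m) w - p n m w\<bar> ^ 2)) w \<le> cond_power_sum M W (p n) (\<eta> k) 2 w"
          unfolding cond_power_sum_def using mf
          by (intro member_le_sum[where f="\<lambda>m. nn_cond_exp (completion M) (stopped_algebra M W (p n m)) (\<lambda>w. ennreal (\<bar>p n (Suc m) w - p n m w\<bar> ^ 2)) w"]) auto
        also have "\<dots> < \<infinity>" using n(2) by (rule order.strict_trans1) simp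
        finally have gh: "0 < G_approx M W n (p n) m w" "c \<le> Hn n (p n m w) w * G_approx M W n (p n) m w"
          using elim(1) n(1) m by auto
        have uk: "u \<in> {0..\<eta> k w}" using u k by auto
        have "ennreal \<bar>G_approx M W n (p n) m w - G u w\<bar> \<le> XG k n w" unfolding XG_def m_def by (rule SUP_upper[OF uk])
        then have 1: "\<bar>G_approx M W n (p n) m w - G u w\<bar> \<le> 1 / real (Suc j)" using n(3) order_trans by (fastforce simp: ennreal_le_iff)
        have "ennreal \<bar>Hn n (p n m w) w - H u w\<bar> \<le> XH k n w" unfolding XH_def m_def by (rule SUP_upper[OF uk])
        then have 2: "\<bar>Hn n (p n m w) w - H u w\<bar> \<le> 1 / real (Suc j)" using n(4) order_trans by (fastforce simp: ennreal_le_iff)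
        show ?thesis using gh 1 2 by blast
      qed
      then obtain g h where "\<And>j. 0 < g j \<and> c \<le> h j * g j \<and> \<bar>g j - G u w\<bar> \<le> 1 / real (Suc j) \<and> \<bar>h j - H u w\<bar> \<le> 1 / real (Suc j)" by metis
      then have "0 < G u w \<and> c / G u w \<le> H u w" by (intro limit_lower_bound[OF c, of g h]) auto
      then show "G u w > 0 \<and> H u w \<ge> 3 * ?d / ((?d + 2) * G u w)" by (simp add: c_def)
    qed
  qed
  then show ?thesis by (rule AE_pair_lborel[OF pM])
qed

section \<open>Exit from a ball of random radius\<close>

context bm
begin

lemma measurable_path_joint:
  fixes X :: "real \<Rightarrow> 'a \<Rightarrow> 'b::{metric_space}"
  assumes X: "\<And>s. 0 \<le> s \<Longrightarrow> X s \<in> borel_measurable N" and c: "\<And>w. w \<in> space N \<Longrightarrow> continuous_on {0..} (\<lambda>s. X s w)"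
  shows "(\<lambda>x. X (max 0 (fst x)) (snd x)) \<in> borel_measurable (borel \<Otimes>\<^sub>M N)"
proof (rule borel_measurable_LIMSEQ_metric)
  fix n :: nat
  have 1: "(\<lambda>x. nat \<lceil>(fst x :: real) * 2 ^ n\<rceil>) \<in> borel \<Otimes>\<^sub>M N \<rightarrow>\<^sub>M count_space UNIV" by measurable
  show "(\<lambda>x. X (real (nat \<lceil>(fst x :: real) * 2 ^ n\<rceil>) * (1 / 2 ^ n)) (snd x)) \<in> borel_measurable (borel \<Otimes>\<^sub>M N)"
  proof (rule measurable_compose_countable[OF _ 1])
    fix i :: nat
    show "(\<lambda>x. X (real i * (1 / 2 ^ n)) (snd x)) \<in> borel_measurable (borel \<Otimes>\<^sub>M N)"
      by (rule measurable_compose[OF measurable_snd X]) simp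
  qed
next
  fix x :: "real \<times> 'a" assume x: "x \<in> space (borel \<Otimes>\<^sub>M N)"
  have eq: "nat \<lceil>fst x * 2 ^ n\<rceil> = disc n (\<lambda>_. max 0 (fst x)) (snd x)" for n
    by (cases "0 \<le> fst x") (auto simp: disc_def max_def nat_eq_iff ceiling_le_zero mult_nonpos_nonneg)
  show "(\<lambda>n. X (real (nat \<lceil>fst x * 2 ^ n\<rceil>) * (1 / 2 ^ n)) (snd x)) \<longlonglongrightarrow> X (max 0 (fst x)) (snd x)"
    unfolding eq using x
    by (intro continuous_on_tendsto_compose[OF c disc_tendsto]) (auto simp: space_pair_measure)
qed

text \<open>Rounding a time up to a dyadic one may lead past \<open>t\<close>; the minimum with
  \<open>t\<close> keeps the approximations measurable with respect to \<open>F t\<close>.\<close>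

lemma measurable_path_progressive:
  fixes X :: "real \<Rightarrow> 'a \<Rightarrow> 'b::{metric_space}"
  assumes X: "\<And>s. 0 \<le> s \<Longrightarrow> X s \<in> borel_measurable (F s)" and c: "\<And>w. w \<in> space N \<Longrightarrow> continuous_on {0..} (\<lambda>s. X s w)"
    and t: "0 \<le> t"
  shows "(\<lambda>(u, w). X u w) \<in> borel_measurable (restrict_space borel {0..t} \<Otimes>\<^sub>M F t)"
proof (rule borel_measurable_LIMSEQ_metric)
  fix n :: nat
  have 0: "(\<lambda>x. x) \<in> restrict_space borel {0..t} \<rightarrow>\<^sub>M borel" by (rule measurable_restrict_space1) simp
  have 1: "(\<lambda>x. nat \<lceil>fst x * 2 ^ n\<rceil>) \<in> restrict_space borel {0..t} \<Otimes>\<^sub>M F t \<rightarrow>\<^sub>M count_space UNIV"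
    using measurable_compose[OF measurable_fst 0] by measurable
  show "(\<lambda>x. X (min t (real (nat \<lceil>fst x * 2 ^ n\<rceil>) * (1 / 2 ^ n))) (snd x)) \<in> borel_measurable (restrict_space borel {0..t} \<Otimes>\<^sub>M F t)"
  proof (rule measurable_compose_countable[OF _ 1])
    fix i :: nat
    show "(\<lambda>x. X (min t (real i * (1 / 2 ^ n))) (snd x)) \<in> borel_measurable (restrict_space borel {0..t} \<Otimes>\<^sub>M F t)"
      by (rule measurable_compose[OF measurable_snd measurable_F_mono[OF X]]) (use t in auto)
  qed
next
  fix x assume x: "x \<in> space (restrict_space borel {0..t} \<Otimes>\<^sub>M F t)"
  then have x': "0 \<le> fst x" "fst x \<le> t" "snd x \<in> space N" by (auto simp: space_pair_measure space_restrict_space space_F)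
  have eq: "nat \<lceil>fst x * 2 ^ n\<rceil> = disc n (\<lambda>_. fst x) (snd x)" for n by (simp add: disc_def)
  have "(\<lambda>n. min t (real (disc n (\<lambda>_. fst x) (snd x)) * (1 / 2 ^ n))) \<longlonglongrightarrow> min t (fst x)"
    by (intro tendsto_min tendsto_const disc_tendsto x')
  then have l: "(\<lambda>n. min t (real (disc n (\<lambda>_. fst x) (snd x)) * (1 / 2 ^ n))) \<longlonglongrightarrow> fst x" using x' by simp
  have "(\<lambda>n. X (min t (real (nat \<lceil>fst x * 2 ^ n\<rceil>) * (1 / 2 ^ n))) (snd x)) \<longlonglongrightarrow> X (fst x) (snd x)"
    unfolding eq using x' t by (intro continuous_on_tendsto_compose[OF c[OF x'(3)] l]) auto
  then show "(\<lambda>n. X (min t (real (nat \<lceil>fst x * 2 ^ n\<rceil>) * (1 / 2 ^ n))) (snd x)) \<longlonglongrightarrow> (case x of (u, w) \<Rightarrow> X u w)"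
    by (simp add: case_prod_beta)
qed

lemma measurable_min_stopping:
  assumes "stopping_time F \<tau>"
  shows "(\<lambda>w. min (\<tau> w) t) \<in> borel_measurable (F t)"
proof (rule borel_measurableI_le)
  fix c
  have "{w \<in> space (F t). min (\<tau> w) t \<le> c} = (if t \<le> c then space (F t) else {w \<in> space (F t). \<tau> w \<le> c})"
    by (auto simp: min_def)
  then show "{w \<in> space (F t). min (\<tau> w) t \<le> c} \<in> sets (F t)"
    using stopping_time_le_const[OF assms, of c t] by (simp add: pred_def)
qed

lemma measurable_path_min_stopping:
  fixes X :: "real \<Rightarrow> 'a \<Rightarrow> 'b::{metric_space}"
  assumes X: "\<And>s. 0 \<le> s \<Longrightarrow> X s \<in> borel_measurable (F s)" and c: "\<And>w. w \<in> space N \<Longrightarrow> continuous_on {0..} (\<lambda>s. X s w)"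
    and t: "0 \<le> t" and v: "v \<in> borel_measurable (F t)" "\<And>w. w \<in> space N \<Longrightarrow> 0 \<le> v w \<and> v w \<le> t"
  shows "(\<lambda>w. X (v w) w) \<in> borel_measurable (F t)"
proof -
  have "v \<in> F t \<rightarrow>\<^sub>M restrict_space borel {0..t}"
    by (rule measurable_restrict_space2) (use v in \<open>auto simp: space_F\<close>)
  then have "(\<lambda>w. (v w, w)) \<in> F t \<rightarrow>\<^sub>M restrict_space borel {0..t} \<Otimes>\<^sub>M F t" by measurable
  from measurable_compose[OF this measurable_path_progressive[OF X c t]] show ?thesis by simp
qed

lemma measurable_path_stopping:
  fixes X :: "real \<Rightarrow> 'a \<Rightarrow> 'b::{metric_space}"
  assumes X: "\<And>s. 0 \<le> s \<Longrightarrow> X s \<in> borel_measurable (F s)" and c: "\<And>w. w \<in> space N \<Longrightarrow> continuous_on {0..} (\<lambda>s. X s w)"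
    and \<tau>: "stopping_time F \<tau>" "\<And>w. w \<in> space N \<Longrightarrow> 0 \<le> \<tau> w"
  shows "(\<lambda>w. X (\<tau> w) w) \<in> borel_measurable (pre_sigma \<tau>)"
proof (rule measurableI)
  fix A :: "'b set" assume A: "A \<in> sets borel"
  show "(\<lambda>w. X (\<tau> w) w) -` A \<inter> space (pre_sigma \<tau>) \<in> sets (pre_sigma \<tau>)"
  proof (rule sets_pre_sigmaI[OF \<tau>(1)])
    fix t
    show "{w \<in> (\<lambda>w. X (\<tau> w) w) -` A \<inter> space (pre_sigma \<tau>). \<tau> w \<le> t} \<in> sets (F t)"
    proof (cases "0 \<le> t")
      case False
      then have "{w \<in> (\<lambda>w. X (\<tau> w) w) -` A \<inter> space (pre_sigma \<tau>). \<tau> w \<le> t} = {}"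
        using \<tau>(2) by (fastforce simp: space_pre_sigma)
      then show ?thesis using sets.empty_sets[of "F t"] by (simp only:)
    next
      case True
      have "(\<lambda>w. X (min (\<tau> w) t) w) \<in> borel_measurable (F t)"
        by (rule measurable_path_min_stopping[OF X c True measurable_min_stopping[OF \<tau>(1)]]) (use \<tau>(2) True in auto)
      from measurable_sets[OF this A] have "(\<lambda>w. X (min (\<tau> w) t) w) -` A \<inter> space (F t) \<in> sets (F t)" .
      moreover have "{w \<in> space (F t). \<tau> w \<le> t} \<in> sets (F t)" using stopping_timeD[OF \<tau>(1)] by (simp add: pred_def)
      moreover have "{w \<in> (\<lambda>w. X (\<tau> w) w) -` A \<inter> space (pre_sigma \<tau>). \<tau> w \<le> t} =
        ((\<lambda>w. X (min (\<tau> w) t) w) -` A \<inter> space (F t)) \<inter> {w \<in> space (F t). \<tau> w \<le> t}"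
        by (auto simp: space_pre_sigma space_F min_def)
      ultimately show ?thesis by auto
    qed
  qed
qed simp

section \<open>Conditional expectations recovered from integrals over events\<close>

text \<open>Where \<open>g < f\<close>, the value of \<open>g\<close> is finite; restricting to
  \<open>g \<le> C\<close> makes its integral finite, so that the two integrals can be
  subtracted.\<close>

lemma AE_le_of_set_nn_integrals:
  assumes \<sigma>: "stopping_time F \<sigma>" and f: "f \<in> borel_measurable (pre_sigma \<sigma>)" and g: "g \<in> borel_measurable (pre_sigma \<sigma>)"
    and le: "\<And>A. A \<in> sets (pre_sigma \<sigma>) \<Longrightarrow> (\<integral>\<^sup>+w. indicator A w * f w \<partial>N) \<le> (\<integral>\<^sup>+w. indicator A w * g w \<partial>N)"
  shows "AE w in N. f w \<le> (g w :: ennreal)"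
proof -
  have [measurable]: "f \<in> borel_measurable N" "g \<in> borel_measurable N"
    by (rule measurable_pre_sigma_N[OF \<sigma> f] measurable_pre_sigma_N[OF \<sigma> g])+
  have "AE w in N. \<forall>C::nat. \<not> (g w < f w \<and> g w \<le> of_nat C)"
    unfolding AE_all_countable
  proof
    fix C :: nat
    define A where "A = {w \<in> space (pre_sigma \<sigma>). g w < f w \<and> g w \<le> of_nat C}"
    have A: "A \<in> sets (pre_sigma \<sigma>)" unfolding A_def using f g by measurable
    then have [measurable]: "A \<in> sets N" using subalgebra_pre_sigma[OF \<sigma>] by (auto simp: subalgebra_def)
    have fin: "(\<integral>\<^sup>+w. indicator A w * g w \<partial>N) < \<infinity>"
    proof -
      have "(\<integral>\<^sup>+w. indicator A w * g w \<partial>N) \<le> (\<integral>\<^sup>+w. of_nat C \<partial>N)"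
        by (intro nn_integral_mono) (auto simp: A_def split: split_indicator)
      also have "\<dots> < \<infinity>" by (simp add: emeasure_space_1 of_nat_less_top)
      finally show ?thesis .
    qed
    have "(\<integral>\<^sup>+w. indicator A w * f w - indicator A w * g w \<partial>N) = (\<integral>\<^sup>+w. indicator A w * f w \<partial>N) - (\<integral>\<^sup>+w. indicator A w * g w \<partial>N)"
    proof (rule nn_integral_diff)
      show "AE w in N. indicator A w * g w \<le> indicator A w * f w" by (auto simp: A_def split: split_indicator)
    qed (use fin in simp_all)
    also have "\<dots> = 0" using le[OF A] order.strict_trans1[OF le[OF A] fin] by (simp add: diff_eq_0_iff_ennreal)
    finally have "AE w in N. indicator A w * f w - indicator A w * g w = 0" by (subst nn_integral_0_iff_AE[symmetric]) auto
    with AE_space show "AE w in N. \<not> (g w < f w \<and> g w \<le> of_nat C)"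
    proof eventually_elim
      case (elim w)
      show ?case
      proof
        assume a: "g w < f w \<and> g w \<le> of_nat C"
        then have "w \<in> A" using elim by (auto simp: A_def space_pre_sigma)
        then have "f w - g w = 0" using elim by simp
        then have "f w \<le> g w" using a by (simp add: diff_eq_0_iff_ennreal)
        with a show False by (auto dest: leD)
      qed
    qed
  qed
  then show ?thesis
  proof eventually_elim
    case (elim w)
    show ?case
    proof (rule ccontr)
      assume "\<not> f w \<le> g w"
      then have lt: "g w < f w" by simp
      then have "g w < \<infinity>" by (simp add: order.strict_trans2)
      then obtain C :: nat where "g w < of_nat C" using ennreal_Ex_less_of_nat[of "g w"] by auto
      then show False using elim lt by (auto intro: less_imp_le)
    qed
  qed
qed

text \<open>For \<open>f\<close> that is integrable only on each piece of a countable cover by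
  events of the past. Indicators of such events commute with conditional expectation, so the pieces
  determine it almost everywhere.\<close>

lemma cond_exp_localI:
  assumes \<sigma>: "stopping_time F \<sigma>" and A: "\<And>c::nat. A c \<in> sets (pre_sigma \<sigma>)" and cover: "\<And>w. w \<in> space N \<Longrightarrow> \<exists>c. w \<in> A c"
    and f[measurable]: "f \<in> borel_measurable N" and g: "g \<in> borel_measurable (pre_sigma \<sigma>)"
    and i: "\<And>c. integrable N (\<lambda>w. indicator (A c) w * f w)" "\<And>c. integrable N (\<lambda>w. indicator (A c) w * g w)"
    and eq: "\<And>B c. B \<in> sets (pre_sigma \<sigma>) \<Longrightarrow> B \<subseteq> A c \<Longrightarrow> (\<integral>w. indicator B w * f w \<partial>N) = (\<integral>w. indicator B w * g w \<partial>N)"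
  shows "AE w in N. nn_cond_exp N (pre_sigma \<sigma>) (\<lambda>w. ennreal \<bar>f w\<bar>) w < \<infinity> \<and> real_cond_exp N (pre_sigma \<sigma>) f w = g w"
proof -
  interpret S: finite_measure_subalgebra N "pre_sigma \<sigma>" by (rule sigma_finite_subalgebra_pre_sigma[OF \<sigma>])
  let ?c = "nn_cond_exp N (pre_sigma \<sigma>)"
  have [measurable]: "A c \<in> sets N" for c using A[of c] subalgebra_pre_sigma[OF \<sigma>] by (auto simp: subalgebra_def)
  have [measurable]: "g \<in> borel_measurable N" by (rule measurable_pre_sigma_N[OF \<sigma> g])
  have "AE w in N. w \<in> A c \<longrightarrow> ?c (\<lambda>w. ennreal \<bar>f w\<bar>) w < \<infinity> \<and> real_cond_exp N (pre_sigma \<sigma>) f w = g w" for c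
  proof -
    have feq: "(\<lambda>w. indicator (A c) w * ennreal (f w)) = (\<lambda>w. ennreal (indicator (A c) w * f w))"
      "(\<lambda>w. indicator (A c) w * ennreal (- f w)) = (\<lambda>w. ennreal (- (indicator (A c) w * f w)))"
      by (auto simp: fun_eq_iff split: split_indicator)
    have Am: "(\<lambda>w. indicator (A c) w :: ennreal) \<in> borel_measurable (pre_sigma \<sigma>)" using A[of c] by simp
    have "(\<integral>\<^sup>+w. indicator (A c) w * ?c (\<lambda>w. ennreal \<bar>f w\<bar>) w \<partial>N) = (\<integral>\<^sup>+w. indicator (A c) w * ennreal \<bar>f w\<bar> \<partial>N)"
      by (rule S.nn_cond_exp_intg) (use Am in auto)
    also have "\<dots> = (\<integral>\<^sup>+w. ennreal (norm (indicator (A c) w * f w)) \<partial>N)"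
      by (intro nn_integral_cong) (auto split: split_indicator)
    also have "\<dots> < \<infinity>" using i(1)[of c] by (simp add: integrable_iff_bounded)
    finally have "AE w in N. indicator (A c) w * ?c (\<lambda>w. ennreal \<bar>f w\<bar>) w \<noteq> \<infinity>"
      by (intro nn_integral_PInf_AE) auto
    moreover have "AE w in N. real_cond_exp N (pre_sigma \<sigma>) (\<lambda>w. indicator (A c) w * f w) w = indicator (A c) w * g w"
    proof (rule S.real_cond_exp_charact)
      fix B assume B: "B \<in> sets (pre_sigma \<sigma>)"
      have BA: "B \<inter> A c \<in> sets (pre_sigma \<sigma>)" using B A[of c] by auto
      have "(\<integral>w\<in>B. indicator (A c) w * f w \<partial>N) = (\<integral>w. indicator (B \<inter> A c) w * f w \<partial>N)"
        unfolding set_lebesgue_integral_def by (intro Bochner_Integration.integral_cong) (auto split: split_indicator)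
      also have "\<dots> = (\<integral>w. indicator (B \<inter> A c) w * g w \<partial>N)" by (rule eq[OF BA]) auto
      also have "\<dots> = (\<integral>w\<in>B. indicator (A c) w * g w \<partial>N)"
        unfolding set_lebesgue_integral_def by (intro Bochner_Integration.integral_cong) (auto split: split_indicator)
      finally show "(\<integral>w\<in>B. indicator (A c) w * f w \<partial>N) = (\<integral>w\<in>B. indicator (A c) w * g w \<partial>N)" .
    next
      show "(\<lambda>w. indicator (A c) w * g w) \<in> borel_measurable (pre_sigma \<sigma>)" using A[of c] g by measurable
    qed (use i in auto)
    moreover have "AE w in N. ?c (\<lambda>w. indicator (A c) w * ennreal (f w)) w = indicator (A c) w * ?c (\<lambda>w. ennreal (f w)) w"
      "AE w in N. ?c (\<lambda>w. indicator (A c) w * ennreal (- f w)) w = indicator (A c) w * ?c (\<lambda>w. ennreal (- f w)) w"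
      by (rule S.nn_cond_exp_prod[OF Am, THEN AE_symmetric]; simp)+
    ultimately show ?thesis
      unfolding feq by eventually_elim (auto simp: real_cond_exp_def less_top)
  qed
  then have "AE w in N. \<forall>c. w \<in> A c \<longrightarrow> ?c (\<lambda>w. ennreal \<bar>f w\<bar>) w < \<infinity> \<and> real_cond_exp N (pre_sigma \<sigma>) f w = g w"
    unfolding AE_all_countable by blast
  with AE_space show ?thesis by eventually_elim (use cover in blast)
qed

end

section \<open>Moments of the exit time from a ball\<close>

text \<open>Represents powers of a duration by the excess \<open>D - s\<close> and by the event
  \<open>s \<le> D\<close>, weighted with the density \<open>k s^(k - 1)\<close>; this turns a bound
  on the residual time into a bound on moments.\<close>

lemma nn_integral_power_pos_part:
  fixes D :: real
  assumes D: "0 \<le> D" and k: "0 < k"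
  shows "(\<integral>\<^sup>+s. ennreal (real k * s ^ (k - 1) * (D - s)) * indicator {0..D} s \<partial>lborel) = ennreal (D ^ (k + 1) / real (k + 1))"
    and "(\<integral>\<^sup>+s. ennreal (real k * s ^ (k - 1)) * indicator {0..D} s \<partial>lborel) = ennreal (D ^ k)"
proof -
  obtain m where m: "k = Suc m" using k by (cases k) auto
  define c where "c = real k / real (k + 1)"
  have c: "c * real (k + 1) = real k" unfolding c_def by simp
  have "(\<integral>\<^sup>+s. ennreal (real k * s ^ (k - 1) * (D - s)) * indicator {0..D} s \<partial>lborel) =
     ennreal ((D ^ k * D - c * D ^ (k + 1)) - (0 ^ k * D - c * 0 ^ (k + 1)))"
  proof (rule nn_integral_FTC_Icc[where F="\<lambda>s. s ^ k * D - c * s ^ (k + 1)"])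
    fix s assume s: "s \<in> {0..D}"
    have "((\<lambda>s. s ^ k * D - c * s ^ (k + 1)) has_real_derivative
        real k * s ^ (k - Suc 0) * D - c * (real (k + 1) * s ^ (k + 1 - Suc 0))) (at s)"
      by (intro DERIV_diff DERIV_cmult DERIV_cmult_right DERIV_pow)
    also have "c * (real (k + 1) * s ^ (k + 1 - Suc 0)) = real k * s ^ k" by (simp only: mult.assoc[symmetric] c) simp
    also have "real k * s ^ (k - Suc 0) * D - real k * s ^ k = real k * s ^ (k - 1) * (D - s)" by (simp add: m algebra_simps)
    finally show "((\<lambda>s. s ^ k * D - c * s ^ (k + 1)) has_real_derivative real k * s ^ (k - 1) * (D - s)) (at s)"
      .
    show "0 \<le> real k * s ^ (k - 1) * (D - s)" using s by auto
  qed (use D in auto)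
  also have "D ^ k * D - c * D ^ (k + 1) = D ^ (k + 1) / real (k + 1)"
  proof -
    have "c = 1 - 1 / real (k + 1)" unfolding c_def by (simp add: field_simps)
    then show ?thesis by (simp only: left_diff_distrib mult_1_left) simp
  qed
  finally show "(\<integral>\<^sup>+s. ennreal (real k * s ^ (k - 1) * (D - s)) * indicator {0..D} s \<partial>lborel) = ennreal (D ^ (k + 1) / real (k + 1))"
    by (simp add: m)
  have "(\<integral>\<^sup>+s. ennreal (real k * s ^ (k - 1)) * indicator {0..D} s \<partial>lborel) = ennreal (D ^ k - 0 ^ k)"
  proof (rule nn_integral_FTC_Icc[where F="\<lambda>s. s ^ k"])
    fix s assume s: "s \<in> {0..D}"
    show "((\<lambda>s. s ^ k) has_real_derivative real k * s ^ (k - 1)) (at s)"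
      by (auto intro!: derivative_eq_intros)
    show "0 \<le> real k * s ^ (k - 1)" using s by auto
  qed (use D in auto)
  then show "(\<integral>\<^sup>+s. ennreal (real k * s ^ (k - 1)) * indicator {0..D} s \<partial>lborel) = ennreal (D ^ k)" by (simp add: m)
qed

text \<open>\<open>R\<close> is the squared radius and is known at \<open>\<sigma>\<close>. Only
  \<open>inside\<close> and \<open>exit\<close> are retained from the hitting time; the definition
  of \<open>\<tau>\<close> as an infimum does not enter the moment computations.\<close>

locale bm_exit = bm N F W for N :: "'a measure" and F and W :: "real \<Rightarrow> 'a \<Rightarrow> real ^ 'd" +
  fixes \<sigma> \<tau> R :: "'a \<Rightarrow> real"
  assumes st: "stopping_time F \<sigma>" "stopping_time F \<tau>"
    and ord: "\<And>w. w \<in> space N \<Longrightarrow> 0 \<le> \<sigma> w \<and> \<sigma> w \<le> \<tau> w"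
    and R_meas: "R \<in> borel_measurable (pre_sigma \<sigma>)"
    and inside: "\<And>w s. w \<in> space N \<Longrightarrow> \<sigma> w \<le> s \<Longrightarrow> s \<le> \<tau> w \<Longrightarrow> (norm (W s w - W (\<sigma> w) w))\<^sup>2 \<le> R w"
    and exit: "\<And>w. w \<in> space N \<Longrightarrow> (norm (W (\<tau> w) w - W (\<sigma> w) w))\<^sup>2 = R w"
begin

lemma meas_N [measurable]: "\<sigma> \<in> borel_measurable N" "\<tau> \<in> borel_measurable N" "R \<in> borel_measurable N"
    "(\<lambda>w. W (\<sigma> w) w) \<in> borel_measurable N" "(\<lambda>w. W (\<tau> w) w) \<in> borel_measurable N"
    "(\<lambda>w. W (min (\<tau> w) (real K)) w) \<in> borel_measurable N"
proof -
  have nn: "0 \<le> \<sigma> w" "0 \<le> \<tau> w" if "w \<in> space N" for w using ord[OF that] by auto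
  show [measurable]: "\<sigma> \<in> borel_measurable N" "\<tau> \<in> borel_measurable N"
    using st by (auto intro: measurable_stopping_time_N)
  show "R \<in> borel_measurable N" using measurable_pre_sigma_N[OF st(1) R_meas] .
  show "(\<lambda>w. W (\<sigma> w) w) \<in> borel_measurable N" "(\<lambda>w. W (\<tau> w) w) \<in> borel_measurable N"
    "(\<lambda>w. W (min (\<tau> w) (real K)) w) \<in> borel_measurable N"
    by (rule measurable_W_random, measurable, simp add: nn)+
qed

lemma R_nonneg: "w \<in> space N \<Longrightarrow> 0 \<le> R w"
  using exit[of w] by (metis zero_le_power2)

lemma set_N: "A \<in> sets (pre_sigma \<sigma>) \<Longrightarrow> A \<in> sets N"
  using subalgebra_pre_sigma[OF st(1)] by (auto simp: subalgebra_def)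

text \<open>Optional stopping for \<open>|x|\<^sup>2 - d s\<close> between \<open>min \<tau> (\<sigma> + s)\<close> and \<open>\<tau>\<close>.\<close>

lemma residual_time:
  fixes K :: nat
  assumes A: "A \<in> sets (pre_sigma \<sigma>)" and s: "0 \<le> s"
  defines "D \<equiv> \<lambda>w. if \<sigma> w \<le> K then min (\<tau> w) K - \<sigma> w else 0"
  shows "ennreal (real CARD('d)) * (\<integral>\<^sup>+w. indicator A w * ennreal (D w - s) \<partial>N) \<le>
    (\<integral>\<^sup>+w. indicator A w * (ennreal (R w) * indicator {s..} (D w)) \<partial>N)"
proof -
  let ?d = "real CARD('d)"
  define \<rho> where "\<rho> w = min (\<tau> w) (\<sigma> w + s)" for w
  have st\<sigma>s: "stopping_time F (\<lambda>w. \<sigma> w + s)"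
  proof
    fix t
    have "Measurable.pred (F t) (\<lambda>w. \<sigma> w \<le> t - s)" by (rule stopping_time_le_const[OF st(1)]) (use s in auto)
    then show "Measurable.pred (F t) (\<lambda>w. \<sigma> w + s \<le> t)" by (simp add: le_diff_eq)
  qed
  have st\<rho>: "stopping_time F \<rho>" unfolding \<rho>_def[abs_def] by (intro stopping_time_min st st\<sigma>s)
  have \<rho>: "0 \<le> \<sigma> w \<and> \<sigma> w \<le> \<rho> w \<and> \<rho> w \<le> \<tau> w" if "w \<in> space N" for w using ord[OF that] s by (auto simp: \<rho>_def)
  \<comment> \<open>Selects the event that the exit has not occurred by \<open>\<sigma> + s\<close>,
    known at \<open>\<rho>\<close>; there \<open>\<rho> = \<sigma> + s\<close>.\<close>
  define Y :: "'a \<Rightarrow> real" where "Y w = indicator A w * indicator {w \<in> space (pre_sigma \<rho>). \<rho> w < \<tau> w} w" for w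
  have AN[measurable]: "A \<in> sets N" by (rule set_N[OF A])
  have Y: "Y \<in> borel_measurable (pre_sigma \<rho>)"
  proof -
    have "(indicator A :: 'a \<Rightarrow> real) \<in> borel_measurable (pre_sigma \<rho>)"
      by (rule measurable_pre_sigma_mono[OF st(1) st\<rho>]) (use \<rho> A in auto)
    moreover have "{w \<in> space (pre_sigma \<rho>). \<rho> w < \<tau> w} \<in> sets (pre_sigma \<rho>)"
      using stopping_time_less[OF st\<rho> st(2)] by (simp add: pred_def)
    ultimately show ?thesis unfolding Y_def[abs_def] by measurable
  qed
  have Yb: "\<bar>Y w\<bar> \<le> 1" "0 \<le> Y w" for w by (auto simp: Y_def split: split_indicator)
  define Z where "Z w = (if \<rho> w \<le> K then Y w else 0)" for w
  have Zn: "0 \<le> Z w" for w using Yb by (simp add: Z_def)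
  note [measurable] = measurable_pre_sigma_N[OF st\<rho> Y] measurable_stopping_time_N[OF st\<rho>]
  have [measurable]: "Z \<in> borel_measurable N" "D \<in> borel_measurable N"
    unfolding Z_def[abs_def] D_def by measurable
  note m = mart_truncated[OF mart_norm2 st(1) st\<rho> st(2) \<rho> Y Yb(1), of K, folded Z_def]
  have Z1: "Z w = 1 \<and> \<rho> w = \<sigma> w + s \<and> \<sigma> w + s < \<tau> w \<and> \<sigma> w + s \<le> K \<and> w \<in> A \<and> D w = min (\<tau> w) K - \<sigma> w \<and> s \<le> D w" if "Z w \<noteq> 0" "w \<in> space N" for w
    using that s by (auto simp: Z_def Y_def \<rho>_def D_def min_def split: if_splits split_indicator_asm)
  have Z0: "D w \<le> s" if "Z w = 0" "w \<in> A" "w \<in> space N" for w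
    using that s by (auto simp: Z_def Y_def \<rho>_def D_def min_def space_pre_sigma split: if_splits split_indicator_asm)
  \<comment> \<open>At the later time the squared distance is at most \<open>R\<close>, the path
    being still in the ball; at the earlier time it is nonnegative and is dropped.\<close>
  have e1: "Z w * ((norm (W (min (\<tau> w) K) w - W (\<sigma> w) w))\<^sup>2 - ?d * (min (\<tau> w) K - \<sigma> w)) - Z w * ((norm (W (\<rho> w) w - W (\<sigma> w) w))\<^sup>2 - ?d * (\<rho> w - \<sigma> w))
     \<le> Z w * (R w) - ?d * (Z w * (D w - s))" if w: "w \<in> space N" for w
  proof (cases "Z w = 0")
    case False
    note z = Z1[OF False w]
    have "(norm (W (min (\<tau> w) K) w - W (\<sigma> w) w))\<^sup>2 \<le> R w"
      by (rule inside[OF w]) (use z ord[OF w] s in auto)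
    moreover have "0 \<le> (norm (W (\<rho> w) w - W (\<sigma> w) w))\<^sup>2" by simp
    moreover have "Z w = 1" "\<rho> w - \<sigma> w = s" "min (\<tau> w) K - \<sigma> w = D w" using z by auto
    ultimately show ?thesis by (simp only: right_diff_distrib mult_1_left)
  qed simp
  have iD: "integrable N (\<lambda>w. Z w * (D w - s))"
  proof (rule integrable_const_bound[where B="real K"])
    show "AE w in N. norm (Z w * (D w - s)) \<le> real K" (is "AE w in N. ?P w")
    proof (rule AE_I2)
      fix w assume "w \<in> space N"
      then show "?P w" using Z1[of w] ord[of w] s by (cases "Z w = 0") auto
    qed
  qed simp
  have eqD: "(\<integral>\<^sup>+w. indicator A w * ennreal (D w - s) \<partial>N) = (\<integral>\<^sup>+w. ennreal (Z w * (D w - s)) \<partial>N)"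
  proof (rule nn_integral_cong)
    fix w assume "w \<in> space N"
    then show "indicator A w * ennreal (D w - s) = ennreal (Z w * (D w - s))"
      using Z1[of w] Z0[of w] by (cases "Z w = 0") (auto simp: ennreal_neg split: split_indicator)
  qed
  have Dn: "0 \<le> Z w * (D w - s)" if "w \<in> space N" for w using Z1[of w] that by (cases "Z w = 0") auto
  have RHS: "(\<integral>\<^sup>+w. ennreal (Z w * R w) \<partial>N) \<le> (\<integral>\<^sup>+w. indicator A w * (ennreal (R w) * indicator {s..} (D w)) \<partial>N)"
  proof (rule nn_integral_mono)
    fix w assume "w \<in> space N"
    then show "ennreal (Z w * R w) \<le> indicator A w * (ennreal (R w) * indicator {s..} (D w))"
      using Z1[of w] by (cases "Z w = 0") auto
  qed
  have LHS: "ennreal ?d * (\<integral>\<^sup>+w. ennreal (Z w * (D w - s)) \<partial>N) = ennreal (?d * (\<integral>w. Z w * (D w - s) \<partial>N))"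
    using Dn by (subst nn_integral_eq_integral[OF iD]) (auto intro!: AE_I2 simp: ennreal_mult integral_nonneg_AE)
  show ?thesis
  proof (cases "(\<integral>\<^sup>+w. ennreal (Z w * R w) \<partial>N) = \<infinity>")
    case True
    then show ?thesis using RHS by (simp add: top_unique)
  next
    case False
    have iR: "integrable N (\<lambda>w. Z w * R w)"
      by (rule integrableI_nonneg) (use False Zn R_nonneg in \<open>auto intro!: AE_I2 simp: less_top\<close>)
    have "0 = (\<integral>w. Z w * ((norm (W (min (\<tau> w) K) w - W (\<sigma> w) w))\<^sup>2 - ?d * (min (\<tau> w) K - \<sigma> w)) - Z w * ((norm (W (\<rho> w) w - W (\<sigma> w) w))\<^sup>2 - ?d * (\<rho> w - \<sigma> w)) \<partial>N)"
      using m by simp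
    also have "\<dots> \<le> (\<integral>w. Z w * R w - ?d * (Z w * (D w - s)) \<partial>N)"
      by (rule integral_mono) (use m iR iD e1 in auto)
    also have "\<dots> = (\<integral>w. Z w * R w \<partial>N) - ?d * (\<integral>w. Z w * (D w - s) \<partial>N)" using iR iD by simp
    finally have "ennreal (?d * (\<integral>w. Z w * (D w - s) \<partial>N)) \<le> ennreal (\<integral>w. Z w * R w \<partial>N)" by (intro ennreal_leI) simp
    also have "\<dots> = (\<integral>\<^sup>+w. ennreal (Z w * R w) \<partial>N)"
      by (rule nn_integral_eq_integral[symmetric, OF iR]) (use Zn R_nonneg in \<open>auto intro!: AE_I2\<close>)
    finally show ?thesis unfolding eqD LHS using RHS by (rule order_trans)
  qed
qed

text \<open>\<open>residual_time\<close> integrated over \<open>s\<close> with density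
  \<open>k s^(k - 1)\<close>: by Fubini the left side becomes a multiple of the moment of order
  \<open>k + 1\<close>, the right side the moment of order \<open>k\<close> weighted with
  \<open>R\<close>.\<close>

lemma moment_step_truncated:
  fixes K :: nat
  assumes A: "A \<in> sets (pre_sigma \<sigma>)"
  defines "D \<equiv> \<lambda>w. if \<sigma> w \<le> K then min (\<tau> w) K - \<sigma> w else 0"
  shows "ennreal (real CARD('d) / real (k + 1)) * (\<integral>\<^sup>+w. indicator A w * ennreal (D w ^ (k + 1)) \<partial>N) \<le>
    (\<integral>\<^sup>+w. indicator A w * (ennreal (R w) * ennreal (D w ^ k)) \<partial>N)"
proof (cases "k = 0")
  case True
  have "(\<integral>\<^sup>+w. indicator A w * (ennreal (R w) * indicator {0..} (D w)) \<partial>N) \<le> (\<integral>\<^sup>+w. indicator A w * (ennreal (R w) * ennreal (D w ^ k)) \<partial>N)"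
    by (intro nn_integral_mono) (auto simp: True split: split_indicator)
  with residual_time[OF A order_refl, of K] show ?thesis by (simp add: True D_def)
next
  case False
  let ?d = "real CARD('d)"
  have AN[measurable]: "A \<in> sets N" by (rule set_N[OF A])
  have Dm[measurable]: "D \<in> borel_measurable N" unfolding D_def by measurable
  have Dn: "0 \<le> D w" if "w \<in> space N" for w using ord[OF that] by (auto simp: D_def)
  have rt: "ennreal ?d * (\<integral>\<^sup>+w. indicator A w * ennreal (D w - s) \<partial>N) \<le>
    (\<integral>\<^sup>+w. indicator A w * (ennreal (R w) * indicator {s..} (D w)) \<partial>N)" if "0 \<le> s" for s
    using residual_time[OF A that, of K] by (simp only: D_def)
  interpret pair_sigma_finite lborel N ..
  define v where "v s = ennreal (real k * s ^ (k - 1))" for s :: real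
  have [measurable]: "v \<in> borel_measurable borel" unfolding v_def[abs_def] by measurable
  have "ennreal (?d / real (k + 1)) * (\<integral>\<^sup>+w. indicator A w * ennreal (D w ^ (k + 1)) \<partial>N) =
     ennreal ?d * (\<integral>\<^sup>+w. indicator A w * ennreal (D w ^ (k + 1) / real (k + 1)) \<partial>N)"
  proof -
    have "(\<integral>\<^sup>+w. indicator A w * ennreal (D w ^ (k + 1) / real (k + 1)) \<partial>N) = (\<integral>\<^sup>+w. ennreal (1 / real (k + 1)) * (indicator A w * ennreal (D w ^ (k + 1))) \<partial>N)"
    proof (rule nn_integral_cong)
      fix w assume "w \<in> space N"
      then show "indicator A w * ennreal (D w ^ (k + 1) / real (k + 1)) = ennreal (1 / real (k + 1)) * (indicator A w * ennreal (D w ^ (k + 1)))"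
        using Dn[of w] by (auto simp: ennreal_mult[symmetric] split: split_indicator)
    qed
    also have "\<dots> = ennreal (1 / real (k + 1)) * (\<integral>\<^sup>+w. indicator A w * ennreal (D w ^ (k + 1)) \<partial>N)"
      by (rule nn_integral_cmult) measurable
    finally show ?thesis by (simp add: mult.assoc[symmetric] ennreal_mult[symmetric])
  qed
  also have "(\<integral>\<^sup>+w. indicator A w * ennreal (D w ^ (k + 1) / real (k + 1)) \<partial>N) = (\<integral>\<^sup>+w. (\<integral>\<^sup>+s. indicator {0..} s * (v s * (indicator A w * ennreal (D w - s))) \<partial>lborel) \<partial>N)"
  proof (rule nn_integral_cong)
    fix w assume w: "w \<in> space N"
    have "(\<integral>\<^sup>+s. indicator {0..} s * (v s * (indicator A w * ennreal (D w - s))) \<partial>lborel) = (\<integral>\<^sup>+s. indicator A w * (ennreal (real k * s ^ (k - 1) * (D w - s)) * indicator {0..D w} s) \<partial>lborel)"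
      by (intro nn_integral_cong) (auto simp: v_def ennreal_mult[symmetric] ennreal_neg split: split_indicator)
    also have "\<dots> = indicator A w * (\<integral>\<^sup>+s. ennreal (real k * s ^ (k - 1) * (D w - s)) * indicator {0..D w} s \<partial>lborel)"
      by (rule nn_integral_cmult) measurable
    also have "\<dots> = indicator A w * ennreal (D w ^ (k + 1) / real (k + 1))"
      using nn_integral_power_pos_part(1)[OF Dn[OF w], of k] False by simp
    finally show "indicator A w * ennreal (D w ^ (k + 1) / real (k + 1)) = (\<integral>\<^sup>+s. indicator {0..} s * (v s * (indicator A w * ennreal (D w - s))) \<partial>lborel)" by simp
  qed
  also have "\<dots> = (\<integral>\<^sup>+s. (\<integral>\<^sup>+w. indicator {0..} s * (v s * (indicator A w * ennreal (D w - s))) \<partial>N) \<partial>lborel)"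
    by (rule Fubini') measurable
  also have "ennreal ?d * \<dots> = (\<integral>\<^sup>+s. indicator {0..} s * (v s * (ennreal ?d * (\<integral>\<^sup>+w. indicator A w * ennreal (D w - s) \<partial>N))) \<partial>lborel)"
  proof (subst nn_integral_cmult[symmetric])
    have cm: "(\<integral>\<^sup>+w. a * (b * f w) \<partial>N) = a * (b * (\<integral>\<^sup>+w. f w \<partial>N))" if "f \<in> borel_measurable N" for a b :: ennreal and f
      using that by (simp add: nn_integral_cmult)
    have "ennreal ?d * (\<integral>\<^sup>+w. indicator {0..} s * (v s * (indicator A w * ennreal (D w - s))) \<partial>N) =
        indicator {0..} s * (v s * (ennreal ?d * (\<integral>\<^sup>+w. indicator A w * ennreal (D w - s) \<partial>N)))" for s
      by (subst cm) (auto simp: mult_ac)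
    then show "(\<integral>\<^sup>+s. ennreal ?d * (\<integral>\<^sup>+w. indicator {0..} s * (v s * (indicator A w * ennreal (D w - s))) \<partial>N) \<partial>lborel) =
        (\<integral>\<^sup>+s. indicator {0..} s * (v s * (ennreal ?d * (\<integral>\<^sup>+w. indicator A w * ennreal (D w - s) \<partial>N))) \<partial>lborel)" by simp
  qed measurable
  also have "\<dots> \<le> (\<integral>\<^sup>+s. indicator {0..} s * (v s * (\<integral>\<^sup>+w. indicator A w * (ennreal (R w) * indicator {s..} (D w)) \<partial>N)) \<partial>lborel)"
    by (intro nn_integral_mono) (auto split: split_indicator intro!: mult_left_mono rt)
  also have "\<dots> = (\<integral>\<^sup>+s. (\<integral>\<^sup>+w. indicator {0..} s * (v s * (indicator A w * (ennreal (R w) * indicator {s..} (D w)))) \<partial>N) \<partial>lborel)"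
  proof (intro nn_integral_cong)
    fix s :: real
    have "(\<lambda>w. indicator {s..} (D w) :: ennreal) \<in> borel_measurable N" by measurable
    then show "indicator {0..} s * (v s * (\<integral>\<^sup>+w. indicator A w * (ennreal (R w) * indicator {s..} (D w)) \<partial>N)) = (\<integral>\<^sup>+w. indicator {0..} s * (v s * (indicator A w * (ennreal (R w) * indicator {s..} (D w)))) \<partial>N)"
      by (simp add: nn_integral_cmult)
  qed
  also have "\<dots> = (\<integral>\<^sup>+w. (\<integral>\<^sup>+s. indicator {0..} s * (v s * (indicator A w * (ennreal (R w) * indicator {s..} (D w)))) \<partial>lborel) \<partial>N)"
  proof (rule Fubini'[symmetric])
    have [measurable]: "(\<lambda>x. indicator {fst x..} (D (snd x)) :: ennreal) \<in> borel_measurable (lborel \<Otimes>\<^sub>M N)"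
      unfolding indicator_def atLeast_iff by measurable
    show "(\<lambda>(s, w). indicator {0..} s * (v s * (indicator A w * (ennreal (R w) * indicator {s..} (D w))))) \<in> borel_measurable (lborel \<Otimes>\<^sub>M N)"
      unfolding case_prod_beta by measurable
  qed
  also have "\<dots> = (\<integral>\<^sup>+w. indicator A w * (ennreal (R w) * ennreal (D w ^ k)) \<partial>N)"
  proof (rule nn_integral_cong)
    fix w assume w: "w \<in> space N"
    have "(\<integral>\<^sup>+s. indicator {0..} s * (v s * (indicator A w * (ennreal (R w) * indicator {s..} (D w)))) \<partial>lborel) = (\<integral>\<^sup>+s. indicator A w * ennreal (R w) * (ennreal (real k * s ^ (k - 1)) * indicator {0..D w} s) \<partial>lborel)"
      by (intro nn_integral_cong) (auto simp: v_def mult_ac split: split_indicator)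
    also have "\<dots> = indicator A w * ennreal (R w) * (\<integral>\<^sup>+s. ennreal (real k * s ^ (k - 1)) * indicator {0..D w} s \<partial>lborel)"
      by (rule nn_integral_cmult) measurable
    also have "\<dots> = indicator A w * (ennreal (R w) * ennreal (D w ^ k))"
      using nn_integral_power_pos_part(2)[OF Dn[OF w], of k] False by (simp add: mult.assoc)
    finally show "(\<integral>\<^sup>+s. indicator {0..} s * (v s * (indicator A w * (ennreal (R w) * indicator {s..} (D w)))) \<partial>lborel) = indicator A w * (ennreal (R w) * ennreal (D w ^ k))" .
  qed
  finally show ?thesis .
qed

end

section \<open>Further polynomial martingales for the exit point\<close>

context bm
begin

lemma mart_square: "mart (\<lambda>s x. real CARD('d) * (x $ j)\<^sup>2 - (norm x)\<^sup>2)"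
proof (rule mart_eq)
  show "mart (\<lambda>s x. real CARD('d) * herm 2 s (x $ j) - ((norm x)\<^sup>2 - real CARD('d) * s))"
    by (intro mart_diff mart_cmult mart_1 mart_norm2)
qed (simp add: herm_eqs algebra_simps)

lemma sum_herm2: "(\<Sum>k\<in>UNIV - {j}. herm 2 s (x $ k)) = (norm x)\<^sup>2 - (x $ j)\<^sup>2 - (real CARD('d) - 1) * s" for x :: "real ^ 'd"
  by (simp add: herm_eqs sum_offdiag norm_sq_sum sum_subtractf algebra_simps)

text \<open>At exit \<open>|x|^2\<close> equals \<open>R\<close>, so this polynomial reduces the
  third moment of a coordinate to its first moment. The weights \<open>d - 1\<close> and
  \<open>-3\<close> cancel the terms in \<open>s\<close>.\<close>

lemma mart_cubic: "mart (\<lambda>s x. (real CARD('d) + 2) * (x $ j) ^ 3 - 3 * ((norm x)\<^sup>2 * x $ j))"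
proof (rule mart_eq)
  show "mart (\<lambda>s x. (real CARD('d) - 1) * herm 3 s (x $ j) - 3 * (\<Sum>k\<in>UNIV - {j}. herm 1 s (x $ j) * herm 2 s (x $ k)))"
    by (intro mart_diff mart_cmult mart_sum mart_1 mart_2) auto
  fix s :: real and x :: "real ^ 'd"
  show "(real CARD('d) - 1) * herm 3 s (x $ j) - 3 * (\<Sum>k\<in>UNIV - {j}. herm 1 s (x $ j) * herm 2 s (x $ k)) =
    (real CARD('d) + 2) * (x $ j) ^ 3 - 3 * ((norm x)\<^sup>2 * x $ j)"
    unfolding sum_distrib_left[symmetric] sum_herm2 by (simp add: herm_eqs algebra_simps power2_eq_square power3_eq_cube)
qed

text \<open>Its sum over \<open>j\<close> is twice the polynomial of \<open>mart_quartic\<close>; a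
  single coordinate is distinguished because (B) prescribes the fourth moment of each coordinate
  separately.\<close>

lemma mart_quartic_coordinate:
  "mart (\<lambda>s x. (real CARD('d) + 4) * (x $ j) ^ 4 + (\<Sum>k\<in>UNIV. (x $ k) ^ 4) - 6 * ((norm x)\<^sup>2 * (x $ j)\<^sup>2))"
proof (rule mart_eq)
  show "mart (\<lambda>s x. (real CARD('d) - 1) * herm 4 s (x $ j) + (\<Sum>k\<in>UNIV - {j}. herm 4 s (x $ k)) - 6 * (\<Sum>k\<in>UNIV - {j}. herm 2 s (x $ j) * herm 2 s (x $ k)))"
    by (intro mart_diff mart_add mart_cmult mart_sum mart_1 mart_2) auto
  fix s :: real and x :: "real ^ 'd"
  have "(\<Sum>k\<in>UNIV - {j}. herm 4 s (x $ k)) = (\<Sum>k\<in>UNIV. (x $ k) ^ 4) - (x $ j) ^ 4 - 6 * s * ((norm x)\<^sup>2 - (x $ j)\<^sup>2) + 3 * (real CARD('d) - 1) * s\<^sup>2"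
    by (simp add: herm_eqs sum_offdiag norm_sq_sum sum.distrib sum_subtractf sum_distrib_left algebra_simps)
  note F = this
  show "(real CARD('d) - 1) * herm 4 s (x $ j) + (\<Sum>k\<in>UNIV - {j}. herm 4 s (x $ k)) - 6 * (\<Sum>k\<in>UNIV - {j}. herm 2 s (x $ j) * herm 2 s (x $ k)) =
    (real CARD('d) + 4) * (x $ j) ^ 4 + (\<Sum>k\<in>UNIV. (x $ k) ^ 4) - 6 * ((norm x)\<^sup>2 * (x $ j)\<^sup>2)"
    unfolding sum_distrib_left[symmetric] sum_herm2 F by (simp add: herm_eqs algebra_simps power2_eq_square power4_eq_xxxx)
qed

text \<open>Not harmonic in \<open>x\<close>: the elapsed time remains, and is wanted. At exit the
  identity reduces the mean of the duration times \<open>x_i x_j\<close> to that of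
  \<open>R x_i x_j\<close>.\<close>

lemma mart_cross:
  assumes ij: "i \<noteq> j"
  shows "mart (\<lambda>s x. (norm x)\<^sup>2 * (x $ i * x $ j) - (real CARD('d) + 4) * (s * (x $ i * x $ j)))"
proof (rule mart_eq)
  show "mart (\<lambda>s x. herm 3 s (x $ i) * herm 1 s (x $ j) + herm 1 s (x $ i) * herm 3 s (x $ j) +
     (\<Sum>k\<in>UNIV - {i} - {j}. herm 1 s (x $ i) * herm 1 s (x $ j) * herm 2 s (x $ k)))"
    using ij by (intro mart_add mart_sum mart_2 mart_3) auto
  fix s :: real and x :: "real ^ 'd"
  have "(\<Sum>k\<in>UNIV - {i} - {j}. herm 2 s (x $ k)) = (\<Sum>k\<in>UNIV - {i}. herm 2 s (x $ k)) - herm 2 s (x $ j)"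
    using ij by (subst sum_diff1) auto
  then have F: "(\<Sum>k\<in>UNIV - {i} - {j}. herm 2 s (x $ k)) = (norm x)\<^sup>2 - (x $ i)\<^sup>2 - (x $ j)\<^sup>2 - (real CARD('d) - 2) * s"
    unfolding sum_herm2 by (simp add: herm_eqs algebra_simps)
  show "herm 3 s (x $ i) * herm 1 s (x $ j) + herm 1 s (x $ i) * herm 3 s (x $ j) +
     (\<Sum>k\<in>UNIV - {i} - {j}. herm 1 s (x $ i) * herm 1 s (x $ j) * herm 2 s (x $ k)) =
     (norm x)\<^sup>2 * (x $ i * x $ j) - (real CARD('d) + 4) * (s * (x $ i * x $ j))"
    unfolding sum_distrib_left[symmetric] F by (simp add: herm_eqs algebra_simps power2_eq_square power3_eq_cube)
qed

end

section \<open>Conditional moments at the exit time\<close>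

context bm_exit
begin

abbreviation "\<Delta> \<equiv> \<lambda>w. \<tau> w - \<sigma> w"
abbreviation "X \<equiv> \<lambda>w. W (\<tau> w) w - W (\<sigma> w) w"
abbreviation "nnc \<equiv> nn_cond_exp N (pre_sigma \<sigma>)"

lemma \<Delta>_nonneg: "w \<in> space N \<Longrightarrow> 0 \<le> \<Delta> w" using ord by simp

lemma nn_Fatou_bound:
  assumes m: "\<And>K::nat. f K \<in> borel_measurable N" and lim: "\<And>w. w \<in> space N \<Longrightarrow> \<forall>\<^sub>F K in sequentially. f K w = g w"
    and le: "\<And>K. (\<integral>\<^sup>+w. f K w \<partial>N) \<le> (C :: ennreal)"
  shows "(\<integral>\<^sup>+w. g w \<partial>N) \<le> C"
proof -
  have "(\<integral>\<^sup>+w. g w \<partial>N) = (\<integral>\<^sup>+w. liminf (\<lambda>K. f K w) \<partial>N)"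
  proof (rule nn_integral_cong)
    fix w assume "w \<in> space N"
    then have "(\<lambda>K. f K w) \<longlonglongrightarrow> g w" by (intro tendsto_eventually lim)
    then show "g w = liminf (\<lambda>K. f K w)" by (rule lim_imp_Liminf[OF sequentially_bot, symmetric])
  qed
  also have "\<dots> \<le> liminf (\<lambda>K. \<integral>\<^sup>+w. f K w \<partial>N)" by (rule nn_integral_liminf) (rule m)
  also have "\<dots> \<le> limsup (\<lambda>K. \<integral>\<^sup>+w. f K w \<partial>N)" by (rule Liminf_le_Limsup) simp
  also have "\<dots> \<le> C" by (rule Limsup_bounded) (simp add: le)
  finally show ?thesis .
qed

lemma eventually_truncation: "\<forall>\<^sub>F K in sequentially. \<sigma> w \<le> real K \<and> min (\<tau> w) (real K) = \<tau> w"
proof -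
  have "\<forall>\<^sub>F K in sequentially. \<sigma> w \<le> real K" using eventually_min_eq[of "\<sigma> w"] by eventually_elim (auto simp: min_def split: if_splits)
  with eventually_min_eq[of "\<tau> w"] show ?thesis by eventually_elim auto
qed

sublocale S: finite_measure_subalgebra N "pre_sigma \<sigma>" by (rule sigma_finite_subalgebra_pre_sigma[OF st(1)])

text \<open>Fatou's lemma removes the cut, and \<open>R\<close>, known at \<open>\<sigma>\<close>,
  leaves the conditional expectation. Working in \<open>ennreal\<close> avoids any prior finiteness,
  so that iteration is immediate.\<close>

lemma moment_step:
  "AE w in N. nnc (\<lambda>w. ennreal (\<Delta> w ^ (k + 1))) w \<le> ennreal (real (k + 1) / real CARD('d)) * (ennreal (R w) * nnc (\<lambda>w. ennreal (\<Delta> w ^ k)) w)"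
proof (rule AE_le_of_set_nn_integrals[OF st(1)])
  show "(\<lambda>w. ennreal (real (k + 1) / real CARD('d)) * (ennreal (R w) * nnc (\<lambda>w. ennreal (\<Delta> w ^ k)) w)) \<in> borel_measurable (pre_sigma \<sigma>)"
    using R_meas by measurable
  fix A assume A: "A \<in> sets (pre_sigma \<sigma>)"
  have AN[measurable]: "A \<in> sets N" by (rule set_N[OF A])
  let ?r = "ennreal (real (k + 1) / real CARD('d))"
  define D where "D K w = (if \<sigma> w \<le> real K then min (\<tau> w) (real K) - \<sigma> w else 0)" for K w
  have [measurable]: "D K \<in> borel_measurable N" for K unfolding D_def[abs_def] by measurable
  have D: "0 \<le> D K w" "D K w \<le> \<Delta> w" if "w \<in> space N" for K w using ord[OF that] by (auto simp: D_def)
  have "(\<integral>\<^sup>+w. indicator A w * ennreal (\<Delta> w ^ (k + 1)) \<partial>N) \<le> ?r * (\<integral>\<^sup>+w. indicator A w * (ennreal (R w) * ennreal (\<Delta> w ^ k)) \<partial>N)"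
  proof (rule nn_Fatou_bound[where f="\<lambda>K w. indicator A w * ennreal (D K w ^ (k + 1))"])
    show "\<forall>\<^sub>F K in sequentially. indicator A w * ennreal (D K w ^ (k + 1)) = indicator A w * ennreal (\<Delta> w ^ (k + 1))" for w
      using eventually_truncation[of w] by eventually_elim (simp add: D_def)
    fix K
    have "(\<integral>\<^sup>+w. indicator A w * ennreal (D K w ^ (k + 1)) \<partial>N) = ?r * (ennreal (real CARD('d) / real (k + 1)) * (\<integral>\<^sup>+w. indicator A w * ennreal (D K w ^ (k + 1)) \<partial>N))"
      by (simp add: mult.assoc[symmetric] ennreal_mult[symmetric])
    also have "\<dots> \<le> ?r * (\<integral>\<^sup>+w. indicator A w * (ennreal (R w) * ennreal (D K w ^ k)) \<partial>N)"
      using moment_step_truncated[OF A, of k K] by (intro mult_left_mono) (simp_all only: D_def zero_le)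
    also have "\<dots> \<le> ?r * (\<integral>\<^sup>+w. indicator A w * (ennreal (R w) * ennreal (\<Delta> w ^ k)) \<partial>N)"
      using D by (intro mult_left_mono nn_integral_mono ennreal_leI power_mono) auto
    finally show "(\<integral>\<^sup>+w. indicator A w * ennreal (D K w ^ (k + 1)) \<partial>N) \<le> ?r * (\<integral>\<^sup>+w. indicator A w * (ennreal (R w) * ennreal (\<Delta> w ^ k)) \<partial>N)" .
  qed simp
  also have "(\<integral>\<^sup>+w. indicator A w * (ennreal (R w) * ennreal (\<Delta> w ^ k)) \<partial>N) = (\<integral>\<^sup>+w. (indicator A w * ennreal (R w)) * ennreal (\<Delta> w ^ k) \<partial>N)"
    by (simp add: mult.assoc)
  also have "\<dots> = (\<integral>\<^sup>+w. (indicator A w * ennreal (R w)) * nnc (\<lambda>w. ennreal (\<Delta> w ^ k)) w \<partial>N)"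
    by (rule S.nn_cond_exp_intg[symmetric]) (use A R_meas in measurable)
  also have "?r * \<dots> = (\<integral>\<^sup>+w. ?r * ((indicator A w * ennreal (R w)) * nnc (\<lambda>w. ennreal (\<Delta> w ^ k)) w) \<partial>N)"
    by (rule nn_integral_cmult[symmetric]) measurable
  also have "\<dots> = (\<integral>\<^sup>+w. indicator A w * (?r * (ennreal (R w) * nnc (\<lambda>w. ennreal (\<Delta> w ^ k)) w)) \<partial>N)"
    by (intro nn_integral_cong) (simp add: mult_ac)
  finally have "(\<integral>\<^sup>+w. indicator A w * ennreal (\<Delta> w ^ (k + 1)) \<partial>N) \<le> (\<integral>\<^sup>+w. indicator A w * (?r * (ennreal (R w) * nnc (\<lambda>w. ennreal (\<Delta> w ^ k)) w)) \<partial>N)" .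
  moreover have "(\<integral>\<^sup>+w. indicator A w * nnc (\<lambda>w. ennreal (\<Delta> w ^ (k + 1))) w \<partial>N) = (\<integral>\<^sup>+w. indicator A w * ennreal (\<Delta> w ^ (k + 1)) \<partial>N)"
    by (rule S.nn_cond_exp_intg) (use A in measurable)
  ultimately show "(\<integral>\<^sup>+w. indicator A w * nnc (\<lambda>w. ennreal (\<Delta> w ^ (k + 1))) w \<partial>N)
      \<le> (\<integral>\<^sup>+w. indicator A w * (?r * (ennreal (R w) * nnc (\<lambda>w. ennreal (\<Delta> w ^ k)) w)) \<partial>N)" by simp
qed simp

lemma moment_bound: "AE w in N. nnc (\<lambda>w. ennreal (\<Delta> w ^ k)) w \<le> ennreal (fact k * (R w / real CARD('d)) ^ k)"
proof (induction k)
  case 0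
  have "AE w in N. (1::ennreal) = nnc (\<lambda>w. 1) w" by (rule S.nn_cond_exp_F_meas) simp
  then show ?case by eventually_elim simp
next
  case (Suc k)
  from Suc moment_step[of k] AE_space show ?case
  proof eventually_elim
    case (elim w)
    have R: "0 \<le> R w" using elim(3) by (rule R_nonneg)
    have "nnc (\<lambda>w. ennreal (\<Delta> w ^ (k + 1))) w \<le> ennreal (real (k + 1) / real CARD('d)) * (ennreal (R w) * ennreal (fact k * (R w / real CARD('d)) ^ k))"
      using elim(1) by (intro order_trans[OF elim(2)] mult_left_mono) auto
    also have "\<dots> = ennreal (real (k + 1) / real CARD('d) * (R w * (fact k * (R w / real CARD('d)) ^ k)))"
      using R by (simp add: ennreal_mult[symmetric])
    also have "real (k + 1) / real CARD('d) * (R w * (fact k * (R w / real CARD('d)) ^ k)) = fact (Suc k) * (R w / real CARD('d)) ^ Suc k"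
      by simp
    finally show ?case by simp
  qed
qed

text \<open>One inequality is the moment bound of order 1. For the other, optional stopping at the
  cut time equates the mean of \<open>|x|^2\<close> with \<open>d\<close> times that of the cut
  duration; Fatou's lemma on the left and monotonicity on the right give the remaining
  direction.\<close>

lemma cond_exp_duration: "AE w in N. nnc (\<lambda>w. ennreal (\<Delta> w)) w = ennreal (R w / real CARD('d))"
proof -
  let ?d = "real CARD('d)"
  have "AE w in N. ennreal (R w) \<le> ennreal ?d * nnc (\<lambda>w. ennreal (\<Delta> w)) w"
  proof (rule AE_le_of_set_nn_integrals[OF st(1)])
    fix A assume A: "A \<in> sets (pre_sigma \<sigma>)"
    have AN[measurable]: "A \<in> sets N" by (rule set_N[OF A])
    define Z :: "nat \<Rightarrow> 'a \<Rightarrow> real" where "Z K w = (if \<sigma> w \<le> real K then indicator A w else 0)" for K w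
    have [measurable]: "Z K \<in> borel_measurable N" for K unfolding Z_def[abs_def] by measurable
    have Z0: "0 \<le> Z K w" for K w by (auto simp: Z_def)
    have Y: "(indicator A :: 'a \<Rightarrow> real) \<in> borel_measurable (pre_sigma \<sigma>)" using A by simp
    have Yb: "\<bar>indicator A w :: real\<bar> \<le> 1" "0 \<le> (indicator A w :: real) \<and> (indicator A w :: real) \<le> 1" for w by (auto split: split_indicator)
    have "(\<integral>\<^sup>+w. indicator A w * ennreal (R w) \<partial>N) \<le> ennreal ?d * (\<integral>\<^sup>+w. indicator A w * ennreal (\<Delta> w) \<partial>N)"
    proof (rule nn_Fatou_bound[where f="\<lambda>K w. ennreal (Z K w * (norm (W (min (\<tau> w) (real K)) w - W (\<sigma> w) w))\<^sup>2)"])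
      show "\<forall>\<^sub>F K in sequentially. ennreal (Z K w * (norm (W (min (\<tau> w) (real K)) w - W (\<sigma> w) w))\<^sup>2) = indicator A w * ennreal (R w)" if "w \<in> space N" for w
        using eventually_truncation[of w] by eventually_elim (simp add: Z_def exit[OF that] split: split_indicator)
      fix K
      have m: "integrable N (\<lambda>w. Z K w * ((norm (W (min (\<tau> w) (real K)) w - W (\<sigma> w) w))\<^sup>2 - ?d * (min (\<tau> w) (real K) - \<sigma> w)))"
        "(\<integral>w. Z K w * ((norm (W (min (\<tau> w) (real K)) w - W (\<sigma> w) w))\<^sup>2 - ?d * (min (\<tau> w) (real K) - \<sigma> w)) \<partial>N) = 0"
        unfolding Z_def by (rule mart_truncated_0[OF mart_norm2 st ord Y Yb(1)]; simp)+
      have s1: "integrable N (\<lambda>w. Z K w * (min (\<tau> w) (real K) - \<sigma> w))"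
        using fourth_moment_truncated(2)[OF st ord Y Yb(2), of K 1] by (simp add: Z_def)
      have "integrable N (\<lambda>w. Z K w * ((norm (W (min (\<tau> w) (real K)) w - W (\<sigma> w) w))\<^sup>2 - ?d * (min (\<tau> w) (real K) - \<sigma> w)) + ?d * (Z K w * (min (\<tau> w) (real K) - \<sigma> w)))"
        by (intro Bochner_Integration.integrable_add integrable_mult_right m s1)
      then have n2: "integrable N (\<lambda>w. Z K w * (norm (W (min (\<tau> w) (real K)) w - W (\<sigma> w) w))\<^sup>2)" by (simp add: algebra_simps)
      have "(\<integral>w. Z K w * (norm (W (min (\<tau> w) (real K)) w - W (\<sigma> w) w))\<^sup>2 - ?d * (Z K w * (min (\<tau> w) (real K) - \<sigma> w)) \<partial>N) = 0"
        using m(2) by (simp add: algebra_simps)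
      then have e: "(\<integral>w. Z K w * (norm (W (min (\<tau> w) (real K)) w - W (\<sigma> w) w))\<^sup>2 \<partial>N) = ?d * (\<integral>w. Z K w * (min (\<tau> w) (real K) - \<sigma> w) \<partial>N)"
        using n2 s1 by simp
      have Zs: "0 \<le> Z K w * (min (\<tau> w) (real K) - \<sigma> w)" "Z K w * (min (\<tau> w) (real K) - \<sigma> w) \<le> indicator A w * \<Delta> w" if "w \<in> space N" for w
        using ord[OF that] by (auto simp: Z_def split: split_indicator)
      have "(\<integral>\<^sup>+w. ennreal (Z K w * (norm (W (min (\<tau> w) (real K)) w - W (\<sigma> w) w))\<^sup>2) \<partial>N) = ennreal (?d * (\<integral>w. Z K w * (min (\<tau> w) (real K) - \<sigma> w) \<partial>N))"
        using Z0 by (subst nn_integral_eq_integral[OF n2]) (auto simp: e)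
      also have "\<dots> = ennreal ?d * (\<integral>\<^sup>+w. ennreal (Z K w * (min (\<tau> w) (real K) - \<sigma> w)) \<partial>N)"
        using Zs by (subst nn_integral_eq_integral[OF s1]) (auto intro!: AE_I2 simp: ennreal_mult' integral_nonneg_AE)
      also have "\<dots> \<le> ennreal ?d * (\<integral>\<^sup>+w. indicator A w * ennreal (\<Delta> w) \<partial>N)"
      proof (intro mult_left_mono nn_integral_mono)
        fix w assume "w \<in> space N"
        then have "ennreal (Z K w * (min (\<tau> w) (real K) - \<sigma> w)) \<le> ennreal (indicator A w * \<Delta> w)" by (intro ennreal_leI Zs)
        then show "ennreal (Z K w * (min (\<tau> w) (real K) - \<sigma> w)) \<le> indicator A w * ennreal (\<Delta> w)" by (auto split: split_indicator_asm)
      qed simp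
      finally show "(\<integral>\<^sup>+w. ennreal (Z K w * (norm (W (min (\<tau> w) (real K)) w - W (\<sigma> w) w))\<^sup>2) \<partial>N) \<le> ennreal ?d * (\<integral>\<^sup>+w. indicator A w * ennreal (\<Delta> w) \<partial>N)" .
    qed simp
    also have "(\<integral>\<^sup>+w. indicator A w * ennreal (\<Delta> w) \<partial>N) = (\<integral>\<^sup>+w. indicator A w * nnc (\<lambda>w. ennreal (\<Delta> w)) w \<partial>N)"
      by (rule S.nn_cond_exp_intg[symmetric]) (use A in measurable)
    also have "ennreal ?d * \<dots> = (\<integral>\<^sup>+w. indicator A w * (ennreal ?d * nnc (\<lambda>w. ennreal (\<Delta> w)) w) \<partial>N)"
      by (subst nn_integral_cmult[symmetric]) (auto intro!: nn_integral_cong simp: mult_ac)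
    finally show "(\<integral>\<^sup>+w. indicator A w * ennreal (R w) \<partial>N) \<le> (\<integral>\<^sup>+w. indicator A w * (ennreal ?d * nnc (\<lambda>w. ennreal (\<Delta> w)) w) \<partial>N)" .
  qed (use R_meas in measurable)
  with moment_bound[of 1] show ?thesis
  proof eventually_elim
    case (elim w)
    have "ennreal (1 / ?d) * ennreal (R w) \<le> ennreal (1 / ?d) * (ennreal ?d * nnc (\<lambda>w. ennreal (\<Delta> w)) w)" using elim(2) by (rule mult_left_mono) simp
    then have "ennreal (R w / ?d) \<le> nnc (\<lambda>w. ennreal (\<Delta> w)) w" by (simp add: mult.assoc[symmetric] ennreal_mult'[symmetric])
    then show ?case using elim(1) by (intro antisym) auto
  qed
qed

text \<open>Where the weight is nonzero the exit point lies in a fixed ball, and a continuous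
  function is bounded there.\<close>

lemma integrable_bounded_on_ball:
  fixes Q :: "real ^ 'd \<Rightarrow> real"
  assumes Q: "continuous_on UNIV Q" and Z: "Z \<in> borel_measurable N" "\<And>w. w \<in> space N \<Longrightarrow> \<bar>Z w\<bar> \<le> B" "\<And>w. w \<in> space N \<Longrightarrow> Z w \<noteq> 0 \<Longrightarrow> R w \<le> c"
  obtains b where "0 \<le> b" "\<And>x. (norm x)\<^sup>2 \<le> c \<Longrightarrow> \<bar>Q x\<bar> \<le> b" "integrable N (\<lambda>w. Z w * Q (X w))"
proof -
  have "compact (Q ` cball 0 (sqrt \<bar>c\<bar>))" by (intro compact_continuous_image continuous_on_subset[OF Q]) auto
  then obtain b0 where b0: "\<And>y. y \<in> Q ` cball 0 (sqrt \<bar>c\<bar>) \<Longrightarrow> norm y \<le> b0" using compact_imp_bounded bounded_iff by metis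
  define b where "b = \<bar>b0\<bar>"
  have b: "\<bar>Q x\<bar> \<le> b" if "(norm x)\<^sup>2 \<le> c" for x
  proof -
    have "norm x \<le> sqrt \<bar>c\<bar>" using that by (intro real_le_rsqrt) auto
    then have "norm (Q x) \<le> b0" by (intro b0) auto
    then show ?thesis by (auto simp: b_def)
  qed
  have Qm: "(\<lambda>w. Q (X w)) \<in> borel_measurable N"
    by (rule measurable_compose[OF _ borel_measurable_continuous_onI[OF Q]]) measurable
  have "integrable N (\<lambda>w. Z w * Q (X w))"
  proof (rule integrable_const_bound[where B="\<bar>B\<bar> * b"])
    show "AE w in N. norm (Z w * Q (X w)) \<le> \<bar>B\<bar> * b" (is "AE w in N. ?P w")
    proof (rule AE_I2)
      fix w assume w: "w \<in> space N"
      show "?P w"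
      proof (cases "Z w = 0")
        case False
        then have "\<bar>Q (X w)\<bar> \<le> b" using Z(3)[OF w] exit[OF w] by (intro b) auto
        then show ?thesis using Z(2)[OF w] by (auto simp: abs_mult intro!: mult_mono)
      qed (simp add: b_def)
    qed
  qed (use Z Qm in measurable)
  then show ?thesis using b by (intro that[of b]) (auto simp: b_def)
qed

text \<open>Until the exit the path stays in the ball, so the bound on that ball dominates all cut
  versions and the cut can be removed.\<close>

lemma harmonic_exit:
  assumes P: "mart (\<lambda>s x. P x)" "P 0 = 0" "continuous_on UNIV P"
    and Z: "Z \<in> borel_measurable (pre_sigma \<sigma>)" "\<And>w. w \<in> space N \<Longrightarrow> \<bar>Z w\<bar> \<le> B" "\<And>w. w \<in> space N \<Longrightarrow> Z w \<noteq> 0 \<Longrightarrow> R w \<le> c"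
  shows "(\<integral>w. Z w * P (X w) \<partial>N) = 0"
proof -
  have ZN[measurable]: "Z \<in> borel_measurable N" by (rule measurable_pre_sigma_N[OF st(1) Z(1)])
  obtain b where b: "0 \<le> b" "\<And>x. (norm x)\<^sup>2 \<le> c \<Longrightarrow> \<bar>P x\<bar> \<le> b" and "integrable N (\<lambda>w. Z w * P (X w))"
    by (rule integrable_bounded_on_ball[OF P(3) ZN Z(2,3)]) auto
  define f where "f K w = (if \<sigma> w \<le> real K then Z w else 0) * P (W (min (\<tau> w) (real K)) w - W (\<sigma> w) w)" for K w
  have f: "integrable N (f K)" "integral\<^sup>L N (f K) = 0" for K
    unfolding f_def[abs_def] by (rule mart_truncated_0[OF P(1) st ord Z(1,2) P(2)]; assumption)+
  have Pm[measurable]: "P \<in> borel_measurable borel" by (rule borel_measurable_continuous_onI[OF P(3)])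
  have "(\<lambda>K. integral\<^sup>L N (f K)) \<longlonglongrightarrow> (\<integral>w. Z w * P (X w) \<partial>N)"
  proof (rule integral_dominated_convergence[where w="\<lambda>_. \<bar>B\<bar> * b"])
    show "(\<lambda>w. Z w * P (X w)) \<in> borel_measurable N" by measurable
    show "f K \<in> borel_measurable N" for K using f(1)[of K] by auto
    show "AE w in N. (\<lambda>K. f K w) \<longlonglongrightarrow> Z w * P (X w)" (is "AE w in N. ?P w")
    proof (rule AE_I2)
      fix w
      show "?P w"
        by (rule tendsto_eventually, use eventually_truncation[of w] in \<open>eventually_elim\<close>) (simp add: f_def)
    qed
    show "AE w in N. norm (f K w) \<le> \<bar>B\<bar> * b" (is "AE w in N. ?P w") for K
    proof (rule AE_I2)
      fix w assume w: "w \<in> space N"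
      show "?P w"
      proof (cases "Z w = 0 \<or> real K < \<sigma> w")
        case False
        then have "(norm (W (min (\<tau> w) (real K)) w - W (\<sigma> w) w))\<^sup>2 \<le> R w"
          using ord[OF w] by (intro inside[OF w]) auto
        then have "\<bar>P (W (min (\<tau> w) (real K)) w - W (\<sigma> w) w)\<bar> \<le> b" using False Z(3)[OF w] by (intro b) auto
        then show ?thesis using Z(2)[OF w] b(1) by (auto simp: f_def abs_mult intro!: mult_mono)
      qed (use b(1) in \<open>auto simp: f_def\<close>)
    qed
  qed simp
  then show ?thesis unfolding f(2) by (simp add: LIMSEQ_const_iff)
qed

end

context bm_exit
begin

text \<open>\<open>R\<close> is finite but need not be bounded. These events of the past exhaust the
  space, and on each of them the exit point is bounded.\<close>

definition level :: "nat \<Rightarrow> 'a set" where "level c = {w \<in> space (pre_sigma \<sigma>). R w \<le> real c}"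

lemma level: "level c \<in> sets (pre_sigma \<sigma>)" "w \<in> space N \<Longrightarrow> \<exists>c. w \<in> level c" "w \<in> level c \<Longrightarrow> R w \<le> real c" "level c \<subseteq> space N"
proof -
  show "level c \<in> sets (pre_sigma \<sigma>)" unfolding level_def using R_meas by measurable
qed (use real_arch_simple[of "R w"] in \<open>auto simp: level_def space_pre_sigma\<close>)

lemma weight:
  assumes B: "B \<in> sets (pre_sigma \<sigma>)" "B \<subseteq> level c"
  shows "(\<lambda>w. indicator B w * R w ^ i) \<in> borel_measurable (pre_sigma \<sigma>)"
    and "w \<in> space N \<Longrightarrow> \<bar>indicator B w * R w ^ i\<bar> \<le> real c ^ i"
    and "w \<in> space N \<Longrightarrow> indicator B w * R w ^ i \<noteq> 0 \<Longrightarrow> R w \<le> real c"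
proof -
  show "(\<lambda>w. indicator B w * R w ^ i) \<in> borel_measurable (pre_sigma \<sigma>)" using B(1) R_meas by measurable
  have R: "R w \<le> real c" if "w \<in> B" using B(2) level(3) that by blast
  show "\<bar>indicator B w * R w ^ i\<bar> \<le> real c ^ i" if "w \<in> space N"
    using R R_nonneg[OF that] by (auto split: split_indicator intro!: power_mono)
  show "R w \<le> real c" if "indicator B w * R w ^ i \<noteq> 0"
    using R that by (cases "w \<in> B") auto
qed

text \<open>The weight \<open>R ^ i\<close> is admissible because \<open>R\<close> is known at
  \<open>\<sigma>\<close>; since it equals a power of \<open>|X|^2\<close> at exit, it lets factors
  of \<open>|X|^2\<close> be pulled out of a polynomial.\<close>

lemma harmonic_exit_level:
  assumes P: "mart (\<lambda>s x. P x)" "P 0 = 0" "continuous_on UNIV P" and B: "B \<in> sets (pre_sigma \<sigma>)" "B \<subseteq> level c"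
  shows "(\<integral>w. (indicator B w * R w ^ i) * P (X w) \<partial>N) = 0"
  by (rule harmonic_exit[OF P weight[OF B]]; assumption)

lemma integrable_level:
  fixes Q :: "real ^ 'd \<Rightarrow> real"
  assumes Q: "continuous_on UNIV Q" and B: "B \<in> sets (pre_sigma \<sigma>)" "B \<subseteq> level c"
  shows "integrable N (\<lambda>w. (indicator B w * R w ^ i) * Q (X w))"
proof -
  have m: "(\<lambda>w. indicator B w * R w ^ i) \<in> borel_measurable N" by (rule measurable_pre_sigma_N[OF st(1) weight(1)[OF B]])
  show ?thesis by (rule integrable_bounded_on_ball[OF Q m weight(2,3)[OF B]]) auto
qed

lemma integrable_level_R:
  assumes B: "B \<in> sets (pre_sigma \<sigma>)" "B \<subseteq> level c"
  shows "integrable N (\<lambda>w. indicator B w * R w ^ i)"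
  using integrable_level[OF continuous_on_const[of UNIV 1] B, of i] by simp

lemma X_component_meas: "(\<lambda>w. X w $ j) \<in> borel_measurable N"
  by (intro measurable_vec_nth_compose) measurable

lemma cond_exp_cubic:
  "AE w in N. nnc (\<lambda>w. ennreal \<bar>(X w $ j) ^ 3\<bar>) w < \<infinity> \<and> real_cond_exp N (pre_sigma \<sigma>) (\<lambda>w. (X w $ j) ^ 3) w = 0"
proof (rule cond_exp_localI[OF st(1) level(1,2), where g="\<lambda>_. 0"])
  have c: "continuous_on UNIV (\<lambda>x::real ^ 'd. x $ j)" "continuous_on UNIV (\<lambda>x::real ^ 'd. (x $ j) ^ 3)" by (intro continuous_intros)+
  have "integrable N (\<lambda>w. (indicator B w * R w ^ 0) * (X w $ j) ^ 3)" if "B \<in> sets (pre_sigma \<sigma>)" "B \<subseteq> level c" for B c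
    by (rule integrable_level[OF c(2) that])
  then have i3: "integrable N (\<lambda>w. indicator B w * (X w $ j) ^ 3)" if "B \<in> sets (pre_sigma \<sigma>)" "B \<subseteq> level c" for B c
    using that by (simp only: power_0 mult_1_right)
  show "integrable N (\<lambda>w. indicator (level c) w * (X w $ j) ^ 3)" for c by (rule i3[OF level(1) order_refl])
  fix B c assume B: "B \<in> sets (pre_sigma \<sigma>)" "B \<subseteq> level c"
  have i1: "integrable N (\<lambda>w. indicator B w * R w ^ 1 * X w $ j)" by (rule integrable_level[OF c(1) B])
  have 1: "(\<integral>w. indicator B w * R w ^ 1 * X w $ j \<partial>N) = 0"
    by (rule harmonic_exit_level[OF _ _ c(1) B]) (use mart_1[of 1 j] in \<open>simp_all\<close>)
  have "(\<integral>w. indicator B w * R w ^ 0 * ((real CARD('d) + 2) * (X w $ j) ^ 3 - 3 * ((norm (X w))\<^sup>2 * X w $ j)) \<partial>N) = 0"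
    by (rule harmonic_exit_level[OF mart_cubic _ _ B]) (auto intro!: continuous_intros)
  also have "(\<integral>w. indicator B w * R w ^ 0 * ((real CARD('d) + 2) * (X w $ j) ^ 3 - 3 * ((norm (X w))\<^sup>2 * X w $ j)) \<partial>N) =
     (\<integral>w. (real CARD('d) + 2) * (indicator B w * (X w $ j) ^ 3) - 3 * (indicator B w * R w ^ 1 * X w $ j) \<partial>N)"
    by (intro Bochner_Integration.integral_cong) (simp_all add: exit algebra_simps)
  also have "\<dots> = (real CARD('d) + 2) * (\<integral>w. indicator B w * (X w $ j) ^ 3 \<partial>N) - 3 * (\<integral>w. indicator B w * R w ^ 1 * X w $ j \<partial>N)"
    using i1 i3[OF B] by (subst Bochner_Integration.integral_diff) (auto simp del: power_one_right)
  finally have "(real CARD('d) + 2) * (\<integral>w. indicator B w * (X w $ j) ^ 3 \<partial>N) = 0" unfolding 1 by simp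
  moreover have "real CARD('d) + 2 \<noteq> 0" using of_nat_0_le_iff[of "CARD('d)", where ?'a=real] by linarith
  ultimately show "(\<integral>w. indicator B w * (X w $ j) ^ 3 \<partial>N) = (\<integral>w. indicator B w * 0 \<partial>N)" by simp
qed (use X_component_meas in auto)

text \<open>With \<open>|X|^2 = R\<close> three martingales give linear equations for the mean of
  \<open>X_j^4\<close>, the mean of the sum of fourth powers and the mean of \<open>R X_j^2\<close>:
  \<open>d E2 = ER\<close>, \<open>(d + 2) ES = 3 ER\<close> and
  \<open>(d + 4) E4 + ES = 6 E2\<close>. Their solution for \<open>E4\<close> is the claim.\<close>

lemma cond_exp_quartic:
  "AE w in N. nnc (\<lambda>w. ennreal \<bar>\<bar>X w $ j\<bar> ^ 4\<bar>) w < \<infinity> \<and>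
     real_cond_exp N (pre_sigma \<sigma>) (\<lambda>w. \<bar>X w $ j\<bar> ^ 4) w = 3 * (R w)\<^sup>2 / (real CARD('d) * (real CARD('d) + 2))"
proof (rule cond_exp_localI[OF st(1) level(1,2)])
  let ?d = "real CARD('d)"
  have d: "0 < ?d" by simp
  have a4: "\<bar>X w $ j\<bar> ^ 4 = (X w $ j) ^ 4" for w by (simp add: power_even_abs)
  have c: "continuous_on UNIV (\<lambda>x::real ^ 'd. (x $ k)\<^sup>2)" "continuous_on UNIV (\<lambda>x::real ^ 'd. (x $ k) ^ 4)"
    "continuous_on UNIV (\<lambda>x::real ^ 'd. \<Sum>k\<in>UNIV. (x $ k) ^ 4)" for k by (intro continuous_intros)+
  have "integrable N (\<lambda>w. (indicator B w * R w ^ 0) * (X w $ k) ^ 4)" if "B \<in> sets (pre_sigma \<sigma>)" "B \<subseteq> level c" for B c k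
    by (rule integrable_level[OF c(2) that])
  then have i4: "integrable N (\<lambda>w. indicator B w * (X w $ k) ^ 4)" if "B \<in> sets (pre_sigma \<sigma>)" "B \<subseteq> level c" for B c k
    using that by (simp only: power_0 mult_1_right)
  have "integrable N (\<lambda>w. (indicator B w * R w ^ 0) * (\<Sum>k\<in>UNIV. (X w $ k) ^ 4))" if "B \<in> sets (pre_sigma \<sigma>)" "B \<subseteq> level c" for B c
    by (rule integrable_level[OF c(3) that])
  then have iS: "integrable N (\<lambda>w. indicator B w * (\<Sum>k\<in>UNIV. (X w $ k) ^ 4))" if "B \<in> sets (pre_sigma \<sigma>)" "B \<subseteq> level c" for B c
    using that by (simp only: power_0 mult_1_right)
  have iR: "integrable N (\<lambda>w. indicator B w * (R w)\<^sup>2)" if "B \<in> sets (pre_sigma \<sigma>)" "B \<subseteq> level c" for B c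
    by (rule integrable_level_R[OF that])
  show "integrable N (\<lambda>w. indicator (level c) w * \<bar>X w $ j\<bar> ^ 4)" for c unfolding a4 by (rule i4[OF level(1) order_refl])
  have "integrable N (\<lambda>w. (3 / (?d * (?d + 2))) * (indicator (level c) w * (R w)\<^sup>2))" for c
    by (intro integrable_mult_right iR[OF level(1) order_refl])
  then show "integrable N (\<lambda>w. indicator (level c) w * (3 * (R w)\<^sup>2 / (?d * (?d + 2))))" for c by (simp add: mult_ac)
  show "(\<lambda>w. 3 * (R w)\<^sup>2 / (?d * (?d + 2))) \<in> borel_measurable (pre_sigma \<sigma>)" using R_meas by measurable
  fix B c assume B: "B \<in> sets (pre_sigma \<sigma>)" "B \<subseteq> level c"
  have i2: "integrable N (\<lambda>w. indicator B w * R w ^ 1 * (X w $ j)\<^sup>2)" by (rule integrable_level[OF c(1) B])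
  define S where "S w = (\<Sum>k\<in>UNIV. (X w $ k) ^ 4)" for w
  define E4 where "E4 = (\<integral>w. indicator B w * (X w $ j) ^ 4 \<partial>N)"
  define ES where "ES = (\<integral>w. indicator B w * S w \<partial>N)"
  define E2 where "E2 = (\<integral>w. indicator B w * R w ^ 1 * (X w $ j)\<^sup>2 \<partial>N)"
  define ER where "ER = (\<integral>w. indicator B w * (R w)\<^sup>2 \<partial>N)"
  have iS': "integrable N (\<lambda>w. indicator B w * S w)" unfolding S_def by (rule iS[OF B])
  have n4: "norm (X w) ^ 4 = (R w)\<^sup>2" if "w \<in> space N" for w
    unfolding exit[OF that, symmetric] by (simp add: power_mult[symmetric])
  have "0 = (\<integral>w. indicator B w * R w ^ 1 * (?d * (X w $ j)\<^sup>2 - (norm (X w))\<^sup>2) \<partial>N)"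
    by (rule harmonic_exit_level[OF mart_square _ _ B, symmetric]) (auto intro!: continuous_intros)
  also have "\<dots> = (\<integral>w. ?d * (indicator B w * R w ^ 1 * (X w $ j)\<^sup>2) - indicator B w * (R w)\<^sup>2 \<partial>N)"
    by (intro Bochner_Integration.integral_cong) (simp_all add: exit right_diff_distrib mult_ac power2_eq_square[of "R _"])
  also have "\<dots> = ?d * E2 - ER"
    using i2 iR[OF B] unfolding E2_def ER_def by (subst Bochner_Integration.integral_diff) (auto simp del: power_one_right)
  finally have e2: "?d * E2 = ER" by simp
  have "0 = (\<integral>w. indicator B w * R w ^ 0 * ((?d + 2) * (\<Sum>k\<in>UNIV. (X w $ k) ^ 4) - 3 * norm (X w) ^ 4) \<partial>N)"
    by (rule harmonic_exit_level[OF mart_quartic _ _ B, symmetric]) (auto intro!: continuous_intros)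
  also have "\<dots> = (\<integral>w. (?d + 2) * (indicator B w * S w) - 3 * (indicator B w * (R w)\<^sup>2) \<partial>N)"
    by (intro Bochner_Integration.integral_cong) (simp_all add: n4 S_def algebra_simps)
  also have "\<dots> = (?d + 2) * ES - 3 * ER"
    using iS' iR[OF B] unfolding ES_def ER_def by (subst Bochner_Integration.integral_diff) auto
  finally have eS: "(?d + 2) * ES = 3 * ER" by simp
  have "0 = (\<integral>w. indicator B w * R w ^ 0 * ((?d + 4) * (X w $ j) ^ 4 + (\<Sum>k\<in>UNIV. (X w $ k) ^ 4) - 6 * ((norm (X w))\<^sup>2 * (X w $ j)\<^sup>2)) \<partial>N)"
    by (rule harmonic_exit_level[OF mart_quartic_coordinate _ _ B, symmetric]) (auto intro!: continuous_intros)
  also have "\<dots> = (\<integral>w. ((?d + 4) * (indicator B w * (X w $ j) ^ 4) + indicator B w * S w) - 6 * (indicator B w * R w ^ 1 * (X w $ j)\<^sup>2) \<partial>N)"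
    by (intro Bochner_Integration.integral_cong) (simp_all add: exit S_def algebra_simps)
  also have "\<dots> = (?d + 4) * E4 + ES - 6 * E2"
    using i2 i4[OF B, of j] iS' unfolding ES_def E4_def E2_def
    by (subst Bochner_Integration.integral_diff) (auto simp del: power_one_right)
  finally have e4: "(?d + 4) * E4 + ES = 6 * E2" by simp
  have E2v: "E2 = ER / ?d" using e2 d by (simp add: field_simps)
  have ESv: "ES = 3 * ER / (?d + 2)" using eS d by (simp add: field_simps)
  have "(?d + 4) * E4 = (?d + 4) * (3 * ER / (?d * (?d + 2)))"
  proof -
    have "6 * (ER / ?d) - 3 * ER / (?d + 2) = (?d + 4) * (3 * ER / (?d * (?d + 2)))"
      using d by (simp add: field_simps)
    then show ?thesis using e4 unfolding E2v ESv by linarith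
  qed
  moreover have "?d + 4 \<noteq> 0" using d by linarith
  ultimately have "E4 = 3 * ER / (?d * (?d + 2))" by (metis mult_cancel_left)
  moreover have "(\<integral>w. indicator B w * (3 * (R w)\<^sup>2 / (?d * (?d + 2))) \<partial>N) = (\<integral>w. 3 / (?d * (?d + 2)) * (indicator B w * (R w)\<^sup>2) \<partial>N)"
    by (rule Bochner_Integration.integral_cong) (simp_all add: mult_ac)
  moreover have "(\<integral>w. 3 / (?d * (?d + 2)) * (indicator B w * (R w)\<^sup>2) \<partial>N) = 3 / (?d * (?d + 2)) * ER"
    unfolding ER_def by (rule integral_mult_right_zero)
  ultimately show "(\<integral>w. indicator B w * \<bar>X w $ j\<bar> ^ 4 \<partial>N) = (\<integral>w. indicator B w * (3 * (R w)\<^sup>2 / (?d * (?d + 2))) \<partial>N)"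
    unfolding a4 E4_def by simp
qed (use X_component_meas in auto)

definition cross :: "'d \<Rightarrow> 'd \<Rightarrow> 'a \<Rightarrow> real" where
  "cross i j w = (LINT s:{\<sigma> w..\<tau> w}|lborel. (W s w $ i - W (\<sigma> w) w $ i) * (W s w $ j - W (\<sigma> w) w $ j))"

text \<open>As \<open>x_i x_j\<close> is harmonic, the integrand at each time before the exit may be
  replaced, in the mean, by its value at the exit. The integral then becomes the duration times
  \<open>X_i X_j\<close>. By \<open>mart_cross\<close> its mean is that of \<open>R X_i X_j\<close>
  divided by \<open>d + 4\<close>, which is 0.\<close>

lemma cross_exit:
  assumes ij: "i \<noteq> j" and B: "B \<in> sets (pre_sigma \<sigma>)" "B \<subseteq> level c"
  shows "integrable N (\<lambda>w. indicator B w * cross i j w)" "(\<integral>w. indicator B w * cross i j w \<partial>N) = 0"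
    "cross i j \<in> borel_measurable N"
proof -
  let ?d = "real CARD('d)"
  define h where "h x = x $ i * x $ j" for x :: "real ^ 'd"
  have hc: "continuous_on UNIV h" unfolding h_def by (intro continuous_intros)
  have hm[measurable]: "h \<in> borel_measurable borel" by (rule borel_measurable_continuous_onI[OF hc])
  have hb: "\<bar>h x\<bar> \<le> (norm x)\<^sup>2" for x
    unfolding h_def abs_mult power2_eq_square by (intro mult_mono component_le_norm_cart) auto
  have BN[measurable]: "B \<in> sets N" by (rule set_N[OF B(1)])
  have Bc: "R w \<le> real c" if "w \<in> B" for w using B(2) level(3) that by blast
  have mart_h: "mart (\<lambda>s x. h x)" using mart_2[OF ij, of 1 1] by (simp add: h_def)
  have h0: "h 0 = 0" by (simp add: h_def)
  interpret pair_sigma_finite lborel N ..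
  define Y where "Y s w = W (max 0 s) w - W (\<sigma> w) w" for s w
  have Ym[measurable]: "(\<lambda>x. Y (fst x) (snd x)) \<in> borel_measurable (borel \<Otimes>\<^sub>M N)"
    unfolding Y_def by (intro borel_measurable_diff measurable_path_joint measurable_W continuous_W) measurable
  \<comment> \<open>The right end, a null set of times, is left out so that the indicator is decided
    at the intermediate time \<open>\<rho>\<close> used below.\<close>
  define H where "H s w = indicator {\<sigma> w..<\<tau> w} s * h (Y s w)" for s w
  have Hm[measurable]: "(\<lambda>x. H (fst x) (snd x)) \<in> borel_measurable (borel \<Otimes>\<^sub>M N)"
    unfolding H_def indicator_def atLeastLessThan_iff by measurable
  have cross_eq: "cross i j w = (\<integral>s. H s w \<partial>lborel)" if w: "w \<in> space N" for w
    unfolding cross_def set_lebesgue_integral_def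
  proof (rule integral_cong_AE)
    have [measurable]: "(\<lambda>s. Y s w) \<in> borel_measurable borel" using measurable_compose[OF measurable_Pair2'[OF w] Ym] by simp
    have "(\<lambda>s. indicator {\<sigma> w..\<tau> w} s *\<^sub>R h (Y s w)) \<in> borel_measurable lborel" by measurable
    moreover have "indicator {\<sigma> w..\<tau> w} s *\<^sub>R h (Y s w) = indicator {\<sigma> w..\<tau> w} s *\<^sub>R ((W s w $ i - W (\<sigma> w) w $ i) * (W s w $ j - W (\<sigma> w) w $ j))" for s
      using ord[OF w] by (auto simp: h_def Y_def max_def split: split_indicator)
    ultimately show "(\<lambda>s. indicator {\<sigma> w..\<tau> w} s *\<^sub>R ((W s w $ i - W (\<sigma> w) w $ i) * (W s w $ j - W (\<sigma> w) w $ j))) \<in> borel_measurable lborel" by (simp only:)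
    show "(\<lambda>s. H s w) \<in> borel_measurable lborel" unfolding H_def by measurable
    show "AE s in lborel. indicator {\<sigma> w..\<tau> w} s *\<^sub>R ((W s w $ i - W (\<sigma> w) w $ i) * (W s w $ j - W (\<sigma> w) w $ j)) = H s w"
      using AE_lborel_singleton[of "\<tau> w"]
    proof eventually_elim
      case (elim s)
      then show ?case using ord[OF w] by (auto simp: H_def h_def Y_def max_def split: split_indicator)
    qed
  qed
  have cm: "(\<lambda>w. \<integral>s. H s w \<partial>lborel) \<in> borel_measurable N"
  proof (rule lborel.borel_measurable_lebesgue_integral)
    have sw: "(\<lambda>x. (snd x, fst x)) \<in> N \<Otimes>\<^sub>M lborel \<rightarrow>\<^sub>M borel \<Otimes>\<^sub>M N" by measurable
    from measurable_compose[OF sw Hm] show "(\<lambda>(w, s). H s w) \<in> borel_measurable (N \<Otimes>\<^sub>M lborel)"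
      by (simp add: case_prod_unfold)
  qed
  show "cross i j \<in> borel_measurable N" by (rule measurable_cong[THEN iffD2, OF _ cm]) (rule cross_eq)
  have \<Delta>fin: "integrable N (\<lambda>w. indicator B w * \<Delta> w)"
  proof (rule integrableI_nonneg)
    have "(\<integral>\<^sup>+w. ennreal (indicator B w * \<Delta> w) \<partial>N) = (\<integral>\<^sup>+w. indicator B w * ennreal (\<Delta> w) \<partial>N)"
      by (intro nn_integral_cong) (auto split: split_indicator)
    also have "\<dots> = (\<integral>\<^sup>+w. indicator B w * nnc (\<lambda>w. ennreal (\<Delta> w)) w \<partial>N)"
      by (rule S.nn_cond_exp_intg[symmetric]) (use B in measurable)
    also have "\<dots> \<le> (\<integral>\<^sup>+w. ennreal (real c / ?d) \<partial>N)"
    proof (rule nn_integral_mono_AE, use cond_exp_duration in \<open>eventually_elim\<close>)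
      case (elim w)
      then show ?case using Bc[of w] by (auto split: split_indicator intro!: ennreal_leI divide_right_mono)
    qed
    also have "\<dots> < \<infinity>" by (simp add: emeasure_space_1)
    finally show "(\<integral>\<^sup>+w. ennreal (indicator B w * \<Delta> w) \<partial>N) < \<infinity>" .
  qed (use ord in \<open>auto intro!: AE_I2\<close>)
  have YX: "indicator B w * \<bar>H s w\<bar> \<le> real c * (indicator B w * indicator {\<sigma> w..<\<tau> w} s)" if w: "w \<in> space N" for s w
  proof (cases "w \<in> B \<and> s \<in> {\<sigma> w..<\<tau> w}")
    case True
    then have "(norm (Y s w))\<^sup>2 \<le> R w" using ord[OF w] inside[OF w, of s] by (auto simp: Y_def max_def)
    then show ?thesis using True hb[of "Y s w"] Bc[of w] by (auto simp: H_def)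
  qed (auto simp: H_def)
  have ind_int: "(\<integral>\<^sup>+s. indicator {\<sigma> w..<\<tau> w} s \<partial>lborel) = ennreal (\<Delta> w)" if "w \<in> space N" for w using ord[OF that] by simp
  have im: "(\<lambda>x. indicator {\<sigma> (snd x)..<\<tau> (snd x)} (fst x) :: real) \<in> borel_measurable (lborel \<Otimes>\<^sub>M N)"
    unfolding indicator_def atLeastLessThan_iff by measurable
  have iI: "integrable (lborel \<Otimes>\<^sub>M N) (\<lambda>x. indicator B (snd x) * indicator {\<sigma> (snd x)..<\<tau> (snd x)} (fst x) :: real)"
  proof (rule integrableI_nonneg)
    show m: "(\<lambda>x. indicator B (snd x) * indicator {\<sigma> (snd x)..<\<tau> (snd x)} (fst x) :: real) \<in> borel_measurable (lborel \<Otimes>\<^sub>M N)" using im by measurable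
    have "(\<integral>\<^sup>+x. ennreal (indicator B (snd x) * indicator {\<sigma> (snd x)..<\<tau> (snd x)} (fst x)) \<partial>(lborel \<Otimes>\<^sub>M N)) =
      (\<integral>\<^sup>+w. (\<integral>\<^sup>+s. ennreal (indicator B w * indicator {\<sigma> w..<\<tau> w} s) \<partial>lborel) \<partial>N)"
      by (subst nn_integral_snd[symmetric]) (use m in auto)
    also have "\<dots> = (\<integral>\<^sup>+w. ennreal (indicator B w * \<Delta> w) \<partial>N)"
    proof (rule nn_integral_cong)
      fix w assume w: "w \<in> space N"
      have "(\<integral>\<^sup>+s. ennreal (indicator B w * indicator {\<sigma> w..<\<tau> w} s) \<partial>lborel) = (\<integral>\<^sup>+s. indicator B w * indicator {\<sigma> w..<\<tau> w} s \<partial>lborel)"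
        by (intro nn_integral_cong) (auto split: split_indicator)
      also have "\<dots> = indicator B w * ennreal (\<Delta> w)" by (subst nn_integral_cmult) (auto simp: ind_int[OF w])
      finally show "(\<integral>\<^sup>+s. ennreal (indicator B w * indicator {\<sigma> w..<\<tau> w} s) \<partial>lborel) = ennreal (indicator B w * \<Delta> w)" by (auto split: split_indicator)
    qed
    also have "\<dots> < \<infinity>" using \<Delta>fin ord by (subst nn_integral_eq_integral) (auto intro!: AE_I2)
    finally show "(\<integral>\<^sup>+x. ennreal (indicator B (snd x) * indicator {\<sigma> (snd x)..<\<tau> (snd x)} (fst x)) \<partial>(lborel \<Otimes>\<^sub>M N)) < \<infinity>" .
  qed auto
  have iH: "integrable (lborel \<Otimes>\<^sub>M N) (\<lambda>x. indicator B (snd x) * H (fst x) (snd x))"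
  proof (rule Bochner_Integration.integrable_bound[OF integrable_mult_right[OF iI, of "real c"]])
    show "(\<lambda>x. indicator B (snd x) * H (fst x) (snd x)) \<in> borel_measurable (lborel \<Otimes>\<^sub>M N)" using Hm by measurable
    show "AE x in lborel \<Otimes>\<^sub>M N. norm (indicator B (snd x) * H (fst x) (snd x)) \<le> norm (real c * (indicator B (snd x) * indicator {\<sigma> (snd x)..<\<tau> (snd x)} (fst x)))"
      using YX by (intro AE_I2) (auto simp: space_pair_measure abs_mult)
  qed
  define K where "K s w = indicator B w * (indicator {\<sigma> w..<\<tau> w} s * h (X w))" for s w
  have Km: "(\<lambda>x. K (fst x) (snd x)) \<in> borel_measurable (lborel \<Otimes>\<^sub>M N)" unfolding K_def using im by measurable
  have Kb: "\<bar>K s w\<bar> \<le> real c * (indicator B w * indicator {\<sigma> w..<\<tau> w} s)" if w: "w \<in> space N" for s w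
    using hb[of "X w"] exit[OF w] Bc[of w] by (auto simp: K_def split: split_indicator)
  have iK: "integrable (lborel \<Otimes>\<^sub>M N) (\<lambda>x. K (fst x) (snd x))"
  proof (rule Bochner_Integration.integrable_bound[OF integrable_mult_right[OF iI, of "real c"] Km])
    show "AE x in lborel \<Otimes>\<^sub>M N. norm (K (fst x) (snd x)) \<le> norm (real c * (indicator B (snd x) * indicator {\<sigma> (snd x)..<\<tau> (snd x)} (fst x)))"
      using Kb by (intro AE_I2) (auto simp: space_pair_measure)
  qed
  \<comment> \<open>For fixed \<open>s\<close>, optional stopping between
    \<open>\<rho> = max \<sigma> (min s \<tau>)\<close> and \<open>\<tau>\<close> exchanges the
    product at time \<open>s\<close> for the one at exit, on the event
    \<open>\<sigma> \<le> s < \<tau>\<close>.\<close>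
  have slice: "(\<integral>w. indicator B w * H s w \<partial>N) = (\<integral>w. K s w \<partial>N)" for s
  proof (cases "0 \<le> s")
    case False
    then have "indicator {\<sigma> w..<\<tau> w} s = (0::real)" if "w \<in> space N" for w using ord[OF that] by auto
    then show ?thesis by (intro Bochner_Integration.integral_cong) (auto simp: H_def K_def)
  next
    case True
    define \<rho> where "\<rho> w = max (\<sigma> w) (min s (\<tau> w))" for w
    have st\<rho>: "stopping_time F \<rho>" unfolding \<rho>_def[abs_def] by (intro stopping_time_max stopping_time_min st stopping_time_const)
    have \<rho>: "0 \<le> \<sigma> w \<and> \<sigma> w \<le> \<rho> w \<and> \<rho> w \<le> \<tau> w" if "w \<in> space N" for w using ord[OF that] by (auto simp: \<rho>_def)
    define Z :: "'a \<Rightarrow> real" where "Z w = indicator B w * (indicator {w \<in> space (pre_sigma \<sigma>). \<sigma> w \<le> s} w * indicator {w \<in> space (pre_sigma \<rho>). \<rho> w < \<tau> w} w)" for w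
    have Zm: "Z \<in> borel_measurable (pre_sigma \<rho>)"
    proof -
      have "{w \<in> space (pre_sigma \<sigma>). \<sigma> w \<le> s} \<in> sets (pre_sigma \<sigma>)" using measurable_stopping_time_pre_sigma[OF st(1)] by measurable
      then have "{w \<in> space (pre_sigma \<sigma>). \<sigma> w \<le> s} \<in> sets (pre_sigma \<rho>)" "B \<in> sets (pre_sigma \<rho>)"
        using mono_pre_sigma[OF st(1) st\<rho>] \<rho> B(1) by auto
      moreover have "{w \<in> space (pre_sigma \<rho>). \<rho> w < \<tau> w} \<in> sets (pre_sigma \<rho>)"
        using stopping_time_less[OF st\<rho> st(2)] by (simp add: pred_def)
      ultimately show ?thesis unfolding Z_def[abs_def] by measurable
    qed
    have Zb: "\<bar>Z w\<bar> \<le> 1" for w by (auto simp: Z_def split: split_indicator)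
    have Zv: "Z w = indicator B w * indicator {\<sigma> w..<\<tau> w} s" if "w \<in> space N" for w
      using that ord[OF that] by (auto simp: Z_def \<rho>_def space_pre_sigma split: split_indicator)
    have Z\<rho>: "\<rho> w = s \<and> w \<in> B \<and> \<sigma> w \<le> s \<and> s < \<tau> w" if "w \<in> space N" "Z w \<noteq> 0" for w
      using that Zv[OF that(1)] by (auto simp: \<rho>_def split: split_indicator_asm)
    have [measurable]: "Z \<in> borel_measurable N" "\<rho> \<in> borel_measurable N"
      using measurable_pre_sigma_N[OF st\<rho> Zm] measurable_stopping_time_N[OF st\<rho>] by auto
    have [measurable]: "(\<lambda>w. W (\<rho> w) w) \<in> borel_measurable N"
    proof (rule measurable_W_random)
      show "0 \<le> \<rho> w" if "w \<in> space N" for w using \<rho>[OF that] by linarith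
    qed measurable
    note m = mart_truncated[OF mart_h st(1) st\<rho> st(2) \<rho> Zm Zb]
    have sH: "indicator B w * H s w = Z w * h (W (\<rho> w) w - W (\<sigma> w) w)" if w: "w \<in> space N" for w
      using Zv[OF w] Z\<rho>[OF w] True by (cases "Z w = 0") (auto simp: H_def Y_def split: split_indicator_asm)
    have sK: "K s w = Z w * h (X w)" if w: "w \<in> space N" for w
      using Zv[OF w] by (simp add: K_def)
    have b: "\<bar>(if \<rho> w \<le> real k then Z w else 0) * h (W u w - W (\<sigma> w) w)\<bar> \<le> real c"
      if w: "w \<in> space N" and u: "Z w \<noteq> 0 \<Longrightarrow> \<rho> w \<le> real k \<Longrightarrow> \<sigma> w \<le> u \<and> u \<le> \<tau> w" for w k u
    proof (cases "Z w \<noteq> 0 \<and> \<rho> w \<le> real k")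
      case True
      then have "\<bar>h (W u w - W (\<sigma> w) w)\<bar> \<le> real c"
        using hb[of "W u w - W (\<sigma> w) w"] inside[OF w, of u] u Z\<rho>[OF w] Bc[of w] by (auto intro: order_trans)
      then have "\<bar>Z w\<bar> * \<bar>h (W u w - W (\<sigma> w) w)\<bar> \<le> 1 * real c" using Zb[of w] by (intro mult_mono) auto
      then show ?thesis using True by (simp add: abs_mult)
    qed auto
    have ev: "\<forall>\<^sub>F k in sequentially. \<rho> w \<le> real k \<and> min (\<tau> w) (real k) = \<tau> w" for w
    proof -
      have "\<forall>\<^sub>F k in sequentially. \<rho> w \<le> real k" using eventually_min_eq[of "\<rho> w"] by eventually_elim (auto simp: min_def split: if_splits)
      with eventually_min_eq[of "\<tau> w"] show ?thesis by eventually_elim auto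
    qed
    have l1: "(\<lambda>k. \<integral>w. (if \<rho> w \<le> real k then Z w else 0) * h (W (min (\<tau> w) (real k)) w - W (\<sigma> w) w) \<partial>N) \<longlonglongrightarrow> (\<integral>w. Z w * h (X w) \<partial>N)"
    proof (rule integral_dominated_convergence[where w="\<lambda>_. real c"])
      show "AE w in N. (\<lambda>k. (if \<rho> w \<le> real k then Z w else 0) * h (W (min (\<tau> w) (real k)) w - W (\<sigma> w) w)) \<longlonglongrightarrow> Z w * h (X w)" (is "AE w in N. ?P w")
      proof (rule AE_I2)
        fix w show "?P w"
          by (rule tendsto_eventually, use ev[of w] in \<open>eventually_elim\<close>) simp
      qed
      show "AE w in N. norm ((if \<rho> w \<le> real k then Z w else 0) * h (W (min (\<tau> w) (real k)) w - W (\<sigma> w) w)) \<le> real c" for k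
        unfolding real_norm_def by (rule AE_I2, rule b) (use \<rho> in fastforce)+
    qed measurable
    have l2: "(\<lambda>k. \<integral>w. (if \<rho> w \<le> real k then Z w else 0) * h (W (\<rho> w) w - W (\<sigma> w) w) \<partial>N) \<longlonglongrightarrow> (\<integral>w. Z w * h (W (\<rho> w) w - W (\<sigma> w) w) \<partial>N)"
    proof (rule integral_dominated_convergence[where w="\<lambda>_. real c"])
      show "AE w in N. (\<lambda>k. (if \<rho> w \<le> real k then Z w else 0) * h (W (\<rho> w) w - W (\<sigma> w) w)) \<longlonglongrightarrow> Z w * h (W (\<rho> w) w - W (\<sigma> w) w)" (is "AE w in N. ?P w")
      proof (rule AE_I2)
        fix w show "?P w"
          by (rule tendsto_eventually, use ev[of w] in \<open>eventually_elim\<close>) simp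
      qed
      show "AE w in N. norm ((if \<rho> w \<le> real k then Z w else 0) * h (W (\<rho> w) w - W (\<sigma> w) w)) \<le> real c" for k
        unfolding real_norm_def by (rule AE_I2, rule b) (use \<rho> in fastforce)+
    qed measurable
    have "(\<integral>w. Z w * h (X w) \<partial>N) = (\<integral>w. Z w * h (W (\<rho> w) w - W (\<sigma> w) w) \<partial>N)"
      by (rule LIMSEQ_unique[OF l1]) (use l2 m(3) in simp)
    moreover have "(\<integral>w. indicator B w * H s w \<partial>N) = (\<integral>w. Z w * h (W (\<rho> w) w - W (\<sigma> w) w) \<partial>N)"
      by (rule Bochner_Integration.integral_cong) (simp_all add: sH)
    moreover have "(\<integral>w. K s w \<partial>N) = (\<integral>w. Z w * h (X w) \<partial>N)"
      by (rule Bochner_Integration.integral_cong) (simp_all add: sK)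
    ultimately show ?thesis by simp
  qed
  have iH': "integrable (lborel \<Otimes>\<^sub>M N) (\<lambda>(s, w). indicator B w * H s w)" using iH by (simp add: case_prod_unfold)
  have iK': "integrable (lborel \<Otimes>\<^sub>M N) (\<lambda>(s, w). K s w)" using iK by (simp add: case_prod_unfold)
  have eq1: "(\<integral>s. indicator B w * H s w \<partial>lborel) = indicator B w * cross i j w" if "w \<in> space N" for w
    unfolding cross_eq[OF that] by simp
  have "integrable N (\<lambda>w. \<integral>s. indicator B w * H s w \<partial>lborel)" by (rule integrable_snd[OF iH'])
  then show "integrable N (\<lambda>w. indicator B w * cross i j w)"
    by (subst Bochner_Integration.integrable_cong[OF refl eq1[symmetric]])
  have "(\<integral>w. indicator B w * cross i j w \<partial>N) = (\<integral>w. (\<integral>s. indicator B w * H s w \<partial>lborel) \<partial>N)"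
    by (rule Bochner_Integration.integral_cong) (rule refl, rule eq1[symmetric])
  also have "\<dots> = (\<integral>s. (\<integral>w. indicator B w * H s w \<partial>N) \<partial>lborel)" by (rule Fubini_integral[OF iH'])
  also have "\<dots> = (\<integral>s. (\<integral>w. K s w \<partial>N) \<partial>lborel)" by (simp add: slice)
  also have "\<dots> = (\<integral>w. (\<integral>s. K s w \<partial>lborel) \<partial>N)" by (rule Fubini_integral[OF iK', symmetric])
  also have "\<dots> = (\<integral>w. indicator B w * (\<Delta> w * h (X w)) \<partial>N)"
  proof (rule Bochner_Integration.integral_cong)
    fix w assume "w \<in> space N"
    then show "(\<integral>s. K s w \<partial>lborel) = indicator B w * (\<Delta> w * h (X w))" using ord[of w] by (simp add: K_def)
  qed simp
  finally have main: "(\<integral>w. indicator B w * cross i j w \<partial>N) = (\<integral>w. indicator B w * (\<Delta> w * h (X w)) \<partial>N)" .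
  \<comment> \<open>The martingale of \<open>mart_cross\<close> at the cut time. On \<open>B\<close>
    it is dominated by a constant plus a multiple of the duration, integrable by
    \<open>\<Delta>fin\<close>.\<close>
  define f where "f k w = (if \<sigma> w \<le> real k then indicator B w else 0) * ((norm (W (min (\<tau> w) (real k)) w - W (\<sigma> w) w))\<^sup>2 * h (W (min (\<tau> w) (real k)) w - W (\<sigma> w) w) - (?d + 4) * ((min (\<tau> w) (real k) - \<sigma> w) * h (W (min (\<tau> w) (real k)) w - W (\<sigma> w) w)))" for k w
  have YB: "(indicator B :: 'a \<Rightarrow> real) \<in> borel_measurable (pre_sigma \<sigma>)" "\<bar>indicator B w :: real\<bar> \<le> 1" for w using B(1) by (auto split: split_indicator)
  have f: "integrable N (f k)" "integral\<^sup>L N (f k) = 0" for k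
    unfolding f_def[abs_def] h_def by (rule mart_truncated_0[OF mart_cross[OF ij] st ord YB]; simp)+
  have ih: "integrable N (\<lambda>w. indicator B w * (\<Delta> w * h (X w)))"
  proof (rule Bochner_Integration.integrable_bound[OF integrable_mult_right[OF \<Delta>fin, of "real c"]])
    show "AE w in N. norm (indicator B w * (\<Delta> w * h (X w))) \<le> norm (real c * (indicator B w * \<Delta> w))" (is "AE w in N. ?P w")
    proof (rule AE_I2)
      fix w assume w: "w \<in> space N"
      show "?P w"
      proof (cases "w \<in> B")
        case True
        then have "\<bar>h (X w)\<bar> \<le> real c" using hb[of "X w"] exit[OF w] Bc[of w] by auto
        then have "\<Delta> w * \<bar>h (X w)\<bar> \<le> \<Delta> w * real c" using ord[OF w] by (intro mult_left_mono) auto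
        then show ?thesis using True ord[OF w] by (simp add: abs_mult mult.commute)
      qed simp
    qed
  qed measurable
  have iR: "integrable N (\<lambda>w. indicator B w * R w ^ 1 * h (X w))" by (rule integrable_level[OF hc B])
  have R0: "(\<integral>w. indicator B w * R w ^ 1 * h (X w) \<partial>N) = 0" by (rule harmonic_exit_level[OF mart_h h0 hc B])
  have "(\<lambda>k. integral\<^sup>L N (f k)) \<longlonglongrightarrow> (\<integral>w. indicator B w * R w ^ 1 * h (X w) - (?d + 4) * (indicator B w * (\<Delta> w * h (X w))) \<partial>N)"
  proof (rule integral_dominated_convergence[where w="\<lambda>w. real c * real c + (?d + 4) * (real c * (indicator B w * \<Delta> w))"])
    show "f k \<in> borel_measurable N" for k using f(1)[of k] by auto
    show "integrable N (\<lambda>w. real c * real c + (?d + 4) * (real c * (indicator B w * \<Delta> w)))" using \<Delta>fin by auto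
    show "AE w in N. (\<lambda>k. f k w) \<longlonglongrightarrow> indicator B w * R w ^ 1 * h (X w) - (?d + 4) * (indicator B w * (\<Delta> w * h (X w)))" (is "AE w in N. ?P w")
    proof (rule AE_I2)
      fix w assume w: "w \<in> space N"
      show "?P w"
        by (rule tendsto_eventually, use eventually_truncation[of w] in \<open>eventually_elim\<close>) (simp add: f_def exit[OF w] algebra_simps)
    qed
    show "AE w in N. norm (f k w) \<le> real c * real c + (?d + 4) * (real c * (indicator B w * \<Delta> w))" (is "AE w in N. ?P w") for k
    proof (rule AE_I2)
      fix w assume w: "w \<in> space N"
      show "?P w"
      proof (cases "w \<in> B \<and> \<sigma> w \<le> real k")
        case True
        define y where "y = W (min (\<tau> w) (real k)) w - W (\<sigma> w) w"
        define r where "r = min (\<tau> w) (real k) - \<sigma> w"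
        have r: "0 \<le> r" "r \<le> \<Delta> w" using True ord[OF w] by (auto simp: r_def)
        have y: "(norm y)\<^sup>2 \<le> real c" unfolding y_def using inside[OF w, of "min (\<tau> w) (real k)"] True ord[OF w] Bc[of w] by auto
        then have hy: "\<bar>h y\<bar> \<le> real c" using hb[of y] by simp
        have "\<bar>f k w\<bar> \<le> \<bar>(norm y)\<^sup>2 * h y\<bar> + \<bar>(?d + 4) * (r * h y)\<bar>"
          using True by (simp add: f_def y_def[symmetric] r_def[symmetric] abs_triangle_ineq4)
        also have "\<bar>(norm y)\<^sup>2 * h y\<bar> \<le> real c * real c" unfolding abs_mult using y hy by (intro mult_mono) auto
        also have "\<bar>(?d + 4) * (r * h y)\<bar> \<le> (?d + 4) * (\<Delta> w * real c)"
          unfolding abs_mult using r hy by (intro mult_mono) auto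
        finally show ?thesis using True by (simp add: mult_ac)
      qed (use ord[OF w] in \<open>auto simp: f_def\<close>)
    qed
  qed measurable
  then have "(\<integral>w. indicator B w * R w ^ 1 * h (X w) - (?d + 4) * (indicator B w * (\<Delta> w * h (X w))) \<partial>N) = 0"
    unfolding f(2) by (simp add: LIMSEQ_const_iff)
  moreover have "(\<integral>w. indicator B w * R w ^ 1 * h (X w) - (?d + 4) * (indicator B w * (\<Delta> w * h (X w))) \<partial>N) =
     0 - (?d + 4) * (\<integral>w. indicator B w * (\<Delta> w * h (X w)) \<partial>N)"
    by (subst Bochner_Integration.integral_diff[OF iR integrable_mult_right[OF ih]]) (simp only: R0 integral_mult_right_zero)
  moreover have "?d + 4 \<noteq> 0" using of_nat_0_le_iff[of "CARD('d)", where ?'a=real] by linarith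
  ultimately show "(\<integral>w. indicator B w * cross i j w \<partial>N) = 0" unfolding main by simp
qed

lemma cond_exp_cross:
  assumes ij: "i \<noteq> j"
  shows "AE w in N. nnc (\<lambda>w. ennreal \<bar>cross i j w\<bar>) w < \<infinity> \<and> real_cond_exp N (pre_sigma \<sigma>) (cross i j) w = 0"
proof (rule cond_exp_localI[OF st(1) level(1,2), where g="\<lambda>_. 0"])
  show "cross i j \<in> borel_measurable N" by (rule cross_exit(3)[OF ij level(1) order_refl])
  show "integrable N (\<lambda>w. indicator (level c) w * cross i j w)" for c by (rule cross_exit(1)[OF ij level(1) order_refl])
  show "(\<integral>w. indicator B w * cross i j w \<partial>N) = (\<integral>w. indicator B w * 0 \<partial>N)" if "B \<in> sets (pre_sigma \<sigma>)" "B \<subseteq> level c" for B c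
    using cross_exit(2)[OF ij that] by simp
qed auto

end

section \<open>Hitting times and the ball partition\<close>

text \<open>By the intermediate value theorem the level is met before any point where
  \<open>f\<close> is at least \<open>c\<close>, and the closed level set contains its infimum. The
  last equivalence reads the event \<open>T \<le> t\<close> off the path up to \<open>t\<close>, as
  a stopping time requires.\<close>

lemma first_hit:
  fixes f :: "real \<Rightarrow> real"
  assumes f: "continuous_on {a..} f" and lt: "f a < c" and ex: "\<exists>s\<ge>a. c \<le> f s"
  defines "T \<equiv> Inf {s. s > a \<and> f s = c}"
  shows "a < T" "f T = c" "\<And>s. a \<le> s \<Longrightarrow> s \<le> T \<Longrightarrow> f s \<le> c" "\<And>t. T \<le> t \<longleftrightarrow> (\<exists>u\<in>{a..t}. c \<le> f u)"
proof -
  define S where "S = {s. s > a \<and> f s = c}"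
  have hit: "\<exists>s'\<in>S. s' \<le> s" if "a \<le> s" "c \<le> f s" for s
  proof -
    have "\<exists>x\<ge>a. x \<le> s \<and> f x = c"
      using that lt by (intro IVT' continuous_on_subset[OF f]) auto
    then show ?thesis using lt by (auto simp: S_def less_le)
  qed
  have S_eq: "S = {s \<in> {a..}. f s = c}" using lt by (auto simp: S_def less_le)
  have cl: "closed S" unfolding S_eq by (rule continuous_closed_preimage_constant[OF f]) simp
  have ne: "S \<noteq> {}" using ex hit by blast
  have bdd: "bdd_below S" by (rule bdd_belowI[of _ a]) (auto simp: S_def)
  have T: "T \<in> S" unfolding T_def S_def[symmetric] by (rule closed_contains_Inf[OF ne bdd cl])
  then show "a < T" "f T = c" by (auto simp: S_def)
  have low: "T \<le> s" if "s \<in> S" for s unfolding T_def S_def[symmetric] by (rule cInf_lower[OF that bdd])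
  show "f s \<le> c" if "a \<le> s" "s \<le> T" for s
  proof (rule ccontr)
    assume "\<not> f s \<le> c"
    then have "\<exists>s'\<in>S. s' \<le> s" by (intro hit) (use that in auto)
    then obtain s' where s': "s' \<in> S" "s' \<le> s" by blast
    then have "s = T" using low[of s'] that by simp
    then show False using \<open>\<not> f s \<le> c\<close> \<open>f T = c\<close> by simp
  qed
  show "T \<le> t \<longleftrightarrow> (\<exists>u\<in>{a..t}. c \<le> f u)" for t
  proof
    assume "T \<le> t" then show "\<exists>u\<in>{a..t}. c \<le> f u" using \<open>a < T\<close> \<open>f T = c\<close> by (intro bexI[of _ T]) auto
  next
    assume "\<exists>u\<in>{a..t}. c \<le> f u"
    then obtain u where u: "a \<le> u" "u \<le> t" "c \<le> f u" by auto
    obtain s' where "s' \<in> S" "s' \<le> u" using hit[of u] u by auto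
    then show "T \<le> t" using low[of s'] u by simp
  qed
qed

lemma closure_Rats_Icc:
  assumes "a < b" shows "closure ({a..b} \<inter> \<rat>) = {a..b::real}"
proof -
  have "(\<Union>f\<in>{1::real} \<rightarrow> \<rat>. {f 1}) = (\<rat> :: real set)"
  proof (intro equalityI subsetI)
    fix q :: real assume "q \<in> \<rat>"
    then show "q \<in> (\<Union>f\<in>{1::real} \<rightarrow> \<rat>. {f 1})" by (intro UN_I[of "\<lambda>_. q"]) auto
  qed auto
  with closure_rationals_in_convex_set[of "{a..b}"] assms show ?thesis by (simp add: interior_atLeastAtMost_real)
qed

lemma rational_exceeds:
  fixes k :: "real \<Rightarrow> real"
  assumes "a < b" and k: "continuous_on {a..b} k" and u: "u \<in> {a..b}" "c < k u"
  shows "\<exists>q\<in>{a..b} \<inter> \<rat>. c < k q"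
proof (rule ccontr)
  assume "\<not> ?thesis"
  then have le: "\<And>q. q \<in> {a..b} \<inter> \<rat> \<Longrightarrow> k q \<le> c" by (auto simp: not_less)
  have "k u \<le> c"
    by (rule continuous_le_on_closure[of "{a..b} \<inter> \<rat>" k]) (use closure_Rats_Icc[OF \<open>a < b\<close>] k u le in auto)
  with u show False by simp
qed

context bm
begin

text \<open>The event \<open>\<tau> \<le> t\<close> means that the squared distance from the
  starting point reaches \<open>R\<close> during the random interval from \<open>\<sigma>\<close> to
  \<open>t\<close>. Parametrising that interval by \<open>q\<close> in \<open>[0, 1]\<close> reduces
  this to countably many random times measurable at time \<open>t\<close>.\<close>

lemma stopping_time_hit:
  assumes \<sigma>: "stopping_time F \<sigma>" "\<And>w. w \<in> space N \<Longrightarrow> 0 \<le> \<sigma> w"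
    and R: "R \<in> borel_measurable (pre_sigma \<sigma>)" "\<And>w. w \<in> space N \<Longrightarrow> 0 < R w"
    and unb: "\<And>w r. w \<in> space N \<Longrightarrow> \<exists>s\<ge>\<sigma> w. r \<le> (norm (W s w - W (\<sigma> w) w))\<^sup>2"
  defines "\<tau> \<equiv> \<lambda>w. Inf {s. s > \<sigma> w \<and> (norm (W s w - W (\<sigma> w) w))\<^sup>2 = R w}"
  shows "stopping_time F \<tau>" "\<And>w. w \<in> space N \<Longrightarrow> \<sigma> w < \<tau> w"
    "\<And>w. w \<in> space N \<Longrightarrow> (norm (W (\<tau> w) w - W (\<sigma> w) w))\<^sup>2 = R w"
    "\<And>w s. w \<in> space N \<Longrightarrow> \<sigma> w \<le> s \<Longrightarrow> s \<le> \<tau> w \<Longrightarrow> (norm (W s w - W (\<sigma> w) w))\<^sup>2 \<le> R w"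
proof -
  define g where "g w s = (norm (W s w - W (\<sigma> w) w))\<^sup>2" for w s
  have gc: "continuous_on {\<sigma> w..} (g w)" if "w \<in> space N" for w
    unfolding g_def by (intro continuous_intros continuous_on_subset[OF continuous_W[OF that]]) (use \<sigma>(2)[OF that] in auto)
  note h = first_hit[OF gc _ unb[folded g_def], of _ "R _", folded g_def]
  have h0: "g w (\<sigma> w) < R w" if "w \<in> space N" for w using R(2)[OF that] by (simp add: g_def)
  have \<tau>: "\<tau> w = Inf {s. s > \<sigma> w \<and> g w s = R w}" for w by (simp add: \<tau>_def g_def)
  show lt: "\<sigma> w < \<tau> w" if "w \<in> space N" for w unfolding \<tau> by (rule h(1)[OF that h0[OF that] that])
  show "(norm (W (\<tau> w) w - W (\<sigma> w) w))\<^sup>2 = R w" if "w \<in> space N" for w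
    using h(2)[OF that h0[OF that] that] unfolding \<tau>[symmetric] by (simp add: g_def)
  show "(norm (W s w - W (\<sigma> w) w))\<^sup>2 \<le> R w" if "w \<in> space N" "\<sigma> w \<le> s" "s \<le> \<tau> w" for w s
    using h(3)[OF that(1) h0[OF that(1)] that(1) that(2)] that(3) unfolding \<tau>[symmetric] by (simp add: g_def)
  show "stopping_time F \<tau>"
  proof
    fix t
    show "Measurable.pred (F t) (\<lambda>w. \<tau> w \<le> t)"
    proof (cases "0 \<le> t")
      case False
      then have "\<not> \<tau> w \<le> t" if "w \<in> space (F t)" for w using lt[of w] \<sigma>(2)[of w] that by (simp add: space_F)
      then have "{w \<in> space (F t). \<tau> w \<le> t} = {}" by blast
      then show ?thesis using sets.empty_sets[of "F t"] by (simp only: pred_def)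
    next
      case True
      \<comment> \<open>Moves linearly from \<open>min \<sigma> t\<close> to \<open>t\<close>; it
        never exceeds \<open>t\<close>, so the path at \<open>v q\<close> is measurable with respect
        to \<open>F t\<close>.\<close>
      define v where "v q w = min (\<sigma> w) t + q * (t - min (\<sigma> w) t)" for q w
      define R' where "R' w = (if \<sigma> w \<le> t then R w else 0)" for w
      have v: "0 \<le> v q w \<and> v q w \<le> t" if "0 \<le> q" "q \<le> 1" "w \<in> space N" for q w
      proof -
        have "0 \<le> min (\<sigma> w) t" "min (\<sigma> w) t \<le> t" using \<sigma>(2)[OF that(3)] True by auto
        moreover have "q * (t - min (\<sigma> w) t) \<le> 1 * (t - min (\<sigma> w) t)" "0 \<le> q * (t - min (\<sigma> w) t)"
          using that by (intro mult_right_mono mult_nonneg_nonneg; simp)+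
        moreover have "min (\<sigma> w) t + q * (t - min (\<sigma> w) t) \<le> min (\<sigma> w) t + 1 * (t - min (\<sigma> w) t)"
          by (rule add_left_mono) fact
        ultimately show ?thesis unfolding v_def by simp
      qed
      have mm: "(\<lambda>w. min (\<sigma> w) t) \<in> borel_measurable (F t)" by (rule measurable_min_stopping[OF \<sigma>(1)])
      have vm: "v q \<in> borel_measurable (F t)" for q unfolding v_def[abs_def] using mm by measurable
      have Wv: "(\<lambda>w. W (v q w) w) \<in> borel_measurable (F t)" if "0 \<le> q" "q \<le> 1" for q
        by (rule measurable_path_min_stopping[OF adapted_W continuous_W True vm v[OF that]])
      have Ws: "(\<lambda>w. W (min (\<sigma> w) t) w) \<in> borel_measurable (F t)"
        by (rule measurable_path_min_stopping[OF adapted_W continuous_W True mm]) (use \<sigma>(2) True in auto)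
      have R'm: "R' \<in> borel_measurable (F t)" unfolding R'_def[abs_def] by (rule measurable_restrict_pre_sigma[OF \<sigma>(1) R(1)])
      have \<sigma>m: "Measurable.pred (F t) (\<lambda>w. \<sigma> w \<le> t)" by (rule stopping_timeD[OF \<sigma>(1)])
      let ?Q = "{0..1} \<inter> \<rat> :: real set"
      have cQ: "countable ?Q" by (intro countable_Int2 countable_rat)
      \<comment> \<open>Rational parameters may miss the hitting point itself, so the level is only
        approached within \<open>1 / (k + 1)\<close> for every \<open>k\<close>; compactness of the
        interval gives back a point where it is reached.\<close>
      define P where "P w \<longleftrightarrow> \<sigma> w \<le> t \<and> (\<forall>k::nat. \<exists>q\<in>?Q. R' w - 1 / real (Suc k) < (norm (W (v q w) w - W (min (\<sigma> w) t) w))\<^sup>2)" for w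
      have "Measurable.pred (F t) P"
        unfolding P_def[abs_def]
      proof (intro pred_intros_logic \<sigma>m pred_intros_countable measurable_pred_countable cQ)
        fix k :: nat and q :: real assume "q \<in> ?Q"
        then have [measurable]: "(\<lambda>w. W (v q w) w) \<in> borel_measurable (F t)" by (intro Wv) auto
        show "Measurable.pred (F t) (\<lambda>w. R' w - 1 / real (Suc k) < (norm (W (v q w) w - W (min (\<sigma> w) t) w))\<^sup>2)"
          using Ws R'm by measurable
      qed
      moreover have "\<tau> w \<le> t \<longleftrightarrow> P w" if "w \<in> space (F t)" for w
      proof -
        have w: "w \<in> space N" using that by (simp add: space_F)
        have 1: "\<tau> w \<le> t \<longleftrightarrow> (\<exists>u\<in>{\<sigma> w..t}. R w \<le> g w u)" unfolding \<tau> by (rule h(4)[OF w h0[OF w] w])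
        show ?thesis
        proof (cases "\<sigma> w \<le> t")
          case False
          then show ?thesis unfolding 1 by (auto simp: P_def)
        next
          case le: True
          have vq: "v q w = \<sigma> w + q * (t - \<sigma> w)" and R': "R' w = R w" and ms: "min (\<sigma> w) t = \<sigma> w" for q
            using le by (auto simp: v_def R'_def)
          have vr: "v q w \<in> {\<sigma> w..t}" if "q \<in> {0..1}" for q
            using v[of q w] w that le by (auto simp: vq)
          show ?thesis
          proof
            assume "\<tau> w \<le> t"
            then obtain u where u: "u \<in> {\<sigma> w..t}" "R w \<le> g w u" using 1 by auto
            have "\<exists>q0\<in>{0..1}. v q0 w = u"
            proof (cases "\<sigma> w = t")
              case True then show ?thesis using u by (intro bexI[of _ 0]) (auto simp: vq)
            next
              case False
              then show ?thesis using u le by (intro bexI[of _ "(u - \<sigma> w) / (t - \<sigma> w)"]) (auto simp: vq field_simps)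
            qed
            then obtain q0 where q0: "q0 \<in> {0..1}" "v q0 w = u" by blast
            have cont: "continuous_on {0..1} (\<lambda>q. g w (v q w))"
              by (rule continuous_on_compose2[OF gc[OF w]]) (use vr in \<open>auto simp: vq intro!: continuous_intros\<close>)
            have "\<exists>q\<in>?Q. R w - 1 / real (Suc k) < g w (v q w)" for k
            proof (rule rational_exceeds[OF _ cont q0(1)])
              have "0 < 1 / real (Suc k)" by simp
              then show "R w - 1 / real (Suc k) < g w (v q0 w)" using u(2) unfolding q0(2) by linarith
            qed simp
            then show "P w" using le by (simp add: P_def R' ms g_def)
          next
            assume "P w"
            then have ex: "\<exists>u\<in>{\<sigma> w..t}. R w - 1 / real (Suc k) < g w u" for k
              using vr unfolding P_def R' ms g_def by blast
            have "compact {\<sigma> w..t}" "{\<sigma> w..t} \<noteq> {}" "continuous_on {\<sigma> w..t} (g w)"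
              using le by (auto intro: continuous_on_subset[OF gc[OF w]])
            from continuous_attains_sup[OF this] obtain u where u: "u \<in> {\<sigma> w..t}" "\<And>y. y \<in> {\<sigma> w..t} \<Longrightarrow> g w y \<le> g w u" by blast
            have "R w - 1 / real (Suc k) \<le> g w u" for k using ex[of k] u(2) by fastforce
            moreover have "(\<lambda>k. R w - 1 / real (Suc k)) \<longlonglongrightarrow> R w - 0"
              using LIMSEQ_inverse_real_of_nat by (intro tendsto_intros) (simp add: inverse_eq_divide)
            ultimately have "R w - 0 \<le> g w u" by (intro LIMSEQ_le_const2) auto
            then show "\<tau> w \<le> t" using u(1) 1 by auto
          qed
        qed
      qed
      ultimately show ?thesis by (subst measurable_cong) auto
    qed
  qed
qed

text \<open>The density of one coordinate at time \<open>s\<close> is at most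
  \<open>1 / sqrt (2 pi s)\<close>, so the probability of lying within distance \<open>r\<close> of
  the origin tends to 0 as \<open>s\<close> grows.\<close>

lemma AE_unbounded: "AE w in N. \<forall>r. \<exists>s\<ge>0. r < norm (W s w)"
proof -
  have "AE w in N. \<forall>r::nat. \<exists>s::nat. real r < norm (W (real s) w)"
    unfolding AE_all_countable
  proof
    fix r :: nat
    obtain j :: 'd where True by simp
    let ?E = "\<lambda>s::nat. {w \<in> space N. norm (W (real s) w) \<le> real r}"
    have m: "W (real s) \<in> borel_measurable N" for s by simp
    have E: "?E s \<in> sets N" for s using m[of s] by measurable
    have le: "prob (?E s) \<le> 2 * real r / sqrt (2 * pi * real s)" if s: "0 < s" for s
    proof -
      have "prob (?E s) \<le> prob ((\<lambda>w. W (real s) w $ j - W 0 w $ j) -` {- real r..real r} \<inter> space N)"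
      proof (rule finite_measure_mono)
        show "?E s \<subseteq> (\<lambda>w. W (real s) w $ j - W 0 w $ j) -` {- real r..real r} \<inter> space N"
        proof
          fix w assume "w \<in> ?E s"
          then show "w \<in> (\<lambda>w. W (real s) w $ j - W 0 w $ j) -` {- real r..real r} \<inter> space N"
            using component_le_norm_cart[of "W (real s) w" j] by (auto simp: W_0)
        qed
        have "(\<lambda>w. W (real s) w $ j - W 0 w $ j) \<in> borel_measurable N"
          by (intro borel_measurable_diff measurable_vec_nth_compose measurable_W) auto
        then show "(\<lambda>w. W (real s) w $ j - W 0 w $ j) -` {- real r..real r} \<inter> space N \<in> sets N" by (rule measurable_sets) simp
      qed
      also have "\<dots> = measure (distr N borel (\<lambda>w. W (real s) w $ j - W 0 w $ j)) {- real r..real r}"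
        by (rule measure_distr[symmetric]) (auto intro!: borel_measurable_diff measurable_vec_nth_compose measurable_W)
      also have "\<dots> = measure (gauss (real s)) {- real r..real r}"
        using distr_increment[of 0 "real s" j] s by simp
      also have "\<dots> \<le> 2 * real r / sqrt (2 * pi * real s)"
      proof -
        have "emeasure (gauss (real s)) {- real r..real r} = (\<integral>\<^sup>+x. ennreal (normal_density 0 (sqrt (real s)) x) * indicator {- real r..real r} x \<partial>lborel)"
          by (rule emeasure_density) auto
        also have "\<dots> \<le> (\<integral>\<^sup>+x. ennreal (1 / sqrt (2 * pi * real s)) * indicator {- real r..real r} x \<partial>lborel)"
          using s by (intro nn_integral_mono mult_right_mono ennreal_leI) (auto simp: normal_density_def intro!: divide_right_mono)
        also have "\<dots> = ennreal (1 / sqrt (2 * pi * real s)) * ennreal (2 * real r)"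
          by (subst nn_integral_cmult_indicator) auto
        also have "\<dots> = ennreal (2 * real r / sqrt (2 * pi * real s))" by (simp add: ennreal_mult[symmetric])
        finally show ?thesis unfolding measure_def by (intro enn2real_leI) auto
      qed
      finally show ?thesis .
    qed
    have lim: "(\<lambda>s. 2 * real r / sqrt (2 * pi * real s)) \<longlonglongrightarrow> 0"
    proof (rule real_tendsto_divide_at_top[OF tendsto_const])
      show "LIM s sequentially. sqrt (2 * pi * real s) :> at_top"
        by (rule filterlim_compose[OF sqrt_at_top], rule filterlim_tendsto_pos_mult_at_top[OF tendsto_const _ filterlim_real_sequentially]) simp
    qed
    have "prob (\<Inter>s. ?E s) \<le> 0"
    proof (rule LIMSEQ_le_const[OF lim], intro exI[of _ 1] allI impI)
      fix s :: nat assume "1 \<le> s"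
      then show "prob (\<Inter>s. ?E s) \<le> 2 * real r / sqrt (2 * pi * real s)"
        by (intro order_trans[OF finite_measure_mono le]) (use E in auto)
    qed
    then have "(\<Inter>s. ?E s) \<in> null_sets N" using E by (intro null_setsI) (auto simp: emeasure_eq_measure measure_le_0_iff)
    then have "AE w in N. w \<notin> (\<Inter>s. ?E s)" by (rule AE_not_in)
    with AE_space show "AE w in N. \<exists>s::nat. real r < norm (W (real s) w)" by eventually_elim (auto simp: not_le)
  qed
  then show ?thesis
  proof eventually_elim
    case (elim w)
    show ?case
    proof
      fix r :: real
      obtain k :: nat where "r \<le> real k" using real_arch_simple by auto
      moreover obtain s :: nat where "real k < norm (W (real s) w)" using elim by blast
      ultimately show "\<exists>s\<ge>0. r < norm (W s w)" by (intro exI[of _ "real s"]) auto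
    qed
  qed
qed

end

section \<open>The partition by successive exits from balls\<close>

locale bm_ball = bm N F W for N :: "'a measure" and F and W :: "real \<Rightarrow> 'a \<Rightarrow> real ^ 'd" +
  fixes G :: "real \<Rightarrow> 'a \<Rightarrow> real"
  assumes unbounded: "\<And>w r. w \<in> space N \<Longrightarrow> \<exists>s\<ge>0. r < norm (W s w)"
    and adapted_G: "\<And>s. 0 \<le> s \<Longrightarrow> G s \<in> borel_measurable (F s)"
    and continuous_G: "\<And>w. w \<in> space N \<Longrightarrow> continuous_on {0..} (\<lambda>s. G s w)"
    and G_pos: "\<And>w s. w \<in> space N \<Longrightarrow> 0 \<le> s \<Longrightarrow> 0 < G s w"
begin

lemma exceeds_after:
  assumes w: "w \<in> space N" and a: "0 \<le> a"
  shows "\<exists>s\<ge>a. r \<le> (norm (W s w - W a w))\<^sup>2"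
proof -
  have "compact ((\<lambda>s. W s w) ` {0..a})"
    by (intro compact_continuous_image continuous_on_subset[OF continuous_W[OF w]]) auto
  then obtain b where b: "\<And>s. s \<in> {0..a} \<Longrightarrow> norm (W s w) \<le> b"
    using compact_imp_bounded bounded_iff by (metis image_eqI)
  obtain s where s: "0 \<le> s" "\<bar>b\<bar> + \<bar>r\<bar> + 1 < norm (W s w)" using unbounded[OF w] by blast
  have "a \<le> s"
  proof (rule ccontr)
    assume "\<not> a \<le> s" then show False using b[of s] s by auto
  qed
  moreover have "\<bar>r\<bar> + 1 \<le> norm (W s w - W a w)"
    using s b[of a] a norm_triangle_ineq2[of "W s w" "W a w"] by auto
  then have "r \<le> (norm (W s w - W a w))\<^sup>2" using self_le_power[of "norm (W s w - W a w)" 2] by linarith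
  ultimately show ?thesis by blast
qed

abbreviation p :: "nat \<Rightarrow> nat \<Rightarrow> 'a \<Rightarrow> real" where "p \<equiv> ball_partition W G"

definition radius :: "nat \<Rightarrow> nat \<Rightarrow> 'a \<Rightarrow> real" where
  "radius n m w = real CARD('d) / (real n * G (p n m w) w)"

text \<open>Only the stopping property and nonnegativity have to be carried through the induction;
  all else follows at each step from \<open>stopping_time_hit\<close>, whose hypothesis of
  unboundedness is \<open>exceeds_after\<close>.\<close>

lemma p_stop:
  assumes n: "1 \<le> n"
  shows "stopping_time F (p n m) \<and> (\<forall>w\<in>space N. 0 \<le> p n m w)"
    and "radius n m \<in> borel_measurable (pre_sigma (p n m))" "w \<in> space N \<Longrightarrow> 0 < radius n m w"
    and "w \<in> space N \<Longrightarrow> p n m w < p n (Suc m) w"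
    "w \<in> space N \<Longrightarrow> (norm (W (p n (Suc m) w) w - W (p n m w) w))\<^sup>2 = radius n m w"
    "w \<in> space N \<Longrightarrow> p n m w \<le> s \<Longrightarrow> s \<le> p n (Suc m) w \<Longrightarrow> (norm (W s w - W (p n m w) w))\<^sup>2 \<le> radius n m w"
proof -
  have R: "radius n m \<in> borel_measurable (pre_sigma (p n m)) \<and> (\<forall>w\<in>space N. 0 < radius n m w)"
    if "stopping_time F (p n m) \<and> (\<forall>w\<in>space N. 0 \<le> p n m w)" for m
  proof
    have "(\<lambda>w. G (p n m w) w) \<in> borel_measurable (pre_sigma (p n m))"
      by (rule measurable_path_stopping[OF adapted_G continuous_G]) (use that in auto)
    then show "radius n m \<in> borel_measurable (pre_sigma (p n m))" unfolding radius_def[abs_def] by measurable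
    show "\<forall>w\<in>space N. 0 < radius n m w" using that n by (auto simp: radius_def intro!: divide_pos_pos mult_pos_pos G_pos)
  qed
  have Suc_eq: "p n (Suc m) = (\<lambda>w. Inf {s. s > p n m w \<and> (norm (W s w - W (p n m w) w))\<^sup>2 = radius n m w})" for m
    by (simp add: radius_def)
  have hit: "stopping_time F (p n (Suc m))" "\<And>w. w \<in> space N \<Longrightarrow> p n m w < p n (Suc m) w"
    "\<And>w. w \<in> space N \<Longrightarrow> (norm (W (p n (Suc m) w) w - W (p n m w) w))\<^sup>2 = radius n m w"
    "\<And>w s. w \<in> space N \<Longrightarrow> p n m w \<le> s \<Longrightarrow> s \<le> p n (Suc m) w \<Longrightarrow> (norm (W s w - W (p n m w) w))\<^sup>2 \<le> radius n m w"
    if s: "stopping_time F (p n m) \<and> (\<forall>w\<in>space N. 0 \<le> p n m w)" for m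
    unfolding Suc_eq by (rule stopping_time_hit[of "p n m" "radius n m"]; use s R[OF s] exceeds_after in blast)+
  have st: "stopping_time F (p n m) \<and> (\<forall>w\<in>space N. 0 \<le> p n m w)" for m
  proof (induction m)
    case 0 show ?case by (simp add: stopping_time_const)
  next
    case (Suc m)
    show ?case using hit(1,2)[OF Suc] Suc by (meson less_imp_le order_trans)
  qed
  show "stopping_time F (p n m) \<and> (\<forall>w\<in>space N. 0 \<le> p n m w)" by (rule st)
  show "radius n m \<in> borel_measurable (pre_sigma (p n m))" "w \<in> space N \<Longrightarrow> 0 < radius n m w" using R[OF st] by auto
  show "w \<in> space N \<Longrightarrow> p n m w < p n (Suc m) w"
    "w \<in> space N \<Longrightarrow> (norm (W (p n (Suc m) w) w - W (p n m w) w))\<^sup>2 = radius n m w"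
    "w \<in> space N \<Longrightarrow> p n m w \<le> s \<Longrightarrow> s \<le> p n (Suc m) w \<Longrightarrow> (norm (W s w - W (p n m w) w))\<^sup>2 \<le> radius n m w"
    using hit(2,3,4)[OF st] by auto
qed

lemma exit_p: "1 \<le> n \<Longrightarrow> bm_exit N F W (p n m) (p n (Suc m)) (radius n m)"
  using p_stop[where n=n and m=m] p_stop(1)[where n=n and m="Suc m"]
  by unfold_locales (auto intro: less_imp_le)

lemma p_incseq: "1 \<le> n \<Longrightarrow> w \<in> space N \<Longrightarrow> incseq (\<lambda>m. p n m w)"
  by (intro incseq_SucI) (rule less_imp_le[OF p_stop(4)])

text \<open>A finite limit \<open>L\<close> of the times would force the displacements to 0 by
  continuity, whereas their squares equal \<open>radius\<close>, which tends to the positive number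
  \<open>d / (n G(L))\<close>.\<close>

lemma p_unbounded:
  assumes n: "1 \<le> n" and w: "w \<in> space N"
  shows "filterlim (\<lambda>m. p n m w) at_top sequentially"
proof (rule ccontr)
  assume not: "\<not> filterlim (\<lambda>m. p n m w) at_top sequentially"
  note inc = p_incseq[OF n w]
  have "\<exists>Z. \<forall>m. p n m w \<le> Z"
  proof (rule ccontr)
    assume "\<not> ?thesis"
    then have "\<exists>m. Z < p n m w" for Z by (meson not_le)
    then have "\<forall>\<^sub>F m in sequentially. Z \<le> p n m w" for Z
      using incseqD[OF inc] unfolding eventually_sequentially by (metis less_imp_le order_trans)
    then show False using not by (simp add: filterlim_at_top)
  qed
  then obtain Z where Z: "\<And>m. p n m w \<le> Z" by blast
  obtain L where L: "(\<lambda>m. p n m w) \<longlonglongrightarrow> L" using incseq_convergent[OF inc] Z by metis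
  have nn: "0 \<le> p n m w" for m using p_stop(1)[OF n] w by auto
  have L0: "0 \<le> L" by (rule LIMSEQ_le_const[OF L]) (use nn in auto)
  have WL: "(\<lambda>m. W (p n m w) w) \<longlonglongrightarrow> W L w" and GL: "(\<lambda>m. G (p n m w) w) \<longlonglongrightarrow> G L w"
    by (rule continuous_on_tendsto_compose[OF continuous_W[OF w] L] continuous_on_tendsto_compose[OF continuous_G[OF w] L]; use L0 nn in simp)+
  have "(\<lambda>m. (norm (W (p n (Suc m) w) w - W (p n m w) w))\<^sup>2) \<longlonglongrightarrow> (norm (W L w - W L w))\<^sup>2"
    by (intro tendsto_intros LIMSEQ_Suc[OF WL] WL)
  then have "(\<lambda>m. radius n m w) \<longlonglongrightarrow> 0" unfolding p_stop(5)[OF n w] by simp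
  moreover have "(\<lambda>m. radius n m w) \<longlonglongrightarrow> real CARD('d) / (real n * G L w)"
    unfolding radius_def using G_pos[OF w L0] n by (intro tendsto_intros GL) auto
  ultimately have "real CARD('d) / (real n * G L w) = 0" using LIMSEQ_unique by blast
  then show False using G_pos[OF w L0] n by simp
qed

end

section \<open>Number and lengths of the intervals of the ball partition\<close>

context bm
begin

text \<open>Convergence to 0 in probability in terms of measurable exceptional sets, so that suprema
  over all times can be treated without being shown measurable.\<close>

definition small :: "(nat \<Rightarrow> 'a \<Rightarrow> ennreal) \<Rightarrow> bool" where
  "small X \<longleftrightarrow> (\<forall>\<epsilon>>0. \<forall>\<delta>>0. \<forall>\<^sub>F n in sequentially.
     \<exists>E\<in>sets N. emeasure N E \<le> ennreal \<delta> \<and> (\<forall>w\<in>space N - E. X n w \<le> ennreal \<epsilon>))"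

lemma tail_small:
  assumes [measurable]: "\<tau> \<in> borel_measurable N" and \<delta>: "0 < \<delta>"
  shows "\<exists>T::nat. 1 \<le> T \<and> emeasure N {w \<in> space N. real T < \<tau> w} \<le> ennreal \<delta>"
proof -
  let ?A = "\<lambda>T::nat. {w \<in> space N. real T < \<tau> w}"
  have "(\<lambda>T. prob (?A T)) \<longlonglongrightarrow> prob (\<Inter>T. ?A T)"
    by (rule finite_Lim_measure_decseq) (auto simp: decseq_def)
  moreover have "(\<Inter>T. ?A T) = {}"
  proof -
    have "\<exists>T::nat. \<tau> w \<le> real T" for w by (rule real_arch_simple)
    then show ?thesis by (fastforce simp: not_less[symmetric])
  qed
  ultimately have "(\<lambda>T. prob (?A T)) \<longlonglongrightarrow> 0" by simp
  then have "\<forall>\<^sub>F T in sequentially. prob (?A T) < \<delta>" using \<delta> by (rule order_tendstoD(2))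
  with eventually_ge_at_top[of "1::nat"] have "\<forall>\<^sub>F T in sequentially. 1 \<le> T \<and> prob (?A T) < \<delta>" by eventually_elim simp
  then obtain T where "1 \<le> T" "prob (?A T) < \<delta>" by (auto simp: eventually_sequentially)
  then show ?thesis by (intro exI[of _ T]) (auto simp: emeasure_eq_measure intro: ennreal_leI)
qed

text \<open>Every path is uniformly continuous on \<open>[0, T]\<close>, so the events
  \<open>U j\<close>, tested on rational pairs to be measurable, increase to the whole space; one of
  them has probability above \<open>1 - \<delta>\<close>.\<close>

lemma modulus_small:
  fixes X :: "real \<Rightarrow> 'a \<Rightarrow> real"
  assumes X: "\<And>s. 0 \<le> s \<Longrightarrow> X s \<in> borel_measurable N" and c: "\<And>w. w \<in> space N \<Longrightarrow> continuous_on {0..} (\<lambda>s. X s w)"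
    and T: "0 < T" and \<epsilon>: "0 < \<epsilon>" and \<delta>: "0 < \<delta>"
  shows "\<exists>h>0. \<exists>E\<in>sets N. emeasure N E \<le> ennreal \<delta> \<and>
    (\<forall>w\<in>space N - E. \<forall>s\<in>{0..T}. \<forall>u\<in>{0..T}. \<bar>s - u\<bar> \<le> h \<longrightarrow> \<bar>X s w - X u w\<bar> \<le> \<epsilon>)"
proof -
  let ?Q = "{0..T} \<inter> \<rat>"
  have cQ: "countable ?Q" by (intro countable_Int2 countable_rat)
  define U where "U j = {w \<in> space N. \<forall>q\<in>?Q. \<forall>q'\<in>?Q. \<bar>q - q'\<bar> < 1 / real (Suc j) \<longrightarrow> \<bar>X q w - X q' w\<bar> \<le> \<epsilon>}" for j
  have U: "U j \<in> sets N" for j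
  proof -
    have "Measurable.pred N (\<lambda>w. \<forall>q\<in>?Q. \<forall>q'\<in>?Q. \<bar>q - q'\<bar> < 1 / real (Suc j) \<longrightarrow> \<bar>X q w - X q' w\<bar> \<le> \<epsilon>)"
    proof (intro measurable_pred_countable cQ pred_intros_imp')
      fix q q' assume "q \<in> ?Q" "q' \<in> ?Q"
      then have [measurable]: "X q \<in> borel_measurable N" "X q' \<in> borel_measurable N" using X by auto
      show "Measurable.pred N (\<lambda>w. \<bar>X q w - X q' w\<bar> \<le> \<epsilon>)" by measurable
    qed
    then show ?thesis by (simp add: U_def pred_def)
  qed
  have inc: "incseq U"
  proof (rule incseq_SucI)
    fix j have "1 / real (Suc (Suc j)) \<le> 1 / real (Suc j)" by (simp add: field_simps)
    then show "U j \<le> U (Suc j)" by (fastforce simp: U_def)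
  qed
  have "(\<Union>j. U j) = space N"
  proof (intro equalityI subsetI)
    fix w assume w: "w \<in> space N"
    have "uniformly_continuous_on {0..T} (\<lambda>s. X s w)"
      by (intro compact_uniformly_continuous continuous_on_subset[OF c[OF w]]) auto
    then obtain d where d: "0 < d" "\<And>s u. s \<in> {0..T} \<Longrightarrow> u \<in> {0..T} \<Longrightarrow> dist s u < d \<Longrightarrow> dist (X s w) (X u w) < \<epsilon>"
      unfolding uniformly_continuous_on_def using \<epsilon> by metis
    obtain j where j: "inverse (real (Suc j)) < d" using reals_Archimedean[OF d(1)] by blast
    have "w \<in> U j"
      unfolding U_def
    proof (intro CollectI conjI w ballI impI)
      fix q q' assume "q \<in> ?Q" "q' \<in> ?Q" "\<bar>q - q'\<bar> < 1 / real (Suc j)"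
      then show "\<bar>X q w - X q' w\<bar> \<le> \<epsilon>" using d(2)[of q q'] j by (auto simp: dist_real_def inverse_eq_divide)
    qed
    then show "w \<in> (\<Union>j. U j)" by blast
  qed (auto simp: U_def)
  then have "(\<lambda>j. prob (U j)) \<longlonglongrightarrow> 1"
    using finite_Lim_measure_incseq[of U] U inc by (auto simp: prob_space)
  then have "\<forall>\<^sub>F j in sequentially. 1 - \<delta> < prob (U j)" using \<delta> by (intro order_tendstoD(1)) auto
  then obtain j where j: "1 - \<delta> < prob (U j)" by (auto simp: eventually_sequentially)
  have "emeasure N (space N - U j) \<le> ennreal \<delta>"
    using j prob_compl[OF U[of j]] by (auto simp: emeasure_eq_measure intro: ennreal_leI)
  moreover have "\<bar>X s w - X u w\<bar> \<le> \<epsilon>"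
    if w: "w \<in> U j" and s: "s \<in> {0..T}" and u: "u \<in> {0..T}" and su: "\<bar>s - u\<bar> \<le> 1 / (2 * real (Suc j))" for w s u
  proof -
    have "s \<in> closure ?Q" "u \<in> closure ?Q" using closure_Rats_Icc[OF T] s u by auto
    then obtain f g where f: "\<And>k. f k \<in> ?Q" "f \<longlonglongrightarrow> s" and g: "\<And>k. g k \<in> ?Q" "g \<longlonglongrightarrow> u"
      unfolding closure_sequential by metis
    have wN: "w \<in> space N" using w by (simp add: U_def)
    have "(\<lambda>k. X (f k) w) \<longlonglongrightarrow> X s w" "(\<lambda>k. X (g k) w) \<longlonglongrightarrow> X u w"
      by (rule continuous_on_tendsto_compose[OF c[OF wN] f(2)] continuous_on_tendsto_compose[OF c[OF wN] g(2)];
          use f(1) g(1) s u in auto)+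
    then have lim: "(\<lambda>k. \<bar>X (f k) w - X (g k) w\<bar>) \<longlonglongrightarrow> \<bar>X s w - X u w\<bar>" by (intro tendsto_intros)
    \<comment> \<open>Half the width leaves room for the rational approximations of \<open>s\<close>
      and \<open>u\<close>, which must satisfy the strict inequality in \<open>U j\<close>.\<close>
    have "1 / (2 * real (Suc j)) < 1 / real (Suc j)" by (simp add: field_simps)
    with su have "\<bar>s - u\<bar> < 1 / real (Suc j)" by (rule order_le_less_trans)
    moreover have "(\<lambda>k. \<bar>f k - g k\<bar>) \<longlonglongrightarrow> \<bar>s - u\<bar>" by (intro tendsto_intros f g)
    ultimately have "\<forall>\<^sub>F k in sequentially. \<bar>f k - g k\<bar> < 1 / real (Suc j)" by (metis order_tendstoD(2))
    then have "\<forall>\<^sub>F k in sequentially. \<bar>X (f k) w - X (g k) w\<bar> \<le> \<epsilon>"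
    proof eventually_elim
      case (elim k)
      then show ?case using w f(1)[of k] g(1)[of k] unfolding U_def by blast
    qed
    then show ?thesis by (intro tendsto_upperbound[OF lim]) auto
  qed
  ultimately show ?thesis
    by (intro exI[of _ "1 / (2 * real (Suc j))"] conjI bexI[of _ "space N - U j"]) (use U in auto)
qed

end

context bm_ball
begin

lemma p_stopping: "1 \<le> n \<Longrightarrow> stopping_time F (p n m)"
  and p_nonneg: "1 \<le> n \<Longrightarrow> w \<in> space N \<Longrightarrow> 0 \<le> p n m w"
  using p_stop(1) by auto

lemma p_measurable: "1 \<le> n \<Longrightarrow> p n m \<in> borel_measurable N"
  by (rule measurable_stopping_time_N[OF p_stopping])

text \<open>Of the intervals beginning before \<open>T\<close> all but the last lie within
  \<open>[0, T]\<close>, and truncation lets the last add at most 1.\<close>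

lemma truncated_lengths_le:
  assumes n: "1 \<le> n" and w: "w \<in> space N" and T: "0 \<le> T"
  shows "(\<Sum>m<K. indicator {m. p n m w < T} m * min (p n (Suc m) w - p n m w) 1) \<le> min (p n K w) (T + 1)"
proof (induction K)
  case (Suc K)
  have "p n K w < p n (Suc K) w" by (rule p_stop(4)[OF n w])
  then show ?case using Suc by (cases "p n K w < T") (auto simp: min_def split: if_splits)
qed (use T in auto)

definition cond_moment :: "nat \<Rightarrow> nat \<Rightarrow> nat \<Rightarrow> 'a \<Rightarrow> ennreal" where
  "cond_moment n m r = nn_cond_exp N (pre_sigma (p n m)) (\<lambda>w. ennreal (\<bar>p n (Suc m) w - p n m w\<bar> ^ r))"

lemma cond_moment_le:
  assumes n: "1 \<le> n"
  shows "AE w in N. cond_moment n m r w \<le> ennreal (fact r * (radius n m w / real CARD('d)) ^ r)"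
    and "AE w in N. cond_moment n m 1 w = ennreal (radius n m w / real CARD('d))"
proof -
  interpret E: bm_exit N F W "p n m" "p n (Suc m)" "radius n m" by (rule exit_p[OF n])
  have [measurable]: "p n m \<in> borel_measurable N" "p n (Suc m) \<in> borel_measurable N" by (rule p_measurable[OF n])+
  have eq: "AE w in N. cond_moment n m r w = nn_cond_exp N (pre_sigma (p n m)) (\<lambda>w. ennreal ((p n (Suc m) w - p n m w) ^ r)) w" for r
    unfolding cond_moment_def
    by (rule E.S.nn_cond_exp_cong, rule AE_I2, simp only: abs_of_nonneg[OF E.\<Delta>_nonneg]; measurable)
  from eq[of r] E.moment_bound[of r] show "AE w in N. cond_moment n m r w \<le> ennreal (fact r * (radius n m w / real CARD('d)) ^ r)"
    by eventually_elim simp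
  from eq[of 1] E.cond_exp_duration show "AE w in N. cond_moment n m 1 w = ennreal (radius n m w / real CARD('d))"
    by eventually_elim simp
qed

lemma cond_moment_measurable: "1 \<le> n \<Longrightarrow> cond_moment n m r \<in> borel_measurable N"
  unfolding cond_moment_def using measurable_pre_sigma_N[OF p_stopping borel_measurable_nn_cond_exp] by blast

section \<open>Intervals that begin while \<open>G\<close> stays in a compact range\<close>

context
  fixes \<tau> :: "'a \<Rightarrow> real" and \<kappa> T :: real
  assumes \<tau>: "stopping_time F \<tau>" and \<kappa>: "1 \<le> \<kappa>" and T: "0 \<le> T"
    and bnd: "\<And>w s. w \<in> space N \<Longrightarrow> 0 \<le> s \<Longrightarrow> s < \<tau> w \<Longrightarrow> 1 / \<kappa> \<le> G s w \<and> G s w \<le> \<kappa>"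
begin

text \<open>Activity is decided at the left end of the interval, so it can be combined with
  conditional moments; \<open>T\<close> replaces a \<open>\<tau>\<close> that may be
  unbounded.\<close>

definition active :: "nat \<Rightarrow> nat \<Rightarrow> 'a set" where
  "active n m = {w \<in> space N. p n m w < \<tau> w \<and> p n m w < T}"

context
  fixes n :: nat
  assumes n: "1 \<le> n"
begin

lemma active_pre_sigma: "active n m \<in> sets (pre_sigma (p n m))"
proof -
  have "Measurable.pred (pre_sigma (p n m)) (\<lambda>w. p n m w < \<tau> w)" "Measurable.pred (pre_sigma (p n m)) (\<lambda>w. p n m w < T)"
    by (rule stopping_time_less[OF p_stopping[OF n] \<tau>], rule stopping_time_less[OF p_stopping[OF n] stopping_time_const])
  then have "Measurable.pred (pre_sigma (p n m)) (\<lambda>w. p n m w < \<tau> w \<and> p n m w < T)" by (rule pred_intros_logic)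
  then show ?thesis by (simp add: pred_def active_def space_pre_sigma)
qed

lemma active_sets: "active n m \<in> sets N"
  using active_pre_sigma subalgebra_pre_sigma[OF p_stopping[OF n]] by (auto simp: subalgebra_def)

lemma radius_active:
  assumes "w \<in> active n m"
  shows "1 / (real n * \<kappa>) \<le> radius n m w / real CARD('d)" "radius n m w / real CARD('d) \<le> \<kappa> / real n"
proof -
  have w: "w \<in> space N" and G: "1 / \<kappa> \<le> G (p n m w) w" "G (p n m w) w \<le> \<kappa>"
    using assms bnd[of w "p n m w"] p_nonneg[OF n, of w m] by (auto simp: active_def)
  have pos: "0 < G (p n m w) w" by (rule G_pos[OF w p_nonneg[OF n w]])
  have eq: "radius n m w / real CARD('d) = 1 / (real n * G (p n m w) w)" by (simp add: radius_def)
  show "1 / (real n * \<kappa>) \<le> radius n m w / real CARD('d)"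
    unfolding eq using n \<kappa> pos G(2) by (intro divide_left_mono mult_left_mono) auto
  have "1 \<le> \<kappa> * G (p n m w) w" using G(1) \<kappa> by (simp add: field_simps)
  then show "radius n m w / real CARD('d) \<le> \<kappa> / real n"
    unfolding eq using n pos by (simp add: field_simps)
qed

lemma moment_integral:
  "(\<integral>\<^sup>+w. indicator (active n m) w * cond_moment n m r w \<partial>N) \<le> ennreal (fact r * (\<kappa> / real n) ^ r) * emeasure N (active n m)"
  "(\<integral>\<^sup>+w. indicator (active n m) w * ennreal (\<bar>p n (Suc m) w - p n m w\<bar> ^ r) \<partial>N) = (\<integral>\<^sup>+w. indicator (active n m) w * cond_moment n m r w \<partial>N)"
proof -
  have "(\<integral>\<^sup>+w. indicator (active n m) w * cond_moment n m r w \<partial>N) \<le> (\<integral>\<^sup>+w. ennreal (fact r * (\<kappa> / real n) ^ r) * indicator (active n m) w \<partial>N)"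
  proof (rule nn_integral_mono_AE)
    from cond_moment_le(1)[OF n, of m r] AE_space
    show "AE w in N. indicator (active n m) w * cond_moment n m r w \<le> ennreal (fact r * (\<kappa> / real n) ^ r) * indicator (active n m) w"
    proof eventually_elim
      case (elim w)
      show ?case
      proof (cases "w \<in> active n m")
        case True
        have "fact r * (radius n m w / real CARD('d)) ^ r \<le> fact r * (\<kappa> / real n) ^ r"
          using radius_active[OF True] p_stop(3)[OF n elim(2)] by (intro mult_left_mono power_mono) (auto intro: less_imp_le)
        from order_trans[OF elim(1) ennreal_leI[OF this]] True show ?thesis by simp
      qed simp
    qed
  qed
  also have "\<dots> = ennreal (fact r * (\<kappa> / real n) ^ r) * emeasure N (active n m)" by (rule nn_integral_cmult_indicator[OF active_sets])
  finally show "(\<integral>\<^sup>+w. indicator (active n m) w * cond_moment n m r w \<partial>N) \<le> ennreal (fact r * (\<kappa> / real n) ^ r) * emeasure N (active n m)" .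
  interpret S: finite_measure_subalgebra N "pre_sigma (p n m)" by (rule sigma_finite_subalgebra_pre_sigma[OF p_stopping[OF n]])
  have [measurable]: "p n m \<in> borel_measurable N" "p n (Suc m) \<in> borel_measurable N" by (rule p_measurable[OF n])+
  show "(\<integral>\<^sup>+w. indicator (active n m) w * ennreal (\<bar>p n (Suc m) w - p n m w\<bar> ^ r) \<partial>N) = (\<integral>\<^sup>+w. indicator (active n m) w * cond_moment n m r w \<partial>N)"
    unfolding cond_moment_def
    by (rule S.nn_cond_exp_intg[symmetric]) (use active_pre_sigma in \<open>auto simp del: ball_partition.simps\<close>)
qed

text \<open>The truncated lengths of the active intervals add up to at most \<open>T + 1\<close>, while for large
  \<open>n\<close> each contributes at least half of \<open>1 / (n G)\<close> in the mean.\<close>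

lemma count_active:
  assumes n4: "4 * \<kappa> \<le> real n"
  shows "(\<Sum>m<K. emeasure N (active n m)) \<le> ennreal (2 * real n * \<kappa> * (T + 1))"
proof -
  let ?D = "\<lambda>m w. p n (Suc m) w - p n m w"
  let ?r = "\<lambda>m w. radius n m w / real CARD('d)"
  have [measurable]: "p n m \<in> borel_measurable N" for m by (rule p_measurable[OF n])
  note [measurable] = active_sets
  have [measurable]: "radius n m \<in> borel_measurable N" for m by (rule measurable_pre_sigma_N[OF p_stopping[OF n] p_stop(2)[OF n]])
  have each: "emeasure N (active n m) \<le> ennreal (2 * real n * \<kappa>) * (\<integral>\<^sup>+w. indicator (active n m) w * ennreal (min (?D m w) 1) \<partial>N)" for m
  proof -
    define a where "a = (\<integral>\<^sup>+w. indicator (active n m) w * ennreal (?r m w) \<partial>N)"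
    define b where "b = (\<integral>\<^sup>+w. indicator (active n m) w * ennreal (min (?D m w) 1) \<partial>N)"
    define e where "e = (\<integral>\<^sup>+w. indicator (active n m) w * ennreal (\<bar>?D m w\<bar> ^ 2) \<partial>N)"
    have "a = (\<integral>\<^sup>+w. indicator (active n m) w * cond_moment n m 1 w \<partial>N)"
      unfolding a_def by (rule nn_integral_cong_AE) (use cond_moment_le(2)[OF n, of m] in \<open>eventually_elim, simp\<close>)
    also have "\<dots> = (\<integral>\<^sup>+w. indicator (active n m) w * ennreal (\<bar>?D m w\<bar> ^ 1) \<partial>N)" by (rule moment_integral(2)[symmetric])
    also have "\<dots> \<le> (\<integral>\<^sup>+w. indicator (active n m) w * ennreal (min (?D m w) 1) + indicator (active n m) w * ennreal (\<bar>?D m w\<bar> ^ 2) \<partial>N)"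
    proof (rule nn_integral_mono)
      fix w assume w: "w \<in> space N"
      define D where "D = ?D m w"
      have D: "0 < D" using p_stop(4)[OF n w, of m] unfolding D_def by linarith
      \<comment> \<open>Truncating the length at 1 costs at most the second moment, which is
        absorbed below.\<close>
      have "D \<le> min D 1 + D\<^sup>2"
      proof (cases "D \<le> 1")
        case False then show ?thesis using self_le_power[of D 2] by simp
      qed simp
      then have "ennreal (\<bar>D\<bar> ^ 1) \<le> ennreal (min D 1) + ennreal (\<bar>D\<bar> ^ 2)"
        using D by (subst ennreal_plus[symmetric]) (simp_all add: ennreal_leI del: ennreal_plus)
      then show "indicator (active n m) w * ennreal (\<bar>?D m w\<bar> ^ 1) \<le> indicator (active n m) w * ennreal (min (?D m w) 1) + indicator (active n m) w * ennreal (\<bar>?D m w\<bar> ^ 2)"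
        unfolding D_def[symmetric] distrib_left[symmetric] by (rule mult_left_mono) simp
    qed
    also have "\<dots> = b + e" unfolding b_def e_def by (rule nn_integral_add) measurable
    finally have 1: "a \<le> b + e" .
    have "e = (\<integral>\<^sup>+w. indicator (active n m) w * cond_moment n m 2 w \<partial>N)" unfolding e_def by (rule moment_integral(2))
    also have "\<dots> \<le> (\<integral>\<^sup>+w. ennreal (1 / 2) * (indicator (active n m) w * ennreal (?r m w)) \<partial>N)"
    proof (rule nn_integral_mono_AE)
      from cond_moment_le(1)[OF n, of m 2] AE_space
      show "AE w in N. indicator (active n m) w * cond_moment n m 2 w \<le> ennreal (1 / 2) * (indicator (active n m) w * ennreal (?r m w))"
      proof eventually_elim
        case (elim w)
        show ?case
        proof (cases "w \<in> active n m")
          case True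
          have r0: "0 \<le> ?r m w" using p_stop(3)[OF n elim(2), of m] by simp
          \<comment> \<open>This is the purpose of \<open>4 \<kappa> \<le> n\<close>: the second
            moment is at most \<open>2 r^2\<close> with \<open>r \<le> 1 / 4\<close>, hence at most
            half the mean \<open>r\<close>.\<close>
          have "\<kappa> / real n \<le> 1 / 4" using n4 n by (simp add: field_simps)
          then have r4: "?r m w \<le> 1 / 4" using radius_active(2)[OF True] by linarith
          have "?r m w * ?r m w \<le> 1 / 4 * ?r m w" using r0 r4 by (intro mult_right_mono)
          then have "fact 2 * (?r m w) ^ 2 \<le> 1 / 2 * ?r m w" by (simp add: power2_eq_square fact_2)
          then have "ennreal (fact 2 * (?r m w) ^ 2) \<le> ennreal (1 / 2) * ennreal (?r m w)"
            using r0 by (subst ennreal_mult[symmetric]) (auto intro!: ennreal_leI)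
          then show ?thesis using elim(1) True by (auto intro: order_trans)
        qed simp
      qed
    qed
    also have "\<dots> = ennreal (1 / 2) * a" unfolding a_def by (rule nn_integral_cmult) measurable
    finally have 2: "e \<le> ennreal (1 / 2) * a" .
    \<comment> \<open>Finiteness of \<open>a\<close> allows \<open>a / 2\<close> to be subtracted
      from both sides of \<open>a \<le> b + a / 2\<close>.\<close>
    have "a \<le> (\<integral>\<^sup>+w. ennreal (\<kappa> / real n) \<partial>N)"
      unfolding a_def by (rule nn_integral_mono) (auto intro!: ennreal_leI radius_active(2) split: split_indicator)
    also have "\<dots> < top" by (simp add: emeasure_space_1)
    finally have a_fin: "a < top" .
    have "ennreal (1 / (real n * \<kappa>)) * emeasure N (active n m) = (\<integral>\<^sup>+w. ennreal (1 / (real n * \<kappa>)) * indicator (active n m) w \<partial>N)"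
      by (rule nn_integral_cmult_indicator[symmetric, OF active_sets])
    also have "\<dots> \<le> a" unfolding a_def
      by (rule nn_integral_mono) (auto intro!: ennreal_leI radius_active(1) split: split_indicator)
    finally have 3: "ennreal (1 / (real n * \<kappa>) * prob (active n m)) \<le> a"
      using n \<kappa> by (simp only: emeasure_eq_measure ennreal_mult[of "1 / (real n * \<kappa>)"] measure_nonneg zero_le_divide_1_iff mult_nonneg_nonneg of_nat_0_le_iff order_trans[OF zero_le_one])
    obtain x where x: "0 \<le> x" "a = ennreal x" using a_fin by (cases a) auto
    have nk: "0 < real n * \<kappa>" using n \<kappa> by simp
    have "emeasure N (active n m) \<le> ennreal (2 * real n * \<kappa>) * b"
    proof (cases b)
      case (real y)
      have "ennreal x \<le> ennreal y + ennreal (1 / 2) * ennreal x" using order_trans[OF 1 add_left_mono[OF 2]] x real by simp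
      also have "ennreal y + ennreal (1 / 2) * ennreal x = ennreal (y + 1 / 2 * x)"
        using x(1) real(1) by (subst ennreal_mult[symmetric], simp, simp, subst ennreal_plus[symmetric]) auto
      finally have "x \<le> y + 1 / 2 * x" using x real by (subst (asm) ennreal_le_iff) auto
      moreover have "1 / (real n * \<kappa>) * prob (active n m) \<le> x" using 3 x by simp
      then have "prob (active n m) \<le> real n * \<kappa> * x" using nk by (simp add: field_simps)
      ultimately have "prob (active n m) \<le> real n * \<kappa> * (2 * y)"
        using nk by (intro order_trans[OF _ mult_left_mono[of x "2 * y"]]) auto
      then show ?thesis using real nk by (simp add: emeasure_eq_measure ennreal_mult[symmetric] mult_ac ennreal_leI)
    qed (use n \<kappa> in \<open>auto simp: ennreal_mult_top ennreal_eq_0_iff mult_le_0_iff\<close>)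
    then show ?thesis by (simp add: b_def)
  qed
  have "(\<Sum>m<K. emeasure N (active n m)) \<le> (\<Sum>m<K. ennreal (2 * real n * \<kappa>) * (\<integral>\<^sup>+w. indicator (active n m) w * ennreal (min (?D m w) 1) \<partial>N))"
    by (rule sum_mono) (rule each)
  also have "\<dots> = ennreal (2 * real n * \<kappa>) * (\<integral>\<^sup>+w. (\<Sum>m<K. indicator (active n m) w * ennreal (min (?D m w) 1)) \<partial>N)"
    unfolding sum_distrib_left[symmetric] by (subst nn_integral_sum) (auto simp del: ball_partition.simps)
  also have "\<dots> \<le> ennreal (2 * real n * \<kappa>) * (\<integral>\<^sup>+w. ennreal (T + 1) \<partial>N)"
  proof (intro mult_left_mono nn_integral_mono)
    fix w assume w: "w \<in> space N"
    have D: "0 \<le> min (?D m w) 1" for m using p_stop(4)[OF n w, of m] by linarith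
    have "(\<Sum>m<K. indicator (active n m) w * ennreal (min (?D m w) 1)) \<le> (\<Sum>m<K. ennreal (indicator {m. p n m w < T} m * min (?D m w) 1))"
      by (rule sum_mono) (auto simp: active_def split: split_indicator)
    also have "\<dots> = ennreal (\<Sum>m<K. indicator {m. p n m w < T} m * min (?D m w) 1)" using D by (intro sum_ennreal) (auto intro!: mult_nonneg_nonneg)
    also have "\<dots> \<le> ennreal (T + 1)" using truncated_lengths_le[OF n w T, of K] by (intro ennreal_leI) linarith
    finally show "(\<Sum>m<K. indicator (active n m) w * ennreal (min (?D m w) 1)) \<le> ennreal (T + 1)" .
  qed simp
  also have "\<dots> = ennreal (2 * real n * \<kappa> * (T + 1))" using \<kappa> T by (simp add: emeasure_space_1 ennreal_mult)
  finally show ?thesis .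
qed

lemma sum_moments:
  assumes n4: "4 * \<kappa> \<le> real n"
  shows "(\<integral>\<^sup>+w. (\<Sum>m. indicator (active n m) w * cond_moment n m r w) \<partial>N) \<le> ennreal (fact r * (\<kappa> / real n) ^ r * (2 * real n * \<kappa> * (T + 1)))"
    and "(\<integral>\<^sup>+w. (\<Sum>m. indicator (active n m) w * ennreal (\<bar>p n (Suc m) w - p n m w\<bar> ^ r)) \<partial>N) =
      (\<integral>\<^sup>+w. (\<Sum>m. indicator (active n m) w * cond_moment n m r w) \<partial>N)"
proof -
  have [measurable]: "p n m \<in> borel_measurable N" for m by (rule p_measurable[OF n])
  have [measurable]: "cond_moment n m r \<in> borel_measurable N" for m r by (rule cond_moment_measurable[OF n])
  note [measurable] = active_sets
  let ?I = "\<lambda>m. \<integral>\<^sup>+w. indicator (active n m) w * cond_moment n m r w \<partial>N"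
  have eq: "(\<integral>\<^sup>+w. (\<Sum>m. indicator (active n m) w * cond_moment n m r w) \<partial>N) = (\<Sum>m. ?I m)"
    by (rule nn_integral_suminf) measurable
  show "(\<integral>\<^sup>+w. (\<Sum>m. indicator (active n m) w * ennreal (\<bar>p n (Suc m) w - p n m w\<bar> ^ r)) \<partial>N) =
      (\<integral>\<^sup>+w. (\<Sum>m. indicator (active n m) w * cond_moment n m r w) \<partial>N)"
    unfolding eq by (subst nn_integral_suminf) (measurable, simp only: moment_integral(2))
  have "(\<Sum>m<K. ?I m) \<le> ennreal (fact r * (\<kappa> / real n) ^ r * (2 * real n * \<kappa> * (T + 1)))" for K
  proof -
    have "(\<Sum>m<K. ?I m) \<le> (\<Sum>m<K. ennreal (fact r * (\<kappa> / real n) ^ r) * emeasure N (active n m))"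
      by (rule sum_mono) (rule moment_integral(1))
    also have "\<dots> \<le> ennreal (fact r * (\<kappa> / real n) ^ r) * ennreal (2 * real n * \<kappa> * (T + 1))"
      unfolding sum_distrib_left[symmetric] by (intro mult_left_mono count_active[OF n4]) simp
    also have "\<dots> = ennreal (fact r * (\<kappa> / real n) ^ r * (2 * real n * \<kappa> * (T + 1)))"
      using \<kappa> T by (intro ennreal_mult[symmetric]) auto
    finally show ?thesis .
  qed
  then show "(\<integral>\<^sup>+w. (\<Sum>m. indicator (active n m) w * cond_moment n m r w) \<partial>N) \<le> ennreal (fact r * (\<kappa> / real n) ^ r * (2 * real n * \<kappa> * (T + 1)))"
    unfolding eq unfolding suminf_eq_SUP[of ?I] by (rule SUP_least)
qed

text \<open>The summed moments are of order \<open>n^(1 - r)\<close>, so under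
  \<open>c + 2 \<le> r\<close> the factor \<open>n^c\<close> still leaves \<open>1 / n\<close>. The
  second estimate concerns the lengths themselves and controls the longest active interval.\<close>

lemma sum_moments_Markov:
  assumes n4: "4 * \<kappa> \<le> real n" and \<epsilon>: "0 < \<epsilon>" and cr: "c + 2 \<le> r"
  shows "emeasure N {w \<in> space N. ennreal \<epsilon> \<le> of_nat (n ^ c) * (\<Sum>m. indicator (active n m) w * cond_moment n m r w)}
      \<le> ennreal (fact r * \<kappa> ^ r * (2 * \<kappa> * (T + 1)) / \<epsilon> / real n)" (is ?A)
    and "emeasure N {w \<in> space N. ennreal \<epsilon> \<le> (\<Sum>m. indicator (active n m) w * ennreal (\<bar>p n (Suc m) w - p n m w\<bar> ^ 2))}
      \<le> ennreal (fact 2 * \<kappa> ^ 2 * (2 * \<kappa> * (T + 1)) / \<epsilon> / real n)" (is ?B)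
proof -
  have [measurable]: "p n m \<in> borel_measurable N" for m by (rule p_measurable[OF n])
  have [measurable]: "cond_moment n m r \<in> borel_measurable N" for m r by (rule cond_moment_measurable[OF n])
  note [measurable] = active_sets
  have gen: "emeasure N {w \<in> space N. ennreal \<epsilon> \<le> of_nat (n ^ c) * Y w} \<le> ennreal (fact r * \<kappa> ^ r * (2 * \<kappa> * (T + 1)) / \<epsilon> / real n)"
    if [measurable]: "Y \<in> borel_measurable N" and Y: "(\<integral>\<^sup>+w. Y w \<partial>N) \<le> ennreal (fact r * (\<kappa> / real n) ^ r * (2 * real n * \<kappa> * (T + 1)))" and cr: "c + 2 \<le> r" for Y c r
  proof -
    have iff: "ennreal \<epsilon> \<le> of_nat (n ^ c) * y \<longleftrightarrow> 1 \<le> ennreal (real n ^ c / \<epsilon>) * y" for y :: ennreal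
    proof (cases y)
      case (real z)
      then show ?thesis using \<epsilon> n by (simp add: ennreal_of_nat_eq_real_of_nat ennreal_mult[symmetric] field_simps flip: ennreal_1)
    qed (use n \<epsilon> in \<open>simp add: ennreal_mult_top\<close>)
    have "emeasure N {w \<in> space N. ennreal \<epsilon> \<le> of_nat (n ^ c) * Y w} \<le> ennreal (real n ^ c / \<epsilon>) * (\<integral>\<^sup>+w. Y w * indicator (space N) w \<partial>N)"
      unfolding iff using nn_integral_Markov_inequality[of "Y" "space N" N "ennreal (real n ^ c / \<epsilon>)"] by simp
    also have "\<dots> \<le> ennreal (real n ^ c / \<epsilon>) * ennreal (fact r * (\<kappa> / real n) ^ r * (2 * real n * \<kappa> * (T + 1)))"
      using Y by (intro mult_left_mono) (simp_all cong: nn_integral_cong)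
    also have "\<dots> = ennreal (real n ^ c / \<epsilon> * (fact r * (\<kappa> / real n) ^ r * (2 * real n * \<kappa> * (T + 1))))"
      using \<kappa> T \<epsilon> by (intro ennreal_mult[symmetric]) auto
    also have "\<dots> \<le> ennreal (fact r * \<kappa> ^ r * (2 * \<kappa> * (T + 1)) / \<epsilon> / real n)"
    proof (rule ennreal_leI)
      define C where "C = fact r * \<kappa> ^ r * (2 * \<kappa> * (T + 1)) / \<epsilon>"
      have C: "0 \<le> C" using \<kappa> T \<epsilon> by (simp add: C_def)
      have "real n ^ c / \<epsilon> * (fact r * (\<kappa> / real n) ^ r * (2 * real n * \<kappa> * (T + 1))) = C * (real n ^ (c + 1) / real n ^ r)"
        using n by (simp add: C_def power_divide field_simps)
      also have "real n ^ (c + 1) / real n ^ r \<le> 1 / real n"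
      proof -
        have "real n ^ (c + 2) \<le> real n ^ r" using n cr by (intro power_increasing) auto
        then show ?thesis using n by (simp add: field_simps)
      qed
      then have "C * (real n ^ (c + 1) / real n ^ r) \<le> C * (1 / real n)" using C by (rule mult_left_mono)
      finally show "real n ^ c / \<epsilon> * (fact r * (\<kappa> / real n) ^ r * (2 * real n * \<kappa> * (T + 1))) \<le> fact r * \<kappa> ^ r * (2 * \<kappa> * (T + 1)) / \<epsilon> / real n"
        by (simp add: C_def)
    qed
    finally show ?thesis .
  qed
  show ?A by (rule gen[OF _ sum_moments(1)[OF n4] cr]) measurable
  show ?B using gen[of "\<lambda>w. \<Sum>m. indicator (active n m) w * ennreal (\<bar>p n (Suc m) w - p n m w\<bar> ^ 2)" 2 0] sum_moments[OF n4, of 2]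
    by (simp del: ball_partition.simps)
qed

end

end

lemma eventually_large:
  assumes "0 < \<delta>" shows "\<forall>\<^sub>F n in sequentially. 1 \<le> n \<and> 4 * \<kappa> \<le> real n \<and> C / real n \<le> \<delta>"
proof -
  have "(\<lambda>n. C / real n) \<longlonglongrightarrow> 0" by (rule lim_const_over_n)
  then have "\<forall>\<^sub>F n in sequentially. C / real n < \<delta>" using assms by (rule order_tendstoD)
  moreover have "\<forall>\<^sub>F n in sequentially. 4 * \<kappa> \<le> real n"
    using filterlim_real_sequentially by (auto simp: filterlim_at_top)
  ultimately show ?thesis using eventually_ge_at_top[of "1::nat"] by eventually_elim simp
qed

context
  fixes \<tau> :: "'a \<Rightarrow> real" and \<kappa> :: real
  assumes \<tau>: "stopping_time F \<tau>" and \<kappa>: "1 \<le> \<kappa>"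
    and bnd: "\<And>w s. w \<in> space N \<Longrightarrow> 0 \<le> s \<Longrightarrow> s < \<tau> w \<Longrightarrow> 1 / \<kappa> \<le> G s w \<and> G s w \<le> \<kappa>"
begin

text \<open>Outside the small event \<open>\<tau> > T\<close> every interval counted by
  \<open>first_index\<close> is active, so the sum is dominated by the series of
  \<open>sum_moments_Markov\<close>.\<close>

lemma power_sum_small:
  assumes cr: "c + 2 \<le> r"
  shows "small (\<lambda>n w. of_nat (n ^ c) * (\<Sum>m<first_index (p n) \<tau> w. cond_moment n m r w))"
  unfolding small_def
proof (intro allI impI)
  fix \<epsilon> \<delta> :: real assume \<epsilon>: "0 < \<epsilon>" and \<delta>: "0 < \<delta>"
  have [measurable]: "\<tau> \<in> borel_measurable N" by (rule measurable_stopping_time_N[OF \<tau>])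
  obtain T :: nat where T: "1 \<le> T" "emeasure N {w \<in> space N. real T < \<tau> w} \<le> ennreal (\<delta> / 2)"
    using tail_small[of \<tau> "\<delta> / 2"] \<delta> by auto
  define act where "act = active \<tau> (real T)"
  define C where "C = fact r * \<kappa> ^ r * (2 * \<kappa> * (real T + 1)) / \<epsilon>"
  have "0 < \<delta> / 2" using \<delta> by simp
  from eventually_large[OF this, of \<kappa> C]
  show "\<forall>\<^sub>F n in sequentially. \<exists>E\<in>sets N. emeasure N E \<le> ennreal \<delta> \<and>
    (\<forall>w\<in>space N - E. of_nat (n ^ c) * (\<Sum>m<first_index (p n) \<tau> w. cond_moment n m r w) \<le> ennreal \<epsilon>)"
  proof eventually_elim
    case (elim n)
    then have n: "1 \<le> n" by simp
    have [measurable]: "cond_moment n m r \<in> borel_measurable N" "act n m \<in> sets N" for m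
      unfolding act_def by (rule cond_moment_measurable[OF n], rule active_sets[OF \<tau> \<kappa> _ bnd n]) auto
    let ?Y = "\<lambda>w. \<Sum>m. indicator (act n m) w * cond_moment n m r w"
    let ?E = "{w \<in> space N. real T < \<tau> w} \<union> {w \<in> space N. ennreal \<epsilon> \<le> of_nat (n ^ c) * ?Y w}"
    show ?case
    proof (intro bexI[of _ ?E] conjI ballI)
      show E: "?E \<in> sets N" by measurable
      have "emeasure N ?E \<le> emeasure N {w \<in> space N. real T < \<tau> w} + emeasure N {w \<in> space N. ennreal \<epsilon> \<le> of_nat (n ^ c) * ?Y w}"
        by (rule emeasure_subadditive) measurable
      also have "\<dots> \<le> ennreal (\<delta> / 2) + ennreal (C / real n)"
        unfolding act_def C_def by (intro add_mono T sum_moments_Markov(1)[OF \<tau> \<kappa> _ bnd n]) (use elim cr \<epsilon> in auto)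
      also have "\<dots> \<le> ennreal (\<delta> / 2) + ennreal (\<delta> / 2)" using elim by (intro add_left_mono ennreal_leI) simp
      also have "\<dots> = ennreal \<delta>" using \<delta> by (simp add: ennreal_plus[symmetric] del: ennreal_plus)
      finally show "emeasure N ?E \<le> ennreal \<delta>" .
      fix w assume "w \<in> space N - ?E"
      then have w: "w \<in> space N" "\<tau> w \<le> real T" "of_nat (n ^ c) * ?Y w \<le> ennreal \<epsilon>" by auto
      have "(\<Sum>m<first_index (p n) \<tau> w. cond_moment n m r w) = (\<Sum>m<first_index (p n) \<tau> w. indicator (act n m) w * cond_moment n m r w)"
      proof (rule sum.cong[OF refl])
        fix m assume "m \<in> {..<first_index (p n) \<tau> w}"
        then have "p n m w < \<tau> w" using less_first_index[of "p n" w, OF p_incseq[OF n w(1)] p_unbounded[OF n w(1)]] by simp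
        then have "w \<in> act n m" using w by (simp add: act_def active_def[OF \<tau> \<kappa> _ bnd])
        then show "cond_moment n m r w = indicator (act n m) w * cond_moment n m r w" by simp
      qed
      also have "\<dots> \<le> ?Y w" by (rule sum_le_suminf) auto
      finally show "of_nat (n ^ c) * (\<Sum>m<first_index (p n) \<tau> w. cond_moment n m r w) \<le> ennreal \<epsilon>"
        using w(3) by (meson order_trans mult_left_mono zero_le)
    qed
  qed
qed

text \<open>Outside small events the squared lengths of active intervals sum to less than
  \<open>h^2\<close>, so the left end of the interval containing \<open>s\<close> is within
  \<open>h\<close> of \<open>s\<close>, and the modulus of continuity of \<open>X\<close> does the
  rest.\<close>

lemma sup_small:
  fixes X :: "real \<Rightarrow> 'a \<Rightarrow> real"
  assumes X: "\<And>s. 0 \<le> s \<Longrightarrow> X s \<in> borel_measurable N" and Xc: "\<And>w. w \<in> space N \<Longrightarrow> continuous_on {0..} (\<lambda>s. X s w)"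
  shows "small (\<lambda>n w. SUP s\<in>{0..\<tau> w}. ennreal \<bar>X (p n (current_index (p n) s w) w) w - X s w\<bar>)"
  unfolding small_def
proof (intro allI impI)
  fix \<epsilon> \<delta> :: real assume \<epsilon>: "0 < \<epsilon>" and \<delta>: "0 < \<delta>"
  have [measurable]: "\<tau> \<in> borel_measurable N" by (rule measurable_stopping_time_N[OF \<tau>])
  obtain T :: nat where T: "1 \<le> T" "emeasure N {w \<in> space N. real T < \<tau> w} \<le> ennreal (\<delta> / 3)"
    using tail_small[of \<tau> "\<delta> / 3"] \<delta> by auto
  obtain h U where h: "0 < h" and U[measurable]: "U \<in> sets N" and U_le: "emeasure N U \<le> ennreal (\<delta> / 3)"
    and mod: "\<And>w s u. w \<in> space N - U \<Longrightarrow> s \<in> {0..real T} \<Longrightarrow> u \<in> {0..real T} \<Longrightarrow> \<bar>s - u\<bar> \<le> h \<Longrightarrow> \<bar>X s w - X u w\<bar> \<le> \<epsilon>"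
    using modulus_small[OF X Xc, of "real T" \<epsilon> "\<delta> / 3"] T \<epsilon> \<delta> by fastforce
  define act where "act = active \<tau> (real T)"
  define C where "C = fact 2 * \<kappa> ^ 2 * (2 * \<kappa> * (real T + 1)) / h\<^sup>2"
  have "0 < \<delta> / 3" using \<delta> by simp
  from eventually_large[OF this, of \<kappa> C]
  show "\<forall>\<^sub>F n in sequentially. \<exists>E\<in>sets N. emeasure N E \<le> ennreal \<delta> \<and>
    (\<forall>w\<in>space N - E. (SUP s\<in>{0..\<tau> w}. ennreal \<bar>X (p n (current_index (p n) s w) w) w - X s w\<bar>) \<le> ennreal \<epsilon>)"
  proof eventually_elim
    case (elim n)
    then have n: "1 \<le> n" by simp
    have [measurable]: "p n m \<in> borel_measurable N" "act n m \<in> sets N" for m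
      unfolding act_def by (rule p_measurable[OF n], rule active_sets[OF \<tau> \<kappa> _ bnd n]) auto
    let ?Y = "\<lambda>w. \<Sum>m. indicator (act n m) w * ennreal (\<bar>p n (Suc m) w - p n m w\<bar> ^ 2)"
    let ?A = "{w \<in> space N. real T < \<tau> w}" and ?B = "{w \<in> space N. ennreal (h\<^sup>2) \<le> ?Y w}"
    show ?case
    proof (intro bexI[of _ "?A \<union> U \<union> ?B"] conjI ballI)
      show "?A \<union> U \<union> ?B \<in> sets N" by measurable
      have "emeasure N (?A \<union> U \<union> ?B) \<le> emeasure N (?A \<union> U) + emeasure N ?B"
        by (rule emeasure_subadditive) measurable
      also have "\<dots> \<le> emeasure N ?A + emeasure N U + emeasure N ?B"
        by (intro add_right_mono emeasure_subadditive) measurable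
      also have "\<dots> \<le> ennreal (\<delta> / 3) + ennreal (\<delta> / 3) + ennreal (C / real n)"
        unfolding act_def C_def by (intro add_mono T U_le sum_moments_Markov(2)[OF \<tau> \<kappa> _ bnd n _ _ order_refl[of "0 + 2"]]) (use elim h in auto)
      also have "\<dots> \<le> ennreal (\<delta> / 3) + ennreal (\<delta> / 3) + ennreal (\<delta> / 3)" using elim by (intro add_left_mono ennreal_leI) simp
      also have "\<dots> = ennreal \<delta>" using \<delta> by (simp add: ennreal_plus[symmetric] del: ennreal_plus)
      finally show "emeasure N (?A \<union> U \<union> ?B) \<le> ennreal \<delta>" .
      fix w assume "w \<in> space N - (?A \<union> U \<union> ?B)"
      then have w: "w \<in> space N" "\<tau> w \<le> real T" "?Y w < ennreal (h\<^sup>2)" "w \<in> space N - U" by (auto simp: not_le)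
      show "(SUP s\<in>{0..\<tau> w}. ennreal \<bar>X (p n (current_index (p n) s w) w) w - X s w\<bar>) \<le> ennreal \<epsilon>"
      proof (rule SUP_least)
        fix s assume s: "s \<in> {0..\<tau> w}"
        define m where "m = current_index (p n) s w"
        have m: "p n m w \<le> s" "s < p n (Suc m) w"
          using current_index_ex[of "p n" w s, OF _ p_incseq[OF n w(1)] p_unbounded[OF n w(1)]] s unfolding m_def by auto
        have "\<bar>p n m w - s\<bar> \<le> h"
        \<comment> \<open>An interval beginning exactly at \<open>s = \<tau> w\<close> is not active
          and its length is not controlled, but there the distance is 0.\<close>
        proof (cases "p n m w = s")
          case False
          with m s w(1,2) have "w \<in> act n m" by (auto simp: act_def active_def[OF \<tau> \<kappa> _ bnd] simp del: ball_partition.simps)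
          then have "ennreal (\<bar>p n (Suc m) w - p n m w\<bar> ^ 2) = (\<Sum>i\<in>{m}. indicator (act n i) w * ennreal (\<bar>p n (Suc i) w - p n i w\<bar> ^ 2))" by simp
          also have "\<dots> \<le> ?Y w" by (rule sum_le_suminf) auto
          also have "\<dots> < ennreal (h\<^sup>2)" by (rule w(3))
          finally have "\<bar>p n (Suc m) w - p n m w\<bar> ^ 2 < h\<^sup>2" by (simp add: ennreal_less_iff del: ball_partition.simps)
          then have "\<bar>p n (Suc m) w - p n m w\<bar> < h" using h power_less_imp_less_base less_imp_le by blast
          then show ?thesis using m by linarith
        qed (use h in simp)
        then have "\<bar>X (p n m w) w - X s w\<bar> \<le> \<epsilon>"
          using s w(2) m(1) p_nonneg[OF n w(1), of m] by (intro mod[OF w(4)]) auto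
        then show "ennreal \<bar>X (p n (current_index (p n) s w) w) w - X s w\<bar> \<le> ennreal \<epsilon>"
          unfolding m_def[symmetric] by (rule ennreal_leI)
      qed
    qed
  qed
qed

end

end

section \<open>Right-continuity of the augmented filtration\<close>

context bm
begin

text \<open>The Brownian transition semigroup, written through the process itself, so that its
  continuity in \<open>h\<close> follows from that of the paths.\<close>

definition heat :: "real \<Rightarrow> (real ^ 'd \<Rightarrow> real) \<Rightarrow> real ^ 'd \<Rightarrow> real" where
  "heat h f x = expectation (\<lambda>w. f (x + W h w))"

text \<open>The bound 1, instead of an arbitrary one, keeps the class closed under products and
  under \<open>heat\<close>.\<close>

definition bc :: "(real ^ 'd \<Rightarrow> real) \<Rightarrow> bool" where
  "bc f \<longleftrightarrow> continuous_on UNIV f \<and> (\<forall>x. \<bar>f x\<bar> \<le> 1)"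

lemma bc_measurable: "bc f \<Longrightarrow> f \<in> borel_measurable borel"
  unfolding bc_def by (intro borel_measurable_continuous_onI) auto

lemma heat_tendsto:
  assumes f: "bc f" and h: "\<And>k. 0 \<le> h k" "h \<longlonglongrightarrow> h0" and x: "x \<longlonglongrightarrow> x0"
  shows "(\<lambda>k. heat (h k) f (x k)) \<longlonglongrightarrow> heat h0 f x0"
  unfolding heat_def
proof (rule integral_dominated_convergence[where w="\<lambda>_. 1"])
  have h0: "0 \<le> h0" using h by (intro LIMSEQ_le_const[of h]) auto
  note [measurable] = bc_measurable[OF f]
  have "W (h k) \<in> borel_measurable N" "W h0 \<in> borel_measurable N" for k using h0 h(1) by auto
  then show "(\<lambda>w. f (x0 + W h0 w)) \<in> borel_measurable N" "(\<lambda>w. f (x k + W (h k) w)) \<in> borel_measurable N" for k by measurable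
  show "AE w in N. (\<lambda>k. f (x k + W (h k) w)) \<longlonglongrightarrow> f (x0 + W h0 w)" (is "AE w in N. ?P w")
  proof (rule AE_I2)
    fix w assume w: "w \<in> space N"
    have "(\<lambda>k. W (h k) w) \<longlonglongrightarrow> W h0 w"
      by (rule continuous_on_tendsto_compose[OF continuous_W[OF w] h(2)]) (use h0 h(1) in auto)
    then have "(\<lambda>k. x k + W (h k) w) \<longlonglongrightarrow> x0 + W h0 w" by (intro tendsto_intros x)
    then show "?P w"
      using f by (intro continuous_on_tendsto_compose[of UNIV f]) (auto simp: bc_def)
  qed
  show "AE w in N. norm (f (x k + W (h k) w)) \<le> 1" for k using f by (auto simp: bc_def)
qed simp

lemma bc_heat:
  assumes f: "bc f" and h: "0 \<le> h" shows "bc (heat h f)"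
  unfolding bc_def
proof (intro conjI allI)
  show "continuous_on UNIV (heat h f)"
    unfolding continuous_on_sequentially comp_def using heat_tendsto[OF f, of "\<lambda>_. h" h] h by auto
  fix x
  note [measurable] = bc_measurable[OF f] measurable_W[OF h]
  have "integrable N (\<lambda>w. f (x + W h w))"
    by (rule integrable_const_bound[of _ 1]) (use f in \<open>auto simp: bc_def\<close>)
  then have "\<bar>heat h f x\<bar> \<le> expectation (\<lambda>_. 1)"
    unfolding heat_def using f by (intro order_trans[OF integral_abs_bound integral_mono]) (auto simp: bc_def)
  then show "\<bar>heat h f x\<bar> \<le> 1" by (simp add: prob_space)
qed

lemma measurable_vec: "(\<lambda>z. \<chi> j. z j) \<in> borel_measurable (\<Pi>\<^sub>M j\<in>(UNIV::'d set). (borel :: real measure))"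
proof -
  have "(\<lambda>z. \<chi> j. z j) = (\<lambda>z. \<Sum>j\<in>UNIV. z j *\<^sub>R (axis j 1 :: real ^ 'd))"
    by (auto simp: vec_eq_iff axis_def if_distrib cong: if_cong)
  then show ?thesis by simp
qed

text \<open>Freezing is used twice: at time \<open>r\<close> for the increment, and at time 0 to
  recognise the Gaussian integral as \<open>heat\<close>.\<close>

lemma Markov_property:
  assumes f: "bc f" and r: "0 \<le> r" "r < u" and Y: "Y \<in> borel_measurable (F r)" "\<And>w. w \<in> space N \<Longrightarrow> \<bar>Y w\<bar> \<le> 1"
  shows "(\<integral>w. Y w * f (W u w) \<partial>N) = (\<integral>w. Y w * heat (u - r) f (W r w) \<partial>N)"
proof -
  note [measurable] = bc_measurable[OF f] measurable_vec
  let ?G = "\<lambda>h. \<Pi>\<^sub>M j\<in>(UNIV::'d set). gauss h"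
  have Wr[measurable]: "W r \<in> borel_measurable (F r)" by (rule adapted_W[OF r(1)])
  have WN[measurable]: "W r \<in> borel_measurable N" "W u \<in> borel_measurable N" "W 0 \<in> borel_measurable N" "W (u - r) \<in> borel_measurable N" using r by auto
  note [measurable] = Y(1)
  have YN[measurable]: "Y \<in> borel_measurable N" by (rule measurable_F_N[OF Y(1)])
  have vec: "(\<chi> j. x $ j - y $ j) = x - y" for x y :: "real ^ 'd" by (simp add: vec_eq_iff)
  have b: "\<bar>f x\<bar> \<le> 1" for x using f by (simp add: bc_def)
  have heat: "(\<integral>z. f (x + (\<chi> j. z j)) \<partial>?G (u - r)) = heat (u - r) f x" for x
  proof -
    interpret R: prob_space "restr_to_subalg N (F 0)"
      by (rule prob_space_restr_to_subalg[OF subalgebra_F]) (rule prob_space_axioms)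
    define \<phi> where "\<phi> = (\<lambda>(w::'a, z::'d \<Rightarrow> real). f (x + (\<chi> j. z j)))"
    have "\<phi> \<in> borel_measurable (F 0 \<Otimes>\<^sub>M (\<Pi>\<^sub>M j\<in>UNIV. borel))" unfolding \<phi>_def by measurable
    moreover have eq: "\<phi> (w, \<lambda>j. W (u - r) w $ j - W 0 w $ j) = f (x + W (u - r) w)" if "w \<in> space N" for w
      using that by (simp add: \<phi>_def vec W_0 del: vector_minus_component)
    moreover have "integrable N (\<lambda>w. \<phi> (w, \<lambda>j. W (u - r) w $ j - W 0 w $ j))"
      by (subst Bochner_Integration.integrable_cong[OF refl eq], assumption)
        (rule integrable_const_bound[of _ 1], auto simp: b)
    ultimately have "(\<integral>w. \<phi> (w, \<lambda>j. W (u - r) w $ j - W 0 w $ j) \<partial>N) = (\<integral>w. (\<integral>z. \<phi> (w, z) \<partial>?G (u - r - 0)) \<partial>restr_to_subalg N (F 0))"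
      using r by (intro increment_integral) auto
    moreover have "(\<integral>w. \<phi> (w, \<lambda>j. W (u - r) w $ j - W 0 w $ j) \<partial>N) = heat (u - r) f x"
      unfolding heat_def by (rule Bochner_Integration.integral_cong[OF refl eq])
    ultimately show ?thesis by (simp add: \<phi>_def R.prob_space)
  qed
  define \<phi> where "\<phi> = (\<lambda>(w, z::'d \<Rightarrow> real). Y w * f (W r w + (\<chi> j. z j)))"
  have \<phi>m: "\<phi> \<in> borel_measurable (F r \<Otimes>\<^sub>M (\<Pi>\<^sub>M j\<in>UNIV. borel))" unfolding \<phi>_def by measurable
  have eq: "\<phi> (w, \<lambda>j. W u w $ j - W r w $ j) = Y w * f (W u w)" for w by (simp add: \<phi>_def vec del: vector_minus_component)
  have bm: "bc (heat (u - r) f)" using bc_heat[OF f] r by simp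
  note [measurable] = bc_measurable[OF bm]
  have "(\<integral>w. Y w * f (W u w) \<partial>N) = (\<integral>w. (\<integral>z. \<phi> (w, z) \<partial>?G (u - r)) \<partial>restr_to_subalg N (F r))"
  proof (subst increment_integral[OF r \<phi>m, symmetric])
    show "integrable N (\<lambda>w. \<phi> (w, \<lambda>j. W u w $ j - W r w $ j))"
      unfolding eq by (rule integrable_const_bound[of _ 1]) (auto simp: abs_mult intro!: mult_le_one b Y(2))
  qed (simp add: eq)
  also have "\<dots> = (\<integral>w. Y w * heat (u - r) f (W r w) \<partial>restr_to_subalg N (F r))" by (simp add: \<phi>_def heat)
  also have "\<dots> = (\<integral>w. Y w * heat (u - r) f (W r w) \<partial>N)" by (rule integral_subalgebra2[OF subalgebra_F]) measurable
  finally show ?thesis .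
qed

text \<open>The Markov property moves the last time of a cylinder function down; the limit
  \<open>r \<rightarrow> s\<close> enters only for the first time after \<open>s\<close>.\<close>

lemma germ_orthogonal:
  assumes s: "0 \<le> s"
    and D: "\<And>r. s < r \<Longrightarrow> D \<in> borel_measurable (F r)" "\<And>w. w \<in> space N \<Longrightarrow> \<bar>D w\<bar> \<le> 1"
    and orth: "\<And>Y. Y \<in> borel_measurable (F s) \<Longrightarrow> (\<And>w. w \<in> space N \<Longrightarrow> \<bar>Y w\<bar> \<le> 1) \<Longrightarrow> (\<integral>w. D w * Y w \<partial>N) = 0"
    and I: "finite I" "I \<subseteq> {s<..}" and f: "\<And>u. bc (f u)"
    and Y: "Y \<in> borel_measurable (F s)" "\<And>w. w \<in> space N \<Longrightarrow> \<bar>Y w\<bar> \<le> 1"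
  shows "(\<integral>w. D w * Y w * (\<Prod>u\<in>I. f u (W u w)) \<partial>N) = 0"
  using I f
proof (induction I arbitrary: f rule: finite_linorder_max_induct)
  case empty
  then show ?case using orth[OF Y] by simp
next
  case (insert b I)
  have sb: "s < b" using insert.prems by simp
  have bI: "b \<notin> I" using insert.hyps by auto
  have DY: "\<bar>D w * Y w\<bar> \<le> 1" if "w \<in> space N" for w using D(2) Y(2) that by (simp add: abs_mult mult_le_one)
  show ?case
  proof (cases "I = {}")
    case True
    \<comment> \<open>Times strictly between \<open>s\<close> and \<open>b\<close>, decreasing to
      \<open>s\<close>: at each of them \<open>D\<close> is measurable, which is not known at
      \<open>s\<close> itself.\<close>
    define r where "r k = s + (b - s) / real (Suc (Suc k))" for k :: nat
    have r: "s < r k" "r k < b" for k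
    proof -
      show "s < r k" using sb by (simp add: r_def)
      have "(b - s) / real (Suc (Suc k)) < (b - s) / 1" using sb by (intro divide_strict_left_mono) auto
      then show "r k < b" unfolding r_def by simp
    qed
    have rk0: "0 \<le> r k" for k using r(1)[of k] s by linarith
    have r_lim: "r \<longlonglongrightarrow> s"
    proof -
      have "(\<lambda>k. s + (b - s) * (1 / real (Suc (Suc k)))) \<longlonglongrightarrow> s + (b - s) * 0"
        by (intro tendsto_intros LIMSEQ_Suc[OF LIMSEQ_inverse_real_of_nat[unfolded inverse_eq_divide]])
      then show ?thesis by (simp add: r_def[abs_def])
    qed
    have step: "(\<integral>w. D w * Y w * f b (W b w) \<partial>N) = (\<integral>w. D w * Y w * heat (b - r k) (f b) (W (r k) w) \<partial>N)" for k
    proof (rule Markov_property[OF insert.prems(2)])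
      show "(\<lambda>w. D w * Y w) \<in> borel_measurable (F (r k))"
        using D(1)[OF r(1)] measurable_F_mono[OF Y(1) less_imp_le[OF r(1)]] by measurable
    qed (use r rk0 DY in auto)
    have hb: "bc (heat (b - r k) (f b))" for k by (rule bc_heat[OF insert.prems(2)]) (use r in \<open>simp add: less_imp_le\<close>)
    have hs: "bc (heat (b - s) (f b))" by (rule bc_heat[OF insert.prems(2)]) (use sb in simp)
    note [measurable] = bc_measurable[OF hb] bc_measurable[OF hs] measurable_F_N[OF Y(1)] measurable_F_N[OF D(1)[OF sb]]
    have [measurable]: "W (r k) \<in> borel_measurable N" "W s \<in> borel_measurable N" for k
      using rk0 s by auto
    have "(\<lambda>k. \<integral>w. D w * Y w * heat (b - r k) (f b) (W (r k) w) \<partial>N) \<longlonglongrightarrow> (\<integral>w. D w * Y w * heat (b - s) (f b) (W s w) \<partial>N)"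
    proof (rule integral_dominated_convergence[where w="\<lambda>_. 1"])
      show "AE w in N. (\<lambda>k. D w * Y w * heat (b - r k) (f b) (W (r k) w)) \<longlonglongrightarrow> D w * Y w * heat (b - s) (f b) (W s w)" (is "AE w in N. ?P w")
      proof (rule AE_I2)
        fix w assume w: "w \<in> space N"
        have "(\<lambda>k. W (r k) w) \<longlonglongrightarrow> W s w"
          by (rule continuous_on_tendsto_compose[OF continuous_W[OF w] r_lim]) (use s rk0 in auto)
        then show "?P w"
          by (intro tendsto_intros heat_tendsto[OF insert.prems(2)] r_lim) (use r in \<open>simp add: less_imp_le\<close>)
      qed
      show "AE w in N. norm (D w * Y w * heat (b - r k) (f b) (W (r k) w)) \<le> 1" for k
        unfolding real_norm_def abs_mult[of "D _ * Y _"] using hb[of k] by (intro AE_I2 mult_le_one DY) (auto simp: bc_def)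
    qed measurable
    then have "(\<integral>w. D w * Y w * f b (W b w) \<partial>N) = (\<integral>w. D w * (Y w * heat (b - s) (f b) (W s w)) \<partial>N)"
      unfolding step[symmetric] by (simp add: LIMSEQ_const_iff mult.assoc)
    \<comment> \<open>In the limit the last factor depends on \<open>W s\<close> only, so its
      product with \<open>Y\<close> is known at time \<open>s\<close> and is orthogonal to
      \<open>D\<close>.\<close>
    also have "\<dots> = 0"
    proof (rule orth)
      show "(\<lambda>w. Y w * heat (b - s) (f b) (W s w)) \<in> borel_measurable (F s)"
        using Y(1) adapted_W[OF s] by measurable
      show "\<bar>Y w * heat (b - s) (f b) (W s w)\<bar> \<le> 1" if "w \<in> space N" for w
        unfolding abs_mult using hs by (intro mult_le_one Y(2) that) (auto simp: bc_def)
    qed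
    finally show ?thesis using True by simp
  next
    case False
    define a where "a = Max I"
    have aI: "a \<in> I" and aI_max: "\<And>u. u \<in> I \<Longrightarrow> u \<le> a" using insert.hyps(1) False by (auto simp: a_def)
    have a: "s < a" "a < b" using aI insert by auto
    have h: "bc (heat (b - a) (f b))" by (rule bc_heat[OF insert.prems(2)]) (use a in simp)
    \<comment> \<open>The factor at the last time \<open>b\<close> becomes a function of the
      position at \<open>a\<close> and joins the factor already there.\<close>
    define f' where "f' = f(a := \<lambda>x. f a x * heat (b - a) (f b) x)"
    have f': "bc (f' u)" for u
      using insert.prems(2)[of a] insert.prems(2)[of u] h
      by (auto simp: f'_def bc_def abs_mult intro!: continuous_intros mult_le_one)
    have pb: "\<bar>\<Prod>u\<in>J. f u (W u w)\<bar> \<le> 1" for J w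
      unfolding abs_prod using insert.prems(2) by (intro prod_le_1) (auto simp: bc_def)
    have "(\<integral>w. D w * Y w * (\<Prod>u\<in>insert b I. f u (W u w)) \<partial>N) = (\<integral>w. (D w * Y w * (\<Prod>u\<in>I. f u (W u w))) * f b (W b w) \<partial>N)"
      using insert.hyps(1) bI by (simp add: mult_ac)
    also have "\<dots> = (\<integral>w. (D w * Y w * (\<Prod>u\<in>I. f u (W u w))) * heat (b - a) (f b) (W a w) \<partial>N)"
    proof (rule Markov_property[OF insert.prems(2)])
      have "(\<lambda>w. f u (W u w)) \<in> borel_measurable (F a)" if "u \<in> I" for u
      proof -
        have "s < u" using insert.prems(1) that by auto
        then have "W u \<in> borel_measurable (F a)"
          using s aI_max[OF that] by (intro measurable_F_mono[OF adapted_W]) auto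
        then show ?thesis using bc_measurable[OF insert.prems(2)[of u]] by measurable
      qed
      then show "(\<lambda>w. D w * Y w * (\<Prod>u\<in>I. f u (W u w))) \<in> borel_measurable (F a)"
        using D(1)[OF a(1)] measurable_F_mono[OF Y(1) less_imp_le[OF a(1)]] by measurable
      show "\<bar>D w * Y w * (\<Prod>u\<in>I. f u (W u w))\<bar> \<le> 1" if "w \<in> space N" for w
        unfolding abs_mult[of "D w * Y w"] by (intro mult_le_one DY that pb) simp
    qed (use a s in auto)
    also have "\<dots> = (\<integral>w. D w * Y w * (\<Prod>u\<in>I. f' u (W u w)) \<partial>N)"
    proof (rule Bochner_Integration.integral_cong[OF refl])
      fix w
      have "(\<Prod>u\<in>I. f' u (W u w)) = f' a (W a w) * (\<Prod>u\<in>I - {a}. f' u (W u w))" by (rule prod.remove[OF insert.hyps(1) aI])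
      also have "(\<Prod>u\<in>I - {a}. f' u (W u w)) = (\<Prod>u\<in>I - {a}. f u (W u w))" by (rule prod.cong) (auto simp: f'_def)
      also have "f' a (W a w) * (\<Prod>u\<in>I - {a}. f u (W u w)) = heat (b - a) (f b) (W a w) * (\<Prod>u\<in>I. f u (W u w))"
        by (simp add: f'_def prod.remove[OF insert.hyps(1) aI, of "\<lambda>u. f u (W u w)"] mult_ac)
      finally show "(D w * Y w * (\<Prod>u\<in>I. f u (W u w))) * heat (b - a) (f b) (W a w) = D w * Y w * (\<Prod>u\<in>I. f' u (W u w))"
        by (simp add: mult_ac)
    qed
    also have "\<dots> = 0" by (rule insert.IH) (use insert.prems f' in auto)
    finally show ?thesis .
  qed
qed

text \<open>The indicator of a closed set is the limit of continuous functions of the distance to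
  it, so the orthogonality to products of functions extends to cylinder events by
  domination.\<close>

lemma germ_orthogonal_cylinder:
  fixes D :: "'a \<Rightarrow> real"
  assumes s: "0 \<le> s"
    and D: "\<And>r. s < r \<Longrightarrow> D \<in> borel_measurable (F r)" "\<And>w. w \<in> space N \<Longrightarrow> \<bar>D w\<bar> \<le> 1"
    and orth: "\<And>Y. Y \<in> borel_measurable (F s) \<Longrightarrow> (\<And>w. w \<in> space N \<Longrightarrow> \<bar>Y w\<bar> \<le> 1) \<Longrightarrow> (\<integral>w. D w * Y w \<partial>N) = 0"
    and I: "finite I" "I \<subseteq> {s<..}" and K: "\<And>u. u \<in> I \<Longrightarrow> closed (K u)" and C: "C \<in> sets (F s)"
  shows "(\<integral>w. indicator (C \<inter> {w \<in> space N. \<forall>u\<in>I. W u w \<in> K u}) w * D w \<partial>N) = 0"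
proof -
  define K' where "K' u = (if u \<in> I then K u else {})" for u
  have K': "closed (K' u)" for u using K by (simp add: K'_def)
  \<comment> \<open>The distance to the empty set is 0 by convention, which would yield the constant
    1 in place of the indicator 0.\<close>
  define f where "f m u x = (if K' u = {} then 0 else max 0 (1 - real m * infdist x (K' u)))" for m u x
  have f_bc: "bc (f m u)" for m u
  proof -
    have "continuous_on UNIV (\<lambda>x. max 0 (1 - real m * infdist x (K' u)))" by (intro continuous_intros)
    moreover have "0 \<le> real m * infdist x (K' u)" for x by (intro mult_nonneg_nonneg infdist_nonneg) simp
    ultimately show ?thesis unfolding bc_def f_def by (cases "K' u = {}") (auto simp: abs_le_iff)
  qed
  have f_lim: "(\<lambda>m. f m u x) \<longlonglongrightarrow> indicator (K' u) x" for u x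
  proof (cases "K' u = {} \<or> x \<in> K' u")
    case True
    then have "f m u x = indicator (K' u) x" for m by (auto simp: f_def infdist_zero)
    then show ?thesis by simp
  next
    case False
    then have pos: "0 < infdist x (K' u)"
      using in_closed_iff_infdist_zero[OF K'] infdist_nonneg[of x "K' u"] by (metis less_le)
    obtain m0 :: nat where "1 < real m0 * infdist x (K' u)" using ex_less_of_nat_mult[OF pos] by blast
    have "f m u x = 0" if "m0 \<le> m" for m
    proof -
      have "real m0 * infdist x (K' u) \<le> real m * infdist x (K' u)" using that pos by (intro mult_right_mono) auto
      with \<open>1 < _\<close> have "1 - real m * infdist x (K' u) \<le> 0" by linarith
      then show ?thesis by (simp add: f_def max_absorb1)
    qed
    then have "\<forall>\<^sub>F m in sequentially. f m u x = 0" unfolding eventually_sequentially by blast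
    then show ?thesis using False by (simp add: tendsto_eventually)
  qed
  have ind: "indicator (C \<inter> {w \<in> space N. \<forall>u\<in>I. W u w \<in> K u}) w = (indicator C w * (\<Prod>u\<in>I. indicator (K' u) (W u w)) :: real)"
    if "w \<in> space N" for w
  proof (cases "\<forall>u\<in>I. W u w \<in> K u")
    case False
    then obtain u where "u \<in> I" "W u w \<notin> K u" by blast
    then have "(\<Prod>u\<in>I. indicator (K' u) (W u w)) = (0::real)" using I(1) by (intro prod_zero bexI[of _ u]) (auto simp: K'_def)
    with False show ?thesis by auto
  qed (use that in \<open>auto simp: K'_def split: split_indicator\<close>)
  have Wm: "W u \<in> borel_measurable N" if "u \<in> I" for u using that I(2) s by (intro measurable_W) auto
  have CN[measurable]: "C \<in> sets N" using C sets_F_subset by auto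
  have Dm[measurable]: "D \<in> borel_measurable N" by (rule measurable_F_N[OF D(1)[of "s + 1"]]) simp
  have pm: "(\<lambda>w. \<Prod>u\<in>I. g u (W u w)) \<in> borel_measurable N" if "\<And>u. g u \<in> borel_measurable borel" for g :: "real \<Rightarrow> real ^ 'd \<Rightarrow> real"
    using measurable_compose[OF Wm that] by (intro borel_measurable_prod) auto
  have [measurable]: "(\<lambda>w. \<Prod>u\<in>I. f m u (W u w)) \<in> borel_measurable N" for m by (rule pm[OF bc_measurable[OF f_bc]])
  have [measurable]: "(\<lambda>w. \<Prod>u\<in>I. indicator (K' u) (W u w) :: real) \<in> borel_measurable N"
    by (rule pm) (use K' in \<open>auto intro!: borel_measurable_indicator borel_closed\<close>)
  have "(\<lambda>m. \<integral>w. D w * indicator C w * (\<Prod>u\<in>I. f m u (W u w)) \<partial>N) \<longlonglongrightarrow> (\<integral>w. D w * indicator C w * (\<Prod>u\<in>I. indicator (K' u) (W u w)) \<partial>N)"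
  proof (rule integral_dominated_convergence[where w="\<lambda>_. 1"])
    show "AE w in N. (\<lambda>m. D w * indicator C w * (\<Prod>u\<in>I. f m u (W u w))) \<longlonglongrightarrow> D w * indicator C w * (\<Prod>u\<in>I. indicator (K' u) (W u w))"
      by (intro AE_I2 tendsto_intros f_lim)
    show "AE w in N. norm (D w * indicator C w * (\<Prod>u\<in>I. f m u (W u w))) \<le> 1" (is "AE w in N. ?P w") for m
    proof (rule AE_I2)
      fix w assume "w \<in> space N"
      moreover have "\<bar>\<Prod>u\<in>I. f m u (W u w)\<bar> \<le> 1"
        unfolding abs_prod using f_bc by (intro prod_le_1) (auto simp: bc_def)
      ultimately show "?P w"
        using D(2) by (auto simp: abs_mult split: split_indicator intro!: mult_le_one)
    qed
  qed measurable
  moreover have "(\<integral>w. D w * indicator C w * (\<Prod>u\<in>I. f m u (W u w)) \<partial>N) = 0" for m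
    by (rule germ_orthogonal[OF s D orth I f_bc]) (use C in \<open>auto split: split_indicator\<close>)
  ultimately have "(\<integral>w. D w * indicator C w * (\<Prod>u\<in>I. indicator (K' u) (W u w)) \<partial>N) = 0"
    by (simp add: LIMSEQ_const_iff)
  also have "(\<integral>w. D w * indicator C w * (\<Prod>u\<in>I. indicator (K' u) (W u w)) \<partial>N) =
     (\<integral>w. indicator (C \<inter> {w \<in> space N. \<forall>u\<in>I. W u w \<in> K u}) w * D w \<partial>N)"
    by (rule Bochner_Integration.integral_cong[OF refl]) (simp only: ind mult_ac)
  finally show ?thesis .
qed

text \<open>Let \<open>D\<close> be the indicator of \<open>A\<close> minus its conditional
  expectation given \<open>F s\<close>. It is measurable at every time after \<open>s\<close> and
  orthogonal to \<open>F s\<close>, hence has integral 0 over cylinder events and, by a pi-lambda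
  argument, over all events up to \<open>s + 1\<close>, in particular over \<open>A\<close>. So
  \<open>D\<close> is orthogonal to itself, and \<open>A\<close> belongs to \<open>F s\<close> up to
  a null set.\<close>

lemma right_continuous_F:
  assumes gen: "\<And>v. 0 \<le> v \<Longrightarrow> sets (F v) \<subseteq> sigma_sets (space N) (past_events N W v \<union> null_sets N)"
    and s: "0 \<le> s" and A: "\<And>r. s < r \<Longrightarrow> A \<in> sets (F r)"
  shows "A \<in> sets (F s)"
proof -
  have AN[measurable]: "A \<in> sets N" using A[of "s + 1"] sets_F_subset by auto
  interpret S: finite_measure_subalgebra N "F s" by unfold_locales (rule subalgebra_F)
  \<comment> \<open>Clipping to \<open>[0, 1]\<close> alters the conditional expectation on a null
    set only and gives bounds at every point.\<close>
  define Z where "Z w = max 0 (min 1 (real_cond_exp N (F s) (indicator A) w))" for w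
  have iA: "integrable N (indicator A :: 'a \<Rightarrow> real)"
    by (rule integrable_const_bound[of _ 1]) (auto split: split_indicator)
  have ZF[measurable]: "Z \<in> borel_measurable (F s)" unfolding Z_def by measurable
  have ZN[measurable]: "Z \<in> borel_measurable N" by (rule measurable_F_N[OF ZF])
  have "AE w in N. 0 \<le> real_cond_exp N (F s) (indicator A) w" by (rule S.real_cond_exp_pos) auto
  moreover have "AE w in N. real_cond_exp N (F s) (indicator A) w \<le> real_cond_exp N (F s) (\<lambda>_. 1) w"
    by (rule S.real_cond_exp_mono[OF _ iA]) (auto split: split_indicator)
  moreover have "AE w in N. real_cond_exp N (F s) (\<lambda>_. 1) w = 1" by (rule S.real_cond_exp_F_meas) auto
  ultimately have Z: "AE w in N. real_cond_exp N (F s) (indicator A) w = Z w"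
    by eventually_elim (auto simp: Z_def)
  define D where "D w = indicator A w - Z w" for w
  have Db: "\<bar>D w\<bar> \<le> 1" for w by (auto simp: D_def Z_def split: split_indicator)
  have Dr: "D \<in> borel_measurable (F r)" if "s < r" for r
    unfolding D_def using A[OF that] measurable_F_mono[OF ZF less_imp_le[OF that]] by measurable
  have DN[measurable]: "D \<in> borel_measurable N" unfolding D_def[abs_def] by measurable
  have iD: "integrable N (\<lambda>w. Y w * D w)" if [measurable]: "Y \<in> borel_measurable N" and "\<And>w. w \<in> space N \<Longrightarrow> \<bar>Y w\<bar> \<le> 1" for Y
    by (rule integrable_const_bound[of _ 1]) (use that Db in \<open>auto simp: abs_mult intro!: AE_I2 mult_le_one\<close>)
  have orth: "(\<integral>w. D w * Y w \<partial>N) = 0" if Y[measurable]: "Y \<in> borel_measurable (F s)" and Yb: "\<And>w. w \<in> space N \<Longrightarrow> \<bar>Y w\<bar> \<le> 1" for Y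
  proof -
    have YN[measurable]: "Y \<in> borel_measurable N" by (rule measurable_F_N[OF Y])
    have i1: "integrable N (\<lambda>w. Y w * indicator A w)" "integrable N (\<lambda>w. Y w * Z w)"
      by (rule integrable_const_bound[of _ 1]; use Yb in \<open>auto simp: abs_mult Z_def split: split_indicator intro!: AE_I2 mult_le_one\<close>)+
    have "(\<integral>w. Y w * real_cond_exp N (F s) (indicator A) w \<partial>N) = (\<integral>w. Y w * indicator A w \<partial>N)"
      by (rule S.real_cond_exp_intg(2)[OF i1(1) Y]) simp
    moreover have "(\<integral>w. Y w * real_cond_exp N (F s) (indicator A) w \<partial>N) = (\<integral>w. Y w * Z w \<partial>N)"
      by (rule integral_cong_AE) (use Z in \<open>auto elim!: AE_mp\<close>)
    moreover have "(\<integral>w. D w * Y w \<partial>N) = (\<integral>w. Y w * indicator A w - Y w * Z w \<partial>N)"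
      by (rule Bochner_Integration.integral_cong) (auto simp: D_def algebra_simps)
    ultimately show ?thesis using i1 by simp
  qed
  \<comment> \<open>An event up to \<open>s\<close> together with finitely many positions after
    \<open>s\<close> in closed sets: stable under intersection, and rich enough to generate
    \<open>F (s + 1)\<close>.\<close>
  define P where "P = {C \<inter> {w \<in> space N. \<forall>u\<in>I. W u w \<in> K u} | C I K. C \<in> sets (F s) \<and> finite I \<and> I \<subseteq> {s<..} \<and> (\<forall>u\<in>I. closed (K u))}"
  have P_pow: "P \<subseteq> Pow (space N)" by (auto simp: P_def)
  have P_I: "C \<inter> {w \<in> space N. \<forall>u\<in>I. W u w \<in> K u} \<in> P" if "C \<in> sets (F s)" "finite I" "I \<subseteq> {s<..}" "\<And>u. u \<in> I \<Longrightarrow> closed (K u)" for C I K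
    unfolding P_def using that by blast
  have P_Int: "Int_stable P"
  proof (rule Int_stableI)
    fix a b assume "a \<in> P" "b \<in> P"
    then obtain C I K C' I' K' where *: "a = C \<inter> {w \<in> space N. \<forall>u\<in>I. W u w \<in> K u}" "C \<in> sets (F s)" "finite I" "I \<subseteq> {s<..}" "\<forall>u\<in>I. closed (K u)"
      "b = C' \<inter> {w \<in> space N. \<forall>u\<in>I'. W u w \<in> K' u}" "C' \<in> sets (F s)" "finite I'" "I' \<subseteq> {s<..}" "\<forall>u\<in>I'. closed (K' u)"
      unfolding P_def by blast
    have "a \<inter> b = (C \<inter> C') \<inter> {w \<in> space N. \<forall>u\<in>I \<union> I'. W u w \<in> (if u \<in> I then K u else UNIV) \<inter> (if u \<in> I' then K' u else UNIV)}"
      unfolding * by auto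
    also have "\<dots> \<in> P" using * by (intro P_I) auto
    finally show "a \<inter> b \<in> P" .
  qed
  have base: "B \<in> sigma_sets (space N) P" if "B \<in> past_events N W (s + 1) \<union> null_sets N" for B
  proof -
    have F_P: "C \<in> sigma_sets (space N) P" if C: "C \<in> sets (F s)" for C
    proof -
      have "C \<inter> {w \<in> space N. \<forall>u\<in>{}. W u w \<in> {}} = C" using sets.sets_into_space[OF C] by (auto simp: space_F)
      then show ?thesis using P_I[OF C, of "{}" "\<lambda>_. {}"] by auto
    qed
    from that show ?thesis
    proof
      assume "B \<in> null_sets N" then show ?thesis using null_sets_F F_P by auto
    next
      assume "B \<in> past_events N W (s + 1)"
      then obtain u S where u: "0 \<le> u" "S \<in> sets borel" "B = W u -` S \<inter> space N" by (auto simp: past_events_def)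
      show ?thesis
      proof (cases "u \<le> s")
        case True
        have "W u \<in> borel_measurable (F s)" by (rule measurable_F_mono[OF adapted_W[OF u(1)] True])
        then have "B \<in> sets (F s)" using measurable_sets[OF _ u(2)] unfolding u(3) by (metis space_F)
        then show ?thesis by (rule F_P)
      next
        case False
        have "W u \<in> borel_measurable (sigma (space N) P)"
        proof (rule borel_measurableI)
          fix O' :: "(real ^ 'd) set" assume O': "open O'"
          have "space N \<inter> {w \<in> space N. \<forall>v\<in>{u}. W v w \<in> - O'} \<in> P"
            by (rule P_I) (use False O' sets.top[of "F s"] in \<open>auto simp: space_F\<close>)
          then have "space N - (space N \<inter> {w \<in> space N. \<forall>v\<in>{u}. W v w \<in> - O'}) \<in> sigma_sets (space N) P"
            by (intro sigma_sets.Compl sigma_sets.Basic)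
          moreover have "space N - (space N \<inter> {w \<in> space N. \<forall>v\<in>{u}. W v w \<in> - O'}) = W u -` O' \<inter> space N" by auto
          ultimately show "W u -` O' \<inter> space (sigma (space N) P) \<in> sets (sigma (space N) P)"
            using P_pow by (simp add: space_measure_of sets_measure_of)
        qed
        from measurable_sets[OF this u(2)] show ?thesis
          unfolding u(3) using P_pow by (simp add: space_measure_of sets_measure_of)
      qed
    qed
  qed
  have P_N: "sigma_sets (space N) P \<subseteq> sets N"
  proof (rule sets.sigma_sets_subset)
    show "P \<subseteq> sets N"
    proof
      fix B assume "B \<in> P"
      then obtain C I K where *: "B = C \<inter> {w \<in> space N. \<forall>u\<in>I. W u w \<in> K u}" "C \<in> sets (F s)" "finite I" "I \<subseteq> {s<..}" "\<And>u. u \<in> I \<Longrightarrow> closed (K u)"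
        unfolding P_def by blast
      have "{w \<in> space N. \<forall>u\<in>I. W u w \<in> K u} \<in> sets N"
      proof (rule sets.sets_Collect_finite_All[OF _ *(3)])
        fix u assume u: "u \<in> I"
        have "W u \<in> borel_measurable N" using *(4) u s by (intro measurable_W) auto
        from measurable_sets[OF this borel_closed[OF *(5)[OF u]]]
        show "{w \<in> space N. W u w \<in> K u} \<in> sets N" by (simp add: vimage_def Int_def conj_commute)
      qed
      then show "B \<in> sets N" unfolding *(1) using *(2) sets_F_subset by blast
    qed
  qed
  have "A \<in> sigma_sets (space N) P"
  proof -
    have "A \<in> sigma_sets (space N) (past_events N W (s + 1) \<union> null_sets N)" using gen[of "s + 1"] A[of "s + 1"] s by auto
    moreover have "past_events N W (s + 1) \<union> null_sets N \<subseteq> sigma_sets (space N) P" using base by (rule subsetI)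
    ultimately show ?thesis by (rule subsetD[OF sigma_sets_mono, rotated])
  qed
  then have "(LINT w:A|N. D w) = 0"
  proof (induction rule: sigma_sets_induct_disjoint[OF P_Int P_pow, consumes 1, case_names basic empty compl union])
    case (basic B)
    then obtain C I K where *: "B = C \<inter> {w \<in> space N. \<forall>u\<in>I. W u w \<in> K u}" "C \<in> sets (F s)" "finite I" "I \<subseteq> {s<..}" "\<And>u. u \<in> I \<Longrightarrow> closed (K u)"
      unfolding P_def by blast
    have "(\<integral>w. indicator (C \<inter> {w \<in> space N. \<forall>u\<in>I. W u w \<in> K u}) w * D w \<partial>N) = 0"
    proof (rule germ_orthogonal_cylinder[OF s])
      show "D \<in> borel_measurable (F r)" if "s < r" for r by (rule Dr[OF that])
      show "\<bar>D w\<bar> \<le> 1" for w by (rule Db)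
      show "(\<integral>w. D w * Y w \<partial>N) = 0" if "Y \<in> borel_measurable (F s)" "\<And>w. w \<in> space N \<Longrightarrow> \<bar>Y w\<bar> \<le> 1" for Y
        by (rule orth[OF that])
      show "closed (K u)" if "u \<in> I" for u by (rule *(5)[OF that])
    qed (rule *)+
    then show ?case unfolding set_lebesgue_integral_def *(1) real_scaleR_def .
  next
    case (compl B)
    have [measurable]: "B \<in> sets N" using compl(1) P_N by auto
    have "(\<integral>w. D w * 1 \<partial>N) = 0" by (rule orth) auto
    moreover have "(LINT w:space N - B|N. D w) = (\<integral>w. D w - indicator B w * D w \<partial>N)"
      unfolding set_lebesgue_integral_def by (rule Bochner_Integration.integral_cong) (auto split: split_indicator)
    moreover have "integrable N (\<lambda>w. indicator B w * D w)" "integrable N (\<lambda>w. 1 * D w)"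
      by (rule iD; auto split: split_indicator)+
    ultimately show ?case using compl(2) by (simp add: set_lebesgue_integral_def)
  next
    case (union B)
    have B: "B i \<in> sets N" for i using union(2) P_N by auto
    have "(LINT w:(\<Union>i. B i)|N. D w) = (\<Sum>i. LINT w:B i|N. D w)"
    proof (rule lebesgue_integral_countable_add[OF B])
      have "(\<Union>i. B i) \<in> sets N" using B by auto
      then show "set_integrable N (\<Union>i. B i) D"
        unfolding set_integrable_def by (simp, intro iD) (auto split: split_indicator)
    qed (use union(1) in \<open>auto simp: disjoint_family_on_def\<close>)
    then show ?case using union(3) by simp
  qed (simp add: set_lebesgue_integral_def)
  then have "(\<integral>w. indicator A w * D w \<partial>N) = 0" by (simp add: set_lebesgue_integral_def)
  moreover have "(\<integral>w. D w * Z w \<partial>N) = 0" by (rule orth) (auto simp: Z_def)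
  moreover have "integrable N (\<lambda>w. indicator A w * D w)" by (rule iD) (auto split: split_indicator)
  moreover have "integrable N (\<lambda>w. Z w * D w)" by (rule iD) (auto simp: Z_def)
  ultimately have "(\<integral>w. indicator A w * D w - Z w * D w \<partial>N) = 0" by (simp add: mult.commute)
  \<comment> \<open>Both terms of \<open>D = indicator A - Z\<close> have been shown orthogonal to
    \<open>D\<close>.\<close>
  then have "(\<integral>w. D w * D w \<partial>N) = 0" by (simp add: D_def left_diff_distrib)
  moreover have "integrable N (\<lambda>w. D w * D w)" by (rule iD) (use Db in auto)
  ultimately have "AE w in N. D w * D w = 0" by (subst (asm) integral_nonneg_eq_0_iff_AE) auto
  then have eq: "AE w in N. w \<in> {w \<in> space N. Z w = 1} \<longleftrightarrow> w \<in> A"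
    using AE_space by eventually_elim (auto simp: D_def split: split_indicator_asm)
  have "{w \<in> space N. Z w = 1} \<in> sets (F s)" using ZF by (simp add: space_F[symmetric, of s])
  from sets_F_AE[OF this eq] show ?thesis using sets.sets_into_space[OF AN] .
qed

end

section \<open>Verification of the conditions for the ball partition\<close>

lemma real_eta_hat_upto:
  assumes "0 < t" shows "ereal (eta_hat_upto G t k w) = min (eta_hat G k w) (ereal t)"
proof -
  have "0 \<le> eta_hat G k w" unfolding eta_hat_def by (rule Inf_greatest) auto
  then have "0 \<le> min (eta_hat G k w) (ereal t)" "min (eta_hat G k w) (ereal t) \<le> ereal t" using assms by (auto simp: min_def)
  then show ?thesis unfolding eta_hat_upto_def
    by (cases "min (eta_hat G k w) (ereal t)") auto
qed

lemma eta_hat_upto_bounds: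
  assumes "0 < t" shows "0 \<le> eta_hat_upto G t k w" "eta_hat_upto G t k w \<le> t"
proof -
  have "0 \<le> eta_hat G k w" unfolding eta_hat_def by (rule Inf_greatest) auto
  then have "ereal 0 \<le> ereal (eta_hat_upto G t k w)" using assms unfolding real_eta_hat_upto[OF assms] by (auto simp: zero_ereal_def[symmetric])
  then show "0 \<le> eta_hat_upto G t k w" by simp
  have "ereal (eta_hat_upto G t k w) \<le> ereal t" unfolding real_eta_hat_upto[OF assms] by simp
  then show "eta_hat_upto G t k w \<le> t" by simp
qed

text \<open>Strict inequality is used because an infimum lies strictly below \<open>u\<close>
  exactly when some element does, with no question of attainment.\<close>

lemma eta_hat_upto_less:
  assumes "0 < t"
  shows "eta_hat_upto G t k w < u \<longleftrightarrow> t < u \<or> (\<exists>s. 0 < s \<and> s < u \<and> (real k < G s w \<or> G s w < 1 / real k))"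
proof -
  have "eta_hat_upto G t k w < u \<longleftrightarrow> ereal (eta_hat_upto G t k w) < ereal u" by simp
  also have "\<dots> \<longleftrightarrow> eta_hat G k w < ereal u \<or> t < u" unfolding real_eta_hat_upto[OF assms] by (simp add: min_less_iff_disj)
  also have "eta_hat G k w < ereal u \<longleftrightarrow> (\<exists>s. 0 < s \<and> s < u \<and> (real k < G s w \<or> G s w < 1 / real k))"
    unfolding eta_hat_def Inf_less_iff by auto
  finally show ?thesis by blast
qed

lemma eta_hat_upto_cong:
  assumes "0 < t" "\<And>s. s \<in> {0..t} \<Longrightarrow> G s w = G' s w"
  shows "eta_hat_upto G t k w = eta_hat_upto G' t k w"
proof -
  have "eta_hat_upto G t k w < u \<longleftrightarrow> eta_hat_upto G' t k w < u" for u
  proof (cases "t < u")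
    case False
    have "G s w = G' s w" if "0 < s" "s < u" for s using assms(2)[of s] that False by simp
    then show ?thesis unfolding eta_hat_upto_less[OF assms(1)] by metis
  qed (simp add: eta_hat_upto_less[OF assms(1)])
  then show ?thesis by (meson less_irrefl linorder_neqE)
qed

text \<open>The infimum looks at positive times only; continuity carries the bounds to time 0, where
  the first interval begins.\<close>

lemma bounds_before_eta_hat:
  fixes G :: "real \<Rightarrow> 'a \<Rightarrow> real"
  assumes c: "continuous_on {0..} (\<lambda>s. G s w)" and le: "ereal \<tau> \<le> eta_hat G k w" and s: "0 \<le> s" "s < \<tau>"
  shows "1 / real k \<le> G s w \<and> G s w \<le> real k"
proof -
  have b: "1 / real k \<le> G u w \<and> G u w \<le> real k" if "u \<in> {0<..<\<tau>}" for u
  proof (rule ccontr)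
    assume "\<not> ?thesis"
    then have "ereal u \<in> ereal ` {s. s > 0 \<and> (G s w > real k \<or> G s w < 1 / real k)}" using that by auto
    then have "eta_hat G k w \<le> ereal u" unfolding eta_hat_def by (rule Inf_lower)
    then have "ereal \<tau> \<le> ereal u" using le by (rule order_trans[rotated])
    then show False using that by simp
  qed
  have cl: "closure {0<..<\<tau>} = {0..\<tau>}" using s by (intro closure_greaterThanLessThan) simp
  have c': "continuous_on (closure {0<..<\<tau>}) (\<lambda>s. G s w)" unfolding cl by (rule continuous_on_subset[OF c]) auto
  have sc: "s \<in> closure {0<..<\<tau>}" unfolding cl using s by simp
  show ?thesis using continuous_ge_on_closure[OF c' sc] continuous_le_on_closure[OF c' sc] b by simp
qed

context bm
begin

text \<open>Exceptional sets live in the completion; together with the null set where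
  \<open>X n\<close> and \<open>Y n\<close> differ they are covered by an event of \<open>M\<close>
  of the same measure, which bounds the outer measure.\<close>

lemma small_tends_to_0:
  assumes N: "N = completion M" and X: "small X" and eq: "\<forall>\<^sub>F n in sequentially. AE w in N. X n w = Y n w"
  shows "tends_to_0_in_prob M Y"
  unfolding tends_to_0_in_prob_def
proof (intro allI impI order_tendstoI)
  fix \<epsilon> :: real and a :: ennreal assume \<epsilon>: "0 < \<epsilon>" and a: "0 < a"
  obtain \<delta> where \<delta>: "0 < \<delta>" "ennreal \<delta> < a"
  proof (cases a)
    case (real r) then show ?thesis using a by (intro that[of "r / 2"]) (auto simp: ennreal_less_iff)
  next
    case top then show ?thesis by (intro that[of 1]) auto
  qed
  from X \<epsilon> \<delta>(1) have "\<forall>\<^sub>F n in sequentially. \<exists>E\<in>sets N. emeasure N E \<le> ennreal \<delta> \<and> (\<forall>w\<in>space N - E. X n w \<le> ennreal \<epsilon>)"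
    unfolding small_def by blast
  with eq show "\<forall>\<^sub>F n in sequentially. outer_measure_of M {w \<in> space M. ennreal \<epsilon> < Y n w} < a"
  proof eventually_elim
    case (elim n)
    then obtain E where E: "E \<in> sets N" "emeasure N E \<le> ennreal \<delta>" "\<And>w. w \<in> space N - E \<Longrightarrow> X n w \<le> ennreal \<epsilon>" by blast
    obtain Z where Z: "{w \<in> space N. \<not> X n w = Y n w} \<subseteq> Z" "emeasure N Z = 0" "Z \<in> sets N"
      using elim(1) by (rule AE_E)
    have "E \<union> Z \<in> sets (completion M)" using E(1) Z(3) N by auto
    then obtain A where A: "A \<in> sets M" "E \<union> Z \<subseteq> A" "emeasure N (E \<union> Z) = emeasure M A"
      using completion_upper[of "E \<union> Z" M] N by blast
    have "{w \<in> space M. ennreal \<epsilon> < Y n w} \<subseteq> A"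
    proof
      fix w assume w: "w \<in> {w \<in> space M. ennreal \<epsilon> < Y n w}"
      show "w \<in> A"
      proof (rule ccontr)
        assume "w \<notin> A"
        then have "w \<in> space N - E" "X n w = Y n w" using w A(2) Z(1) N by auto
        then show False using E(3)[of w] w by (simp add: not_le[symmetric])
      qed
    qed
    then have "outer_measure_of M {w \<in> space M. ennreal \<epsilon> < Y n w} \<le> outer_measure_of M A" by (rule outer_measure_of_mono)
    also have "\<dots> = emeasure N (E \<union> Z)" using A by (simp add: outer_measure_of_eq)
    also have "\<dots> \<le> emeasure N E + emeasure N Z" using E(1) Z(3) by (rule emeasure_subadditive)
    also have "\<dots> < a" using E(2) Z(2) \<delta>(2) by (simp add: order_le_less_trans)
    finally show ?case .
  qed
qed simp

lemma measurable_F_AE_cong: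
  assumes f: "f \<in> measurable (F s) B" and eq: "AE w in N. f w = g w" and sp: "\<And>w. w \<in> space N \<Longrightarrow> g w \<in> space B"
  shows "g \<in> measurable (F s) B"
proof (rule measurableI)
  fix A assume "A \<in> sets B"
  then have "f -` A \<inter> space (F s) \<in> sets (F s)" using f by auto
  moreover have eq': "AE w in N. w \<in> f -` A \<inter> space (F s) \<longleftrightarrow> w \<in> g -` A \<inter> space (F s)" using eq by eventually_elim auto
  ultimately show "g -` A \<inter> space (F s) \<in> sets (F s)" by (intro sets_F_AE[OF _ eq']) (auto simp: space_F)
qed (use sp in \<open>auto simp: space_F\<close>)

end

context bm_ball
begin

text \<open>Leaving \<open>[1 / k, k]\<close> means entering an open set, so by continuity rational
  times before \<open>u\<close> decide the event that the time is less than \<open>u\<close>. The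
  event with \<open>\<le>\<close> is decided at every time after \<open>u\<close>, and
  right-continuity \<open>rc\<close> brings it back to \<open>u\<close>.\<close>

lemma stopping_time_eta_hat:
  assumes rc: "\<And>s A. 0 \<le> s \<Longrightarrow> (\<And>r. s < r \<Longrightarrow> A \<in> sets (F r)) \<Longrightarrow> A \<in> sets (F s)" and t: "0 < t"
  shows "stopping_time F (eta_hat_upto G t k)"
proof
  have less: "{w \<in> space N. eta_hat_upto G t k w < u} \<in> sets (F u)" if u: "0 < u" for u
  proof (cases "t < u")
    case True
    then have "{w \<in> space N. eta_hat_upto G t k w < u} = space (F u)" by (auto simp: eta_hat_upto_less[OF t] space_F)
    then show ?thesis by simp
  next
    case False
    let ?O = "{x. real k < x \<or> x < 1 / real k}"
    have O': "open ?O" by (intro open_Collect_disj open_Collect_less continuous_intros)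
    have "(\<exists>s. 0 < s \<and> s < u \<and> G s w \<in> ?O) \<longleftrightarrow> (\<exists>q\<in>\<rat> \<inter> {0<..<u}. G q w \<in> ?O)" if w: "w \<in> space N" for w
    proof
      assume "\<exists>s. 0 < s \<and> s < u \<and> G s w \<in> ?O"
      then obtain s where s: "0 < s" "s < u" "G s w \<in> ?O" by blast
      have "continuous_on {0<..<u} (\<lambda>s. G s w)" by (rule continuous_on_subset[OF continuous_G[OF w]]) auto
      then have "open ({0<..<u} \<inter> (\<lambda>s. G s w) -` ?O)" by (rule continuous_open_preimage[OF _ open_greaterThanLessThan O'])
      moreover have "s \<in> {0<..<u} \<inter> (\<lambda>s. G s w) -` ?O" using s by simp
      ultimately obtain e where e: "0 < e" "\<And>y. dist y s < e \<Longrightarrow> y \<in> {0<..<u} \<inter> (\<lambda>s. G s w) -` ?O"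
        unfolding open_dist by blast
      obtain q where q: "q \<in> \<rat>" "s < q" "q < s + e" using Rats_dense_in_real[of s "s + e"] e(1) by auto
      then have "q \<in> {0<..<u} \<inter> (\<lambda>s. G s w) -` ?O" by (intro e(2)) (simp add: dist_real_def)
      then show "\<exists>q\<in>\<rat> \<inter> {0<..<u}. G q w \<in> ?O" using q(1) by blast
    qed auto
    then have "{w \<in> space N. eta_hat_upto G t k w < u} = {w \<in> space (F u). \<exists>q\<in>\<rat> \<inter> {0<..<u}. G q w \<in> ?O}"
      using False unfolding eta_hat_upto_less[OF t] by (auto simp: space_F)
    moreover have "Measurable.pred (F u) (\<lambda>w. \<exists>q\<in>\<rat> \<inter> {0<..<u}. G q w \<in> ?O)"
    proof (intro measurable_pred_countable countable_Int1 countable_rat)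
      fix q assume "q \<in> \<rat> \<inter> {0<..<u}"
      then have "G q \<in> borel_measurable (F u)" by (intro measurable_F_mono[OF adapted_G]) auto
      then show "Measurable.pred (F u) (\<lambda>w. G q w \<in> ?O)" by measurable
    qed
    ultimately show ?thesis by (simp add: pred_def)
  qed
  fix u
  show "Measurable.pred (F u) (\<lambda>w. eta_hat_upto G t k w \<le> u)"
  proof (cases "0 \<le> u")
    case False
    then have "{w \<in> space (F u). eta_hat_upto G t k w \<le> u} = {}" using eta_hat_upto_bounds(1)[OF t, of G k] by (auto simp: not_le intro: order.strict_trans2)
    then show ?thesis using sets.empty_sets[of "F u"] by (simp only: pred_def)
  next
    case True
    have "{w \<in> space N. eta_hat_upto G t k w \<le> u} \<in> sets (F u)"
    proof (rule rc[OF True])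
      fix r assume r: "u < r"
      define v where "v m = u + (r - u) / real (Suc m)" for m
      have v: "u < v m" "v m \<le> r" for m
      proof -
        show "u < v m" using r by (simp add: v_def)
        have "(r - u) / real (Suc m) \<le> (r - u) / 1" using r by (intro divide_left_mono) auto
        then show "v m \<le> r" unfolding v_def by simp
      qed
      have lim: "v \<longlonglongrightarrow> u"
      proof -
        have "(\<lambda>m. u + (r - u) * (1 / real (Suc m))) \<longlonglongrightarrow> u + (r - u) * 0"
          by (intro tendsto_intros LIMSEQ_inverse_real_of_nat[unfolded inverse_eq_divide])
        then show ?thesis by (simp add: v_def[abs_def])
      qed
      have "{w \<in> space N. eta_hat_upto G t k w \<le> u} = (\<Inter>m. {w \<in> space N. eta_hat_upto G t k w < v m})"
      proof (intro equalityI subsetI)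
        fix w assume "w \<in> (\<Inter>m. {w \<in> space N. eta_hat_upto G t k w < v m})"
        then have "w \<in> space N" "\<And>m. eta_hat_upto G t k w \<le> v m" by (auto intro: less_imp_le)
        then show "w \<in> {w \<in> space N. eta_hat_upto G t k w \<le> u}" using LIMSEQ_le_const[OF lim] by auto
      qed (use v(1) in \<open>auto intro: le_less_trans\<close>)
      moreover have "{w \<in> space N. eta_hat_upto G t k w < v m} \<in> sets (F r)" for m
        using less[of "v m"] v[of m] True sets_F_mono[of "v m" r] by auto
      ultimately show "{w \<in> space N. eta_hat_upto G t k w \<le> u} \<in> sets (F r)" by auto
    qed
    then show ?thesis by (simp add: pred_def space_F)
  qed
qed

lemma cond_exp_length:
  assumes n: "1 \<le> n"
  shows "AE w in N. real_cond_exp N (pre_sigma (p n m)) (\<lambda>w. p n (Suc m) w - p n m w) w = 1 / (real n * G (p n m w) w)"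
proof -
  interpret E: bm_exit N F W "p n m" "p n (Suc m)" "radius n m" by (rule exit_p[OF n])
  have "AE w in N. real_cond_exp N (pre_sigma (p n m)) E.\<Delta> w = enn2real (nn_cond_exp N (pre_sigma (p n m)) (\<lambda>w. ennreal (E.\<Delta> w)) w)"
    by (rule real_cond_exp_nonneg[OF p_stopping[OF n]]) (use p_measurable[OF n] E.\<Delta>_nonneg in \<open>auto intro!: borel_measurable_diff simp del: ball_partition.simps\<close>)
  with E.cond_exp_duration AE_space show ?thesis
  proof eventually_elim
    case (elim w)
    have "0 \<le> radius n m w / real CARD('d)" using p_stop(3)[OF n elim(2), of m] by simp
    then have "enn2real (ennreal (radius n m w / real CARD('d))) = radius n m w / real CARD('d)" by (rule enn2real_ennreal)
    then show ?case using elim(1,3) by (simp add: radius_def)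
  qed
qed

text \<open>The process for which the exit moment \<open>3 R^2 / (d (d + 2))\<close> with
  \<open>R = d / (n G)\<close> equals \<open>H / (n^2 G)\<close> exactly.\<close>

definition optimal :: "real \<Rightarrow> 'a \<Rightarrow> real" where
  "optimal s w = 3 * real CARD('d) / ((real CARD('d) + 2) * G s w)"

lemma optimal:
  "0 \<le> s \<Longrightarrow> optimal s \<in> borel_measurable (F s)"
  "w \<in> space N \<Longrightarrow> continuous_on {0..} (\<lambda>s. optimal s w)"
proof -
  show "optimal s \<in> borel_measurable (F s)" if "0 \<le> s"
    using adapted_G[OF that] unfolding optimal_def[abs_def] by measurable
  show "continuous_on {0..} (\<lambda>s. optimal s w)" if "w \<in> space N"
    unfolding optimal_def using G_pos[OF that]
    by (intro continuous_intros continuous_G[OF that]) (auto simp: less_imp_neq[symmetric] add_eq_0_iff)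
qed

lemma cond_moments_exit:
  assumes n: "1 \<le> n"
  shows "AE w in N. nn_cond_exp N (pre_sigma (p n m)) (\<lambda>w. ennreal \<bar>(W (p n (Suc m) w) w $ j - W (p n m w) w $ j) ^ 3\<bar>) w < \<infinity> \<and>
      real_cond_exp N (pre_sigma (p n m)) (\<lambda>w. (W (p n (Suc m) w) w $ j - W (p n m w) w $ j) ^ 3) w = 0"
    and "AE w in N. nn_cond_exp N (pre_sigma (p n m)) (\<lambda>w. ennreal \<bar>\<bar>W (p n (Suc m) w) w $ j - W (p n m w) w $ j\<bar> ^ 4\<bar>) w < \<infinity> \<and>
      real_cond_exp N (pre_sigma (p n m)) (\<lambda>w. \<bar>W (p n (Suc m) w) w $ j - W (p n m w) w $ j\<bar> ^ 4) w =
        1 / (real n)\<^sup>2 * (optimal (p n m w) w / G (p n m w) w)"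
    and "i \<noteq> j \<Longrightarrow> AE w in N. nn_cond_exp N (pre_sigma (p n m)) (\<lambda>w. ennreal \<bar>cross_integral W (p n) m i j w\<bar>) w < \<infinity> \<and>
      real_cond_exp N (pre_sigma (p n m)) (cross_integral W (p n) m i j) w = 0"
    and "(\<lambda>w. W (p n (Suc m) w) w $ j - W (p n m w) w $ j) \<in> borel_measurable N"
    and "i \<noteq> j \<Longrightarrow> cross_integral W (p n) m i j \<in> borel_measurable N"
proof -
  interpret E: bm_exit N F W "p n m" "p n (Suc m)" "radius n m" by (rule exit_p[OF n])
  show "AE w in N. nn_cond_exp N (pre_sigma (p n m)) (\<lambda>w. ennreal \<bar>(W (p n (Suc m) w) w $ j - W (p n m w) w $ j) ^ 3\<bar>) w < \<infinity> \<and>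
      real_cond_exp N (pre_sigma (p n m)) (\<lambda>w. (W (p n (Suc m) w) w $ j - W (p n m w) w $ j) ^ 3) w = 0"
    using E.cond_exp_cubic[of j] unfolding vector_minus_component .
  from E.cond_exp_quartic[of j] AE_space
  show "AE w in N. nn_cond_exp N (pre_sigma (p n m)) (\<lambda>w. ennreal \<bar>\<bar>W (p n (Suc m) w) w $ j - W (p n m w) w $ j\<bar> ^ 4\<bar>) w < \<infinity> \<and>
      real_cond_exp N (pre_sigma (p n m)) (\<lambda>w. \<bar>W (p n (Suc m) w) w $ j - W (p n m w) w $ j\<bar> ^ 4) w =
        1 / (real n)\<^sup>2 * (optimal (p n m w) w / G (p n m w) w)"
    unfolding vector_minus_component
  proof eventually_elim
    case (elim w)
    have d: "real CARD('d) \<noteq> 0" "real CARD('d) + 2 \<noteq> 0" by (auto simp: add_eq_0_iff)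
    have "G (p n m w) w \<noteq> 0" using G_pos[OF elim(2) p_nonneg[OF n elim(2), of m]] by simp
    then have "3 * (radius n m w)\<^sup>2 / (real CARD('d) * (real CARD('d) + 2)) = 1 / (real n)\<^sup>2 * (optimal (p n m w) w / G (p n m w) w)"
      using d n unfolding radius_def optimal_def by (simp add: divide_simps power2_eq_square)
    then show ?case using elim(1) by (simp only:)
  qed
  have cr: "cross_integral W (p n) m i j = E.cross i j" by (rule ext) (simp only: cross_integral_def E.cross_def)
  show "AE w in N. nn_cond_exp N (pre_sigma (p n m)) (\<lambda>w. ennreal \<bar>cross_integral W (p n) m i j w\<bar>) w < \<infinity> \<and>
      real_cond_exp N (pre_sigma (p n m)) (cross_integral W (p n) m i j) w = 0" if "i \<noteq> j"
    unfolding cr by (rule E.cond_exp_cross[OF that])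
  show "cross_integral W (p n) m i j \<in> borel_measurable N" if "i \<noteq> j"
    unfolding cr by (rule E.cross_exit(3)[OF that E.level(1) order_refl])
  show "(\<lambda>w. W (p n (Suc m) w) w $ j - W (p n m w) w $ j) \<in> borel_measurable N"
    by (intro borel_measurable_diff measurable_vec_nth_compose measurable_W_random p_measurable[OF n] p_nonneg[OF n])
qed

end

section \<open>The exit partition for the given processes\<close>

locale ball_example =
  fixes M :: "'a measure" and W :: "real \<Rightarrow> 'a \<Rightarrow> real ^ 'd" and t :: real and G G' :: "real \<Rightarrow> 'a \<Rightarrow> real"
  assumes BM: "standard_brownian_motion M W" and t_pos: "0 < t"
    and ext: "positive_continuous_extension M W t G G'"
begin

definition good :: "'a \<Rightarrow> bool" where
  "good w \<longleftrightarrow> (W 0 w = 0 \<and> continuous_on {0..} (\<lambda>s. W s w)) \<and> (\<forall>r. \<exists>s\<ge>0. r < norm (W s w)) \<and>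
     continuous_on {0..} (\<lambda>s. G' s w) \<and> (\<forall>s\<ge>0. G' s w > 0) \<and> (\<forall>s\<in>{0..t}. G' s w = G s w)"

text \<open>On the exceptional null set the path is an unbounded straight line and \<open>G0\<close>
  is 1, so that the hypotheses of \<open>bm_ball\<close> hold at every point.\<close>

definition V :: "real \<Rightarrow> 'a \<Rightarrow> real ^ 'd" where
  "V = (\<lambda>s w. if good w then W s w else s *\<^sub>R axis undefined 1)"

definition G0 :: "real \<Rightarrow> 'a \<Rightarrow> real" where
  "G0 s w = (if good w then G' s w else 1)"

lemma AE_good: "AE w in M. good w"
proof -
  define good0 where "good0 w \<longleftrightarrow> W 0 w = 0 \<and> continuous_on {0..} (\<lambda>s. W s w)" for w
  have 0: "AE w in M. good0 w" using BM by (auto simp: standard_brownian_motion_def good0_def)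
  interpret B0: bm "completion M" "augmented_filtration M W" "\<lambda>s w. if good0 w then W s w else s *\<^sub>R axis undefined 1"
    by (rule bm_completion[OF BM 0]) (simp add: good0_def)
  have "AE w in M. \<forall>r. \<exists>s\<ge>0. r < norm (if good0 w then W s w else s *\<^sub>R axis undefined 1)"
    using B0.AE_unbounded unfolding AE_completion_iff .
  moreover have "AE w in M. continuous_on {0..} (\<lambda>s. G' s w) \<and> (\<forall>s\<ge>0. G' s w > 0) \<and> (\<forall>s\<in>{0..t}. G' s w = G s w)"
    using ext by (simp add: positive_continuous_extension_def)
  ultimately show ?thesis using 0 by eventually_elim (auto simp: good_def good0_def)
qed

lemma AE_good': "AE w in completion M. good w" using AE_good by (rule AE_completion)

lemma bm_V: "bm (completion M) (augmented_filtration M W) V"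
  unfolding V_def by (rule bm_completion[OF BM AE_good]) (simp add: good_def)

lemma bm_ball_V: "bm_ball (completion M) (augmented_filtration M W) V G0"
proof -
  interpret B: bm "completion M" "augmented_filtration M W" V by (rule bm_V)
  show ?thesis
  proof
    fix w show "\<exists>s\<ge>0. r < norm (V s w)" for r
    proof (cases "good w")
      case False then show ?thesis by (intro exI[of _ "\<bar>r\<bar> + 1"]) (auto simp: V_def norm_axis_1)
    qed (auto simp: V_def good_def)
    show "continuous_on {0..} (\<lambda>s. G0 s w)"
    proof (cases "good w")
      case True
      then have "continuous_on {0..} (\<lambda>s. G' s w)" by (simp add: good_def)
      with True show ?thesis by (simp add: G0_def)
    qed (simp add: G0_def)
    show "0 < G0 s w" if "0 \<le> s" for s using that by (auto simp: G0_def good_def)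
  next
    fix s :: real assume s: "0 \<le> s"
    have "G' s \<in> borel_measurable (augmented_filtration M W s)"
      using ext s by (simp add: positive_continuous_extension_def adapted_process_def)
    then show "G0 s \<in> borel_measurable (augmented_filtration M W s)"
      by (rule B.measurable_F_AE_cong) (use AE_good' in \<open>auto simp: G0_def elim!: AE_mp\<close>)
  qed
qed

interpretation B: bm_ball "completion M" "augmented_filtration M W" V G0 by (rule bm_ball_V)

text \<open>The filtration is generated by the original \<open>W\<close>, while
  \<open>right_continuous_F\<close> asks for generators in terms of \<open>V\<close>; an event of
  one kind differs from the corresponding event of the other by null sets.\<close>

lemma right_continuous:
  assumes s: "0 \<le> s" and A: "\<And>r. s < r \<Longrightarrow> A \<in> sets (augmented_filtration M W r)"
  shows "A \<in> sets (augmented_filtration M W s)"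
proof (rule B.right_continuous_F[OF _ s A])
  fix v :: real
  let ?S = "sigma_sets (space (completion M)) (past_events (completion M) V v \<union> null_sets (completion M))"
  interpret S: sigma_algebra "space (completion M)" ?S
    by (rule sigma_algebra_sigma_sets) (use augmented_generator_subset[of M V v] in \<open>simp add: past_events_def\<close>)
  have null: "C \<in> ?S" if "C \<in> null_sets (completion M)" for C using that by (intro sigma_sets.Basic) auto
  have "past_events M W v \<union> null_sets (completion M) \<subseteq> ?S"
  proof
    fix E assume E: "E \<in> past_events M W v \<union> null_sets (completion M)"
    then have EN: "E \<in> sets (completion M)"
      using subalgebra_augmented[of W M v] BM unfolding subalgebra_def augmented_filtration_def standard_brownian_motion_def
        sets_measure_of[OF augmented_generator_subset] by (blast intro: sigma_sets.Basic)
    show "E \<in> ?S"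
    proof (cases "E \<in> null_sets (completion M)")
      case False
      then obtain u S where u: "0 \<le> u" "u \<le> v" "S \<in> sets borel" "E = W u -` S \<inter> space M" using E by (auto simp: past_events_def)
      define E' where "E' = V u -` S \<inter> space (completion M)"
      have E'S: "E' \<in> ?S" by (rule sigma_sets.Basic) (use u in \<open>auto simp: past_events_def E'_def\<close>)
      have E'N: "E' \<in> sets (completion M)" unfolding E'_def by (rule measurable_sets[OF B.measurable_W[OF u(1)] u(3)])
      have ae: "AE w in completion M. w \<in> E \<longleftrightarrow> w \<in> E'"
        using AE_good' by eventually_elim (auto simp: u(4) E'_def V_def)
      have "E - E' \<in> null_sets (completion M)"
        using EN E'N by (subst AE_iff_null_sets) (use ae in \<open>auto elim!: AE_mp\<close>)
      moreover have "E' - E \<in> null_sets (completion M)"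
        using EN E'N by (subst AE_iff_null_sets) (use ae in \<open>auto elim!: AE_mp\<close>)
      ultimately have "(E' - (E' - E)) \<union> (E - E') \<in> ?S" using E'S null by blast
      moreover have "E = (E' - (E' - E)) \<union> (E - E')" by blast
      ultimately show ?thesis by simp
    qed (rule null)
  qed
  then show "sets (augmented_filtration M W v) \<subseteq> ?S"
    unfolding augmented_filtration_def sets_measure_of[OF augmented_generator_subset]
    using sigma_sets_mono[of "past_events M W v \<union> null_sets (completion M)" "space (completion M)"] by simp
qed

abbreviation q :: "nat \<Rightarrow> nat \<Rightarrow> 'a \<Rightarrow> real" where "q \<equiv> ball_partition W G'"

lemma q_eq: "good w \<Longrightarrow> q n m w = B.p n m w"
  by (induction m) (simp_all add: V_def G0_def)

lemma AE_q: "AE w in completion M. \<forall>n m. q n m w = B.p n m w"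
  using AE_good' by eventually_elim (simp add: q_eq del: ball_partition.simps)

lemma stopped_q: "stopped_algebra M W (q n m) = B.pre_sigma (B.p n m)"
proof -
  have "B.pre_sigma (q n m) = B.pre_sigma (B.p n m)"
    by (rule B.pre_sigma_AE_cong) (use AE_q in \<open>eventually_elim, blast\<close>)
  then show ?thesis by simp
qed

lemma q_stopping: "1 \<le> n \<Longrightarrow> stopping_time (augmented_filtration M W) (q n m)"
  by (rule B.stopping_time_AE_cong[OF B.p_stopping]) (assumption, use AE_q in \<open>eventually_elim, simp only:\<close>)

lemma q_measurable: "1 \<le> n \<Longrightarrow> q n m \<in> borel_measurable (completion M)"
  by (rule B.measurable_stopping_time_N[OF q_stopping])

lemma partition_q:
  assumes n: "1 \<le> n" shows "random_partition M W (q n)"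
  unfolding random_partition_def
proof (intro conjI allI q_stopping[OF n])
  show "AE w in M. q n 0 w = 0 \<and> incseq (\<lambda>m. q n m w) \<and> filterlim (\<lambda>m. q n m w) at_top sequentially"
    using AE_good AE_space
  proof eventually_elim
    case (elim w)
    have "(\<lambda>m. q n m w) = (\<lambda>m. B.p n m w)" using q_eq[OF elim(1)] by blast
    then show ?case using B.p_incseq[OF n, of w] B.p_unbounded[OF n, of w] elim(2) by (metis ball_partition.simps(1) space_completion)
  qed
qed

lemma has_cond_exp_cong:
  assumes "AE w in completion M. X w = X' w" "X' \<in> borel_measurable (completion M)" "AE w in completion M. Y w = Y' w"
    and n: "1 \<le> n"
    and *: "AE w in completion M. nn_cond_exp (completion M) (B.pre_sigma (B.p n m)) (\<lambda>w. ennreal \<bar>X' w\<bar>) w < \<infinity> \<and>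
      real_cond_exp (completion M) (B.pre_sigma (B.p n m)) X' w = Y' w"
  shows "has_cond_exp M (stopped_algebra M W (q n m)) X Y"
proof -
  interpret S: finite_measure_subalgebra "completion M" "B.pre_sigma (B.p n m)"
    by (rule B.sigma_finite_subalgebra_pre_sigma[OF B.p_stopping[OF n]])
  have eq: "AE w in completion M. X' w = X w" using assms(1) by (auto elim!: AE_mp)
  have X[measurable]: "X \<in> borel_measurable (completion M)"
    by (rule B.measurable_AE_cong[OF assms(2) eq]) simp
  note [measurable] = assms(2)
  have "AE w in completion M. nn_cond_exp (completion M) (B.pre_sigma (B.p n m)) (\<lambda>w. ennreal \<bar>X w\<bar>) w =
      nn_cond_exp (completion M) (B.pre_sigma (B.p n m)) (\<lambda>w. ennreal \<bar>X' w\<bar>) w"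
    by (rule S.nn_cond_exp_cong) (use assms(1) in \<open>auto elim!: AE_mp\<close>)
  moreover have "AE w in completion M. real_cond_exp (completion M) (B.pre_sigma (B.p n m)) X w = real_cond_exp (completion M) (B.pre_sigma (B.p n m)) X' w"
    by (rule S.real_cond_exp_cong[OF assms(1) X assms(2)])
  ultimately show ?thesis unfolding has_cond_exp_def stopped_q using * assms(3) by eventually_elim simp
qed

lemma G_approx_q:
  assumes n: "1 \<le> n"
  shows "AE w in completion M. \<forall>m. G_approx M W n (q n) m w = G0 (B.p n m w) w"
  unfolding AE_all_countable
proof
  fix m
  interpret S: finite_measure_subalgebra "completion M" "B.pre_sigma (B.p n m)"
    by (rule B.sigma_finite_subalgebra_pre_sigma[OF B.p_stopping[OF n]])
  have "AE w in completion M. real_cond_exp (completion M) (B.pre_sigma (B.p n m)) (\<lambda>w. q n (Suc m) w - q n m w) w =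
      real_cond_exp (completion M) (B.pre_sigma (B.p n m)) (\<lambda>w. B.p n (Suc m) w - B.p n m w) w"
    by (rule S.real_cond_exp_cong) (use AE_q in \<open>auto elim!: AE_mp intro!: borel_measurable_diff q_measurable[OF n] B.p_measurable[OF n] simp del: ball_partition.simps\<close>)
  with B.cond_exp_length[OF n, of m] show "AE w in completion M. G_approx M W n (q n) m w = G0 (B.p n m w) w"
    unfolding G_approx_def stopped_q by eventually_elim (use n in simp)
qed

text \<open>The moment identity is exact for each \<open>n\<close>, so one process serves as
  \<open>Hn\<close> for all \<open>n\<close>.\<close>

lemma condition_B_q: "condition_B M W q (\<lambda>_. B.optimal)"
  unfolding condition_B_def
proof (intro allI impI conjI)
  fix n m i j assume n: "1 \<le> (n::nat)"
  have incr: "AE w in completion M. W (q n (Suc m) w) w $ j - W (q n m w) w $ j = V (B.p n (Suc m) w) w $ j - V (B.p n m w) w $ j"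
    using AE_good' AE_q by eventually_elim (simp add: V_def del: ball_partition.simps)
  note [measurable] = B.cond_moments_exit(4)[OF n, of m j]
  show "has_cond_exp M (stopped_algebra M W (q n m)) (\<lambda>w. (W (q n (Suc m) w) w $ j - W (q n m w) w $ j) ^ 3) (\<lambda>w. 0)"
    by (rule has_cond_exp_cong[OF _ _ _ n B.cond_moments_exit(1)[OF n]]) (use incr in \<open>auto elim!: AE_mp simp del: ball_partition.simps\<close>)
  show "has_cond_exp M (stopped_algebra M W (q n m)) (\<lambda>w. \<bar>W (q n (Suc m) w) w $ j - W (q n m w) w $ j\<bar> ^ 4)
      (\<lambda>w. 1 / (real n)\<^sup>2 * (B.optimal (q n m w) w / G_approx M W n (q n) m w))"
  proof (rule has_cond_exp_cong[OF _ _ _ n B.cond_moments_exit(2)[OF n]])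
    from G_approx_q[OF n] AE_q show "AE w in completion M. 1 / (real n)\<^sup>2 * (B.optimal (q n m w) w / G_approx M W n (q n) m w) =
        1 / (real n)\<^sup>2 * (B.optimal (B.p n m w) w / G0 (B.p n m w) w)"
      by eventually_elim (simp del: ball_partition.simps)
  qed (use incr in \<open>auto elim!: AE_mp simp del: ball_partition.simps\<close>)
  show "has_cond_exp M (stopped_algebra M W (q n m)) (cross_integral W (q n) m i j) (\<lambda>w. 0)" if ij: "i \<noteq> j"
  proof (rule has_cond_exp_cong[OF _ B.cond_moments_exit(5)[OF n ij] _ n B.cond_moments_exit(3)[OF n ij]])
    show "AE w in completion M. cross_integral W (q n) m i j w = cross_integral V (B.p n) m i j w"
      using AE_good' AE_q by eventually_elim (simp add: V_def cross_integral_def del: ball_partition.simps)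
  qed simp
qed

text \<open>\<open>X\<close> stands for any process that agrees with \<open>G'\<close> up to
  \<open>\<tau>\<close>, since the conclusion is wanted both for \<open>G\<close> up to time
  \<open>t\<close> and for \<open>G'\<close> beyond it.\<close>

lemma conditions_AC:
  assumes k: "1 \<le> k" and \<tau>: "finite_stopping_time M W \<tau>" and le: "AE w in M. ereal (\<tau> w) \<le> eta_hat G' k w"
    and X: "AE w in M. \<forall>s\<in>{0..\<tau> w}. X s w = G' s w"
  shows "condition_A M W q X \<tau> \<and> condition_C M W q (\<lambda>_. B.optimal) B.optimal \<tau>"
proof -
  define ok where "ok w \<longleftrightarrow> good w \<and> ereal (\<tau> w) \<le> eta_hat G' k w" for w
  \<comment> \<open>The bounds on \<open>G0\<close> before the stopping time are required at every
    point; the value 0 off \<open>ok\<close> makes them vacuous there.\<close>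
  define \<rho> where "\<rho> w = (if ok w then \<tau> w else 0)" for w
  have AE_ok: "AE w in completion M. ok w" using AE_good' AE_completion[OF le] by eventually_elim (simp add: ok_def)
  have \<rho>: "stopping_time (augmented_filtration M W) \<rho>"
    by (rule B.stopping_time_AE_cong[of \<tau>]) (use \<tau> AE_ok in \<open>auto simp: finite_stopping_time_def \<rho>_def elim!: AE_mp\<close>)
  have k1: "1 \<le> real k" using k by simp
  have bnd: "1 / real k \<le> G0 s w \<and> G0 s w \<le> real k" if "0 \<le> s" "s < \<rho> w" for w s
  proof -
    have ok: "ok w" using that by (auto simp: \<rho>_def split: if_splits)
    then show ?thesis using bounds_before_eta_hat[of G' w "\<tau> w" k s] that by (auto simp: ok_def G0_def \<rho>_def good_def)
  qed
  have power: "tends_to_0_in_prob M (\<lambda>n w. of_nat (n ^ c) * cond_power_sum M W (q n) \<tau> r w)" if "c + 2 \<le> r" for c r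
  proof (rule B.small_tends_to_0[OF refl B.power_sum_small[OF \<rho> k1 bnd that]])
    show "\<forall>\<^sub>F n in sequentially. AE w in completion M. of_nat (n ^ c) * (\<Sum>m<first_index (B.p n) \<rho> w. B.cond_moment n m r w) =
        of_nat (n ^ c) * cond_power_sum M W (q n) \<tau> r w"
      using eventually_ge_at_top[of "1::nat"]
    proof eventually_elim
      case (elim n)
      have "AE w in completion M. \<forall>m. B.cond_moment n m r w =
          nn_cond_exp (completion M) (stopped_algebra M W (q n m)) (\<lambda>w. ennreal (\<bar>q n (Suc m) w - q n m w\<bar> ^ r)) w"
        unfolding AE_all_countable stopped_q B.cond_moment_def
      proof
        fix m
        interpret S: finite_measure_subalgebra "completion M" "B.pre_sigma (B.p n m)"
          by (rule B.sigma_finite_subalgebra_pre_sigma[OF B.p_stopping[OF elim]])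
        note [measurable] = q_measurable[OF elim] B.p_measurable[OF elim]
        have "AE w in completion M. ennreal (\<bar>B.p n (Suc m) w - B.p n m w\<bar> ^ r) = ennreal (\<bar>q n (Suc m) w - q n m w\<bar> ^ r)"
          using AE_q by eventually_elim (simp del: ball_partition.simps)
        then show "AE w in completion M. nn_cond_exp (completion M) (B.pre_sigma (B.p n m)) (\<lambda>w. ennreal (\<bar>B.p n (Suc m) w - B.p n m w\<bar> ^ r)) w =
          nn_cond_exp (completion M) (B.pre_sigma (B.p n m)) (\<lambda>w. ennreal (\<bar>q n (Suc m) w - q n m w\<bar> ^ r)) w"
          by (rule S.nn_cond_exp_cong) measurable
      qed
      with AE_q AE_ok show ?case
      proof eventually_elim
        case (elim w)
        have "first_index (q n) \<tau> w = first_index (B.p n) \<rho> w" using elim(1,2) by (simp add: first_index_def \<rho>_def del: ball_partition.simps)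
        then show ?case unfolding cond_power_sum_def using elim(3) by simp
      qed
    qed
  qed
  have sup: "tends_to_0_in_prob M (\<lambda>n w. SUP s\<in>{0..\<tau> w}. ennreal \<bar>A n (current_index (q n) s w) w - Z s w\<bar>)"
    if Y: "\<And>s. 0 \<le> s \<Longrightarrow> Y s \<in> borel_measurable (completion M)" "\<And>w. w \<in> space (completion M) \<Longrightarrow> continuous_on {0..} (\<lambda>s. Y s w)"
      and A: "\<And>n. 1 \<le> n \<Longrightarrow> AE w in completion M. \<forall>m. A n m w = Y (B.p n m w) w"
      and Z: "AE w in completion M. \<forall>s\<in>{0..\<tau> w}. Z s w = Y s w" for Y Z :: "real \<Rightarrow> 'a \<Rightarrow> real" and A
  proof (rule B.small_tends_to_0[OF refl B.sup_small[OF \<rho> k1 bnd Y]])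
    show "\<forall>\<^sub>F n in sequentially. AE w in completion M. (SUP s\<in>{0..\<rho> w}. ennreal \<bar>Y (B.p n (current_index (B.p n) s w) w) w - Y s w\<bar>) =
        (SUP s\<in>{0..\<tau> w}. ennreal \<bar>A n (current_index (q n) s w) w - Z s w\<bar>)"
      using eventually_ge_at_top[of "1::nat"]
    proof eventually_elim
      case (elim n)
      from A[OF this] Z AE_q AE_ok show ?case
      proof eventually_elim
        case (elim w)
        have "current_index (q n) s w = current_index (B.p n) s w" for s using elim(3) by (simp add: current_index_def del: ball_partition.simps)
        then show ?case using elim(1,2,4) by (intro SUP_cong) (auto simp: \<rho>_def simp del: ball_partition.simps)
      qed
    qed
  qed
  have "AE w in completion M. \<forall>s\<in>{0..\<tau> w}. X s w = G0 s w"
    using AE_completion[OF X] AE_good' by eventually_elim (simp add: G0_def)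
  then have "tends_to_0_in_prob M (\<lambda>n w. SUP s\<in>{0..\<tau> w}. ennreal \<bar>G_approx M W n (q n) (current_index (q n) s w) w - X s w\<bar>)"
    by (intro sup[of G0 "\<lambda>n. G_approx M W n (q n)" X] B.measurable_F_N[OF B.adapted_G] B.continuous_G G_approx_q)
  moreover have "tends_to_0_in_prob M (\<lambda>n w. SUP s\<in>{0..\<tau> w}. ennreal \<bar>B.optimal (q n (current_index (q n) s w) w) w - B.optimal s w\<bar>)"
    by (rule sup[of B.optimal "\<lambda>n m w. B.optimal (q n m w) w"])
      (use AE_q B.measurable_F_N[OF B.optimal(1)] B.optimal(2) in \<open>auto elim!: AE_mp simp del: ball_partition.simps\<close>)
  \<comment> \<open>The pairs of a power of \<open>n\<close> and a moment are \<open>(0, 2)\<close>,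
    \<open>(2, 4)\<close> and \<open>(2, 6)\<close>; the first two lie exactly on the limit
    \<open>c + 2 \<le> r\<close>.\<close>
  ultimately show ?thesis
    unfolding condition_A_def condition_C_def using power[of 0 2] power[of 2 4] power[of 2 6] by simp
qed

lemma eta_hat_upto_G: "good w \<Longrightarrow> eta_hat_upto G t k w = eta_hat_upto G' t k w"
  and eta_hat_upto_G0: "good w \<Longrightarrow> eta_hat_upto G0 t k w = eta_hat_upto G' t k w"
  by (rule eta_hat_upto_cong[OF t_pos]; simp add: good_def G0_def)+

lemma finite_stopping_eta: "finite_stopping_time M W (eta_hat_upto G t k)"
proof -
  have "stopping_time (augmented_filtration M W) (eta_hat_upto G t k)"
  proof (rule B.stopping_time_AE_cong)
    show "stopping_time (augmented_filtration M W) (eta_hat_upto G0 t k)"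
      by (rule B.stopping_time_eta_hat[OF right_continuous t_pos])
    show "AE w in completion M. eta_hat_upto G0 t k w = eta_hat_upto G t k w"
      using AE_good' by eventually_elim (simp add: eta_hat_upto_G eta_hat_upto_G0)
  qed
  then show ?thesis by (simp add: finite_stopping_time_def eta_hat_upto_bounds[OF t_pos])
qed

text \<open>On the compact interval \<open>[0, t]\<close> a positive continuous path is bounded and
  bounded away from 0, so from some level on the time equals \<open>t\<close>. The index is shifted
  because the range \<open>[1 / k, k]\<close> makes sense from \<open>k = 1\<close> on.\<close>

lemma exhausting_eta: "exhausting_times M W t (\<lambda>k. eta_hat_upto G t (Suc k))"
  unfolding exhausting_times_def
proof (intro conjI allI finite_stopping_eta)
  have mono: "eta_hat_upto G t (Suc k) w \<le> eta_hat_upto G t (Suc l) w" if "k \<le> l" for k l w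
  proof (rule ccontr)
    assume "\<not> ?thesis"
    then have less: "eta_hat_upto G t (Suc l) w < eta_hat_upto G t (Suc k) w" by simp
    let ?e = "eta_hat_upto G t (Suc k) w"
    have "\<not> t < ?e" using eta_hat_upto_bounds(2)[OF t_pos, of G "Suc k" w] by simp
    with less obtain s where s: "0 < s" "s < ?e" "real (Suc l) < G s w \<or> G s w < 1 / real (Suc l)"
      unfolding eta_hat_upto_less[OF t_pos, of G "Suc l"] by blast
    have "1 / real (Suc l) \<le> 1 / real (Suc k)" using that by (intro divide_left_mono) auto
    then have "real (Suc k) < G s w \<or> G s w < 1 / real (Suc k)" using s(3) that by auto
    then have "?e < ?e" using s(1,2) eta_hat_upto_less[OF t_pos, of G "Suc k" w ?e] by blast
    then show False by simp
  qed
  then show "AE w in M. incseq (\<lambda>k. eta_hat_upto G t (Suc k) w)" by (auto simp: incseq_def)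
  let ?A = "\<lambda>k. {w \<in> space (completion M). eta_hat_upto G t (Suc k) w < t}"
  have m: "eta_hat_upto G t k \<in> borel_measurable (completion M)" for k
    by (rule B.measurable_stopping_time_N) (use finite_stopping_eta in \<open>simp add: finite_stopping_time_def\<close>)
  have A: "?A k \<in> sets (completion M)" for k using m[of "Suc k"] by measurable
  have "(\<lambda>k. measure (completion M) (?A k)) \<longlonglongrightarrow> measure (completion M) (\<Inter>k. ?A k)"
    by (rule B.finite_Lim_measure_decseq) (use A in \<open>auto simp: decseq_def intro: order.strict_trans1[OF mono]\<close>)
  moreover have "(\<Inter>k. ?A k) \<in> null_sets (completion M)"
  proof (subst AE_iff_null_sets)
    show "(\<Inter>k. ?A k) \<in> sets (completion M)" using A by auto
    show "AE w in completion M. w \<notin> (\<Inter>k. ?A k)"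
      using AE_good'
    proof eventually_elim
      case (elim w)
      have c: "continuous_on {0..t} (\<lambda>s. G' s w)" by (rule continuous_on_subset[of "{0..}"]) (use elim in \<open>auto simp: good_def\<close>)
      have ne: "{0..t} \<noteq> {}" "compact {0..t}" using t_pos by auto
      obtain x where x: "x \<in> {0..t}" "\<And>s. s \<in> {0..t} \<Longrightarrow> G' x w \<le> G' s w" using continuous_attains_inf[OF ne(2,1) c] by blast
      obtain y where y: "\<And>s. s \<in> {0..t} \<Longrightarrow> G' s w \<le> G' y w" using continuous_attains_sup[OF ne(2,1) c] by blast
      have pos: "0 < G' x w" using elim x(1) by (auto simp: good_def)
      obtain k :: nat where k: "max (G' y w) (1 / G' x w) \<le> real k" using real_arch_simple by blast
      have "\<not> eta_hat_upto G t (Suc k) w < t"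
        unfolding eta_hat_upto_less[OF t_pos]
      proof (intro notI, elim disjE exE conjE)
        fix s assume s: "0 < s" "s < t"
        have eq: "G s w = G' s w" using elim s by (auto simp: good_def)
        show False if "real (Suc k) < G s w" using that y[of s] k s eq by auto
        show False if "G s w < 1 / real (Suc k)"
        proof -
          have "1 / G' x w < real (Suc k)" using k by simp
          then have "1 / real (Suc k) < G' x w" using pos by (simp add: field_simps)
          then show False using that x(2)[of s] s eq by auto
        qed
      qed simp
      then show ?case by blast
    qed
  qed
  ultimately have "(\<lambda>k. measure (completion M) (?A k)) \<longlonglongrightarrow> 0" by (simp add: measure_eq_0_null_sets)
  then show "(\<lambda>k. measure (completion M) {w \<in> space M. eta_hat_upto G t (Suc k) w < t}) \<longlonglongrightarrow> 0" by simp
qed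

theorem ball_partition_optimal:
  "(\<forall>n\<ge>1. random_partition M W (q n)) \<and>
   exhausting_times M W t (\<lambda>k. eta_hat_upto G t (Suc k)) \<and>
   (\<exists>H Hn.
      progressive_process M W H \<and> locally_integrable M H \<and>
      (\<forall>n\<ge>1. progressive_process M W (Hn n)) \<and>
      condition_B M W q Hn \<and>
      (\<forall>k\<ge>1. condition_A M W q G (eta_hat_upto G t k) \<and>
              condition_C M W q Hn H (eta_hat_upto G t k)) \<and>
      (\<forall>k\<ge>1. \<forall>\<tau>. finite_stopping_time M W \<tau> \<and> (AE w in M. ereal (\<tau> w) \<le> eta_hat G' k w)
         \<longrightarrow> condition_A M W q G' \<tau> \<and> condition_C M W q Hn H \<tau>) \<and>
      (AE (u, w) in restrict_space lborel {0..t} \<Otimes>\<^sub>M M.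
         H u w = 3 * real CARD('d) / ((real CARD('d) + 2) * G u w)))"
proof (intro conjI exI[of _ B.optimal] exI[of _ "\<lambda>_. B.optimal"] allI impI)
  show prog: "progressive_process M W B.optimal" "progressive_process M W B.optimal"
    unfolding progressive_process_def
    using B.measurable_path_progressive[of B.optimal, OF B.optimal] by auto
  show "locally_integrable M B.optimal"
    unfolding locally_integrable_def
  proof (intro AE_I2 allI impI)
    fix w T assume "w \<in> space M"
    then have "continuous_on {0..T} (\<lambda>s. B.optimal s w)" by (intro continuous_on_subset[OF B.optimal(2)]) auto
    then show "set_integrable lebesgue {0..T} (\<lambda>s. B.optimal s w)" by (rule absolutely_integrable_continuous_real)
  qed
  fix k :: nat assume k: "1 \<le> k"
  have "AE w in M. ereal (eta_hat_upto G t k w) \<le> eta_hat G' k w"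
    using AE_good by eventually_elim (simp add: eta_hat_upto_G real_eta_hat_upto[OF t_pos])
  moreover have "AE w in M. \<forall>s\<in>{0..eta_hat_upto G t k w}. G s w = G' s w"
    using AE_good
  proof (eventually_elim, intro ballI)
    fix w s assume "good w" "s \<in> {0..eta_hat_upto G t k w}"
    then show "G s w = G' s w" using eta_hat_upto_bounds(2)[OF t_pos, of G k w] by (auto simp: good_def)
  qed
  ultimately have *: "condition_A M W q G (eta_hat_upto G t k) \<and> condition_C M W q (\<lambda>_. B.optimal) B.optimal (eta_hat_upto G t k)"
    by (rule conditions_AC[OF k finite_stopping_eta])
  then show "condition_A M W q G (eta_hat_upto G t k)" "condition_C M W q (\<lambda>_. B.optimal) B.optimal (eta_hat_upto G t k)" by auto
  fix \<tau> assume \<tau>: "finite_stopping_time M W \<tau> \<and> (AE w in M. ereal (\<tau> w) \<le> eta_hat G' k w)"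
  then have "condition_A M W q G' \<tau> \<and> condition_C M W q (\<lambda>_. B.optimal) B.optimal \<tau>"
    by (intro conditions_AC[OF k]) auto
  then show "condition_A M W q G' \<tau>" "condition_C M W q (\<lambda>_. B.optimal) B.optimal \<tau>" by auto
next
  show "AE (u, w) in restrict_space lborel {0..t} \<Otimes>\<^sub>M M. B.optimal u w = 3 * real CARD('d) / ((real CARD('d) + 2) * G u w)"
  proof (rule AE_pair_lborel)
    show "prob_space M" using BM by (simp add: standard_brownian_motion_def)
    show "AE w in M. \<forall>u\<in>{0..<t}. B.optimal u w = 3 * real CARD('d) / ((real CARD('d) + 2) * G u w)"
      using AE_good by eventually_elim (auto simp: B.optimal_def G0_def good_def)
  qed
qed (rule partition_q exhausting_eta condition_B_q; assumption?)+

end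

theorem theorem3p1:
  fixes M :: "'a measure" and W :: "real \<Rightarrow> 'a \<Rightarrow> real ^ 'd"
    and t :: real and G :: "real \<Rightarrow> 'a \<Rightarrow> real"
  assumes "standard_brownian_motion M W"
    and "t > 0"
    and "adapted_process M W G"
    and "locally_integrable M G"
  shows
    "(\<forall>\<eta> p H Hn.
        exhausting_times M W t \<eta> \<and>
        (\<forall>n\<ge>1. random_partition M W (p n)) \<and>
        progressive_process M W H \<and> locally_integrable M H \<and>
        (\<forall>n\<ge>1. progressive_process M W (Hn n)) \<and>
        condition_B M W p Hn \<and>
        (\<forall>k. condition_A M W p G (\<eta> k) \<and> condition_C M W p Hn H (\<eta> k))
      \<longrightarrow> (AE (u, \<omega>) in restrict_space lborel {0..t} \<Otimes>\<^sub>M M.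
             G u \<omega> > 0 \<and> H u \<omega> \<ge> 3 * real CARD('d) / ((real CARD('d) + 2) * G u \<omega>)))
     \<and>
     ((AE \<omega> in M. continuous_on {0..t} (\<lambda>s. G s \<omega>) \<and> (\<forall>s\<in>{0..t}. G s \<omega> > 0))
      \<longrightarrow> (\<forall>G' p. positive_continuous_extension M W t G G' \<and> p = ball_partition W G' \<longrightarrow>
            (\<forall>n\<ge>1. random_partition M W (p n)) \<and>
            exhausting_times M W t (\<lambda>k. eta_hat_upto G t (Suc k)) \<and>
            (\<exists>H Hn.
               progressive_process M W H \<and> locally_integrable M H \<and>
               (\<forall>n\<ge>1. progressive_process M W (Hn n)) \<and>
               condition_B M W p Hn \<and>
               (\<forall>k\<ge>1. condition_A M W p G (eta_hat_upto G t k) \<and>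
                       condition_C M W p Hn H (eta_hat_upto G t k)) \<and>
               (\<forall>k\<ge>1. \<forall>\<tau>. finite_stopping_time M W \<tau> \<and> (AE \<omega> in M. ereal (\<tau> \<omega>) \<le> eta_hat G' k \<omega>)
                  \<longrightarrow> condition_A M W p G' \<tau> \<and> condition_C M W p Hn H \<tau>) \<and>
               (AE (u, \<omega>) in restrict_space lborel {0..t} \<Otimes>\<^sub>M M.
                  H u \<omega> = 3 * real CARD('d) / ((real CARD('d) + 2) * G u \<omega>)))))"
  apply (rule conjI)
   apply (intro allI impI)
  subgoal for \<eta> p H Hn by (rule lower_bound[OF assms(1,2), of \<eta> p Hn G H]) auto
  apply (intro impI allI)
  subgoal premises prems for G' p
  proof -
    interpret ball_example M W t G G' by unfold_locales (use assms(1,2) prems in auto)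
    show ?thesis unfolding prems(2)[THEN conjunct2] by (rule ball_partition_optimal)
  qed
  done

end
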